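(* Let $s\in\mathbb{N}$, $s\ge1$, $B=(B_1,\dots,B_s)$ with all $B_j\ge1$, let $T$ be a dimension partition tree over $D=\{1,\dots,d\}$ with arity $a=\max_{\alpha\in\mathcal{I}(T)}\#S(\alpha)$ and depth $L=\mathrm{depth}(T)$, and let $f\in\mathcal{F}^T_{s,B}$. For $\varepsilon>0$, denote by $N(f,\varepsilon,d)$ the complexity $N(T,r,U_n)$ sufficient (i.e. minimal over ranks $r$ and tuples $n$) to achieve an error $e^T_{r,U_n}(f)_{L^p}\le\varepsilon$ for the approximation of $f$ in the format $\mathcal{T}_r^T(U_n)$, with error measured in $L^p$, where either $p=2$ and $s$ is arbitrary, or $p=\infty$ and $s\le2$. Then: (i) For the trivial tree $T$ with arity $a=d$ and depth $L=1$, $$N(f,\varepsilon,d)\le C_d\,\varepsilon^{-d/s},$$ with a constant $C_d$ depending super-exponentially on $d$ but not depending on $\varepsilon$. (ii) For a tree with arity $a$ independent of $d$, $$N(f,\varepsilon,d)\le C_d\,L^{a+1}\,\varepsilon^{-(a+1)/s}\,B_1^{(a+1)L}\,B_\star^{a+1},$$ with a constant $C_d$ depending polynomially on $d$ (for fixed $a$) but not depending on $\varepsilon$; here $B_\star=\max_{1\le j\le s}B_j$ if $s\ge2$ and $B_\star=1$ if $s=1$.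
   Context: A dimension partition tree $T$ over $D$ ($d\ge2$) is a rooted tree whose nodes are nonempty subsets of $D$, with root $D$, such that each node $\alpha$ is either a leaf (set of sons $S(\alpha)=\emptyset$) or has a set of sons $S(\alpha)$ forming a partition of $\alpha$ with $\#S(\alpha)\ge2$; the leaves are exactly the singletons. $\mathcal{I}(T)$ is the set of interior nodes. $\mathrm{level}(D)=0$, $\mathrm{level}(\beta)=\mathrm{level}(\alpha)+1$ if $\beta\in S(\alpha)$, and $\mathrm{depth}(T)$ is the maximal level. The trivial tree is $\{D,\{1\},\dots,\{d\}\}$. $\alpha^c=D\setminus\alpha$; $\nu\in D$ is identified with the leaf $\{\nu\}$. Let $\mathcal{X}=\mathcal{X}_1\times\cdots\times\mathcal{X}_d$ with $\mathcal{X}_\nu=I^\nu$ bounded closed intervals, equipped with the uniform (probability) measure; $x_\alpha=(x_\nu)_{\nu\in\alpha}$. $\mathcal{F}^T$ is the class of functions $f:\mathcal{X}\to\mathbb{R}$, $f(x)=f_D((g_\alpha(x_\alpha))_{\alpha\in S(D)})$, where $g_\alpha(x_\alpha)=x_\alpha$ for leaves $\alpha$ and $g_\alpha(x_\alpha)=f_\alpha((g_\beta(x_\beta))_{\beta\in S(\alpha)})$ for interior nodes, with functions $f_\alpha:\prod_{\beta\in S(\alpha)}I^\beta\to I^\alpha$, $\alpha\in\mathcal{I}(T)$, $I^D=\mathbb{R}$ and $I^\alpha\subset\mathbb{R}$ bounded closed intervals for $\alpha\ne D$, all of length at most a fixed number $\Lambda$. $\mathcal{F}^T_{s,B}$ consists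 of those $f\in\mathcal{F}^T$ with $f_\alpha\in W^{s,\infty}$, $\|f_D\|_{W^{s,\infty}}\le1$ and $\|D^{k_\alpha}f_\alpha\|_{L^\infty}\le B_{|k_\alpha|}$ for all multi-indices $k_\alpha\in\mathbb{N}_0^{\#S(\alpha)}$ with $1\le|k_\alpha|\le s$ and all $\alpha\in\mathcal{I}(T)\setminus\{D\}$. $\|h\|_{W^{s,\infty}}=\max_{|k|\le s}\|D^kh\|_{L^\infty}$. For $\alpha\ne D$, $\mathrm{rank}_\alpha(v)$ is the minimal $k$ (possibly infinite) such that $v(x)=\sum_{i=1}^ku_i(x_\alpha)w_i(x_{\alpha^c})$ for some functions $u_i,w_i$. For tuples $r=(r_\alpha)_{\alpha\in T}$ of nonnegative integers with $r_D=1$ (constraint for $\alpha=D$ vacuous), $\mathcal{T}_r^T(U)=\{v\in U:\mathrm{rank}_\alpha(v)\le r_\alpha,\ \alpha\in T\}$, $e_{r,U}^T(f)_{L^p}=\inf_{v\in\mathcal{T}_r^T(U)}\|f-v\|_{L^p(\mathcal{X})}$, and for $U=U_1\otimes\cdots\otimes U_d$, $$N(T,r,U)=\sum_{\alpha\in\mathcal{I}(T)}r_\alpha\prod_{\beta\in S(\alpha)}r_\beta+\sum_{\nu=1}^dr_\nu\dim(U_\nu).$$ Here $U_n=U_{1,n_1}\otimes\cdots\otimes U_{d,n_d}$ with $\dim U_{\nu,m}=m$, $m\ge1$. For $p=2$, the $U_{\nu,m}\subset L^2(\mathcal{X}_\nu)$ are any spaces (e.g. splines or wavelets) with $\inf_{v\in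 U_{\nu,m}}\|u-v\|_{L^2(\mathcal{X}_\nu)}\le M\,m^{-s}\|u\|_{H^s}$ for all $u\in H^s(\mathcal{X}_\nu)$, with $M$ independent of $\nu$, $m$, $d$. For $p=\infty$, $U_{\nu,m}$ is the space of continuous piecewise linear functions on $I^\nu$ with $m$ equispaced nodes including the end points for $m\ge2$, and the constants for $m=1$. The constants $C_d$ are independent of $f\in\mathcal{F}^T_{s,B}$ and $\varepsilon$; they may depend on the fixed quantities $s$, $M$, $\Lambda$, in (i) also on $B$, and in (ii) also on $a$. *)

theory Defs
  imports
    "HOL-Probability.Probability"
    "HOL-Library.Function_Algebras"
    "HOL-Library.Landau_Symbols"
    "HOL-Library.Extended_Nat"
begin

section \<open>Dimension partition trees\<close>

text \<open>
  A tree over a set \<open>D\<close> is given by its sons map \<open>S\<close>; its nodes are the sets reachable from the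
  root \<open>D\<close>.  Values of \<open>S\<close> on sets that are not nodes are irrelevant.
\<close>

inductive_set nodes :: "nat set \<Rightarrow> (nat set \<Rightarrow> nat set set) \<Rightarrow> nat set set"
  for D :: "nat set" and S :: "nat set \<Rightarrow> nat set set" where
  root: "D \<in> nodes D S"
| son: "\<alpha> \<in> nodes D S \<Longrightarrow> \<beta> \<in> S \<alpha> \<Longrightarrow> \<beta> \<in> nodes D S"

definition interior_nodes :: "nat set \<Rightarrow> (nat set \<Rightarrow> nat set set) \<Rightarrow> nat set set" where
  "interior_nodes D S = {\<alpha> \<in> nodes D S. S \<alpha> \<noteq> {}}"

definition dimension_tree :: "nat set \<Rightarrow> (nat set \<Rightarrow> nat set set) \<Rightarrow> bool" where
  "dimension_tree D S \<longleftrightarrow> finite D \<and> 2 \<le> card D \<and>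
     (\<forall>\<alpha>\<in>nodes D S. \<alpha> \<noteq> {} \<and> \<alpha> \<subseteq> D \<and>
        (S \<alpha> = {} \<or> partition_on \<alpha> (S \<alpha>) \<and> 2 \<le> card (S \<alpha>)) \<and>
        (S \<alpha> = {} \<longleftrightarrow> is_singleton \<alpha>))"

definition node_level :: "nat set \<Rightarrow> (nat set \<Rightarrow> nat set set) \<Rightarrow> nat set \<Rightarrow> nat" where
  "node_level D S \<alpha> = (LEAST k. (D, \<alpha>) \<in> {(\<gamma>, \<beta>). \<beta> \<in> S \<gamma>} ^^ k)"

definition depth :: "nat set \<Rightarrow> (nat set \<Rightarrow> nat set set) \<Rightarrow> nat" where
  "depth D S = Max (node_level D S ` nodes D S)"

definition arity :: "nat set \<Rightarrow> (nat set \<Rightarrow> nat set set) \<Rightarrow> nat" where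
  "arity D S = Max ((\<lambda>\<alpha>. card (S \<alpha>)) ` interior_nodes D S)"

definition trivial_tree :: "nat set \<Rightarrow> (nat set \<Rightarrow> nat set set) \<Rightarrow> bool" where
  "trivial_tree D S \<longleftrightarrow> dimension_tree D S \<and> nodes D S = insert D ((\<lambda>\<nu>. {\<nu>}) ` D)"


section \<open>Product domains and Lebesgue norms\<close>

text \<open>
  Points of a product over a finite index set \<open>J\<close> are extensional functions, i.e. elements of
  \<open>PiE J\<close>.  The underlying space of the uniform measures is the closed interval (box) itself, so
  that values of functions outside it are irrelevant.
\<close>

definition cuboid :: "'i set \<Rightarrow> ('i \<Rightarrow> real) \<Rightarrow> ('i \<Rightarrow> real) \<Rightarrow> ('i \<Rightarrow> real) set" where
  "cuboid J lo hi = (\<Pi>\<^sub>E i\<in>J. {lo i..hi i})"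

definition unif :: "real \<Rightarrow> real \<Rightarrow> real measure" where
  "unif a b = uniform_measure (restrict_space lborel {a..b}) {a..b}"

definition unif_cuboid :: "'i set \<Rightarrow> ('i \<Rightarrow> real) \<Rightarrow> ('i \<Rightarrow> real) \<Rightarrow> ('i \<Rightarrow> real) measure" where
  "unif_cuboid J lo hi = (\<Pi>\<^sub>M i\<in>J. unif (lo i) (hi i))"

text \<open>The norm of \<open>L\<^sup>p\<close>, with value \<open>\<infinity>\<close> on functions that are not in \<open>L\<^sup>p\<close>.\<close>

definition Lp_norm :: "ereal \<Rightarrow> 'a measure \<Rightarrow> ('a \<Rightarrow> real) \<Rightarrow> ereal" where
  "Lp_norm p M f =
     (if p = \<infinity> then esssup M (\<lambda>x. ereal \<bar>f x\<bar>)
      else if f \<in> borel_measurable M \<and> integrable M (\<lambda>x. \<bar>f x\<bar> powr real_of_ereal p)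
      then ereal ((\<integral>x. \<bar>f x\<bar> powr real_of_ereal p \<partial>M) powr (1 / real_of_ereal p))
      else \<infinity>)"


section \<open>Weak derivatives and Sobolev spaces on boxes\<close>

definition multi_indices :: "'i set \<Rightarrow> nat \<Rightarrow> ('i \<Rightarrow> nat) set" where
  "multi_indices J s = {k. (\<forall>i. i \<notin> J \<longrightarrow> k i = 0) \<and> sum k J \<le> s}"

definition partial_deriv :: "'i \<Rightarrow> (('i \<Rightarrow> real) \<Rightarrow> real) \<Rightarrow> ('i \<Rightarrow> real) \<Rightarrow> real" where
  "partial_deriv i \<phi> x = deriv (\<lambda>t. \<phi> (x(i := t))) (x i)"

definition partial_derivs :: "'i list \<Rightarrow> (('i \<Rightarrow> real) \<Rightarrow> real) \<Rightarrow> ('i \<Rightarrow> real) \<Rightarrow> real" where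
  "partial_derivs is \<phi> = foldr partial_deriv is \<phi>"

text \<open>
  The classical derivative \<open>D\<^sup>k \<phi>\<close>.  It is only applied to smooth functions, for which the order of
  differentiation, fixed here by an arbitrary enumeration of the multi-index, does not matter.
\<close>

definition classical_deriv :: "('i \<Rightarrow> nat) \<Rightarrow> (('i \<Rightarrow> real) \<Rightarrow> real) \<Rightarrow> ('i \<Rightarrow> real) \<Rightarrow> real" where
  "classical_deriv k \<phi> = partial_derivs (SOME is. \<forall>i. count_list is i = k i) \<phi>"

definition smooth :: "'i set \<Rightarrow> (('i \<Rightarrow> real) \<Rightarrow> real) \<Rightarrow> bool" where
  "smooth J \<phi> \<longleftrightarrow> (\<forall>is. set is \<subseteq> J \<longrightarrow>
     continuous_on (\<Pi>\<^sub>E i\<in>J. UNIV) (partial_derivs is \<phi>) \<and>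
     (\<forall>x\<in>(\<Pi>\<^sub>E i\<in>J. UNIV). \<forall>i\<in>J. (\<lambda>t. partial_derivs is \<phi> (x(i := t))) differentiable (at (x i))))"

text \<open>Smooth functions with compact support in the open box.\<close>

definition test_functions :: "'i set \<Rightarrow> ('i \<Rightarrow> real) \<Rightarrow> ('i \<Rightarrow> real) \<Rightarrow> (('i \<Rightarrow> real) \<Rightarrow> real) set" where
  "test_functions J lo hi = {\<phi>. smooth J \<phi> \<and>
     (\<exists>K. compact K \<and> K \<subseteq> (\<Pi>\<^sub>E i\<in>J. {lo i<..<hi i}) \<and> (\<forall>x\<in>(\<Pi>\<^sub>E i\<in>J. UNIV) - K. \<phi> x = 0))}"

text \<open>
  \<open>g\<close> is the weak derivative \<open>D\<^sup>k f\<close> on the box.  The normalisation of the measure cancels.  Global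
  instead of local integrability suffices, since all derivatives considered are in \<open>L\<^sup>p\<close>, \<open>p \<ge> 1\<close>.
\<close>

definition weak_deriv :: "'i set \<Rightarrow> ('i \<Rightarrow> real) \<Rightarrow> ('i \<Rightarrow> real) \<Rightarrow> ('i \<Rightarrow> nat) \<Rightarrow>
    (('i \<Rightarrow> real) \<Rightarrow> real) \<Rightarrow> (('i \<Rightarrow> real) \<Rightarrow> real) \<Rightarrow> bool" where
  "weak_deriv J lo hi k f g \<longleftrightarrow>
     integrable (unif_cuboid J lo hi) f \<and> integrable (unif_cuboid J lo hi) g \<and>
     (\<forall>\<phi>\<in>test_functions J lo hi.
        (\<integral>x. f x * classical_deriv k \<phi> x \<partial>unif_cuboid J lo hi) =
        (-1) ^ sum k J * (\<integral>x. g x * \<phi> x \<partial>unif_cuboid J lo hi))"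

text \<open>A representative of \<open>D\<^sup>k f\<close> (unique almost everywhere) if the weak derivative exists.\<close>

definition Dk :: "'i set \<Rightarrow> ('i \<Rightarrow> real) \<Rightarrow> ('i \<Rightarrow> real) \<Rightarrow> ('i \<Rightarrow> nat) \<Rightarrow>
    (('i \<Rightarrow> real) \<Rightarrow> real) \<Rightarrow> ('i \<Rightarrow> real) \<Rightarrow> real" where
  "Dk J lo hi k f = (SOME g. weak_deriv J lo hi k f g)"

definition sobolev :: "'i set \<Rightarrow> ('i \<Rightarrow> real) \<Rightarrow> ('i \<Rightarrow> real) \<Rightarrow> nat \<Rightarrow> ereal \<Rightarrow>
    (('i \<Rightarrow> real) \<Rightarrow> real) set" where
  "sobolev J lo hi s p = {f. \<forall>k\<in>multi_indices J s.
     \<exists>g. weak_deriv J lo hi k f g \<and> Lp_norm p (unif_cuboid J lo hi) g < \<infinity>}"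

definition W_inf_norm :: "'i set \<Rightarrow> ('i \<Rightarrow> real) \<Rightarrow> ('i \<Rightarrow> real) \<Rightarrow> nat \<Rightarrow>
    (('i \<Rightarrow> real) \<Rightarrow> real) \<Rightarrow> ereal" where
  "W_inf_norm J lo hi s f =
     (SUP k\<in>multi_indices J s. Lp_norm \<infinity> (unif_cuboid J lo hi) (Dk J lo hi k f))"

text \<open>
  The spaces \<open>H\<^sup>s\<close> of functions of one variable are the case of a one-element index set.
\<close>

definition in_Hs :: "real \<Rightarrow> real \<Rightarrow> nat \<Rightarrow> (real \<Rightarrow> real) \<Rightarrow> bool" where
  "in_Hs a b s u \<longleftrightarrow> (\<lambda>x. u (x ())) \<in> sobolev {()} (\<lambda>_. a) (\<lambda>_. b) s 2"

definition Hs_norm :: "real \<Rightarrow> real \<Rightarrow> nat \<Rightarrow> (real \<Rightarrow> real) \<Rightarrow> real" where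
  "Hs_norm a b s u = sqrt (\<Sum>j\<le>s. (real_of_ereal
     (Lp_norm 2 (unif_cuboid {()} (\<lambda>_. a) (\<lambda>_. b))
        (Dk {()} (\<lambda>_. a) (\<lambda>_. b) (\<lambda>_. j) (\<lambda>x. u (x ())))))\<^sup>2)"


section \<open>Compositional functions\<close>

text \<open>
  \<open>f\<close> is the composition of the functions \<open>fs \<alpha>\<close> along the tree, where \<open>{ilo \<alpha>..ihi \<alpha>}\<close> is the
  interval attached to the node \<open>\<alpha> \<noteq> D\<close>, and \<open>{lo \<nu>..hi \<nu>}\<close> is the domain of the variable \<open>\<nu>\<close>.
\<close>

definition tree_composition :: "nat set \<Rightarrow> (nat set \<Rightarrow> nat set set) \<Rightarrow> (nat \<Rightarrow> real) \<Rightarrow> (nat \<Rightarrow> real) \<Rightarrow>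
    real \<Rightarrow> (nat set \<Rightarrow> real) \<Rightarrow> (nat set \<Rightarrow> real) \<Rightarrow>
    (nat set \<Rightarrow> (nat set \<Rightarrow> real) \<Rightarrow> real) \<Rightarrow> ((nat \<Rightarrow> real) \<Rightarrow> real) \<Rightarrow> bool" where
  "tree_composition D S lo hi \<Lambda> ilo ihi fs f \<longleftrightarrow>
     (\<forall>\<nu>\<in>D. ilo {\<nu>} = lo \<nu> \<and> ihi {\<nu>} = hi \<nu>) \<and>
     (\<forall>\<alpha>\<in>nodes D S - {D}. ilo \<alpha> < ihi \<alpha> \<and> ihi \<alpha> - ilo \<alpha> \<le> \<Lambda>) \<and>
     (\<forall>\<alpha>\<in>interior_nodes D S - {D}. fs \<alpha> ` cuboid (S \<alpha>) ilo ihi \<subseteq> {ilo \<alpha>..ihi \<alpha>}) \<and>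
     (\<exists>g. (\<forall>\<nu>\<in>D. \<forall>x\<in>cuboid {\<nu>} lo hi. g {\<nu>} x = x \<nu>) \<and>
          (\<forall>\<alpha>\<in>interior_nodes D S - {D}. \<forall>x\<in>cuboid \<alpha> lo hi.
             g \<alpha> x = fs \<alpha> (\<lambda>\<beta>\<in>S \<alpha>. g \<beta> (restrict x \<beta>))) \<and>
          (\<forall>x\<in>cuboid D lo hi. f x = fs D (\<lambda>\<beta>\<in>S D. g \<beta> (restrict x \<beta>))))"

text \<open>
  Elements of \<open>W\<^sup>s\<^sup>,\<^sup>\<infinity>\<close> with \<open>s \<ge> 1\<close> are identified with their continuous representatives, as
  composition is not defined for classes of functions modulo null sets.
\<close>

definition tree_class :: "nat set \<Rightarrow> (nat set \<Rightarrow> nat set set) \<Rightarrow> (nat \<Rightarrow> real) \<Rightarrow> (nat \<Rightarrow> real) \<Rightarrow>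
    real \<Rightarrow> nat \<Rightarrow> (nat \<Rightarrow> real) \<Rightarrow> ((nat \<Rightarrow> real) \<Rightarrow> real) set" where
  "tree_class D S lo hi \<Lambda> s B = {f. \<exists>ilo ihi fs. tree_composition D S lo hi \<Lambda> ilo ihi fs f \<and>
     (\<forall>\<alpha>\<in>interior_nodes D S. continuous_on (cuboid (S \<alpha>) ilo ihi) (fs \<alpha>) \<and>
        fs \<alpha> \<in> sobolev (S \<alpha>) ilo ihi s \<infinity>) \<and>
     W_inf_norm (S D) ilo ihi s (fs D) \<le> 1 \<and>
     (\<forall>\<alpha>\<in>interior_nodes D S - {D}. \<forall>k\<in>multi_indices (S \<alpha>) s. 1 \<le> sum k (S \<alpha>) \<longrightarrow>
        Lp_norm \<infinity> (unif_cuboid (S \<alpha>) ilo ihi) (Dk (S \<alpha>) ilo ihi k (fs \<alpha>))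
          \<le> ereal (B (sum k (S \<alpha>))))}"


section \<open>Tree tensor formats\<close>

definition fscale :: "real \<Rightarrow> ('a \<Rightarrow> real) \<Rightarrow> 'a \<Rightarrow> real" where
  "fscale c f = (\<lambda>x. c * f x)"

interpretation fun_vs: vector_space "fscale :: real \<Rightarrow> ('a \<Rightarrow> real) \<Rightarrow> 'a \<Rightarrow> real"
  by standard (simp_all add: fscale_def fun_eq_iff algebra_simps)

definition tensor_space :: "nat set \<Rightarrow> (nat \<Rightarrow> (real \<Rightarrow> real) set) \<Rightarrow> ((nat \<Rightarrow> real) \<Rightarrow> real) set" where
  "tensor_space D V = fun_vs.span {(\<lambda>x. \<Prod>\<nu>\<in>D. u \<nu> (x \<nu>)) | u. \<forall>\<nu>\<in>D. u \<nu> \<in> V \<nu>}"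

definition node_rank :: "nat set \<Rightarrow> (nat \<Rightarrow> real) \<Rightarrow> (nat \<Rightarrow> real) \<Rightarrow> nat set \<Rightarrow>
    ((nat \<Rightarrow> real) \<Rightarrow> real) \<Rightarrow> enat" where
  "node_rank D lo hi \<alpha> v = Inf {enat k | k. \<exists>u w. \<forall>x\<in>cuboid D lo hi.
     v x = (\<Sum>i<k. u i (restrict x \<alpha>) * w i (restrict x (D - \<alpha>)))}"

definition tree_format :: "nat set \<Rightarrow> (nat set \<Rightarrow> nat set set) \<Rightarrow> (nat \<Rightarrow> real) \<Rightarrow> (nat \<Rightarrow> real) \<Rightarrow>
    (nat set \<Rightarrow> nat) \<Rightarrow> ((nat \<Rightarrow> real) \<Rightarrow> real) set \<Rightarrow> ((nat \<Rightarrow> real) \<Rightarrow> real) set" where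
  "tree_format D S lo hi r U = {v\<in>U. \<forall>\<alpha>\<in>nodes D S - {D}. node_rank D lo hi \<alpha> v \<le> enat (r \<alpha>)}"

definition best_error :: "nat set \<Rightarrow> (nat set \<Rightarrow> nat set set) \<Rightarrow> (nat \<Rightarrow> real) \<Rightarrow> (nat \<Rightarrow> real) \<Rightarrow>
    (nat set \<Rightarrow> nat) \<Rightarrow> ((nat \<Rightarrow> real) \<Rightarrow> real) set \<Rightarrow> ereal \<Rightarrow> ((nat \<Rightarrow> real) \<Rightarrow> real) \<Rightarrow> ereal" where
  "best_error D S lo hi r U p f =
     (INF v\<in>tree_format D S lo hi r U. Lp_norm p (unif_cuboid D lo hi) (\<lambda>x. f x - v x))"

definition complexity :: "nat set \<Rightarrow> (nat set \<Rightarrow> nat set set) \<Rightarrow> (nat set \<Rightarrow> nat) \<Rightarrow>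
    (nat \<Rightarrow> (real \<Rightarrow> real) set) \<Rightarrow> nat" where
  "complexity D S r V =
     (\<Sum>\<alpha>\<in>interior_nodes D S. r \<alpha> * (\<Prod>\<beta>\<in>S \<alpha>. r \<beta>)) + (\<Sum>\<nu>\<in>D. r {\<nu>} * fun_vs.dim (V \<nu>))"

text \<open>
  The value is \<open>\<infinity>\<close> if the accuracy \<open>\<epsilon>\<close> cannot be reached; otherwise the infimum is a minimum.
\<close>

definition min_complexity :: "nat set \<Rightarrow> (nat set \<Rightarrow> nat set set) \<Rightarrow> (nat \<Rightarrow> real) \<Rightarrow> (nat \<Rightarrow> real) \<Rightarrow>
    (nat \<Rightarrow> nat \<Rightarrow> (real \<Rightarrow> real) set) \<Rightarrow> ereal \<Rightarrow> ((nat \<Rightarrow> real) \<Rightarrow> real) \<Rightarrow> real \<Rightarrow> enat" where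
  "min_complexity D S lo hi U p f \<epsilon> =
     Inf {enat (complexity D S r (\<lambda>\<nu>. U \<nu> (n \<nu>))) | r n.
       r D = 1 \<and> (\<forall>\<nu>\<in>D. 1 \<le> n \<nu>) \<and>
       best_error D S lo hi r (tensor_space D (\<lambda>\<nu>. U \<nu> (n \<nu>))) p f \<le> ereal \<epsilon>}"


section \<open>Univariate approximation spaces\<close>

text \<open>
  Functions on \<open>{a..b}\<close> are represented by their extension by zero.  An \<open>m\<close>-dimensional subspace of
  \<open>L\<^sup>2\<close> is given by a linear space of representatives in which only zero vanishes almost everywhere,
  so that its dimension as a function space is that of the space of classes.
\<close>

definition L2_subspace :: "real \<Rightarrow> real \<Rightarrow> nat \<Rightarrow> (real \<Rightarrow> real) set \<Rightarrow> bool" where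
  "L2_subspace a b m V \<longleftrightarrow> fun_vs.subspace V \<and> fun_vs.dim V = m \<and>
     (\<forall>u\<in>V. Lp_norm 2 (unif a b) u < \<infinity> \<and> (\<forall>t. t \<notin> {a..b} \<longrightarrow> u t = 0) \<and>
        ((AE t in unif a b. u t = 0) \<longrightarrow> u = (\<lambda>_. 0)))"

definition jackson :: "real \<Rightarrow> nat \<Rightarrow> real \<Rightarrow> real \<Rightarrow> nat \<Rightarrow> (real \<Rightarrow> real) set \<Rightarrow> bool" where
  "jackson M s a b m V \<longleftrightarrow> (\<forall>u. in_Hs a b s u \<longrightarrow>
     (INF v\<in>V. Lp_norm 2 (unif a b) (\<lambda>t. u t - v t)) \<le> ereal (M * real m powr - real s * Hs_norm a b s u))"

definition equispaced_node :: "real \<Rightarrow> real \<Rightarrow> nat \<Rightarrow> nat \<Rightarrow> real" where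
  "equispaced_node a b m i = a + real i * (b - a) / real (m - 1)"

definition piecewise_linear :: "real \<Rightarrow> real \<Rightarrow> nat \<Rightarrow> (real \<Rightarrow> real) set" where
  "piecewise_linear a b m = {u. (\<forall>t. t \<notin> {a..b} \<longrightarrow> u t = 0) \<and>
     (if m = 1 then \<exists>c. \<forall>t\<in>{a..b}. u t = c
      else continuous_on {a..b} u \<and>
        (\<forall>i<m - 1. \<exists>c e. \<forall>t\<in>{equispaced_node a b m i..equispaced_node a b m (Suc i)}. u t = c + e * t))}"

definition approximation_spaces :: "ereal \<Rightarrow> nat \<Rightarrow> real \<Rightarrow> nat set \<Rightarrow> (nat \<Rightarrow> real) \<Rightarrow> (nat \<Rightarrow> real) \<Rightarrow>
    (nat \<Rightarrow> nat \<Rightarrow> (real \<Rightarrow> real) set) \<Rightarrow> bool" where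
  "approximation_spaces p s M D lo hi U \<longleftrightarrow>
     (if p = \<infinity> then \<forall>\<nu>\<in>D. \<forall>m\<ge>1. U \<nu> m = piecewise_linear (lo \<nu>) (hi \<nu>) m
      else \<forall>\<nu>\<in>D. \<forall>m\<ge>1. L2_subspace (lo \<nu>) (hi \<nu>) m (U \<nu> m) \<and> jackson M s (lo \<nu>) (hi \<nu>) m (U \<nu> m))"


section \<open>Dependence of the constants on the dimension\<close>

text \<open>Growth faster than every exponential.\<close>

definition superexponential :: "(nat \<Rightarrow> real) \<Rightarrow> bool" where
  "superexponential C \<longleftrightarrow> (\<forall>K>0. (\<lambda>d. K ^ d) \<in> o(C))"

definition polynomially_bounded :: "(nat \<Rightarrow> real) \<Rightarrow> bool" where
  "polynomially_bounded C \<longleftrightarrow> (\<exists>q. C \<in> O(\<lambda>d. real d ^ q))"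

definition B_star :: "nat \<Rightarrow> (nat \<Rightarrow> real) \<Rightarrow> real" where
  "B_star s B = (if 2 \<le> s then Max (B ` {1..s}) else 1)"

end

theory Submission
  imports Defs
begin

text \<open>
  Fix the variables outside a node \<open>\<alpha>\<close>.  Then \<open>f\<close> is a function \<open>G\<close> of the single number
  \<open>g \<alpha> x\<^sub>\<alpha>\<close>, and composing the \<open>fs\<close> along the path from \<open>\<alpha>\<close> to the root shows that \<open>G\<close> is a
  uniform limit of smooth functions whose derivatives up to order \<open>s\<close> are bounded by
  \<open>K = (C L B\<^sub>1\<^sup>L B\<^sub>\<star>)\<^sup>s\<close>: in each chain rule only the top-order term multiplies a factor with
  coefficient 1, and summing the others along the path gives the factor \<open>L\<close>.  Therefore \<open>R\<close>
  functions of \<open>x\<^sub>\<alpha>\<close> (piecewise polynomials or hat functions of \<open>g \<alpha> x\<^sub>\<alpha>\<close>, and a basis of the given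
  space at a leaf) approximate all these slices with error \<open>O(K R\<^sup>-\<^sup>s)\<close>.  The corresponding linear
  operators in the variables \<open>x\<^sub>\<alpha>\<close> (orthogonal projections for \<open>p = 2\<close>, interpolation for
  \<open>p = \<infinity>\<close>) are contractions.  Composed in the order of the tree, they yield a tensor with all
  ranks at most \<open>R\<close>, and the error is at most the sum of the errors of the at most \<open>d\<^sup>2\<close> nodes.  It remains to
  take \<open>R\<close> of the order \<open>(d\<^sup>2 K / \<epsilon>)\<^sup>1\<^sup>/\<^sup>s\<close>; for \<open>\<epsilon> \<ge> 1\<close> the zero tensor suffices.
\<close>

section \<open>Smooth functions of one real variable\<close>

text \<open>The order of the operators is what keeps the ranks: larger nodes come first. By
  laminarity every later operator acts inside the node or outside it, hence on one side of a
  separated sum with \<open>R\<close> terms, and keeps its length; the leaves come last and put the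
  result into the tensor space. Contractivity lets errors add: f - P w = (f - P f) + P (f - w).

  Slices live on lines, which are null sets, where a weak derivative has no values. The bounds are
  transferred by mollification, since averages of a weak derivative are bounded at every point. The
  kernels remain inside the box because their centres are contracted towards its midpoint, which can
  only shrink derivatives.

  For p = 2, slices are handled by integrating over two independent points with mixed coordinates.
  For p = \<infinity>, nonnegative hats with sum 1 make interpolation contractive, and its order 2
  explains s \<le> 2.

  All ranks are \<open>R\<close> except 1 at the root. Another interior node can cost
  \<open>R\<close> to the power a + 1; the trivial tree has only its root, which gives the exponent
  d. The factor d^2 raised to the power d makes the constant super-exponential.\<close>

fun ndiff :: "nat \<Rightarrow> (real \<Rightarrow> real) \<Rightarrow> bool" where
  "ndiff 0 f = True"
| "ndiff (Suc n) f = ((\<forall>x. f differentiable (at x)) \<and> ndiff n (deriv f))"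

text \<open>Differentiability is required on the whole line, so that iterated \<open>deriv\<close>
  never carries a side condition; intervals enter only through the bounds.\<close>

definition smooth_real :: "(real \<Rightarrow> real) \<Rightarrow> bool" where
  "smooth_real f \<longleftrightarrow> (\<forall>n. ndiff n f)"

lemma ndiff_mono: "ndiff (Suc n) f \<Longrightarrow> ndiff n f"
  by (induction n arbitrary: f) auto

lemma ndiff_has_deriv: "ndiff (Suc n) f \<Longrightarrow> (f has_real_derivative deriv f x) (at x)"
  using DERIV_deriv_iff_real_differentiable by auto

lemma ndiff_SucI:
  assumes "\<And>x. (f has_real_derivative f' x) (at x)" "ndiff n f'"
  shows "ndiff (Suc n) f"
proof -
  have "deriv f = f'"
    using assms(1) by (auto simp: fun_eq_iff intro: DERIV_imp_deriv)
  then show ?thesis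
    using assms real_differentiable_def by auto
qed

lemma ndiff_const: "ndiff n (\<lambda>_. c)"
proof (induction n arbitrary: c)
  case (Suc n)
  show ?case
    by (rule ndiff_SucI[of _ "\<lambda>_. 0"]) (auto simp: Suc)
qed auto

lemma ndiff_affine: "ndiff n (\<lambda>x. c * x + d)"
proof (cases n)
  case (Suc m)
  show ?thesis unfolding Suc
    by (rule ndiff_SucI[of _ "\<lambda>_. c"]) (auto simp: ndiff_const intro!: derivative_eq_intros)
qed auto

lemma ndiff_add: "ndiff n f \<Longrightarrow> ndiff n g \<Longrightarrow> ndiff n (\<lambda>x. f x + g x)"
proof (induction n arbitrary: f g)
  case (Suc n)
  show ?case
    by (rule ndiff_SucI[of _ "\<lambda>x. deriv f x + deriv g x"])
       (use Suc in \<open>auto simp del: ndiff.simps intro!: derivative_eq_intros ndiff_has_deriv Suc\<close>, use Suc in auto)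
qed auto

lemma ndiff_mult: "ndiff n f \<Longrightarrow> ndiff n g \<Longrightarrow> ndiff n (\<lambda>x. f x * g x)"
proof (induction n arbitrary: f g)
  case (Suc n)
  note d = ndiff_has_deriv[OF Suc(2)] ndiff_has_deriv[OF Suc(3)]
  have m: "ndiff n f" "ndiff n g" "ndiff n (deriv f)" "ndiff n (deriv g)"
    using Suc(2,3) ndiff_mono[of n f] ndiff_mono[of n g] by simp_all
  show ?case
    by (rule ndiff_SucI[of _ "\<lambda>x. deriv f x * g x + deriv g x * f x"])
       (rule DERIV_mult[OF d], rule ndiff_add[OF Suc.IH[OF m(3,2)] Suc.IH[OF m(4,1)]])
qed auto

lemma ndiff_compose: "ndiff n f \<Longrightarrow> ndiff n g \<Longrightarrow> ndiff n (\<lambda>x. f (g x))"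
proof (induction n arbitrary: f g)
  case (Suc n)
  note d = ndiff_has_deriv[OF Suc(2)] ndiff_has_deriv[OF Suc(3)]
  have m: "ndiff n g" "ndiff n (deriv f)" "ndiff n (deriv g)"
    using Suc(2,3) ndiff_mono[of n g] by simp_all
  show ?case
    by (rule ndiff_SucI[of _ "\<lambda>x. deriv f (g x) * deriv g x"])
       (rule DERIV_chain2[OF d], rule ndiff_mult[OF Suc.IH[OF m(2,1)] m(3)])
qed auto

lemma derivs_deriv: "(deriv ^^ n) (deriv f) = (deriv ^^ Suc n) f"
  by (simp add: funpow_Suc_right del: funpow.simps)

lemma smooth_real_deriv: "smooth_real f \<Longrightarrow> smooth_real (deriv f)"
  unfolding smooth_real_def using ndiff.simps(2) by blast

lemma smooth_real_derivs: "smooth_real f \<Longrightarrow> smooth_real ((deriv ^^ n) f)"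
  by (induction n) (auto intro: smooth_real_deriv)

lemma smooth_real_has_deriv:
  "smooth_real f \<Longrightarrow> ((deriv ^^ n) f has_real_derivative (deriv ^^ Suc n) f x) (at x)"
  using ndiff_has_deriv[of 0 "(deriv ^^ n) f"] smooth_real_derivs[of f n]
  unfolding smooth_real_def by (metis funpow.simps(2) o_apply)

lemma smooth_real_has_deriv1: "smooth_real f \<Longrightarrow> (f has_real_derivative deriv f x) (at x)"
  using smooth_real_has_deriv[of f 0] by simp

lemma smooth_real_isCont: "smooth_real f \<Longrightarrow> isCont ((deriv ^^ n) f) x"
  using smooth_real_has_deriv DERIV_isCont by blast

lemma smooth_real_continuous_on: "smooth_real f \<Longrightarrow> continuous_on A ((deriv ^^ n) f)"
  by (simp add: continuous_at_imp_continuous_on smooth_real_isCont)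

text \<open>An explicit sequence of derivatives (of \<open>exp_inv\<close>, of a test function, of a
  mollified function) gives smoothness without evaluating iterated \<open>deriv\<close>.\<close>

lemma smooth_realI:
  assumes "\<And>n x. (F n has_real_derivative F (Suc n) x) (at x)"
  shows "smooth_real (F n)"
proof -
  have "ndiff m (F n)" for m n
    using assms by (induction m arbitrary: n) (auto intro: ndiff_SucI simp del: ndiff.simps(2))
  then show ?thesis by (simp add: smooth_real_def)
qed

lemma smooth_real_const: "smooth_real (\<lambda>_. c)"
  by (simp add: smooth_real_def ndiff_const)

lemma smooth_real_affine: "smooth_real (\<lambda>x. c * x + d)"
  by (simp add: smooth_real_def ndiff_affine)

lemma smooth_real_add: "smooth_real f \<Longrightarrow> smooth_real g \<Longrightarrow> smooth_real (\<lambda>x. f x + g x)"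
  by (simp add: smooth_real_def ndiff_add)

lemma smooth_real_mult: "smooth_real f \<Longrightarrow> smooth_real g \<Longrightarrow> smooth_real (\<lambda>x. f x * g x)"
  by (simp add: smooth_real_def ndiff_mult)

lemma smooth_real_compose: "smooth_real f \<Longrightarrow> smooth_real g \<Longrightarrow> smooth_real (\<lambda>x. f (g x))"
  by (simp add: smooth_real_def ndiff_compose)

lemma smooth_real_exp: "smooth_real exp"
  using smooth_realI[of "\<lambda>_. exp"] by (auto intro!: derivative_eq_intros)

lemma derivs_add:
  assumes "smooth_real f" "smooth_real g"
  shows "(deriv ^^ n) (\<lambda>x. f x + g x) = (\<lambda>x. (deriv ^^ n) f x + (deriv ^^ n) g x)"
proof (induction n)
  case (Suc n)
  show ?case
    using assms by (auto simp: Suc fun_eq_iff intro!: DERIV_imp_deriv derivative_eq_intros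
      smooth_real_has_deriv1 smooth_real_derivs)
qed auto

lemma derivs_affine:
  assumes "smooth_real f"
  shows "(deriv ^^ n) (\<lambda>x. f (c * x + d)) = (\<lambda>x. c ^ n * (deriv ^^ n) f (c * x + d))"
proof (induction n)
  case (Suc n)
  have "((\<lambda>x. c ^ n * (deriv ^^ n) f (c * x + d)) has_real_derivative
      c ^ n * ((deriv ^^ Suc n) f (c * x + d) * c)) (at x)" for x
    by (rule DERIV_cmult, rule DERIV_chain2[OF smooth_real_has_deriv[OF assms]])
       (auto intro!: derivative_eq_intros)
  then have "deriv (\<lambda>x. c ^ n * (deriv ^^ n) f (c * x + d)) = (\<lambda>x. c ^ n * ((deriv ^^ Suc n) f (c * x + d) * c))"
    using DERIV_imp_deriv by blast
  then show ?case
    unfolding funpow.simps o_apply Suc by (simp add: mult_ac)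
qed auto

lemma derivs_mult:
  assumes "smooth_real f" "smooth_real g"
  shows "(deriv ^^ n) (\<lambda>x. f x * g x) x =
    (\<Sum>i\<le>n. real (n choose i) * (deriv ^^ i) f x * (deriv ^^ (n - i)) g x)"
  using assms
proof (induction n arbitrary: f g x)
  case (Suc n)
  have s: "smooth_real (deriv f)" "smooth_real (deriv g)"
    using Suc smooth_real_deriv by auto
  have "deriv (\<lambda>x. f x * g x) = (\<lambda>x. deriv f x * g x + f x * deriv g x)"
    using Suc by (auto simp: fun_eq_iff intro!: DERIV_imp_deriv derivative_eq_intros
      smooth_real_has_deriv1)
  then have "(deriv ^^ Suc n) (\<lambda>x. f x * g x) x
     = (deriv ^^ n) (\<lambda>x. deriv f x * g x + f x * deriv g x) x"
    by (simp add: funpow_Suc_right del: funpow.simps)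
  also have "\<dots> = (\<Sum>i\<le>n. real (n choose i) * (deriv ^^ Suc i) f x * (deriv ^^ (n - i)) g x)
     + (\<Sum>i\<le>n. real (n choose i) * (deriv ^^ i) f x * (deriv ^^ (Suc (n - i))) g x)"
    using Suc s by (subst derivs_add) 
      (auto simp: smooth_real_mult funpow_Suc_right simp del: funpow.simps)
  also have "(\<Sum>i\<le>n. real (n choose i) * (deriv ^^ i) f x * (deriv ^^ (Suc (n - i))) g x)
    = f x * (deriv ^^ Suc n) g x + (\<Sum>i\<le>n. real (n choose Suc i) * (deriv ^^ Suc i) f x * (deriv ^^ (n - i)) g x)"
  proof -
    have "(\<Sum>i\<le>n. real (n choose i) * (deriv ^^ i) f x * (deriv ^^ (Suc (n - i))) g x)
      = (\<Sum>i\<le>Suc n. real (n choose i) * (deriv ^^ i) f x * (deriv ^^ (Suc n - i)) g x)"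
      by (simp add: Suc_diff_le del: funpow.simps)
    then show ?thesis
      by (subst (asm) sum.atMost_Suc_shift) (simp del: funpow.simps(2))
  qed
  \<comment> \<open>Both sums now carry the same products, so Pascal's rule merges them.\<close>
  finally show ?case
    by (subst sum.atMost_Suc_shift)
       (simp add: algebra_simps sum.distrib[symmetric] del: funpow.simps(2))
qed auto

text \<open>In the Faa di Bruno expansion only the top-order term carries the coefficient 1; the
  others are collected with a constant that does not depend on the functions.\<close>

lemma derivs_compose_bound:
  "\<exists>c\<ge>0. \<forall>k\<le>K. \<forall>H h x A b b'. smooth_real H \<longrightarrow> smooth_real h \<longrightarrow> 1 \<le> b \<longrightarrow> 1 \<le> b' \<longrightarrow>
     (\<forall>j\<le>k. \<bar>(deriv ^^ j) H (h x)\<bar> \<le> A j) \<longrightarrow> (1 \<le> k \<longrightarrow> \<bar>deriv h x\<bar> \<le> b) \<longrightarrow>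
     (\<forall>j\<in>{2..k}. \<bar>(deriv ^^ j) h x\<bar> \<le> b') \<longrightarrow>
     \<bar>(deriv ^^ k) (\<lambda>x. H (h x)) x\<bar> \<le> A k * b ^ k + c * (\<Sum>j=1..<k. A j * b ^ j * b' ^ (k - j))"
proof (induction K)
  case 0
  show ?case by (rule exI[of _ 0]) auto
next
  case (Suc K)
  then obtain c where "c \<ge> 0 \<and> (\<forall>k\<le>K. \<forall>H h x A b b'. smooth_real H \<longrightarrow> smooth_real h \<longrightarrow> 1 \<le> b \<longrightarrow> 1 \<le> b' \<longrightarrow>
     (\<forall>j\<le>k. \<bar>(deriv ^^ j) H (h x)\<bar> \<le> A j) \<longrightarrow> (1 \<le> k \<longrightarrow> \<bar>deriv h x\<bar> \<le> b) \<longrightarrow>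
     (\<forall>j\<in>{2..k}. \<bar>(deriv ^^ j) h x\<bar> \<le> b') \<longrightarrow>
     \<bar>(deriv ^^ k) (\<lambda>x. H (h x)) x\<bar> \<le> A k * b ^ k + c * (\<Sum>j=1..<k. A j * b ^ j * b' ^ (k - j)))"
    by (elim exE)
  then have c: "c \<ge> 0" and IH': "\<forall>k\<le>K. \<forall>H h x A b b'. smooth_real H \<longrightarrow> smooth_real h \<longrightarrow> 1 \<le> b \<longrightarrow> 1 \<le> b' \<longrightarrow>
     (\<forall>j\<le>k. \<bar>(deriv ^^ j) H (h x)\<bar> \<le> A j) \<longrightarrow> (1 \<le> k \<longrightarrow> \<bar>deriv h x\<bar> \<le> b) \<longrightarrow>
     (\<forall>j\<in>{2..k}. \<bar>(deriv ^^ j) h x\<bar> \<le> b') \<longrightarrow>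
     \<bar>(deriv ^^ k) (\<lambda>x. H (h x)) x\<bar> \<le> A k * b ^ k + c * (\<Sum>j=1..<k. A j * b ^ j * b' ^ (k - j))"
    by (rule conjunct1, rule conjunct2)
  have IH: "\<bar>(deriv ^^ k) (\<lambda>x. H (h x)) x\<bar> \<le> A k * b ^ k + c * (\<Sum>j=1..<k. A j * b ^ j * b' ^ (k - j))"
    if "k \<le> K" "smooth_real H" "smooth_real h" "1 \<le> b" "1 \<le> b'"
     "\<forall>j\<le>k. \<bar>(deriv ^^ j) H (h x)\<bar> \<le> A j" "1 \<le> k \<longrightarrow> \<bar>deriv h x\<bar> \<le> b"
     "\<forall>j\<in>{2..k}. \<bar>(deriv ^^ j) h x\<bar> \<le> b'" for k H h x A b b'
    using IH'[THEN spec, THEN mp, OF that(1), THEN spec, THEN spec, THEN spec, THEN spec, THEN spec, THEN spec,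
      THEN mp, THEN mp, THEN mp, THEN mp, THEN mp, THEN mp, THEN mp, OF that(2-8)] .
  \<comment> \<open>In the Leibniz sum for (H' o h) h', each term i < K costs at most (1 + c) times
    the lower-order sum; the term i = K supplies the top-order summand with coefficient 1 and
    another c times that sum.\<close>
  define c' where "c' = c + (\<Sum>i<K. real (K choose i) * (1 + c))"
  have c': "c \<le> c'" "c' \<ge> 0"
    unfolding c'_def using c by (simp_all add: sum_nonneg)
  have main: "\<bar>(deriv ^^ Suc K) (\<lambda>x. H (h x)) x\<bar> \<le> A (Suc K) * b ^ Suc K + c' * (\<Sum>j=1..<Suc K. A j * b ^ j * b' ^ (Suc K - j))"
    if H: "smooth_real H" "smooth_real h" "1 \<le> b" "1 \<le> b'"
     "\<forall>j\<le>Suc K. \<bar>(deriv ^^ j) H (h x)\<bar> \<le> A j" "1 \<le> Suc K \<longrightarrow> \<bar>deriv h x\<bar> \<le> b"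
     "\<forall>j\<in>{2..Suc K}. \<bar>(deriv ^^ j) h x\<bar> \<le> b'" for H h x A b b'
  proof -
    let ?T = "\<Sum>j=1..<Suc K. A j * b ^ j * b' ^ (Suc K - j)"
    have A0: "A j \<ge> 0" if "j \<le> Suc K" for j
      by (rule order_trans[OF abs_ge_zero H(5)[rule_format, OF that]])
    have "deriv (\<lambda>x. H (h x)) = (\<lambda>x. deriv H (h x) * deriv h x)"
      by (intro ext DERIV_imp_deriv DERIV_chain2[OF smooth_real_has_deriv1 smooth_real_has_deriv1] H)
    then have "(deriv ^^ Suc K) (\<lambda>x. H (h x)) x = (deriv ^^ K) (\<lambda>x. deriv H (h x) * deriv h x) x"
      by (simp add: funpow_Suc_right del: funpow.simps)
    also have "\<dots> = (\<Sum>i\<le>K. real (K choose i) * (deriv ^^ i) (\<lambda>x. deriv H (h x)) x * (deriv ^^ Suc (K - i)) h x)"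
      using H by (subst derivs_mult) (auto simp: smooth_real_deriv smooth_real_compose funpow_Suc_right simp del: funpow.simps)
    finally have eq: "(deriv ^^ Suc K) (\<lambda>x. H (h x)) x =
      (\<Sum>i<K. real (K choose i) * (deriv ^^ i) (\<lambda>x. deriv H (h x)) x * (deriv ^^ Suc (K - i)) h x)
       + (deriv ^^ K) (\<lambda>x. deriv H (h x)) x * deriv h x"
      by (subst (asm) lessThan_Suc_atMost[symmetric]) simp
    \<comment> \<open>The induction hypothesis is used for \<open>deriv H\<close>, whose bounds are
      those of \<open>H\<close> shifted by one.\<close>
    have I: "\<bar>(deriv ^^ i) (\<lambda>x. deriv H (h x)) x\<bar> \<le> A (Suc i) * b ^ i + c * (\<Sum>j=1..<i. A (Suc j) * b ^ j * b' ^ (i - j))"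
      if "i \<le> K" for i
    proof (rule IH[where A = "\<lambda>j. A (Suc j)" and H = "deriv H" and h = h and b = b and b' = b'])
      show "\<forall>j\<le>i. \<bar>(deriv ^^ j) (deriv H) (h x)\<bar> \<le> A (Suc j)"
        using H(5) that by (auto simp: derivs_deriv simp del: funpow.simps)
      show "1 \<le> i \<longrightarrow> \<bar>deriv h x\<bar> \<le> b" "\<forall>j\<in>{2..i}. \<bar>(deriv ^^ j) h x\<bar> \<le> b'"
        using that H(6,7) by simp_all
    qed (use that H(1-4) smooth_real_deriv in simp_all)
    have S: "(\<Sum>j=1..<i. A (Suc j) * b ^ j * b' ^ (i - j)) * B \<le> ?T"
      if "i \<le> K" "B = b \<and> i = K \<or> B = b' \<and> i < K" for i B
    proof -
      have "(\<Sum>j=1..<i. A (Suc j) * b ^ j * b' ^ (i - j)) * B = (\<Sum>j=1..<i. A (Suc j) * b ^ j * b' ^ (i - j) * B)"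
        by (simp add: sum_distrib_right)
      also have "\<dots> \<le> (\<Sum>j=1..<i. A (Suc j) * b ^ Suc j * b' ^ (K - j))"
      proof (rule sum_mono)
        fix j assume j: "j \<in> {1..<i}"
        have "b ^ j * b' ^ (i - j) * B \<le> b ^ Suc j * b' ^ (K - j)"
        proof (cases "i = K")
          case True
          then show ?thesis using that by (auto simp: mult_ac)
        next
          case False
          then have "i < K" "B = b'" using that by auto
          have "b ^ j * (b' ^ (i - j) * b') \<le> b ^ Suc j * b' ^ (K - j)"
          proof (rule mult_mono)
            show "b ^ j \<le> b ^ Suc j" using H(3) by (simp add: mult_ge1_I)
            have "b' ^ (i - j) * b' = b' ^ (Suc i - j)"
              using j by (simp add: Suc_diff_le)
            also have "\<dots> \<le> b' ^ (K - j)"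
              using \<open>i < K\<close> H by (intro power_increasing) auto
            finally show "b' ^ (i - j) * b' \<le> b' ^ (K - j)" .
          qed (use H in auto)
          then show ?thesis using \<open>B = b'\<close> by (simp add: mult_ac)
        qed
        then have "A (Suc j) * (b ^ j * b' ^ (i - j) * B) \<le> A (Suc j) * (b ^ Suc j * b' ^ (K - j))"
          using A0 j that by (intro mult_left_mono) auto
        then show "A (Suc j) * b ^ j * b' ^ (i - j) * B \<le> A (Suc j) * b ^ Suc j * b' ^ (K - j)"
          by (simp add: mult_ac)
      qed
      also have "\<dots> = (\<Sum>j=2..<Suc i. A j * b ^ j * b' ^ (Suc K - j))"
        by (rule sum.reindex_bij_witness[of _ "\<lambda>j. j - 1" Suc]) auto
      also have "\<dots> \<le> ?T"
        using H A0 that by (intro sum_mono2) auto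
      finally show ?thesis .
    qed
    have T: "A (Suc i) * b ^ i * b' \<le> ?T" if "i < K" for i
    proof -
      have "b ^ i * b' \<le> b ^ Suc i * b' ^ (K - i)"
      proof (rule mult_mono)
        show "b ^ i \<le> b ^ Suc i" using H(3) by (simp add: mult_ge1_I)
        show "b' \<le> b' ^ (K - i)" using that H self_le_power[of b' "K - i"] by simp
      qed (use H in auto)
      then have "A (Suc i) * (b ^ i * b') \<le> A (Suc i) * (b ^ Suc i * b' ^ (K - i))"
        using A0 that by (intro mult_left_mono) auto
      also have "\<dots> = (\<Sum>j\<in>{Suc i}. A j * b ^ j * b' ^ (Suc K - j))" by (simp add: mult_ac)
      also have "\<dots> \<le> ?T"
        using H A0 that by (intro sum_mono2) auto
      finally show ?thesis by (simp add: mult_ac)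
    qed
    have "\<bar>(deriv ^^ Suc K) (\<lambda>x. H (h x)) x\<bar> \<le>
      (\<Sum>i<K. \<bar>real (K choose i) * (deriv ^^ i) (\<lambda>x. deriv H (h x)) x * (deriv ^^ Suc (K - i)) h x\<bar>)
       + \<bar>(deriv ^^ K) (\<lambda>x. deriv H (h x)) x * deriv h x\<bar>"
      unfolding eq by (rule order_trans[OF abs_triangle_ineq]) (rule add_right_mono, rule sum_abs)
    also have "\<dots> \<le> (\<Sum>i<K. real (K choose i) * (1 + c) * ?T) + (A (Suc K) * b ^ Suc K + c * ?T)"
    proof (intro add_mono sum_mono)
      fix i assume i: "i \<in> {..<K}"
      have "\<bar>(deriv ^^ i) (\<lambda>x. deriv H (h x)) x * (deriv ^^ Suc (K - i)) h x\<bar>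
        \<le> (A (Suc i) * b ^ i + c * (\<Sum>j=1..<i. A (Suc j) * b ^ j * b' ^ (i - j))) * b'"
        unfolding abs_mult
      proof (rule mult_mono)
        show "\<bar>(deriv ^^ Suc (K - i)) h x\<bar> \<le> b'"
          using H(7) i by (auto simp del: funpow.simps)
      qed (use i I[of i] order_trans[OF abs_ge_zero I[of i]] in auto)
      also have "\<dots> \<le> ?T + c * ?T"
        using T[of i] mult_left_mono[OF S[of i b'] c] i by (simp add: algebra_simps)
      finally have "real (K choose i) * \<bar>(deriv ^^ i) (\<lambda>x. deriv H (h x)) x * (deriv ^^ Suc (K - i)) h x\<bar>
         \<le> real (K choose i) * (?T + c * ?T)"
        by (rule mult_left_mono) auto
      then show "\<bar>real (K choose i) * (deriv ^^ i) (\<lambda>x. deriv H (h x)) x * (deriv ^^ Suc (K - i)) h x\<bar>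
         \<le> real (K choose i) * (1 + c) * ?T"
        by (simp add: abs_mult algebra_simps)
    next
      have "\<bar>(deriv ^^ K) (\<lambda>x. deriv H (h x)) x * deriv h x\<bar>
        \<le> (A (Suc K) * b ^ K + c * (\<Sum>j=1..<K. A (Suc j) * b ^ j * b' ^ (K - j))) * b"
        unfolding abs_mult using H(6) I[of K] order_trans[OF abs_ge_zero I[of K]]
        by (intro mult_mono) auto
      also have "\<dots> \<le> A (Suc K) * b ^ Suc K + c * ?T"
        using mult_left_mono[OF S[of K b] c] by (simp add: algebra_simps)
      finally show "\<bar>(deriv ^^ K) (\<lambda>x. deriv H (h x)) x * deriv h x\<bar> \<le> A (Suc K) * b ^ Suc K + c * ?T" .
    qed
    also have "\<dots> = A (Suc K) * b ^ Suc K + c' * ?T"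
      unfolding c'_def by (simp add: algebra_simps sum_distrib_left sum_distrib_right sum.distrib)
    finally show ?thesis .
  qed
  show ?case
  proof (intro exI[of _ c'] conjI allI impI)
    fix k H h x A b b'
    assume k: "k \<le> Suc K" and H: "smooth_real H" "smooth_real h" "1 \<le> b" "1 \<le> b'"
     "\<forall>j\<le>k. \<bar>(deriv ^^ j) H (h x)\<bar> \<le> A j" "1 \<le> k \<longrightarrow> \<bar>deriv h x\<bar> \<le> b"
     "\<forall>j\<in>{2..k}. \<bar>(deriv ^^ j) h x\<bar> \<le> b'"
    show "\<bar>(deriv ^^ k) (\<lambda>x. H (h x)) x\<bar> \<le> A k * b ^ k + c' * (\<Sum>j=1..<k. A j * b ^ j * b' ^ (k - j))"
    proof (cases "k = Suc K")
      case True
      show ?thesis unfolding True by (rule main[where H = H and h = h and A = A and b = b and b' = b', OF H[unfolded True]])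
    next
      case False
      then have "\<bar>(deriv ^^ k) (\<lambda>x. H (h x)) x\<bar> \<le> A k * b ^ k + c * (\<Sum>j=1..<k. A j * b ^ j * b' ^ (k - j))"
        using k by (intro IH[where H = H and h = h and A = A and b = b and b' = b', OF _ H]) auto
      also have "\<dots> \<le> A k * b ^ k + c' * (\<Sum>j=1..<k. A j * b ^ j * b' ^ (k - j))"
      proof -
        have "0 \<le> A j" if "j \<le> k" for j by (rule order_trans[OF abs_ge_zero H(5)[rule_format, OF that]])
        then have "0 \<le> (\<Sum>j=1..<k. A j * b ^ j * b' ^ (k - j))"
          using H by (intro sum_nonneg) auto
        then show ?thesis using c' by (simp add: mult_right_mono)
      qed
      finally show ?thesis .
    qed
  qed (rule c'(2))
qed

section \<open>Flat functions and bumps\<close>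

definition exp_inv :: "real \<Rightarrow> real" where
  "exp_inv x = (if x > 0 then exp (- (1 / x)) else 0)"

lemma tendsto_poly_mult_exp_neg: "((\<lambda>y. poly p y * exp (- y)) \<longlongrightarrow> (0::real)) at_top"
proof -
  have "((\<lambda>y. \<Sum>i\<le>degree p. coeff p i * (y ^ i / exp y)) \<longlongrightarrow> (\<Sum>i\<le>degree p. coeff p i * 0)) at_top"
    by (intro tendsto_sum tendsto_mult tendsto_const tendsto_power_div_exp_0)
  then show ?thesis
    by (simp add: poly_altdef exp_minus divide_inverse sum_distrib_right mult.assoc)
qed

lemma smooth_real_exp_inv: "smooth_real exp_inv"
proof -
  \<comment> \<open>For x > 0 the n-th derivative is q_n(1/x) exp(-1/x). Differentiating p(1/x)
    exp(-1/x) gives x^(-2) (p - p')(1/x) exp(-1/x), and \<open>[:0, 0, 1:]\<close> is the square of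
    the variable 1/x.\<close>
  define q where "q = rec_nat (1 :: real poly) (\<lambda>_ p. [:0, 0, 1:] * (p - pderiv p))"
  have q: "q 0 = 1" "q (Suc n) = [:0, 0, 1:] * (q n - pderiv (q n))" for n
    by (simp_all add: q_def)
  define F where "F = (\<lambda>n x. if x > 0 then poly (q n) (1 / x) * exp (- (1 / x)) else 0 :: real)"
  have F: "(F n has_real_derivative F (Suc n) x) (at x)" for n x
  proof -
    consider "x > 0" | "x < 0" | "x = 0" by linarith
    then show ?thesis
    proof cases
      case 1
      have "((\<lambda>x. poly (q n) (1 / x) * exp (- (1 / x))) has_real_derivative F (Suc n) x) (at x)"
        using 1 unfolding F_def q
        by (auto intro!: derivative_eq_intros DERIV_chain2[OF poly_DERIV] simp: field_simps power2_eq_square)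
      then show ?thesis
        by (rule has_field_derivative_transform_within_open[of _ _ _ "{0<..}"]) (use 1 in \<open>auto simp: F_def\<close>)
    next
      case 2
      have "((\<lambda>x. 0) has_real_derivative F (Suc n) x) (at x)"
        using 2 by (simp add: F_def)
      then show ?thesis
        by (rule has_field_derivative_transform_within_open[of _ _ _ "{..<0}"]) (use 2 in \<open>auto simp: F_def\<close>)
    next
      case 3
      \<comment> \<open>With y = 1/h the difference quotient at 0 is y q_n(y) exp(-y), which tends
        to 0 as y tends to infinity.\<close>
      have "((\<lambda>y. poly ([:0, 1:] * q n) y * exp (- y)) \<longlongrightarrow> 0) at_top"
        by (rule tendsto_poly_mult_exp_neg)
      then have "((\<lambda>x. poly ([:0, 1:] * q n) (1 / x) * exp (- (1 / x))) \<longlongrightarrow> 0) (at_right 0)"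
        by (rule filterlim_compose) (simp add: divide_inverse filterlim_inverse_at_top_right)
      then have "((\<lambda>h. F n h / h) \<longlongrightarrow> 0) (at_right 0)"
        by (rule Lim_transform_eventually)
           (auto simp: F_def eventually_at_filter)
      moreover have "((\<lambda>h. F n h / h) \<longlongrightarrow> 0) (at_left 0)"
        by (rule tendsto_eventually) (auto simp: F_def eventually_at_filter)
      ultimately have "((\<lambda>h. F n h / h) \<longlongrightarrow> 0) (at 0)"
        by (simp add: filterlim_split_at)
      then show ?thesis
        unfolding 3 DERIV_def by (simp add: F_def)
    qed
  qed
  have "F 0 = exp_inv" by (auto simp: F_def exp_inv_def q)
  with smooth_realI[of F 0] F show ?thesis by simp
qed

text \<open>Left unnormalised; mollification divides by the total mass.\<close>

definition bump :: "real \<Rightarrow> real \<Rightarrow> real \<Rightarrow> real" where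
  "bump c d x = exp_inv (x - c) * exp_inv (d - x)"

lemma smooth_real_bump: "smooth_real (bump c d)"
proof -
  have "smooth_real (\<lambda>x. exp_inv (1 * x + - c) * exp_inv ((- 1) * x + d))"
    by (intro smooth_real_mult smooth_real_compose[OF smooth_real_exp_inv] smooth_real_affine)
  moreover have "bump c d = (\<lambda>x. exp_inv (1 * x + - c) * exp_inv ((- 1) * x + d))"
    by (auto simp: bump_def fun_eq_iff)
  ultimately show ?thesis by simp
qed

lemma bump_nonneg: "bump c d x \<ge> 0"
  by (auto simp: bump_def exp_inv_def)

lemma bump_pos: "bump c d x > 0 \<longleftrightarrow> c < x \<and> x < d"
  by (auto simp: bump_def exp_inv_def)

lemma bump_eq_0: "x \<notin> {c<..<d} \<Longrightarrow> bump c d x = 0"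
  by (auto simp: bump_def exp_inv_def)

text \<open>The complement of a closed interval is open, so the function vanishes in a neighbourhood
  of the point.\<close>

lemma derivs_eq_0_outside:
  assumes "\<And>x. x \<notin> {c..d} \<Longrightarrow> f x = (0::real)" "x \<notin> {c..d}"
  shows "(deriv ^^ n) f x = 0"
  using assms(2)
proof (induction n arbitrary: x)
  case (Suc n)
  have "((\<lambda>_. 0) has_real_derivative 0) (at x)" by simp
  then have "((deriv ^^ n) f has_real_derivative 0) (at x)"
    by (rule has_field_derivative_transform_within_open[of _ _ _ "- {c..d}"])
       (use Suc in \<open>auto intro!: Suc(1)[symmetric]\<close>)
  then show ?case by (simp add: DERIV_imp_deriv)
qed (use assms in auto)

section \<open>Approximation of functions of one variable\<close>

text \<open>
  \<open>u\<close> is a uniform limit of smooth functions with derivatives bounded by \<open>A\<close>.  This form of the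
  bounds is stable under compositions and restriction to lines, without choosing weak derivatives.
\<close>

definition apx :: "nat \<Rightarrow> (nat \<Rightarrow> real) \<Rightarrow> real \<Rightarrow> real \<Rightarrow> (real \<Rightarrow> real) \<Rightarrow> bool" where
  "apx s A a b u \<longleftrightarrow> (\<forall>\<delta>>0. \<exists>h. smooth_real h \<and>
     (\<forall>t\<in>{a..b}. \<bar>h t - u t\<bar> \<le> \<delta> \<and> (\<forall>k\<le>s. \<bar>(deriv ^^ k) h t\<bar> \<le> A k)))"

text \<open>For the inner functions of a composition. The approximants must keep their values in
  \<open>{c..d}\<close>, where the bounds of the outer approximant hold; this also takes the place
  of a bound of order 0. The first derivative has its own bound because it enters the chain rule
  with a higher power.\<close>

definition inner_apx :: "nat \<Rightarrow> real \<Rightarrow> real \<Rightarrow> real \<Rightarrow> real \<Rightarrow> real \<Rightarrow> real \<Rightarrow> (real \<Rightarrow> real) \<Rightarrow> bool" where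
  "inner_apx s B B' a b c d u \<longleftrightarrow> (\<forall>\<delta>>0. \<exists>h. smooth_real h \<and>
     (\<forall>t\<in>{a..b}. \<bar>h t - u t\<bar> \<le> \<delta> \<and> h t \<in> {c..d} \<and> \<bar>deriv h t\<bar> \<le> B \<and>
        (\<forall>k\<in>{2..s}. \<bar>(deriv ^^ k) h t\<bar> \<le> B')))"

lemma apxD:
  "apx s A a b u \<Longrightarrow> \<delta> > 0 \<Longrightarrow> \<exists>h. smooth_real h \<and>
     (\<forall>t\<in>{a..b}. \<bar>h t - u t\<bar> \<le> \<delta> \<and> (\<forall>k\<le>s. \<bar>(deriv ^^ k) h t\<bar> \<le> A k))"
  unfolding apx_def by (elim allE[of _ \<delta>] impE)

lemma inner_apxD:
  "inner_apx s B B' a b c d u \<Longrightarrow> \<delta> > 0 \<Longrightarrow> \<exists>h. smooth_real h \<and>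
     (\<forall>t\<in>{a..b}. \<bar>h t - u t\<bar> \<le> \<delta> \<and> h t \<in> {c..d} \<and> \<bar>deriv h t\<bar> \<le> B \<and>
        (\<forall>k\<in>{2..s}. \<bar>(deriv ^^ k) h t\<bar> \<le> B'))"
  unfolding inner_apx_def by (elim allE[of _ \<delta>] impE)

lemma apx_mono:
  assumes "apx s A a b u" "\<And>k. k \<le> s \<Longrightarrow> A k \<le> A' k" "{a'..b'} \<subseteq> {a..b}"
  shows "apx s A' a' b' u"
  unfolding apx_def
proof (intro allI impI)
  fix \<delta> :: real assume "\<delta> > 0"
  obtain h where h: "smooth_real h"
     "\<forall>t\<in>{a..b}. \<bar>h t - u t\<bar> \<le> \<delta> \<and> (\<forall>k\<le>s. \<bar>(deriv ^^ k) h t\<bar> \<le> A k)"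
    using apxD[OF assms(1) \<open>\<delta> > 0\<close>] by blast
  show "\<exists>h. smooth_real h \<and>
     (\<forall>t\<in>{a'..b'}. \<bar>h t - u t\<bar> \<le> \<delta> \<and> (\<forall>k\<le>s. \<bar>(deriv ^^ k) h t\<bar> \<le> A' k))"
    using h assms(3) by (intro exI[of _ h]) (auto intro: order_trans[OF _ assms(2)])
qed

lemma smooth_real_lipschitz:
  assumes "smooth_real h" "\<And>t. t \<in> {a..b} \<Longrightarrow> \<bar>deriv h t\<bar> \<le> K" "x \<in> {a..b}" "y \<in> {a..b}"
  shows "\<bar>h x - h y\<bar> \<le> K * \<bar>x - y\<bar>"
proof -
  have "norm (h x - h y) \<le> K * norm (x - y)"
    by (rule field_differentiable_bound[of "{a..b}" h "deriv h"])
       (use assms in \<open>auto intro: has_field_derivative_at_within smooth_real_has_deriv1\<close>)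
  then show ?thesis by simp
qed

text \<open>The mean value bound of the approximants survives the uniform limit. It makes the outer
  function stable when the inner one is replaced by an approximant.\<close>

lemma apx_lipschitz:
  assumes "apx s A a b u" "1 \<le> s" "x \<in> {a..b}" "y \<in> {a..b}"
  shows "\<bar>u x - u y\<bar> \<le> A 1 * \<bar>x - y\<bar>"
proof (rule field_le_epsilon)
  fix e :: real assume "e > 0"
  obtain h where h0: "smooth_real h"
    "\<forall>t\<in>{a..b}. \<bar>h t - u t\<bar> \<le> e / 2 \<and> (\<forall>k\<le>s. \<bar>(deriv ^^ k) h t\<bar> \<le> A k)"
    using apxD[OF assms(1) half_gt_zero[OF \<open>e > 0\<close>]] by blast
  have h: "smooth_real h" "\<And>t. t \<in> {a..b} \<Longrightarrow> \<bar>h t - u t\<bar> \<le> e / 2"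
    "\<And>t k. t \<in> {a..b} \<Longrightarrow> k \<le> s \<Longrightarrow> \<bar>(deriv ^^ k) h t\<bar> \<le> A k"
    using h0 by auto
  have "\<bar>h x - h y\<bar> \<le> A 1 * \<bar>x - y\<bar>"
    using h(3)[of _ 1] assms by (intro smooth_real_lipschitz[of h a b]) (auto intro: h)
  with h(2)[OF assms(3)] h(2)[OF assms(4)] show "\<bar>u x - u y\<bar> \<le> A 1 * \<bar>x - y\<bar> + e"
    by linarith
qed

text \<open>
  The bound for the \<open>k\<close>-th derivative of a composition of length \<open>m + 1\<close> (\<open>b\<close> bounds first, \<open>b'\<close>
  higher derivatives); for \<open>k = 0\<close> it is 1, the bound of the outermost function.
\<close>

definition chain_bound :: "real \<Rightarrow> real \<Rightarrow> real \<Rightarrow> nat \<Rightarrow> nat \<Rightarrow> real" where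
  "chain_bound C b b' m k = C ^ (k - 1) * real (m + 1) ^ (k - 1) * b ^ (k * m) * b' ^ (k - 1)"

lemma chain_bound_ge_1:
  assumes "C \<ge> 1" "b \<ge> 1" "b' \<ge> 1"
  shows "chain_bound C b b' m k \<ge> 1"
proof -
  have m: "1 \<le> x * y" if "1 \<le> x" "1 \<le> y" for x y :: real
    using mult_mono[OF that] that by simp
  show ?thesis unfolding chain_bound_def using assms by (intro m one_le_power) auto
qed

text \<open>One more factor in the composition. Lower-order terms are by a factor
  \<open>m + 1\<close> smaller than the top term, and (m+1)^(k-2) (m+2) \<le> (m+2)^(k-1); hence the
  growth in the length is polynomial, apart from the powers of \<open>b\<close>.\<close>

lemma chain_bound_step:
  assumes C: "C \<ge> 1" "C \<ge> c * real s" and c: "c \<ge> 0" and b: "b \<ge> 1" "b' \<ge> 1" and k: "k \<le> s"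
  shows "chain_bound C b b' m k * b ^ k + c * (\<Sum>j=1..<k. chain_bound C b b' m j * b ^ j * b' ^ (k - j))
     \<le> chain_bound C b b' (Suc m) k"
proof -
  consider "k = 0" | "k = 1" | l where "k = Suc (Suc l)"
    by (metis One_nat_def not0_implies_Suc)
  then show ?thesis
  proof cases
    case (3 l)
    \<comment> \<open>A common majorant of all lower-order terms; the top term is exactly
      \<open>C * ?X * (m + 1)\<close>, and the sum of the others fits into a further
      \<open>C * ?X\<close>.\<close>
    let ?X = "C ^ l * real (m + 1) ^ l * b ^ (k * Suc m) * b' ^ Suc l"
    have X: "?X \<ge> 0" using C b by (intro mult_nonneg_nonneg) auto
    have "chain_bound C b b' m j * b ^ j * b' ^ (k - j) \<le> ?X" if j: "j \<in> {1..<k}" for j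
    proof -
      have "chain_bound C b b' m j * b ^ j * b' ^ (k - j) =
          C ^ (j - 1) * real (m + 1) ^ (j - 1) * (b ^ (j * m) * b ^ j) * (b' ^ (j - 1) * b' ^ (k - j))"
        by (simp add: chain_bound_def)
      also have "(b' ^ (j - 1) * b' ^ (k - j)) = b' ^ Suc l"
        using j 3 by (simp add: power_add[symmetric] del: power_Suc)
      also have "(b ^ (j * m) * b ^ j) = b ^ (j * Suc m)"
        by (simp add: power_add[symmetric] add.commute)
      also have "C ^ (j - 1) * real (m + 1) ^ (j - 1) * b ^ (j * Suc m) * b' ^ Suc l \<le> ?X"
      proof -
        have "j * Suc m \<le> k * Suc m" "j - 1 \<le> l" "j \<le> k" using j 3 by (intro mult_le_mono1, auto)
        then show ?thesis
          using C b by (intro mult_mono power_increasing[of "j - 1"] power_increasing[of "j * Suc m"] mult_nonneg_nonneg) auto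
      qed
      finally show ?thesis .
    qed
    then have "(\<Sum>j=1..<k. chain_bound C b b' m j * b ^ j * b' ^ (k - j)) \<le> real (Suc l) * ?X"
      using sum_bounded_above[of "{1..<k}" "\<lambda>j. chain_bound C b b' m j * b ^ j * b' ^ (k - j)" ?X] 3 by simp
    then have "c * (\<Sum>j=1..<k. chain_bound C b b' m j * b ^ j * b' ^ (k - j)) \<le> c * (real (Suc l) * ?X)"
      using c by (rule mult_left_mono)
    also have "\<dots> = (c * real (Suc l)) * ?X" by (simp only: mult_ac)
    also have "\<dots> \<le> C * ?X"
    proof (rule mult_right_mono[OF _ X])
      have "c * real (Suc l) \<le> c * real s" using c k 3 by (intro mult_left_mono) auto
      then show "c * real (Suc l) \<le> C" using C by simp
    qed
    finally have 1: "c * (\<Sum>j=1..<k. chain_bound C b b' m j * b ^ j * b' ^ (k - j)) \<le> C * ?X" .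
    have 2: "chain_bound C b b' m k * b ^ k = C * ?X * real (m + 1)"
      using 3 by (simp add: chain_bound_def power_add mult_ac)
    have "C * ?X * real (m + 1) + C * ?X = C ^ Suc l * (real (m + 1) ^ l * real (m + 2)) * b ^ (k * Suc m) * b' ^ Suc l"
      by (simp add: algebra_simps)
    also have "\<dots> \<le> C ^ Suc l * (real (m + 2) ^ l * real (m + 2)) * b ^ (k * Suc m) * b' ^ Suc l"
      using C b by (intro mult_mono power_mono mult_nonneg_nonneg) auto
    also have "\<dots> = chain_bound C b b' (Suc m) k"
      using 3 by (simp add: chain_bound_def mult_ac)
    finally show ?thesis using 1 2 by linarith
  qed (simp_all add: chain_bound_def power_add mult_ac)
qed

text \<open>\<open>C\<close> is quantified before everything else: it depends on \<open>s\<close>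
  only, so that a single constant serves all dimensions, trees and bounds.\<close>

lemma apx_compose:
  "\<exists>C\<ge>1. \<forall>m b b' c d a0 a1 H u. 1 \<le> b \<longrightarrow> 1 \<le> b' \<longrightarrow> apx s (chain_bound C b b' m) c d H \<longrightarrow>
     inner_apx s b b' a0 a1 c d u \<longrightarrow> u ` {a0..a1} \<subseteq> {c..d} \<longrightarrow> 1 \<le> s \<longrightarrow>
     apx s (chain_bound C b b' (Suc m)) a0 a1 (\<lambda>t. H (u t))"
proof -
  obtain c0 where c0: "c0 \<ge> 0 \<and> (\<forall>k\<le>s. \<forall>H h x A b b'. smooth_real H \<longrightarrow> smooth_real h \<longrightarrow> 1 \<le> b \<longrightarrow> 1 \<le> b' \<longrightarrow>
     (\<forall>j\<le>k. \<bar>(deriv ^^ j) H (h x)\<bar> \<le> A j) \<longrightarrow> (1 \<le> k \<longrightarrow> \<bar>deriv h x\<bar> \<le> b) \<longrightarrow>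
     (\<forall>j\<in>{2..k}. \<bar>(deriv ^^ j) h x\<bar> \<le> b') \<longrightarrow>
     \<bar>(deriv ^^ k) (\<lambda>x. H (h x)) x\<bar> \<le> A k * b ^ k + c0 * (\<Sum>j=1..<k. A j * b ^ j * b' ^ (k - j)))"
    using derivs_compose_bound[of s] by (elim exE)
  note bound = c0[THEN conjunct2, THEN spec, THEN mp, THEN spec, THEN spec, THEN spec, THEN spec, THEN spec, THEN spec,
      THEN mp, THEN mp, THEN mp, THEN mp, THEN mp, THEN mp, THEN mp]
  define C where "C = 1 + c0 * real s"
  have C: "C \<ge> 1" "C \<ge> c0 * real s" using c0 by (auto simp: C_def)
  have "apx s (chain_bound C b b' (Suc m)) a0 a1 (\<lambda>t. H (u t))"
    if b: "1 \<le> b" "1 \<le> b'" and H: "apx s (chain_bound C b b' m) c d H" 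
      and u: "inner_apx s b b' a0 a1 c d u" "u ` {a0..a1} \<subseteq> {c..d}" and s: "1 \<le> s" for m b b' c d a0 a1 H u
    unfolding apx_def
  proof (intro allI impI)
    fix \<delta> :: real assume \<delta>: "\<delta> > 0"
    let ?K = "chain_bound C b b' m 1"
    have K: "?K \<ge> 1" using chain_bound_ge_1 C b by blast
    obtain h where h0: "smooth_real h"
      "\<forall>t\<in>{c..d}. \<bar>h t - H t\<bar> \<le> \<delta> / 2 \<and> (\<forall>k\<le>s. \<bar>(deriv ^^ k) h t\<bar> \<le> chain_bound C b b' m k)"
      using apxD[OF H half_gt_zero[OF \<delta>]] by blast
    have h: "smooth_real h" "\<And>t. t \<in> {c..d} \<Longrightarrow> \<bar>h t - H t\<bar> \<le> \<delta> / 2"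
      "\<And>t k. t \<in> {c..d} \<Longrightarrow> k \<le> s \<Longrightarrow> \<bar>(deriv ^^ k) h t\<bar> \<le> chain_bound C b b' m k"
      using h0 by auto
    \<comment> \<open>\<open>?K\<close> is a Lipschitz constant of the outer function, so this inner
      accuracy costs half of the tolerance and the outer approximant the other half.\<close>
    have \<delta>': "\<delta> / (2 * ?K) > 0" using \<delta> K by simp
    obtain v where v0: "smooth_real v"
      "\<forall>t\<in>{a0..a1}. \<bar>v t - u t\<bar> \<le> \<delta> / (2 * ?K) \<and> v t \<in> {c..d} \<and> \<bar>deriv v t\<bar> \<le> b \<and>
        (\<forall>k\<in>{2..s}. \<bar>(deriv ^^ k) v t\<bar> \<le> b')"
      using inner_apxD[OF u(1) \<delta>'] by blast
    have v: "smooth_real v"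
      "\<And>t. t \<in> {a0..a1} \<Longrightarrow> \<bar>v t - u t\<bar> \<le> \<delta> / (2 * ?K)"
      "\<And>t. t \<in> {a0..a1} \<Longrightarrow> v t \<in> {c..d}"
      "\<And>t. t \<in> {a0..a1} \<Longrightarrow> \<bar>deriv v t\<bar> \<le> b"
      "\<And>t k. t \<in> {a0..a1} \<Longrightarrow> k \<in> {2..s} \<Longrightarrow> \<bar>(deriv ^^ k) v t\<bar> \<le> b'"
      using v0 by blast+
    show "\<exists>h. smooth_real h \<and> (\<forall>t\<in>{a0..a1}. \<bar>h t - H (u t)\<bar> \<le> \<delta> \<and> 
       (\<forall>k\<le>s. \<bar>(deriv ^^ k) h t\<bar> \<le> chain_bound C b b' (Suc m) k))"
    proof (intro exI[of _ "\<lambda>t. h (v t)"] conjI ballI allI impI)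
      show "smooth_real (\<lambda>t. h (v t))" using h(1) v(1) by (rule smooth_real_compose)
    next
      fix t assume t: "t \<in> {a0..a1}"
      have ut: "u t \<in> {c..d}" using u(2) t by blast
      have "\<bar>H (v t) - H (u t)\<bar> \<le> ?K * \<bar>v t - u t\<bar>"
        by (rule apx_lipschitz[OF H s v(3)[OF t] ut])
      also have "\<dots> \<le> ?K * (\<delta> / (2 * ?K))"
        using K by (intro mult_left_mono v(2) t) auto
      also have "\<dots> = \<delta> / 2" using K by simp
      finally show "\<bar>h (v t) - H (u t)\<bar> \<le> \<delta>"
        using h(2)[OF v(3)[OF t]] by linarith
    next
      fix t k assume t: "t \<in> {a0..a1}" and k: "k \<le> s"
      have "\<bar>(deriv ^^ k) (\<lambda>t. h (v t)) t\<bar> \<le>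
         chain_bound C b b' m k * b ^ k + c0 * (\<Sum>j=1..<k. chain_bound C b b' m j * b ^ j * b' ^ (k - j))"
        by (rule bound) (use k t h(1) v(1) b h(3)[OF v(3)[OF t]] v(4)[OF t] v(5)[OF t] in simp_all)
      also have "\<dots> \<le> chain_bound C b b' (Suc m) k"
        using C c0 b k by (intro chain_bound_step) auto
      finally show "\<bar>(deriv ^^ k) (\<lambda>t. h (v t)) t\<bar> \<le> chain_bound C b b' (Suc m) k" .
    qed
  qed
  then show ?thesis by (intro exI[of _ C] conjI allI impI C(1))
qed

text \<open>The minimum puts the right end point, and everything beyond it, into the last
  cell.\<close>

definition pw_cell :: "real \<Rightarrow> real \<Rightarrow> nat \<Rightarrow> real \<Rightarrow> nat" where
  "pw_cell a b q t = min (q - 1) (nat \<lfloor>(t - a) * real q / (b - a)\<rfloor>)"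

text \<open>One index codes the cell (\<open>i div s\<close>) and the degree
  (\<open>i mod s\<close>), so that i < q s enumerates all monomials of degree below
  \<open>s\<close>, centred at the left ends of \<open>q\<close> cells. No continuity across cells
  is imposed.\<close>

definition pw_poly :: "nat \<Rightarrow> real \<Rightarrow> real \<Rightarrow> nat \<Rightarrow> nat \<Rightarrow> real \<Rightarrow> real" where
  "pw_poly s a b q i t = (if pw_cell a b q t = i div s
     then (t - (a + real (i div s) * (b - a) / real q)) ^ (i mod s) else 0)"

lemma pw_poly_measurable [measurable]: "pw_poly s a b q i \<in> borel_measurable borel"
  unfolding pw_poly_def pw_cell_def by measurable

text \<open>Taylor expansion of a smooth approximant at the left end of each cell. The factor 2 pays
  once for the Taylor remainder and once for the distance between \<open>G\<close> and the
  approximant.\<close>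

lemma pw_poly_approx:
  assumes G: "apx s A a b G" and "a < b" "1 \<le> s" "1 \<le> q" "A s > 0"
  shows "\<exists>c. \<forall>t\<in>{a..b}. \<bar>G t - (\<Sum>i<q * s. c i * pw_poly s a b q i t)\<bar> \<le> 2 * A s * ((b - a) / real q) ^ s"
proof -
  define h where "h = (b - a) / real q"
  have h: "h > 0" using assms by (simp add: h_def)
  have "A s * h ^ s > 0" using assms h by simp
  obtain g where g0: "smooth_real g"
    "\<forall>t\<in>{a..b}. \<bar>g t - G t\<bar> \<le> A s * h ^ s \<and> (\<forall>k\<le>s. \<bar>(deriv ^^ k) g t\<bar> \<le> A k)"
    using apxD[OF G \<open>A s * h ^ s > 0\<close>] by blast
  have g: "smooth_real g" "\<And>t. t \<in> {a..b} \<Longrightarrow> \<bar>g t - G t\<bar> \<le> A s * h ^ s"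
    "\<And>t k. t \<in> {a..b} \<Longrightarrow> k \<le> s \<Longrightarrow> \<bar>(deriv ^^ k) g t\<bar> \<le> A k"
    using g0 by auto
  \<comment> \<open>Taylor coefficients, in the coding of cell and degree used by
    \<open>pw_poly\<close>.\<close>
  define c where "c = (\<lambda>i. (deriv ^^ (i mod s)) g (a + real (i div s) * h) / fact (i mod s))"
  have "\<bar>G t - (\<Sum>i<q * s. c i * pw_poly s a b q i t)\<bar> \<le> 2 * A s * h ^ s" if t: "t \<in> {a..b}" for t
  proof -
    define l where "l = pw_cell a b q t"
    define t0 where "t0 = a + real l * h"
    have lq: "l < q" using assms by (auto simp: l_def pw_cell_def)
    have q: "real q * h = b - a" using assms by (simp add: h_def)
    have eq: "(t - a) * real q / (b - a) = (t - a) / h" by (simp add: h_def)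
    have nn: "(t - a) / h \<ge> 0" using t h by simp
    have l_le: "real l * h \<le> t - a"
    proof -
      have "real l \<le> real (nat \<lfloor>(t - a) / h\<rfloor>)" unfolding l_def pw_cell_def eq by simp
      also have "\<dots> \<le> (t - a) / h" using nn by simp
      finally show ?thesis using h by (simp add: field_simps)
    qed
    have l_ge: "t - a \<le> (real l + 1) * h"
    proof (cases "nat \<lfloor>(t - a) / h\<rfloor> \<le> q - 1")
      case True
      then have "l = nat \<lfloor>(t - a) / h\<rfloor>" unfolding l_def pw_cell_def eq by simp
      then have "(t - a) / h < real l + 1" using nn by linarith
      then show ?thesis using h by (simp add: field_simps)
    next
      case False
      then have "l = q - 1" unfolding l_def pw_cell_def eq by simp
      then have "(real l + 1) * h = b - a" using assms q by (simp add: of_nat_diff)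
      then show ?thesis using t by simp
    qed
    have t0: "t0 \<in> {a..b}" "t0 \<le> t" "t - t0 \<le> h"
      using l_le l_ge t h by (auto simp: t0_def algebra_simps)
    have sum: "(\<Sum>i<q * s. c i * pw_poly s a b q i t) = (\<Sum>j<s. (deriv ^^ j) g t0 / fact j * (t - t0) ^ j)"
    proof -
      have "(\<Sum>i<q * s. c i * pw_poly s a b q i t) = (\<Sum>m<q. \<Sum>i=m * s..<m * s + s. c i * pw_poly s a b q i t)"
        by (rule sum.nat_group[symmetric])
      also have "\<dots> = (\<Sum>m<q. (if m = l then (\<Sum>i=l * s..<l * s + s. c i * pw_poly s a b q i t) else 0))"
      proof (intro sum.cong refl)
        fix m
        have "i div s = m" if "i \<in> {m * s..<m * s + s}" for i
          using that by (intro div_nat_eqI) (simp_all add: mult.commute)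
        then have "m \<noteq> l \<Longrightarrow> i \<in> {m * s..<m * s + s} \<Longrightarrow> pw_poly s a b q i t = 0" for i
          by (simp add: pw_poly_def l_def)
        then show "(\<Sum>i=m * s..<m * s + s. c i * pw_poly s a b q i t)
          = (if m = l then (\<Sum>i=l * s..<l * s + s. c i * pw_poly s a b q i t) else 0)" by auto
      qed
      also have "\<dots> = (\<Sum>i=l * s..<l * s + s. c i * pw_poly s a b q i t)" using lq by simp
      also have "\<dots> = (\<Sum>j<s. c (l * s + j) * pw_poly s a b q (l * s + j) t)"
        by (rule sum.reindex_bij_witness[of _ "\<lambda>j. l * s + j" "\<lambda>i. i - l * s"]) auto
      also have "\<dots> = (\<Sum>j<s. (deriv ^^ j) g t0 / fact j * (t - t0) ^ j)"
        using assms by (intro sum.cong) (auto simp: c_def pw_poly_def t0_def h_def l_def[symmetric])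
      finally show ?thesis .
    qed
    have "\<bar>g t - (\<Sum>j<s. (deriv ^^ j) g t0 / fact j * (t - t0) ^ j)\<bar> \<le> A s * h ^ s"
    proof (cases "t = t0")
      case True
      have "(\<Sum>j<s. (deriv ^^ j) g t0 / fact j * (t - t0) ^ j) = (\<Sum>j<s. if j = 0 then g t0 else 0)"
        using True by (intro sum.cong) auto
      then show ?thesis using True assms h by simp
    next
      case False
      have "\<exists>\<xi>. (if t < t0 then t < \<xi> \<and> \<xi> < t0 else t0 < \<xi> \<and> \<xi> < t) \<and>
         g t = (\<Sum>j<s. (deriv ^^ j) g t0 / fact j * (t - t0) ^ j) + (deriv ^^ s) g \<xi> / fact s * (t - t0) ^ s"
        using smooth_real_has_deriv[OF g(1)] assms t t0 False
        by (intro Taylor[of s "\<lambda>n. (deriv ^^ n) g" g a b t0 t]) (auto simp del: funpow.simps(2))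
      then obtain \<xi> where \<xi>': "if t < t0 then t < \<xi> \<and> \<xi> < t0 else t0 < \<xi> \<and> \<xi> < t"
         "g t = (\<Sum>j<s. (deriv ^^ j) g t0 / fact j * (t - t0) ^ j) + (deriv ^^ s) g \<xi> / fact s * (t - t0) ^ s"
        by blast
      have \<xi>: "\<xi> \<in> {t0..t}" "g t = (\<Sum>j<s. (deriv ^^ j) g t0 / fact j * (t - t0) ^ j) + (deriv ^^ s) g \<xi> / fact s * (t - t0) ^ s"
        using \<xi>' t0(2) by auto
      have "\<bar>(deriv ^^ s) g \<xi> / fact s * (t - t0) ^ s\<bar> \<le> A s * h ^ s"
        unfolding abs_mult
      proof (rule mult_mono)
        have "\<bar>(deriv ^^ s) g \<xi>\<bar> / fact s \<le> \<bar>(deriv ^^ s) g \<xi>\<bar> / 1"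
          by (rule divide_left_mono) (auto simp: fact_ge_1)
        then show "\<bar>(deriv ^^ s) g \<xi> / fact s\<bar> \<le> A s" using g(3)[of \<xi> s] \<xi>(1) t t0 by auto
        show "\<bar>(t - t0) ^ s\<bar> \<le> h ^ s"
          using t0 by (simp add: power_abs power_mono)
      qed (use assms in auto)
      then show ?thesis using \<xi>(2) by linarith
    qed
    then show ?thesis using g(2)[OF t] unfolding sum by linarith
  qed
  then show ?thesis unfolding h_def[symmetric] by (intro exI[of _ c] ballI)
qed

section \<open>Hat functions and linear interpolation\<close>

definition hat :: "real \<Rightarrow> real \<Rightarrow> nat \<Rightarrow> nat \<Rightarrow> real \<Rightarrow> real" where
  "hat a b n i t = max 0 (1 - \<bar>t - equispaced_node a b n i\<bar> * real (n - 1) / (b - a))"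

lemma hat_nonneg: "hat a b n i t \<ge> 0"
  by (simp add: hat_def)

lemma equispaced_node_alt: "equispaced_node a b n i = a + real i * ((b - a) / real (n - 1))"
  by (simp add: equispaced_node_def)

lemma equispaced_node_Suc:
  "equispaced_node a b n (Suc i) = equispaced_node a b n i + (b - a) / real (n - 1)"
  unfolding equispaced_node_alt of_nat_Suc distrib_right by simp

text \<open>In the local coordinate \<theta> of the cell with left node \<open>k\<close> only the
  hats of its two end points are nonzero.\<close>

lemma hat_eq:
  assumes "a < b" "n \<ge> 2" "t = equispaced_node a b n k + \<theta> * ((b - a) / real (n - 1))" "0 \<le> \<theta>" "\<theta> \<le> 1"
  shows "hat a b n i t = (if i = k then 1 - \<theta> else if i = Suc k then \<theta> else 0)"
proof -
  define h where "h = (b - a) / real (n - 1)"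
  have "h > 0" using assms by (simp add: h_def)
  have x: "t - equispaced_node a b n i = (real k + \<theta> - real i) * h"
    unfolding assms(3) equispaced_node_alt h_def[symmetric] by (simp add: algebra_simps)
  have e: "(t - equispaced_node a b n i) * real (n - 1) / (b - a) = real k + \<theta> - real i"
    unfolding x using assms(1,2) by (simp add: h_def)
  have "\<bar>t - equispaced_node a b n i\<bar> * real (n - 1) / (b - a) = \<bar>real k + \<theta> - real i\<bar>"
    unfolding e[symmetric] using assms(1) by (simp add: abs_mult)
  then have h: "hat a b n i t = max 0 (1 - \<bar>real k + \<theta> - real i\<bar>)"
    by (simp add: hat_def)
  consider "i = k" | "i = Suc k" | "i < k" | "i > Suc k" by linarith
  then show ?thesis
  proof cases
    case 3
    then have "real i + 1 \<le> real k" by linarith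
    then show ?thesis using 3 h assms by auto
  next
    case 4
    then have "real i \<ge> real k + 2" by linarith
    then show ?thesis using 4 h assms by auto
  qed (use h assms in auto)
qed

lemma equispaced_cell:
  assumes "a < b" "n \<ge> 2" "t \<in> {a..b}"
  shows "\<exists>k \<theta>. k < n - 1 \<and> 0 \<le> \<theta> \<and> \<theta> \<le> 1 \<and> t = equispaced_node a b n k + \<theta> * ((b - a) / real (n - 1))"
proof -
  define h where "h = (b - a) / real (n - 1)"
  have h: "h > 0" "real (n - 1) * h = b - a" using assms by (auto simp: h_def)
  \<comment> \<open>Capping at \<open>n - 2\<close> assigns the right end point to the last cell,
    with \<theta> = 1.\<close>
  define k where "k = min (n - 2) (nat \<lfloor>(t - a) / h\<rfloor>)"
  define \<theta> where "\<theta> = (t - a) / h - real k"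
  have nn: "(t - a) / h \<ge> 0" using assms h by simp
  have "(t - a) / h \<le> real (n - 1)" using h assms by (simp add: field_simps)
  then have "0 \<le> \<theta>" "\<theta> \<le> 1" unfolding \<theta>_def k_def using nn assms by linarith+
  moreover have "t = equispaced_node a b n k + \<theta> * h"
    unfolding equispaced_node_alt h_def[symmetric] using h by (simp add: \<theta>_def field_simps)
  moreover have "k < n - 1" unfolding k_def using assms(2) by linarith
  ultimately show ?thesis unfolding h_def
    by (intro exI[of _ k] exI[of _ \<theta>]) simp
qed

lemma sum_hat:
  assumes "a < b" "n \<ge> 2" "t = equispaced_node a b n k + \<theta> * ((b - a) / real (n - 1))" "0 \<le> \<theta>" "\<theta> \<le> 1"
    "k < n - 1"
  shows "(\<Sum>i<n. w i * hat a b n i t) = (1 - \<theta>) * w k + \<theta> * w (Suc k)"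
proof -
  have "(\<Sum>i<n. w i * hat a b n i t) = (\<Sum>i<n. (if i = k then w k * (1 - \<theta>) else 0) + (if i = Suc k then w (Suc k) * \<theta> else 0))"
    using assms by (intro sum.cong) (auto simp: hat_eq)
  also have "\<dots> = (1 - \<theta>) * w k + \<theta> * w (Suc k)"
    using assms by (auto simp: sum.distrib mult.commute)
  finally show ?thesis .
qed

lemma sum_hat_eq_1:
  assumes "a < b" "n \<ge> 2" "t \<in> {a..b}"
  shows "(\<Sum>i<n. hat a b n i t) = 1"
proof -
  obtain k \<theta> where "k < n - 1" "0 \<le> \<theta>" "\<theta> \<le> 1" "t = equispaced_node a b n k + \<theta> * ((b - a) / real (n - 1))"
    using equispaced_cell[OF assms] by blast
  then show ?thesis using sum_hat[of a b n t k \<theta> "\<lambda>_. 1"] assms by simp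
qed

lemma equispaced_node_in: "a \<le> b \<Longrightarrow> n \<ge> 2 \<Longrightarrow> i < n \<Longrightarrow> equispaced_node a b n i \<in> {a..b}"
proof -
  assume a: "a \<le> b" "n \<ge> 2" "i < n"
  have "real i * (b - a) / real (n - 1) \<le> real (n - 1) * (b - a) / real (n - 1)"
    using a by (intro divide_right_mono mult_right_mono) auto
  then show ?thesis using a by (auto simp: equispaced_node_def)
qed

text \<open>Estimated for an approximant with arbitrarily small extra error \<open>e\<close>, so
  that no constant is lost in the limit. Orders beyond 2 are out of reach for linear
  interpolation.\<close>

lemma hat_interpolation_error:
  assumes G: "apx s A a b G" and ab: "a < b" "n \<ge> 2" and s: "s = 1 \<or> s = 2" and t: "t \<in> {a..b}"
  shows "\<bar>G t - (\<Sum>i<n. G (equispaced_node a b n i) * hat a b n i t)\<bar> \<le> A s * ((b - a) / real (n - 1)) ^ s"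
proof -
  define h where "h = (b - a) / real (n - 1)"
  have h: "h > 0" using ab by (simp add: h_def)
  obtain k \<theta> where k: "k < n - 1" "0 \<le> \<theta>" "\<theta> \<le> 1" "t = equispaced_node a b n k + \<theta> * h"
    using equispaced_cell[OF ab t] unfolding h_def by blast
  let ?x = "equispaced_node a b n k" and ?y = "equispaced_node a b n (Suc k)"
  have xy: "?x \<in> {a..b}" "?y \<in> {a..b}" using equispaced_node_in k ab by auto
  have sum: "(\<Sum>i<n. G (equispaced_node a b n i) * hat a b n i t) = (1 - \<theta>) * G ?x + \<theta> * G ?y"
    using k ab unfolding h_def by (intro sum_hat) auto
  have y: "?y = ?x + h" using equispaced_node_Suc ab by (simp add: h_def)
  have tx: "t - ?x = \<theta> * h" "?y - t = (1 - \<theta>) * h" using k y by (auto simp: algebra_simps)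
  have AA: "A s \<ge> 0"
  proof -
    obtain g where g0: "smooth_real g"
      "\<forall>t\<in>{a..b}. \<bar>g t - G t\<bar> \<le> 1 \<and> (\<forall>k\<le>s. \<bar>(deriv ^^ k) g t\<bar> \<le> A k)"
      using apxD[OF G zero_less_one] by blast
    have g: "smooth_real g" "\<And>t. t \<in> {a..b} \<Longrightarrow> \<bar>g t - G t\<bar> \<le> 1"
      "\<And>t k. t \<in> {a..b} \<Longrightarrow> k \<le> s \<Longrightarrow> \<bar>(deriv ^^ k) g t\<bar> \<le> A k"
      using g0 by auto
    from g(3)[OF t, of s] show ?thesis by simp
  qed
  have "\<bar>G t - ((1 - \<theta>) * G ?x + \<theta> * G ?y)\<bar> \<le> A s * h ^ s + e" if e: "e > 0" for e :: real
  proof -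
    obtain g where g0: "smooth_real g"
      "\<forall>t\<in>{a..b}. \<bar>g t - G t\<bar> \<le> e / 2 \<and> (\<forall>k\<le>s. \<bar>(deriv ^^ k) g t\<bar> \<le> A k)"
      using apxD[OF G half_gt_zero[OF e]] by blast
    have g: "smooth_real g" "\<And>t. t \<in> {a..b} \<Longrightarrow> \<bar>g t - G t\<bar> \<le> e / 2"
      "\<And>t k. t \<in> {a..b} \<Longrightarrow> k \<le> s \<Longrightarrow> \<bar>(deriv ^^ k) g t\<bar> \<le> A k"
      using g0 by auto
    have main: "\<bar>g t - ((1 - \<theta>) * g ?x + \<theta> * g ?y)\<bar> \<le> A s * h ^ s"
    proof -
      have e1: "g t - ((1 - \<theta>) * g ?x + \<theta> * g ?y) = (1 - \<theta>) * (g t - g ?x) + \<theta> * (g t - g ?y)"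
        by (simp add: algebra_simps)
      from s show ?thesis
      proof
        assume s: "s = 1"
        have d: "\<And>t. t \<in> {a..b} \<Longrightarrow> \<bar>deriv g t\<bar> \<le> A 1" using g(3)[of _ 1] s by simp
        have "\<bar>g t - g ?x\<bar> \<le> A 1 * \<bar>t - ?x\<bar>" "\<bar>g t - g ?y\<bar> \<le> A 1 * \<bar>t - ?y\<bar>"
          by (rule smooth_real_lipschitz[OF g(1) d]; use t xy in simp)+
        moreover have "\<bar>t - ?x\<bar> \<le> h" "\<bar>t - ?y\<bar> \<le> h"
          unfolding abs_minus_commute[of t ?y] tx using h k by (auto simp: abs_mult mult_left_le_one_le)
        then have "A 1 * \<bar>t - ?x\<bar> \<le> A 1 * h" "A 1 * \<bar>t - ?y\<bar> \<le> A 1 * h"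
          using AA s by (auto intro!: mult_left_mono)
        ultimately have "\<bar>g t - g ?x\<bar> \<le> A 1 * h" "\<bar>g t - g ?y\<bar> \<le> A 1 * h" by linarith+
        then have "(1 - \<theta>) * \<bar>g t - g ?x\<bar> + \<theta> * \<bar>g t - g ?y\<bar> \<le> (1 - \<theta>) * (A 1 * h) + \<theta> * (A 1 * h)"
          using k by (intro add_mono mult_left_mono) auto
        also have "\<dots> = A 1 * h" by (simp add: algebra_simps)
        finally have "\<bar>(1 - \<theta>) * (g t - g ?x) + \<theta> * (g t - g ?y)\<bar> \<le> A 1 * h"
          using abs_triangle_ineq[of "(1 - \<theta>) * (g t - g ?x)" "\<theta> * (g t - g ?y)"] k
          by (simp add: abs_mult)
        then show ?thesis unfolding e1 s by simp
      next
        assume s: "s = 2"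
        \<comment> \<open>Both nodal values are expanded about \<open>t\<close>, not about a
          node.\<close>
        have T: "\<exists>r. \<bar>r\<bar> \<le> A 2 / 2 \<and> g z = g t + deriv g t * (z - t) + r * (z - t)\<^sup>2" if z: "z \<in> {a..b}" for z
        proof (cases "z = t")
          case True
          then show ?thesis using AA s by (intro exI[of _ 0]) auto
        next
          case False
          have "\<exists>\<xi>. (if z < t then z < \<xi> \<and> \<xi> < t else t < \<xi> \<and> \<xi> < z) \<and>
            g z = (\<Sum>j<2. (deriv ^^ j) g t / fact j * (z - t) ^ j) + (deriv ^^ 2) g \<xi> / fact 2 * (z - t) ^ 2"
            using smooth_real_has_deriv[OF g(1)] z t False
            by (intro Taylor[of 2 "\<lambda>n. (deriv ^^ n) g" g a b t z]) (auto simp del: funpow.simps(2))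
          then obtain \<xi> where \<xi>: "if z < t then z < \<xi> \<and> \<xi> < t else t < \<xi> \<and> \<xi> < z"
            "g z = (\<Sum>j<2. (deriv ^^ j) g t / fact j * (z - t) ^ j) + (deriv ^^ 2) g \<xi> / fact 2 * (z - t) ^ 2"
            by blast
          have "\<xi> \<in> {a..b}" using \<xi>(1) z t by (auto split: if_splits)
          then have "\<bar>(deriv ^^ 2) g \<xi>\<bar> \<le> A 2" using g(3)[of \<xi> 2] s by simp
          then show ?thesis using \<xi>(2)
            by (intro exI[of _ "(deriv ^^ 2) g \<xi> / 2"]) (simp add: numeral_2_eq_2)
        qed
        obtain r where r: "\<bar>r\<bar> \<le> A 2 / 2" "g ?x = g t + deriv g t * (?x - t) + r * (?x - t)\<^sup>2" using T[OF xy(1)] by blast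
        obtain r' where r': "\<bar>r'\<bar> \<le> A 2 / 2" "g ?y = g t + deriv g t * (?y - t) + r' * (?y - t)\<^sup>2" using T[OF xy(2)] by blast
        have x: "?x - t = - (\<theta> * h)" "?y - t = (1 - \<theta>) * h" using tx by auto
        \<comment> \<open>The first-order terms cancel, since (1 - \<theta>) (-\<theta> h) +
          \<theta> (1 - \<theta>) h = 0.\<close>
        have "g t - ((1 - \<theta>) * g ?x + \<theta> * g ?y) = - (((1 - \<theta>) * \<theta>\<^sup>2 * r + \<theta> * (1 - \<theta>)\<^sup>2 * r') * h\<^sup>2)"
          unfolding r(2) r'(2) x by (simp add: algebra_simps power2_eq_square)
        then have "\<bar>g t - ((1 - \<theta>) * g ?x + \<theta> * g ?y)\<bar> = \<bar>(1 - \<theta>) * \<theta>\<^sup>2 * r + \<theta> * (1 - \<theta>)\<^sup>2 * r'\<bar> * h\<^sup>2"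
          by (simp add: abs_mult)
        also have "\<dots> \<le> A 2 * h\<^sup>2"
        proof (rule mult_right_mono)
          have q: "(1 - \<theta>) * \<theta>\<^sup>2 \<le> 1" "\<theta> * (1 - \<theta>)\<^sup>2 \<le> 1" "(1 - \<theta>) * \<theta>\<^sup>2 \<ge> 0" "\<theta> * (1 - \<theta>)\<^sup>2 \<ge> 0"
            using k by (auto intro!: mult_le_one power_le_one)
          have "\<bar>(1 - \<theta>) * \<theta>\<^sup>2 * r\<bar> \<le> 1 * (A 2 / 2)" "\<bar>\<theta> * (1 - \<theta>)\<^sup>2 * r'\<bar> \<le> 1 * (A 2 / 2)"
            unfolding abs_mult[of _ r] abs_mult[of _ r'] using q r(1) r'(1) by (intro mult_mono; simp)+
          then show "\<bar>(1 - \<theta>) * \<theta>\<^sup>2 * r + \<theta> * (1 - \<theta>)\<^sup>2 * r'\<bar> \<le> A 2" by linarith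
        qed simp
        finally show ?thesis using s by simp
      qed
    qed
    have "\<bar>(1 - \<theta>) * (g ?x - G ?x) + \<theta> * (g ?y - G ?y)\<bar> \<le> (1 - \<theta>) * (e / 2) + \<theta> * (e / 2)"
      using mult_left_mono[OF g(2)[OF xy(1)], of "1 - \<theta>"] mult_left_mono[OF g(2)[OF xy(2)], of \<theta>] k
      by (intro order_trans[OF abs_triangle_ineq] add_mono) (simp_all add: abs_mult)
    then have "\<bar>(1 - \<theta>) * (g ?x - G ?x) + \<theta> * (g ?y - G ?y)\<bar> \<le> e / 2" by argo
    moreover have "G t - ((1 - \<theta>) * G ?x + \<theta> * G ?y) =
      - (g t - G t) + (g t - ((1 - \<theta>) * g ?x + \<theta> * g ?y)) + ((1 - \<theta>) * (g ?x - G ?x) + \<theta> * (g ?y - G ?y))"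
      by (simp add: algebra_simps)
    ultimately show ?thesis using g(2)[OF t] main by linarith
  qed
  then show ?thesis unfolding sum h_def[symmetric] by (rule field_le_epsilon)
qed

section \<open>Uniform measures and univariate Sobolev functions\<close>

lemma space_unif [simp]: "space (unif a b) = {a..b}"
  by (simp add: unif_def uniform_measure_def space_restrict_space)

lemma sets_unif: "sets (unif a b) = sets (restrict_space borel {a..b})"
  by (simp add: unif_def uniform_measure_def sets_restrict_space)

lemma borel_measurable_unifI: "f \<in> borel_measurable borel \<Longrightarrow> f \<in> borel_measurable (unif a b)"
  using measurable_restrict_space1 measurable_cong_sets[OF sets_unif refl] by blast

lemma unif_eq_density:
  assumes "a < b"
  shows "unif a b = density (restrict_space lborel {a..b}) (\<lambda>_. ennreal (1 / (b - a)))"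
proof -
  have "emeasure (restrict_space lborel {a..b}) {a..b} = ennreal (b - a)"
    using assms by (simp add: emeasure_restrict_space)
  moreover have "1 / ennreal (b - a) = ennreal (1 / (b - a))"
    using assms divide_ennreal[of 1 "b - a"] by simp
  ultimately show ?thesis
    unfolding unif_def uniform_measure_def
    by (intro density_cong measurable_restrict_space1) (auto intro!: AE_I2 simp: space_restrict_space)
qed

lemma prob_space_unif: "a < b \<Longrightarrow> prob_space (unif a b)"
  unfolding unif_def by (intro prob_space_uniform_measure) (simp_all add: emeasure_restrict_space)

lemma borel_measurable_restrict_iff_unif:
  fixes f :: "real \<Rightarrow> real"
  shows "f \<in> borel_measurable (restrict_space lborel {a..b}) \<longleftrightarrow> f \<in> borel_measurable (unif a b)"
proof -
  have "(borel_measurable (restrict_space lborel {a..b}) :: (real \<Rightarrow> real) set) = borel_measurable (unif a b)"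
    by (rule measurable_cong_sets) (auto simp: sets_unif sets_restrict_space)
  then show ?thesis by simp
qed

lemma integrable_unif_iff:
  fixes f :: "real \<Rightarrow> real"
  assumes "a < b" "f \<in> borel_measurable (unif a b)"
  shows "integrable (unif a b) f \<longleftrightarrow> integrable lborel (\<lambda>t. indicator {a..b} t * f t)"
proof -
  have m: "f \<in> borel_measurable (restrict_space lborel {a..b})"
    using assms by (simp add: borel_measurable_restrict_iff_unif)
  have "integrable (unif a b) f \<longleftrightarrow> integrable (restrict_space lborel {a..b}) (\<lambda>t. (1 / (b - a)) *\<^sub>R f t)"
    unfolding unif_eq_density[OF assms(1)] using m assms by (intro integrable_density) auto
  also have "\<dots> \<longleftrightarrow> integrable (restrict_space lborel {a..b}) f"
    unfolding real_scaleR_def using integrable_mult_left_iff[of _ "1 / (b - a)" f] assms(1)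
    by (simp del: times_divide_eq_left)
  finally show ?thesis by (simp add: integrable_restrict_space)
qed

lemma integral_unif:
  fixes f :: "real \<Rightarrow> real"
  assumes "a < b" "f \<in> borel_measurable (unif a b)"
  shows "(\<integral>t. f t \<partial>unif a b) = (\<integral>t. indicator {a..b} t * f t \<partial>lborel) / (b - a)"
proof -
  have m: "f \<in> borel_measurable (restrict_space lborel {a..b})"
    using assms by (simp add: borel_measurable_restrict_iff_unif)
  have "(\<integral>t. f t \<partial>unif a b) = (\<integral>t. (1 / (b - a)) *\<^sub>R f t \<partial>restrict_space lborel {a..b})"
    unfolding unif_eq_density[OF assms(1)] using m assms by (intro integral_density) auto
  also have "\<dots> = (\<integral>t. f t \<partial>restrict_space lborel {a..b}) / (b - a)"
    by simp
  finally show ?thesis by (simp add: integral_restrict_space)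
qed

lemma smooth_real_measurable: "smooth_real u \<Longrightarrow> (deriv ^^ n) u \<in> borel_measurable borel"
  by (intro borel_measurable_continuous_onI smooth_real_continuous_on)

text \<open>Each step moves one derivative by partial integration; the boundary terms vanish because
  \<phi> is 0 at \<open>a\<close> and \<open>b\<close>.\<close>

lemma smooth_real_vanishing_parts:
  assumes "smooth_real u" "smooth_real \<phi>" "a < b" "\<And>t. t \<notin> {c..d} \<Longrightarrow> \<phi> t = 0" "a < c" "d < b"
  shows "(\<integral>t. indicator {a..b} t * (u t * (deriv ^^ j) \<phi> t) \<partial>lborel)
    = (- 1) ^ j * (\<integral>t. indicator {a..b} t * ((deriv ^^ j) u t * \<phi> t) \<partial>lborel)"
  using assms(2,4)
proof (induction j arbitrary: \<phi>)
  case (Suc j)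
  have s: "smooth_real (deriv \<phi>)" using Suc smooth_real_deriv by blast
  have z: "t \<notin> {c..d} \<Longrightarrow> deriv \<phi> t = 0" for t
    using derivs_eq_0_outside[of c d \<phi> t 1] Suc by simp
  let ?v = "(deriv ^^ j) u"
  have v: "smooth_real ?v" using assms smooth_real_derivs by blast
  have d: "((\<lambda>t. ?v t * \<phi> t) has_real_derivative (deriv ?v t * \<phi> t + deriv \<phi> t * ?v t)) (at t)" for t
    using v Suc by (intro DERIV_mult smooth_real_has_deriv1)
  have c0: "isCont \<phi> t" "isCont (deriv \<phi>) t" "isCont ?v t" "isCont (deriv ?v) t" for t
    using smooth_real_isCont[where f = \<phi> and n = 0] smooth_real_isCont[where f = "deriv \<phi>" and n = 0]
      smooth_real_isCont[where f = ?v and n = 0] smooth_real_isCont[where f = "deriv ?v" and n = 0] smooth_real_deriv[OF v] v s Suc(2) by simp_all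
  have "(\<integral>t. (deriv ?v t * \<phi> t + deriv \<phi> t * ?v t) * indicator {a..b} t \<partial>lborel) = ?v b * \<phi> b - ?v a * \<phi> a"
    using assms by (intro integral_FTC_Icc_real d continuous_intros c0) auto
  also have "\<dots> = 0" using Suc.prems(2)[of a] Suc.prems(2)[of b] assms by simp
  also have "(\<integral>t. (deriv ?v t * \<phi> t + deriv \<phi> t * ?v t) * indicator {a..b} t \<partial>lborel)
    = (\<integral>t. (deriv ?v t * \<phi> t) * indicator {a..b} t \<partial>lborel) + (\<integral>t. (deriv \<phi> t * ?v t) * indicator {a..b} t \<partial>lborel)"
    by (simp only: distrib_right, intro Bochner_Integration.integral_add borel_integrable_atLeastAtMost continuous_intros c0)
  finally have parts: "(\<integral>t. indicator {a..b} t * (?v t * deriv \<phi> t) \<partial>lborel) = - (\<integral>t. indicator {a..b} t * (deriv ?v t * \<phi> t) \<partial>lborel)"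
    by (simp add: mult_ac)
  have "(\<integral>t. indicator {a..b} t * (u t * (deriv ^^ Suc j) \<phi> t) \<partial>lborel) = 
     (\<integral>t. indicator {a..b} t * (u t * (deriv ^^ j) (deriv \<phi>) t) \<partial>lborel)"
    by (simp only: derivs_deriv)
  also have "\<dots> = (- 1) ^ j * (\<integral>t. indicator {a..b} t * (?v t * deriv \<phi> t) \<partial>lborel)"
    by (rule Suc.IH[OF s z])
  finally show ?case unfolding parts by simp
qed simp

section \<open>One variable as the index type \<open>unit\<close>, and test functions\<close>

lemma fun_upd_unit [simp]: "(x :: unit \<Rightarrow> 'a)(() := t) = (\<lambda>_. t)"
  by (auto simp: fun_eq_iff)

lemma unit_fun_eta: "(\<lambda>_. x ()) = (x :: unit \<Rightarrow> 'a)"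
  by (auto simp: fun_eq_iff)

lemma count_list_unit: "count_list is () = length is"
  by (induction "is") auto

lemma partial_derivs_unit:
  "partial_derivs is \<phi> x = (deriv ^^ length is) (\<lambda>t. \<phi> (\<lambda>_. t)) (x ())"
proof (induction "is" arbitrary: x)
  case Nil
  then show ?case by (simp add: partial_derivs_def unit_fun_eta)
next
  case (Cons i "is")
  have "partial_derivs (i # is) \<phi> x = deriv (\<lambda>t. partial_derivs is \<phi> (x(() := t))) (x ())"
    by (simp add: partial_derivs_def partial_deriv_def)
  also have "\<dots> = deriv ((deriv ^^ length is) (\<lambda>t. \<phi> (\<lambda>_. t))) (x ())"
    by (simp add: Cons)
  finally show ?case by simp
qed

text \<open>The enumeration chosen by \<open>SOME\<close> is harmless here: a list over
  \<open>unit\<close> is determined by its length.\<close>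

lemma classical_deriv_unit:
  "classical_deriv (\<lambda>_::unit. j) \<phi> x = (deriv ^^ j) (\<lambda>t. \<phi> (\<lambda>_. t)) (x ())"
proof -
  let ?P = "\<lambda>is :: unit list. \<forall>i. count_list is i = j"
  have "?P (replicate j ())" by (simp add: count_list_unit)
  then have "?P (SOME is. ?P is)" by (rule someI)
  then have "length (SOME is. ?P is) = j" by (simp add: count_list_unit)
  then show ?thesis by (simp add: classical_deriv_def partial_derivs_unit)
qed

lemma PiE_unit_UNIV: "PiE {()} (\<lambda>_. A) = {x. x () \<in> A}"
  by (auto simp: PiE_def extensional_def)

text \<open>The compact support is projected to the line, where its minimum and maximum give a
  closed subinterval of the open interval.\<close>

lemma test_function_unitD:
  assumes "\<phi> \<in> test_functions {()} (\<lambda>_. a) (\<lambda>_. b)" "a < b"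
  shows "smooth_real (\<lambda>t. \<phi> (\<lambda>_. t))"
    and "\<exists>c d. a < c \<and> d < b \<and> (\<forall>t. t \<notin> {c..d} \<longrightarrow> \<phi> (\<lambda>_. t) = 0)"
proof -
  from assms obtain K where s: "smooth {()} \<phi>" and K: "compact K" "K \<subseteq> PiE {()} (\<lambda>_. {a<..<b})"
    and 0: "\<And>x. x \<notin> K \<Longrightarrow> \<phi> x = 0"
    unfolding test_functions_def by (auto simp: PiE_unit_UNIV)
  let ?\<phi> = "\<lambda>t. \<phi> (\<lambda>_. t)"
  have "(deriv ^^ n) ?\<phi> differentiable (at t)" for n t
  proof -
    have "(\<lambda>t. partial_derivs (replicate n ()) \<phi> ((\<lambda>_. t)(() := t))) differentiable (at t)"
      using s unfolding smooth_def by (auto simp: PiE_unit_UNIV)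
    then show ?thesis by (simp add: partial_derivs_unit)
  qed
  then have "((deriv ^^ n) ?\<phi> has_real_derivative (deriv ^^ Suc n) ?\<phi> t) (at t)" for n t
    using DERIV_deriv_iff_real_differentiable by auto
  from smooth_realI[of "\<lambda>n. (deriv ^^ n) ?\<phi>" 0, OF this] show "smooth_real ?\<phi>" by simp
  define K' where "K' = (\<lambda>x. x ()) ` K"
  have "compact K'" unfolding K'_def
    by (rule compact_continuous_image[OF continuous_on_subset[OF continuous_on_product_coordinates] K(1)]) auto
  have K': "K' \<subseteq> {a<..<b}" using K(2) by (auto simp: K'_def PiE_unit_UNIV)
  have z: "?\<phi> t = 0" if "t \<notin> K'" for t
  proof (rule 0, rule notI)
    assume "(\<lambda>_. t) \<in> K"
    then have "(\<lambda>x. x ()) (\<lambda>_. t) \<in> K'" unfolding K'_def by (rule imageI)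
    then show False using that by simp
  qed
  show "\<exists>c d. a < c \<and> d < b \<and> (\<forall>t. t \<notin> {c..d} \<longrightarrow> ?\<phi> t = 0)"
  proof (cases "K' = {}")
    case True
    then show ?thesis using z assms by (intro exI[of _ "(a + b) / 2"]) auto
  next
    case False
    obtain c where c: "c \<in> K'" "\<forall>t\<in>K'. c \<le> t" using compact_attains_inf[OF \<open>compact K'\<close> False] by blast
    obtain d where d: "d \<in> K'" "\<forall>t\<in>K'. t \<le> d" using compact_attains_sup[OF \<open>compact K'\<close> False] by blast
    show ?thesis
    proof (rule exI[of _ c], rule exI[of _ d], intro conjI allI impI)
      fix t assume "t \<notin> {c..d}"
      then have "t \<notin> K'" using c d by auto
      then show "?\<phi> t = 0" by (rule z)
    qed (use c(1) d(1) K' in auto)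
  qed
qed

lemma test_function_unitI:
  assumes "smooth_real \<phi>" "\<And>t. t \<notin> {c..d} \<Longrightarrow> \<phi> t = 0" "a < c" "d < b"
  shows "(\<lambda>x. \<phi> (x ())) \<in> test_functions {()} (\<lambda>_. a) (\<lambda>_. b)"
  unfolding test_functions_def
proof (intro CollectI conjI exI[of _ "(\<lambda>t. (\<lambda>_::unit. t)) ` {c..d}"])
  show "smooth {()} (\<lambda>x. \<phi> (x ()))"
    unfolding smooth_def partial_derivs_unit
  proof (intro allI impI conjI ballI)
    fix "is" :: "unit list"
    show "continuous_on (PiE {()} (\<lambda>_. UNIV)) (\<lambda>x. (deriv ^^ length is) \<phi> (x ()))"
      by (rule continuous_on_compose2[OF smooth_real_continuous_on[OF assms(1), of UNIV]])
         (auto intro: continuous_on_subset[OF continuous_on_product_coordinates])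
    show "(\<lambda>t. (deriv ^^ length is) \<phi> ((x(i := t)) ())) differentiable at (x i)" for x and i :: unit
      using smooth_real_has_deriv[OF assms(1)] real_differentiable_def by auto
  qed
  show "compact ((\<lambda>t. (\<lambda>_::unit. t)) ` {c..d})"
    by (rule compact_continuous_image) (auto intro: continuous_on_coordinatewise_then_product)
  show "\<forall>x\<in>PiE {()} (\<lambda>_. UNIV) - (\<lambda>t _. t) ` {c..d}. \<phi> (x ()) = 0"
  proof
    fix x :: "unit \<Rightarrow> real" assume x: "x \<in> PiE {()} (\<lambda>_. UNIV) - (\<lambda>t _. t) ` {c..d}"
    have "(\<lambda>_::unit. x ()) \<in> (\<lambda>t _. t) ` {c..d}" if "x () \<in> {c..d}"
      using that by (rule imageI)
    then have "x () \<notin> {c..d}" using x unit_fun_eta[of x] by auto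
    then show "\<phi> (x ()) = 0" by (rule assms(2))
  qed
qed (use assms in \<open>auto simp: PiE_unit_UNIV\<close>)

lemma unif_cuboid_unit:
  fixes G :: "(unit \<Rightarrow> real) \<Rightarrow> real"
  assumes "a < b" "G \<in> borel_measurable (unif_cuboid {()} (\<lambda>_. a) (\<lambda>_. b))"
  shows "(\<lambda>t. G (\<lambda>_. t)) \<in> borel_measurable (unif a b)"
    and "integral\<^sup>L (unif_cuboid {()} (\<lambda>_. a) (\<lambda>_. b)) G = (\<integral>t. G (\<lambda>_. t) \<partial>unif a b)"
    and "integrable (unif_cuboid {()} (\<lambda>_. a) (\<lambda>_. b)) G \<longleftrightarrow> integrable (unif a b) (\<lambda>t. G (\<lambda>_. t))"
    and "(AE t in unif a b. P t) \<Longrightarrow> (AE x in unif_cuboid {()} (\<lambda>_. a) (\<lambda>_. b). P (x ()))"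
proof -
  interpret prob_space "unif a b" using prob_space_unif assms by blast
  interpret product_sigma_finite "\<lambda>_::unit. unif a b" ..
  let ?M = "unif_cuboid {()} (\<lambda>_. a) (\<lambda>_. b)"
  have M: "?M = PiM {()} (\<lambda>_. unif a b)" by (simp add: unif_cuboid_def)
  have "(\<lambda>t. \<lambda>i\<in>{()}. t) \<in> measurable (unif a b) (PiM {()} (\<lambda>_. unif a b))"
    by (intro measurable_restrict) auto
  moreover have eq: "(\<lambda>t::real. \<lambda>i\<in>{()}. t) = (\<lambda>t. (\<lambda>_. t))" by (auto simp: fun_eq_iff)
  ultimately have "(\<lambda>t. (\<lambda>_. t)) \<in> measurable (unif a b) ?M" unfolding M eq by (simp only:)
  from measurable_compose[OF this assms(2)] show g: "(\<lambda>t. G (\<lambda>_. t)) \<in> borel_measurable (unif a b)" .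
  show "integral\<^sup>L ?M G = (\<integral>t. G (\<lambda>_. t) \<partial>unif a b)"
    using product_integral_singleton[OF g, of "()"] by (simp add: M unit_fun_eta)
  have dm: "(\<lambda>x. x ()) \<in> measurable ?M (unif a b)" unfolding M by measurable
  have d: "distr ?M (unif a b) (\<lambda>x. x ()) = unif a b" unfolding M by (rule distr_singleton)
  show "integrable ?M G \<longleftrightarrow> integrable (unif a b) (\<lambda>t. G (\<lambda>_. t))"
    using integrable_distr_eq[OF dm g] unfolding d by (simp add: unit_fun_eta)
  show "AE x in ?M. P (x ())" if "AE t in unif a b. P t"
    using AE_distrD[OF dm, of P] that unfolding d .
qed

lemma smooth_real_integrable_unif:
  assumes "smooth_real u" "a < b"
  shows "integrable (unif a b) ((deriv ^^ n) u)"
proof -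
  have "integrable lborel (\<lambda>x. (deriv ^^ n) u x * indicator {a..b} x)"
    by (intro borel_integrable_atLeastAtMost smooth_real_isCont assms)
  then show ?thesis
    using integrable_unif_iff[OF assms(2) borel_measurable_unifI[OF smooth_real_measurable[OF assms(1)]]]
    by (simp add: mult.commute)
qed

lemma measurable_unif_cuboid_unit:
  "f \<in> borel_measurable borel \<Longrightarrow> (\<lambda>x. f (x ())) \<in> borel_measurable (unif_cuboid {()} (\<lambda>_. a) (\<lambda>_. b))"
  unfolding unif_cuboid_def
  by (rule measurable_compose[OF measurable_component_singleton[of "()"] borel_measurable_unifI]) auto

lemma weak_deriv_smooth:
  assumes "smooth_real u" "a < b"
  shows "weak_deriv {()} (\<lambda>_. a) (\<lambda>_. b) (\<lambda>_. j) (\<lambda>x. u (x ())) (\<lambda>x. (deriv ^^ j) u (x ()))"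
  unfolding weak_deriv_def
proof (intro conjI ballI)
  let ?M = "unif_cuboid {()} (\<lambda>_. a) (\<lambda>_. b)"
  have mu: "(\<lambda>x. (deriv ^^ n) u (x ())) \<in> borel_measurable ?M" for n
    by (intro measurable_unif_cuboid_unit smooth_real_measurable assms)
  show "integrable ?M (\<lambda>x. (deriv ^^ j) u (x ()))"
    using unif_cuboid_unit(3)[OF assms(2) mu] smooth_real_integrable_unif[OF assms] by simp
  show "integrable ?M (\<lambda>x. u (x ()))"
    using unif_cuboid_unit(3)[OF assms(2) mu[of 0]] smooth_real_integrable_unif[OF assms, of 0] by simp
  fix \<phi> assume "\<phi> \<in> test_functions {()} (\<lambda>_. a) (\<lambda>_. b)"
  note \<phi> = test_function_unitD[OF this assms(2)]
  then obtain c d where cd: "a < c" "d < b" "\<And>t. t \<notin> {c..d} \<Longrightarrow> \<phi> (\<lambda>_. t) = 0" by blast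
  let ?\<phi> = "\<lambda>t. \<phi> (\<lambda>_. t)"
  have m\<phi>: "(deriv ^^ n) ?\<phi> \<in> borel_measurable borel" for n
    by (intro smooth_real_measurable \<phi>)
  have eq: "\<phi> x = ?\<phi> (x ())" for x by (simp add: unit_fun_eta)
  have mb: "(\<lambda>t. (deriv ^^ n) u t * (deriv ^^ m) ?\<phi> t) \<in> borel_measurable borel" for n m
    using smooth_real_measurable[OF assms(1)] m\<phi> by measurable
  have I: "(\<integral>x. (deriv ^^ n) u (x ()) * (deriv ^^ m) ?\<phi> (x ()) \<partial>?M) =
     (\<integral>t. indicator {a..b} t * ((deriv ^^ n) u t * (deriv ^^ m) ?\<phi> t) \<partial>lborel) / (b - a)" for n m
    by (subst unif_cuboid_unit(2)[OF assms(2)])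
       (auto intro!: measurable_unif_cuboid_unit mb integral_unif assms borel_measurable_unifI)
  show "(\<integral>x. u (x ()) * classical_deriv (\<lambda>_. j) \<phi> x \<partial>?M) = (- 1) ^ (\<Sum>i\<in>{()}. j) *
      (\<integral>x. (deriv ^^ j) u (x ()) * \<phi> x \<partial>?M)"
    using I[of 0 j] I[of j 0] smooth_real_vanishing_parts[OF assms(1) \<phi>(1) assms(2) cd(3) cd(1,2), of j]
    by (simp add: classical_deriv_unit unit_fun_eta)
qed

text \<open>The positive and the negative part of \<open>g\<close> are densities of two finite
  measures that agree on all rays; the measures are therefore equal, and densities are unique almost
  everywhere.\<close>

lemma AE_eq_0_if_interval_integrals_eq_0:
  fixes g :: "real \<Rightarrow> real"
  assumes g: "integrable lborel g" and 0: "\<And>x. (\<integral>t. indicator {x<..} t * g t \<partial>lborel) = 0"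
  shows "AE t in lborel. g t = 0"
proof -
  have [measurable]: "g \<in> borel_measurable borel" using g by simp
  have gi: "integrable lborel (\<lambda>t. indicator {x<..} t * max 0 (s * g t))" for x s
    by (rule Bochner_Integration.integrable_bound[OF integrable_mult_right[OF g, of s]]) (auto simp: indicator_def)
  have e: "emeasure (density lborel (\<lambda>t. ennreal (max 0 (s * g t)))) {x<..}
     = ennreal (\<integral>t. indicator {x<..} t * max 0 (s * g t) \<partial>lborel)" for x s
  proof -
    have "emeasure (density lborel (\<lambda>t. ennreal (max 0 (s * g t)))) {x<..}
       = (\<integral>\<^sup>+t. ennreal (indicator {x<..} t * max 0 (s * g t)) \<partial>lborel)"
      by (subst emeasure_density) (auto intro!: nn_integral_cong simp: indicator_def)
    also have "\<dots> = ennreal (\<integral>t. indicator {x<..} t * max 0 (s * g t) \<partial>lborel)"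
      by (rule nn_integral_eq_integral[OF gi]) (auto simp: indicator_def)
    finally show ?thesis .
  qed
  have "density lborel (\<lambda>t. ennreal (max 0 (1 * g t))) = density lborel (\<lambda>t. ennreal (max 0 (- 1 * g t)))"
  proof (rule measure_eqI_lessThan)
    fix x
    have "(\<integral>t. indicator {x<..} t * max 0 (1 * g t) \<partial>lborel) - (\<integral>t. indicator {x<..} t * max 0 (- 1 * g t) \<partial>lborel)
      = (\<integral>t. indicator {x<..} t * max 0 (1 * g t) - indicator {x<..} t * max 0 (- 1 * g t) \<partial>lborel)"
      by (rule Bochner_Integration.integral_diff[symmetric]; rule gi)
    also have "\<dots> = (\<integral>t. indicator {x<..} t * g t \<partial>lborel)"
      by (intro Bochner_Integration.integral_cong) (auto simp: indicator_def)
    finally show "emeasure (density lborel (\<lambda>t. ennreal (max 0 (1 * g t)))) {x<..} =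
      emeasure (density lborel (\<lambda>t. ennreal (max 0 (- 1 * g t)))) {x<..}"
      unfolding e 0 by simp
    show "emeasure (density lborel (\<lambda>t. ennreal (max 0 (1 * g t)))) {x<..} < \<infinity>"
      unfolding e by simp
  qed simp_all
  then have "AE t in lborel. ennreal (max 0 (1 * g t)) = ennreal (max 0 (- 1 * g t))"
    by (intro sigma_finite_measure.density_unique[OF sigma_finite_lborel]) auto
  then show ?thesis by eventually_elim (auto simp: max_def split: if_splits)
qed

text \<open>The fundamental lemma of the calculus of variations: indicators of open intervals are
  limits of test functions, which reduces it to integrals over rays.\<close>

lemma AE_eq_0_if_test_integrals_eq_0:
  fixes g :: "real \<Rightarrow> real"
  assumes ab: "a < b" and g: "integrable lborel (\<lambda>t. indicator {a..b} t * g t)"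
    and 0: "\<And>\<phi> c d. smooth_real \<phi> \<Longrightarrow> a < c \<Longrightarrow> d < b \<Longrightarrow> (\<And>t. t \<notin> {c..d} \<Longrightarrow> \<phi> t = 0) \<Longrightarrow>
       (\<integral>t. indicator {a..b} t * (g t * \<phi> t) \<partial>lborel) = 0"
  shows "AE t in lborel. indicator {a..b} t * g t = 0"
proof (rule AE_eq_0_if_interval_integrals_eq_0[OF g])
  fix x
  let ?g = "\<lambda>t. indicator {a..b} t * g t"
  have [measurable]: "?g \<in> borel_measurable borel" using g by simp
  have I: "(\<integral>t. indicator {c<..<d} t * ?g t \<partial>lborel) = 0" if cd: "a < c" "d < b" for c d
  proof -
    \<comment> \<open>1 - exp(-n bump) is smooth, lies between 0 and 1, vanishes off (c,d) and tends
      to 1 inside.\<close>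
    define \<phi> where "\<phi> = (\<lambda>(n::nat) t. 1 + (- 1) * exp (- real n * bump c d t + 0))"
    have sm: "smooth_real (\<phi> n)" for n
      unfolding \<phi>_def
      by (intro smooth_real_add smooth_real_mult smooth_real_const smooth_real_compose[OF smooth_real_exp] smooth_real_bump)
    have [measurable]: "\<phi> n \<in> borel_measurable borel" for n
      using smooth_real_measurable[OF sm, of 0] by simp
    have b: "\<bar>\<phi> n t\<bar> \<le> 1" for n t
      using bump_nonneg[of c d t] by (auto simp: \<phi>_def)
    have z: "t \<notin> {c<..<d} \<Longrightarrow> \<phi> n t = 0" for n t
      by (simp add: \<phi>_def bump_eq_0)
    have "(\<lambda>n. \<integral>t. ?g t * \<phi> n t \<partial>lborel) \<longlonglongrightarrow> (\<integral>t. indicator {c<..<d} t * ?g t \<partial>lborel)"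
    proof (rule integral_dominated_convergence[where w = "\<lambda>t. \<bar>?g t\<bar>"])
      show "AE t in lborel. (\<lambda>n. ?g t * \<phi> n t) \<longlonglongrightarrow> indicator {c<..<d} t * ?g t"
      proof (intro AE_I2)
        fix t
        show "(\<lambda>n. ?g t * \<phi> n t) \<longlonglongrightarrow> indicator {c<..<d} t * ?g t"
        proof (cases "t \<in> {c<..<d}")
          case True
          then have p: "bump c d t > 0" by (simp add: bump_pos)
          have "(\<lambda>n. exp (- bump c d t) ^ n) \<longlonglongrightarrow> 0" by (rule LIMSEQ_realpow_zero) (use p in auto)
          then have "(\<lambda>n. ?g t * (1 + (- 1) * exp (- bump c d t) ^ n)) \<longlonglongrightarrow> ?g t * (1 + (- 1) * 0)"
            by (rule tendsto_mult[OF tendsto_const tendsto_add[OF tendsto_const tendsto_mult[OF tendsto_const]]])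
          then show ?thesis using True by (simp add: \<phi>_def exp_of_nat_mult[symmetric])
        qed (simp add: z)
      qed
      show "AE t in lborel. norm (?g t * \<phi> n t) \<le> \<bar>?g t\<bar>" for n
        using b[of n] by (intro AE_I2) (simp add: abs_mult mult_left_le)
      show "integrable lborel (\<lambda>t. \<bar>?g t\<bar>)" using g by (rule integrable_abs)
    qed measurable
    moreover have "(\<integral>t. ?g t * \<phi> n t \<partial>lborel) = 0" for n
    proof -
      have "\<phi> n t = 0" if "t \<notin> {c..d}" for t
        by (rule z) (use that in auto)
      from 0[OF sm cd this] show ?thesis by (simp add: mult_ac)
    qed
    ultimately show ?thesis by (simp add: LIMSEQ_const_iff)
  qed
  \<comment> \<open>Up to end points the ray meets [a,b] in (c,b). Test functions need room on both
    sides, so this interval is exhausted by shrinking it by 1/(n+1).\<close>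
  define c where "c = max x a"
  have "(\<lambda>n. \<integral>t. indicator {c + 1 / real (Suc n)<..<b - 1 / real (Suc n)} t * ?g t \<partial>lborel) \<longlonglongrightarrow> (\<integral>t. indicator {c<..<b} t * ?g t \<partial>lborel)"
  proof (rule integral_dominated_convergence[where w = "\<lambda>t. \<bar>?g t\<bar>"])
    show "AE t in lborel. (\<lambda>n. indicator {c + 1 / real (Suc n)<..<b - 1 / real (Suc n)} t * ?g t) \<longlonglongrightarrow> indicator {c<..<b} t * ?g t"
    proof (intro AE_I2 tendsto_mult tendsto_const)
      fix t
      have l: "(\<lambda>n. c + 1 / real (Suc n)) \<longlonglongrightarrow> c + 0" "(\<lambda>n. b - 1 / real (Suc n)) \<longlonglongrightarrow> b - 0"
        by (intro tendsto_intros LIMSEQ_Suc lim_1_over_n)+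
      show "(\<lambda>n. indicator {c + 1 / real (Suc n)<..<b - 1 / real (Suc n)} t :: real) \<longlonglongrightarrow> indicator {c<..<b} t"
      proof (cases "t \<in> {c<..<b}")
        case True
        then have "\<forall>\<^sub>F n in sequentially. c + 1 / real (Suc n) < t" "\<forall>\<^sub>F n in sequentially. t < b - 1 / real (Suc n)"
          using order_tendstoD(2)[OF l(1), of t] order_tendstoD(1)[OF l(2), of t] by auto
        then have "\<forall>\<^sub>F n in sequentially. indicator {c + 1 / real (Suc n)<..<b - 1 / real (Suc n)} t = (indicator {c<..<b} t :: real)"
          by eventually_elim (use True in \<open>simp add: indicator_def\<close>)
        then show ?thesis by (rule tendsto_eventually)
      next
        case False
        have "t \<notin> {c + 1 / real (Suc n)<..<b - 1 / real (Suc n)}" for n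
        proof -
          have "1 / real (Suc n) > 0" by simp
          with False show ?thesis unfolding greaterThanLessThan_iff by linarith
        qed
        then have "(\<lambda>n. indicator {c + 1 / real (Suc n)<..<b - 1 / real (Suc n)} t :: real) = (\<lambda>n. indicator {c<..<b} t)"
          using False by (simp only: indicator_simps not_False_eq_True)
        then show ?thesis by (simp only: tendsto_const)
      qed
    qed
    show "AE t in lborel. norm (indicator {c + 1 / real (Suc n)<..<b - 1 / real (Suc n)} t * ?g t) \<le> \<bar>?g t\<bar>" for n
      by (intro AE_I2) (simp add: indicator_def)
    show "integrable lborel (\<lambda>t. \<bar>?g t\<bar>)" using g by (rule integrable_abs)
  qed measurable
  moreover have "(\<integral>t. indicator {c + 1 / real (Suc n)<..<b - 1 / real (Suc n)} t * ?g t \<partial>lborel) = 0" for n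
  proof (rule I)
    have "1 / real (Suc n) > 0" by simp
    then show "a < c + 1 / real (Suc n)" "b - 1 / real (Suc n) < b" unfolding c_def by linarith+
  qed
  ultimately have "(\<integral>t. indicator {c<..<b} t * ?g t \<partial>lborel) = 0" by (simp add: LIMSEQ_const_iff)
  also have "(\<integral>t. indicator {c<..<b} t * ?g t \<partial>lborel) = (\<integral>t. indicator {x<..} t * ?g t \<partial>lborel)"
  proof (rule integral_cong_AE)
    have "AE t in lborel. t \<noteq> a" "AE t in lborel. t \<noteq> b" by (rule AE_lborel_singleton)+
    then show "AE t in lborel. indicator {c<..<b} t * ?g t = indicator {x<..} t * ?g t"
      by eventually_elim (auto simp: c_def indicator_def)
  qed measurable
  finally show "(\<integral>t. indicator {x<..} t * ?g t \<partial>lborel) = 0" .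
qed

text \<open>\<open>Dk\<close> is an arbitrary weak derivative; only uniqueness connects it, and with
  it \<open>Hs_norm\<close>, to the classical derivative.\<close>

lemma weak_deriv_smooth_unique:
  assumes "smooth_real u" "a < b" "weak_deriv {()} (\<lambda>_. a) (\<lambda>_. b) (\<lambda>_. j) (\<lambda>x. u (x ())) G"
  shows "AE x in unif_cuboid {()} (\<lambda>_. a) (\<lambda>_. b). G x = (deriv ^^ j) u (x ())"
proof -
  let ?M = "unif_cuboid {()} (\<lambda>_. a) (\<lambda>_. b)"
  let ?v = "(deriv ^^ j) u"
  let ?h = "\<lambda>t. G (\<lambda>_. t) - ?v t"
  have G: "integrable ?M G" using assms(3) by (simp add: weak_deriv_def)
  then have mG: "G \<in> borel_measurable ?M" by simp
  note w = weak_deriv_smooth[OF assms(1,2), of j]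
  have v: "integrable ?M (\<lambda>x. ?v (x ()))" using w by (simp add: weak_deriv_def)
  have g: "integrable (unif a b) (\<lambda>t. G (\<lambda>_. t))"
    using unif_cuboid_unit(3)[OF assms(2) mG] G by simp
  then have h: "integrable (unif a b) ?h"
    using smooth_real_integrable_unif[OF assms(1,2)] by simp
  then have mh: "?h \<in> borel_measurable (unif a b)" by simp
  have "AE t in lborel. indicator {a..b} t * ?h t = 0"
  proof (rule AE_eq_0_if_test_integrals_eq_0[OF assms(2)])
    show "integrable lborel (\<lambda>t. indicator {a..b} t * ?h t)"
      using integrable_unif_iff[OF assms(2) mh] h by blast
    fix \<phi> :: "real \<Rightarrow> real" and c d assume \<phi>: "smooth_real \<phi>" "a < c" "d < b" "\<And>t. t \<notin> {c..d} \<Longrightarrow> \<phi> t = 0"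
    let ?\<phi> = "\<lambda>x :: unit \<Rightarrow> real. \<phi> (x ())"
    have t: "?\<phi> \<in> test_functions {()} (\<lambda>_. a) (\<lambda>_. b)"
      by (rule test_function_unitI[OF \<phi>(1,4,2,3)])
    have m\<phi>: "\<phi> \<in> borel_measurable borel" using smooth_real_measurable[OF \<phi>(1), of 0] by simp
    have m\<phi>': "?\<phi> \<in> borel_measurable ?M" using measurable_unif_cuboid_unit[OF m\<phi>] .
    have eq: "(- 1) ^ (\<Sum>i\<in>{()}. j) * (\<integral>x. G x * ?\<phi> x \<partial>?M) = (- 1) ^ (\<Sum>i\<in>{()}. j) * (\<integral>x. ?v (x ()) * ?\<phi> x \<partial>?M)"
      by (rule trans[OF assms(3)[unfolded weak_deriv_def, THEN conjunct2, THEN conjunct2, THEN bspec, OF t, symmetric]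
        w[unfolded weak_deriv_def, THEN conjunct2, THEN conjunct2, THEN bspec, OF t]])
    have mv: "(\<lambda>x. ?v (x ())) \<in> borel_measurable ?M" using v by simp
    have "bounded (range \<phi>)"
    proof -
      have "bounded (\<phi> ` {c..d})"
        using smooth_real_continuous_on[OF \<phi>(1), of _ 0] by (intro compact_imp_bounded compact_continuous_image) auto
      then have "bounded (insert 0 (\<phi> ` {c..d}))" by simp
      moreover have "range \<phi> \<subseteq> insert 0 (\<phi> ` {c..d})"
      proof (rule image_subsetI)
        fix t show "\<phi> t \<in> insert 0 (\<phi> ` {c..d})" using \<phi>(4)[of t] by blast
      qed
      ultimately show ?thesis by (rule bounded_subset)
    qed
    then obtain C where C: "\<And>t. \<bar>\<phi> t\<bar> \<le> C" by (auto simp: bounded_iff)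
    have ig: "integrable (unif a b) (\<lambda>t. f t * \<phi> t)" if f: "integrable (unif a b) f" for f
    proof (rule Bochner_Integration.integrable_bound)
      show "integrable (unif a b) (\<lambda>t. C * f t)" using f by simp
      show "(\<lambda>t. f t * \<phi> t) \<in> borel_measurable (unif a b)"
        using f borel_measurable_unifI[OF m\<phi>] by measurable
      show "AE x in unif a b. norm (f x * \<phi> x) \<le> norm (C * f x)"
      proof (intro AE_I2)
        fix x
        have "\<bar>\<phi> x\<bar> \<le> \<bar>C\<bar>" using C[of x] by linarith
        then have "\<bar>f x\<bar> * \<bar>\<phi> x\<bar> \<le> \<bar>f x\<bar> * \<bar>C\<bar>" by (intro mult_left_mono) auto
        then show "norm (f x * \<phi> x) \<le> norm (C * f x)" by (simp add: abs_mult mult.commute)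
      qed
    qed
    have "(\<integral>x. G x * ?\<phi> x \<partial>?M) = (\<integral>t. G (\<lambda>_. t) * \<phi> t \<partial>unif a b)"
      by (subst unif_cuboid_unit(2)[OF assms(2)]) (use mG m\<phi>' in measurable)
    moreover have "(\<integral>x. ?v (x ()) * ?\<phi> x \<partial>?M) = (\<integral>t. ?v t * \<phi> t \<partial>unif a b)"
      by (subst unif_cuboid_unit(2)[OF assms(2)]) (use mv m\<phi>' in measurable)
    ultimately have "(\<integral>t. G (\<lambda>_. t) * \<phi> t \<partial>unif a b) - (\<integral>t. ?v t * \<phi> t \<partial>unif a b) = 0"
      using eq by simp
    also have "(\<integral>t. G (\<lambda>_. t) * \<phi> t \<partial>unif a b) - (\<integral>t. ?v t * \<phi> t \<partial>unif a b) = (\<integral>t. ?h t * \<phi> t \<partial>unif a b)"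
      unfolding left_diff_distrib
      by (rule Bochner_Integration.integral_diff[symmetric, OF ig[OF g] ig[OF smooth_real_integrable_unif[OF assms(1,2)]]])
    also have "\<dots> = (\<integral>t. indicator {a..b} t * (?h t * \<phi> t) \<partial>lborel) / (b - a)"
      using mh borel_measurable_unifI[OF m\<phi>] by (intro integral_unif assms(2) borel_measurable_times)
    finally show "(\<integral>t. indicator {a..b} t * (?h t * \<phi> t) \<partial>lborel) = 0" using assms(2) by simp
  qed
  then have "AE t in lborel. t \<in> {a..b} \<longrightarrow> G (\<lambda>_. t) = ?v t"
    by eventually_elim auto
  then have "AE t in unif a b. G (\<lambda>_. t) = ?v t"
    unfolding unif_eq_density[OF assms(2)]
    by (subst AE_density) (auto simp: AE_restrict_space_iff)
  from unif_cuboid_unit(4)[OF assms(2) mG this] show ?thesis by (simp add: unit_fun_eta)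
qed

section \<open>Mean-square norms and the norm of H^s\<close>

lemma Lp_norm_2_le:
  assumes "f \<in> borel_measurable M" "integrable M (\<lambda>x. (f x)\<^sup>2)" "(\<integral>x. (f x)\<^sup>2 \<partial>M) \<le> c\<^sup>2" "c \<ge> 0"
  shows "Lp_norm 2 M f \<le> ereal c"
proof -
  have p: "\<bar>f x\<bar> powr 2 = (f x)\<^sup>2" for x by (cases "f x = 0") (auto simp: powr_numeral)
  have "(\<integral>x. (f x)\<^sup>2 \<partial>M) powr (1 / 2) \<le> (c\<^sup>2) powr (1 / 2)"
    using assms by (intro powr_mono2) auto
  also have "\<dots> = c" using assms by (simp add: powr_half_sqrt)
  finally show ?thesis using assms by (simp add: Lp_norm_def p)
qed

text \<open>Any finite bound excludes the default value \<infinity> of \<open>Lp_norm\<close>. The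
  disjunction lists the forms in which such a bound is supplied.\<close>

lemma Lp_norm_2_less_top:
  assumes "Lp_norm 2 M f < ereal c \<or> Lp_norm 2 M f \<le> ereal c \<or> Lp_norm 2 M f < \<infinity>"
  shows "f \<in> borel_measurable M" "integrable M (\<lambda>x. (f x)\<^sup>2)"
     "Lp_norm 2 M f = ereal (sqrt (\<integral>x. (f x)\<^sup>2 \<partial>M))"
proof -
  have p: "\<bar>f x\<bar> powr 2 = (f x)\<^sup>2" for x by (cases "f x = 0") (auto simp: powr_numeral)
  show *: "f \<in> borel_measurable M" "integrable M (\<lambda>x. (f x)\<^sup>2)"
    using assms by (auto simp: Lp_norm_def p split: if_splits)
  show "Lp_norm 2 M f = ereal (sqrt (\<integral>x. (f x)\<^sup>2 \<partial>M))"
    using * by (simp add: Lp_norm_def p powr_half_sqrt)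
qed

text \<open>On a probability space a pointwise bound also bounds the mean-square norm; s + 1 orders
  contribute. This makes the Jackson estimate applicable to the smooth approximants of a
  slice.\<close>

lemma Hs_norm_smooth:
  assumes u: "smooth_real u" "a < b" and K: "\<And>t k. t \<in> {a..b} \<Longrightarrow> k \<le> s \<Longrightarrow> \<bar>(deriv ^^ k) u t\<bar> \<le> K" and "K \<ge> 0"
  shows "in_Hs a b s u" "Hs_norm a b s u \<le> sqrt (real (s + 1)) * K"
proof -
  let ?M = "unif_cuboid {()} (\<lambda>_. a) (\<lambda>_. b)"
  interpret U: prob_space "unif a b" using prob_space_unif assms by blast
  interpret prob_space ?M unfolding unif_cuboid_def by (intro prob_space_PiM prob_space_unif u)
  have sp: "space ?M = {x. x () \<in> {a..b}}" by (auto simp: unif_cuboid_def space_PiM PiE_unit_UNIV)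
  have N: "Lp_norm 2 ?M G \<le> ereal K" if "weak_deriv {()} (\<lambda>_. a) (\<lambda>_. b) (\<lambda>_. j) (\<lambda>x. u (x ())) G" "j \<le> s" for G j
  proof -
    have [measurable]: "G \<in> borel_measurable ?M"
      using that(1) unfolding weak_deriv_def by (intro borel_measurable_integrable) (elim conjE)
    have ae: "AE x in ?M. (G x)\<^sup>2 \<le> K\<^sup>2"
      using weak_deriv_smooth_unique[OF u that(1)] AE_space
    proof eventually_elim
      case (elim x)
      then have "\<bar>G x\<bar> \<le> K" using K[of "x ()" j] that by (simp add: sp)
      then show ?case using \<open>K \<ge> 0\<close> by (simp add: abs_le_square_iff[symmetric])
    qed
    have i: "integrable ?M (\<lambda>x. (G x)\<^sup>2)"
      by (rule integrable_const_bound[of _ "K\<^sup>2"]) (use ae in auto)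
    moreover have "(\<integral>x. (G x)\<^sup>2 \<partial>?M) \<le> K\<^sup>2"
      using integral_mono_AE[OF i _ ae] by (simp add: prob_space)
    ultimately show ?thesis using \<open>K \<ge> 0\<close> by (intro Lp_norm_2_le) auto
  qed
  have k: "k \<in> multi_indices {()} s \<longleftrightarrow> k () \<le> s" "k = (\<lambda>_. k ())" for k :: "unit \<Rightarrow> nat"
    by (auto simp: multi_indices_def fun_eq_iff)
  show "in_Hs a b s u"
    unfolding in_Hs_def sobolev_def
  proof (intro CollectI ballI)
    fix k assume "k \<in> multi_indices {()} s"
    then have "k () \<le> s" by (simp add: k(1))
    have w: "weak_deriv {()} (\<lambda>_. a) (\<lambda>_. b) k (\<lambda>x. u (x ())) (\<lambda>x. (deriv ^^ k ()) u (x ()))"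
      using weak_deriv_smooth[OF u, of "k ()"] k(2)[of k] by simp
    moreover have "Lp_norm 2 ?M (\<lambda>x. (deriv ^^ k ()) u (x ())) \<le> ereal K"
      using N[of "k ()"] \<open>k () \<le> s\<close> weak_deriv_smooth[OF u, of "k ()"] by blast
    ultimately show "\<exists>g. weak_deriv {()} (\<lambda>_. a) (\<lambda>_. b) k (\<lambda>x. u (x ())) g \<and> Lp_norm 2 ?M g < \<infinity>"
      using ereal_infty_less(1) order_le_less_trans by (intro exI conjI) (assumption, auto)
  qed
  let ?n = "\<lambda>j. Lp_norm 2 ?M (Dk {()} (\<lambda>_. a) (\<lambda>_. b) (\<lambda>_. j) (\<lambda>x. u (x ())))"
  have "(real_of_ereal (?n j))\<^sup>2 \<le> K\<^sup>2" if "j \<le> s" for j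
  proof -
    have "\<exists>G. weak_deriv {()} (\<lambda>_. a) (\<lambda>_. b) (\<lambda>_. j) (\<lambda>x. u (x ())) G"
      by (rule exI, rule weak_deriv_smooth[OF u])
    from someI_ex[OF this] have "weak_deriv {()} (\<lambda>_. a) (\<lambda>_. b) (\<lambda>_. j) (\<lambda>x. u (x ())) (Dk {()} (\<lambda>_. a) (\<lambda>_. b) (\<lambda>_. j) (\<lambda>x. u (x ())))"
      unfolding Dk_def .
    from N[OF this that] have n: "?n j \<le> ereal K" .
    from Lp_norm_2_less_top(3)[of ?M _ K] n obtain r where "?n j = ereal r" "r \<ge> 0"
      by (metis Bochner_Integration.integral_nonneg real_sqrt_ge_zero zero_le_power2)
    then show ?thesis using n by (simp add: power_mono)
  qed
  then have "(\<Sum>j\<le>s. (real_of_ereal (?n j))\<^sup>2) \<le> (\<Sum>j\<le>s. K\<^sup>2)" by (intro sum_mono) auto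
  then have "Hs_norm a b s u \<le> sqrt (\<Sum>j\<le>s. K\<^sup>2)" unfolding Hs_norm_def by (rule real_sqrt_le_mono)
  also have "\<dots> = sqrt (real (s + 1)) * K" using \<open>K \<ge> 0\<close> by (simp add: real_sqrt_mult)
  finally show "Hs_norm a b s u \<le> sqrt (real (s + 1)) * K" .
qed

section \<open>Restriction of Sobolev functions to lines\<close>

lemma tendsto_coordinatewise:
  fixes f :: "'a \<Rightarrow> 'i \<Rightarrow> real"
  assumes "\<And>i. ((\<lambda>n. f n i) \<longlongrightarrow> l i) F"
  shows "(f \<longlongrightarrow> l) F"
proof -
  have "limitin (product_topology (\<lambda>i. euclidean) UNIV) f l F"
    unfolding limitin_componentwise using assms by (simp add: eventually_True)
  then show ?thesis by (simp add: euclidean_product_topology)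
qed

text \<open>Extensionality makes the box a product over all indices, with the one-point factor
  \<open>{undefined}\<close> off \<open>J\<close>, to which the theorem of Tychonoff
  applies.\<close>

lemma compact_PiE_Icc:
  fixes c d :: "'i \<Rightarrow> real"
  shows "compact (\<Pi>\<^sub>E i\<in>J. {c i..d i})"
proof -
  have "(\<Pi>\<^sub>E i\<in>J. {c i..d i}) = PiE UNIV (\<lambda>i. if i \<in> J then {c i..d i} else {undefined})"
    by (auto simp: PiE_def extensional_def Pi_def)
  moreover have "compactin (product_topology (\<lambda>i. euclidean) UNIV) (PiE UNIV (\<lambda>i. if i \<in> J then {c i..d i} else {undefined}))"
    unfolding compactin_PiE by simp
  ultimately show ?thesis by (simp add: euclidean_product_topology)
qed

lemma connected_PiE_Icc:
  fixes c d :: "'i \<Rightarrow> real"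
  shows "connected (\<Pi>\<^sub>E i\<in>J. {c i..d i})"
proof -
  have "(\<Pi>\<^sub>E i\<in>J. {c i..d i}) = PiE UNIV (\<lambda>i. if i \<in> J then {c i..d i} else {undefined})"
    by (auto simp: PiE_def extensional_def Pi_def)
  moreover have "connectedin (product_topology (\<lambda>i. euclidean) UNIV) (PiE UNIV (\<lambda>i. if i \<in> J then {c i..d i} else {undefined}))"
    unfolding connectedin_PiE by simp
  ultimately show ?thesis by (simp add: euclidean_product_topology)
qed

text \<open>A partial derivative hits only its own factor, so that the result depends on the
  multiplicities in the list and not on its order.\<close>

lemma partial_derivs_prod:
  assumes "finite J" "\<And>i. i \<in> J \<Longrightarrow> smooth_real (\<psi> i)" "set js \<subseteq> J"
  shows "partial_derivs js (\<lambda>y. \<Prod>i\<in>J. \<psi> i (y i)) = (\<lambda>y. \<Prod>i\<in>J. (deriv ^^ count_list js i) (\<psi> i) (y i))"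
    and "j \<in> J \<Longrightarrow> ((\<lambda>t. \<Prod>i\<in>J. (deriv ^^ count_list js i) (\<psi> i) ((x(j := t)) i)) has_real_derivative
       (\<Prod>i\<in>J. (deriv ^^ count_list (j # js) i) (\<psi> i) (x i))) (at (x j))"
proof -
  have d: "((\<lambda>t. \<Prod>i\<in>J. (deriv ^^ count_list js i) (\<psi> i) ((x(j := t)) i)) has_real_derivative
       (\<Prod>i\<in>J. (deriv ^^ count_list (j # js) i) (\<psi> i) (x i))) (at (x j))" if j: "j \<in> J" for j js and x :: "'a \<Rightarrow> real"
  proof -
    have 1: "(\<Prod>i\<in>J. (deriv ^^ count_list js i) (\<psi> i) ((x(j := t)) i)) =
       (deriv ^^ count_list js j) (\<psi> j) t * (\<Prod>i\<in>J - {j}. (deriv ^^ count_list js i) (\<psi> i) (x i))" for t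
      using assms(1) j by (subst prod.remove[of J j]) (auto intro!: prod.cong)
    have 2: "(\<Prod>i\<in>J. (deriv ^^ count_list (j # js) i) (\<psi> i) (x i)) =
       (deriv ^^ Suc (count_list js j)) (\<psi> j) (x j) * (\<Prod>i\<in>J - {j}. (deriv ^^ count_list js i) (\<psi> i) (x i))"
      using assms(1) j by (subst prod.remove[of J j]) (auto intro!: prod.cong split: if_splits)
    show ?thesis unfolding 1 2
      by (rule DERIV_cmult_right[OF smooth_real_has_deriv[OF assms(2)[OF j]]])
  qed
  show "j \<in> J \<Longrightarrow> ((\<lambda>t. \<Prod>i\<in>J. (deriv ^^ count_list js i) (\<psi> i) ((x(j := t)) i)) has_real_derivative
       (\<Prod>i\<in>J. (deriv ^^ count_list (j # js) i) (\<psi> i) (x i))) (at (x j))"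
    by (rule d)
  show "partial_derivs js (\<lambda>y. \<Prod>i\<in>J. \<psi> i (y i)) = (\<lambda>y. \<Prod>i\<in>J. (deriv ^^ count_list js i) (\<psi> i) (y i))"
    using assms(3)
  proof (induction js)
    case (Cons j js)
    show ?case
    proof
      fix y
      have "partial_derivs (j # js) (\<lambda>y. \<Prod>i\<in>J. \<psi> i (y i)) y =
        deriv (\<lambda>t. partial_derivs js (\<lambda>y. \<Prod>i\<in>J. \<psi> i (y i)) (y(j := t))) (y j)"
        by (simp add: partial_derivs_def partial_deriv_def)
      also have "partial_derivs js (\<lambda>y. \<Prod>i\<in>J. \<psi> i (y i)) = (\<lambda>y. \<Prod>i\<in>J. (deriv ^^ count_list js i) (\<psi> i) (y i))"
        using Cons by simp
      also have "deriv (\<lambda>t. \<Prod>i\<in>J. (deriv ^^ count_list js i) (\<psi> i) ((y(j := t)) i)) (y j) =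
         (\<Prod>i\<in>J. (deriv ^^ count_list (j # js) i) (\<psi> i) (y i))"
        by (rule DERIV_imp_deriv[OF d]) (use Cons in simp)
      finally show "partial_derivs (j # js) (\<lambda>y. \<Prod>i\<in>J. \<psi> i (y i)) y = (\<Prod>i\<in>J. (deriv ^^ count_list (j # js) i) (\<psi> i) (y i))" .
    qed
  qed (simp add: partial_derivs_def)
qed

lemma test_function_prod:
  fixes \<psi> :: "'i \<Rightarrow> real \<Rightarrow> real"
  assumes J: "finite J" and s: "\<And>i. i \<in> J \<Longrightarrow> smooth_real (\<psi> i)"
    and z: "\<And>i t. i \<in> J \<Longrightarrow> t \<notin> {c i..d i} \<Longrightarrow> \<psi> i t = 0" and cd: "\<And>i. i \<in> J \<Longrightarrow> lo i < c i \<and> d i < hi i"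
  shows "(\<lambda>y. \<Prod>i\<in>J. \<psi> i (y i)) \<in> test_functions J lo hi"
  unfolding test_functions_def
proof (intro CollectI conjI exI[of _ "\<Pi>\<^sub>E i\<in>J. {c i..d i}"])
  show "smooth J (\<lambda>y. \<Prod>i\<in>J. \<psi> i (y i))"
    unfolding smooth_def
  proof (intro allI impI conjI ballI)
    fix js assume js: "set js \<subseteq> J"
    have eq: "partial_derivs js (\<lambda>y. \<Prod>i\<in>J. \<psi> i (y i)) = (\<lambda>y. \<Prod>i\<in>J. (deriv ^^ count_list js i) (\<psi> i) (y i))"
      by (rule partial_derivs_prod(1)[OF J _ js]) (rule s)
    have "continuous_on (\<Pi>\<^sub>E i\<in>J. UNIV) (\<lambda>y. (deriv ^^ count_list js i) (\<psi> i) (y i))" if "i \<in> J" for i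
      by (rule continuous_on_compose2[OF smooth_real_continuous_on[OF s[OF that], of UNIV]])
         (auto intro: continuous_on_subset[OF continuous_on_product_coordinates])
    note c = this
    show "continuous_on (\<Pi>\<^sub>E i\<in>J. UNIV) (partial_derivs js (\<lambda>y. \<Prod>i\<in>J. \<psi> i (y i)))"
      unfolding eq by (intro continuous_on_prod c)
    show "(\<lambda>t. partial_derivs js (\<lambda>y. \<Prod>i\<in>J. \<psi> i (y i)) (x(j := t))) differentiable at (x j)" if "j \<in> J" for x j
    proof -
      have "((\<lambda>t. \<Prod>i\<in>J. (deriv ^^ count_list js i) (\<psi> i) ((x(j := t)) i)) has_real_derivative
         (\<Prod>i\<in>J. (deriv ^^ count_list (j # js) i) (\<psi> i) (x i))) (at (x j))"
        by (rule partial_derivs_prod(2)[OF J _ js that]) (rule s)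
      then show ?thesis unfolding eq real_differentiable_def by (rule exI)
    qed
  qed
  show "compact (\<Pi>\<^sub>E i\<in>J. {c i..d i})" by (rule compact_PiE_Icc)
  show "(\<Pi>\<^sub>E i\<in>J. {c i..d i}) \<subseteq> (\<Pi>\<^sub>E i\<in>J. {lo i<..<hi i})"
    using cd by (intro PiE_mono) force
  show "\<forall>x\<in>(\<Pi>\<^sub>E i\<in>J. UNIV) - (\<Pi>\<^sub>E i\<in>J. {c i..d i}). (\<Prod>i\<in>J. \<psi> i (x i)) = 0"
  proof
    fix x assume "x \<in> (\<Pi>\<^sub>E i\<in>J. UNIV) - (\<Pi>\<^sub>E i\<in>J. {c i..d i})"
    then obtain i where "i \<in> J" "x i \<notin> {c i..d i}" unfolding PiE_def Pi_def by auto
    then show "(\<Prod>i\<in>J. \<psi> i (x i)) = 0" using J z by (intro prod_zero) auto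
  qed
qed

text \<open>Whatever enumeration \<open>SOME\<close> picks for the multi-index, it has the
  prescribed multiplicities, and for products nothing else matters.\<close>

lemma classical_deriv_prod:
  assumes "finite J" "\<And>i. i \<in> J \<Longrightarrow> smooth_real (\<psi> i)" "j \<in> J"
  shows "classical_deriv (\<lambda>i. if i = j then \<kappa> else 0) (\<lambda>y. \<Prod>i\<in>J. \<psi> i (y i)) y =
    (deriv ^^ \<kappa>) (\<psi> j) (y j) * (\<Prod>i\<in>J - {j}. \<psi> i (y i))"
proof -
  let ?k = "\<lambda>i. if i = j then \<kappa> else 0"
  define js where "js = (SOME js. \<forall>i. count_list js i = ?k i)"
  have "\<forall>i. count_list (replicate \<kappa> j) i = ?k i"
    by (induction \<kappa>) auto
  then have js: "\<forall>i. count_list js i = ?k i" unfolding js_def by (rule someI)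
  have "set js \<subseteq> J"
  proof
    fix i assume "i \<in> set js"
    then have "count_list js i \<noteq> 0" by (simp add: count_list_0_iff)
    then show "i \<in> J" using js assms by (auto split: if_splits)
  qed
  then have "classical_deriv ?k (\<lambda>y. \<Prod>i\<in>J. \<psi> i (y i)) y = (\<Prod>i\<in>J. (deriv ^^ count_list js i) (\<psi> i) (y i))"
    unfolding classical_deriv_def js_def[symmetric]
    by (subst partial_derivs_prod(1)) (use assms in simp_all)
  also have "\<dots> = (deriv ^^ \<kappa>) (\<psi> j) (y j) * (\<Prod>i\<in>J - {j}. \<psi> i (y i))"
    using assms js by (subst prod.remove[of J j]) (auto intro!: prod.cong)
  finally show ?thesis .
qed

lemma smooth_real_bounded:
  assumes "smooth_real \<phi>" "\<And>t. t \<notin> {c..d} \<Longrightarrow> \<phi> t = 0"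
  shows "\<exists>C\<ge>0. \<forall>t. \<bar>(deriv ^^ n) \<phi> t\<bar> \<le> C"
proof -
  have "bounded ((deriv ^^ n) \<phi> ` {c..d})"
    using smooth_real_continuous_on[OF assms(1)] by (intro compact_imp_bounded compact_continuous_image) auto
  then obtain C where "\<forall>x\<in>(deriv ^^ n) \<phi> ` {c..d}. norm x \<le> C" unfolding bounded_iff by blast
  then have C: "\<And>t. t \<in> {c..d} \<Longrightarrow> \<bar>(deriv ^^ n) \<phi> t\<bar> \<le> C" by simp
  have "\<bar>(deriv ^^ n) \<phi> t\<bar> \<le> \<bar>C\<bar>" for t
  proof (cases "t \<in> {c..d}")
    case True
    then show ?thesis using C[OF True] by linarith
  next
    case False
    then show ?thesis using derivs_eq_0_outside[OF assms(2) False] by simp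
  qed
  then show ?thesis by (intro exI[of _ "\<bar>C\<bar>"]) auto
qed

text \<open>Differentiation under the integral. A quadratic Taylor bound for the kernel, uniform in
  its argument, gives the remainder directly. The affine form \<open>p y + q * t\<close> covers
  kernels whose centre moves linearly in \<open>t\<close>.\<close>

lemma DERIV_convolution:
  assumes w: "integrable M w" and p: "p \<in> borel_measurable M" and \<rho>: "smooth_real \<rho>" "\<And>t. t \<notin> {c..d} \<Longrightarrow> \<rho> t = 0"
  shows "((\<lambda>t. \<integral>y. w y * \<rho> (p y + q * t) \<partial>M) has_real_derivative (\<integral>y. w y * (q * deriv \<rho> (p y + q * t)) \<partial>M)) (at t)"
proof -
  have B: "\<exists>C\<ge>0. \<forall>t. \<bar>(deriv ^^ n) \<rho> t\<bar> \<le> C" for n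
    by (rule smooth_real_bounded[OF \<rho>])
  obtain C0 where C0: "\<And>t. \<bar>\<rho> t\<bar> \<le> C0" using B[of 0] by auto
  obtain C1 where C1: "\<And>t. \<bar>deriv \<rho> t\<bar> \<le> C1" using B[of 1] by auto
  obtain C2 where C2: "C2 \<ge> 0" "\<And>t. \<bar>deriv (deriv \<rho>) t\<bar> \<le> C2"
    using B[of 2] by (auto simp: numeral_2_eq_2)
  have [measurable]: "w \<in> borel_measurable M" "\<rho> \<in> borel_measurable borel" "deriv \<rho> \<in> borel_measurable borel"
    using w smooth_real_measurable[OF \<rho>(1), of 0] smooth_real_measurable[OF \<rho>(1), of 1] by auto
  note [measurable] = p
  have i: "integrable M (\<lambda>y. w y * g (p y + q * t))" if g: "\<And>t. \<bar>g t\<bar> \<le> C" and [measurable]: "g \<in> borel_measurable borel" for g t C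
  proof (rule Bochner_Integration.integrable_bound[OF integrable_mult_right[OF w, of C]])
    show "AE y in M. norm (w y * g (p y + q * t)) \<le> norm (C * w y)"
    proof (intro AE_I2)
      fix y
      have "\<bar>g (p y + q * t)\<bar> \<le> \<bar>C\<bar>" using g[of "p y + q * t"] by linarith
      then have "\<bar>w y\<bar> * \<bar>g (p y + q * t)\<bar> \<le> \<bar>w y\<bar> * \<bar>C\<bar>" by (intro mult_left_mono) auto
      then show "norm (w y * g (p y + q * t)) \<le> norm (C * w y)" by (simp add: abs_mult mult.commute)
    qed
  qed measurable
  \<comment> \<open>Two applications of the mean value inequality; the sharper constant C2/2 would
    bring nothing.\<close>
  have T: "\<bar>\<rho> (u + \<delta>) - \<rho> u - \<delta> * deriv \<rho> u\<bar> \<le> C2 * \<delta>\<^sup>2" for u \<delta>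
  proof -
    define g where "g x = \<rho> x - x * deriv \<rho> u" for x
    have g: "(g has_real_derivative deriv \<rho> x - deriv \<rho> u) (at x)" for x
    proof -
      have "((\<lambda>x. \<rho> x - x * deriv \<rho> u) has_real_derivative deriv \<rho> x - 1 * deriv \<rho> u) (at x)"
        by (rule DERIV_diff[OF smooth_real_has_deriv1[OF \<rho>(1)] DERIV_cmult_right[OF DERIV_ident]])
      then show ?thesis unfolding g_def[abs_def] by simp
    qed
    have g': "norm (deriv \<rho> x - deriv \<rho> u) \<le> C2 * \<bar>\<delta>\<bar>" if x: "x \<in> cball u \<bar>\<delta>\<bar>" for x
    proof -
      have "norm (deriv \<rho> x - deriv \<rho> u) \<le> C2 * norm (x - u)"
      proof (rule field_differentiable_bound[where S = UNIV and f = "deriv \<rho>" and f' = "deriv (deriv \<rho>)"])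
        show "(deriv \<rho> has_field_derivative deriv (deriv \<rho>) z) (at z)" for z
          by (rule smooth_real_has_deriv1[OF smooth_real_deriv[OF \<rho>(1)]])
        show "norm (deriv (deriv \<rho>) z) \<le> C2" for z using C2(2)[of z] by simp
      qed simp_all
      also have "\<dots> \<le> C2 * \<bar>\<delta>\<bar>" using x C2(1) by (intro mult_left_mono) (auto simp: dist_real_def)
      finally show ?thesis .
    qed
    have "norm (g (u + \<delta>) - g u) \<le> (C2 * \<bar>\<delta>\<bar>) * norm ((u + \<delta>) - u)"
      by (rule field_differentiable_bound[where S = "cball u \<bar>\<delta>\<bar>" and f = g and f' = "\<lambda>x. deriv \<rho> x - deriv \<rho> u"])
         (rule convex_cball, rule has_field_derivative_at_within[OF g], erule g', simp_all add: dist_real_def)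
    moreover have "g (u + \<delta>) - g u = \<rho> (u + \<delta>) - \<rho> u - \<delta> * deriv \<rho> u"
      by (simp add: g_def algebra_simps)
    ultimately show ?thesis by (simp add: power2_eq_square)
  qed
  let ?D = "\<integral>y. w y * (q * deriv \<rho> (p y + q * t)) \<partial>M"
  let ?H = "\<lambda>t. \<integral>y. w y * \<rho> (p y + q * t) \<partial>M"
  have iD: "integrable M (\<lambda>y. w y * (q * deriv \<rho> (p y + q * t)))"
  proof -
    have "integrable M (\<lambda>y. q * (w y * deriv \<rho> (p y + q * t)))"
      by (rule integrable_mult_right[OF i[OF C1]]) measurable
    then show ?thesis by (simp only: mult.left_commute[of "w _" q])
  qed
  have i0: "integrable M (\<lambda>y. w y * \<rho> (p y + q * t))" for t
    by (rule i[OF C0]) measurable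
  have E: "\<bar>?H (t + \<delta>) - ?H t - \<delta> * ?D\<bar> \<le> C2 * (q * \<delta>)\<^sup>2 * (\<integral>y. \<bar>w y\<bar> \<partial>M)" for \<delta>
  proof -
    define r where "r y = w y * \<rho> (p y + q * (t + \<delta>)) - w y * \<rho> (p y + q * t) - \<delta> * (w y * (q * deriv \<rho> (p y + q * t)))" for y
    have ri: "integrable M r"
      unfolding r_def by (rule Bochner_Integration.integrable_diff[OF Bochner_Integration.integrable_diff[OF i0 i0] integrable_mult_right[OF iD]])
    have "?H (t + \<delta>) - ?H t - \<delta> * ?D = (\<integral>y. r y \<partial>M)"
      unfolding r_def
      by (subst Bochner_Integration.integral_diff[OF Bochner_Integration.integrable_diff[OF i0 i0] integrable_mult_right[OF iD]],
          subst Bochner_Integration.integral_diff[OF i0 i0], subst integral_mult_right_zero, rule refl)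
    also have "\<bar>\<dots>\<bar> \<le> (\<integral>y. \<bar>r y\<bar> \<partial>M)"
      using integral_norm_bound[of M r] by simp
    also have "\<dots> \<le> (\<integral>y. C2 * (q * \<delta>)\<^sup>2 * \<bar>w y\<bar> \<partial>M)"
    proof (rule integral_mono)
      show "integrable M (\<lambda>y. \<bar>r y\<bar>)" using ri by (rule integrable_abs)
      show "integrable M (\<lambda>y. C2 * (q * \<delta>)\<^sup>2 * \<bar>w y\<bar>)" using w by (intro integrable_mult_right integrable_abs)
      fix y
      have "r y = w y * (\<rho> (p y + q * t + q * \<delta>) - \<rho> (p y + q * t) - (q * \<delta>) * deriv \<rho> (p y + q * t))"
        unfolding r_def by (simp add: algebra_simps)
      also have "\<bar>\<dots>\<bar> \<le> \<bar>w y\<bar> * (C2 * (q * \<delta>)\<^sup>2)"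
        unfolding abs_mult[of "w y"] by (rule mult_left_mono[OF T abs_ge_zero])
      finally show "\<bar>r y\<bar> \<le> C2 * (q * \<delta>)\<^sup>2 * \<bar>w y\<bar>"
        by (simp add: mult_ac)
    qed
    finally show ?thesis by simp
  qed
  have "((\<lambda>\<delta>. (?H (t + \<delta>) - ?H t) / \<delta> - ?D) \<longlongrightarrow> 0) (at 0)"
  proof (rule Lim_null_comparison)
    show "\<forall>\<^sub>F \<delta> in at 0. norm ((?H (t + \<delta>) - ?H t) / \<delta> - ?D) \<le> C2 * q\<^sup>2 * (\<integral>y. \<bar>w y\<bar> \<partial>M) * \<bar>\<delta>\<bar>"
      unfolding eventually_at_filter
    proof (intro always_eventually allI impI)
      fix \<delta> :: real assume "\<delta> \<noteq> 0"
      then have "(?H (t + \<delta>) - ?H t) / \<delta> - ?D = (?H (t + \<delta>) - ?H t - \<delta> * ?D) / \<delta>" by (simp add: field_simps)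
      then have "norm ((?H (t + \<delta>) - ?H t) / \<delta> - ?D) \<le> C2 * (q * \<delta>)\<^sup>2 * (\<integral>y. \<bar>w y\<bar> \<partial>M) / \<bar>\<delta>\<bar>"
        using E[of \<delta>] \<open>\<delta> \<noteq> 0\<close> by (simp add: divide_right_mono)
      also have "\<dots> = C2 * q\<^sup>2 * (\<integral>y. \<bar>w y\<bar> \<partial>M) * (\<delta>\<^sup>2 / \<bar>\<delta>\<bar>)" by (simp add: power_mult_distrib)
      also have "\<delta>\<^sup>2 / \<bar>\<delta>\<bar> = \<bar>\<delta>\<bar>" using \<open>\<delta> \<noteq> 0\<close> by (simp add: power2_eq_square field_simps abs_if)
      finally show "norm ((?H (t + \<delta>) - ?H t) / \<delta> - ?D) \<le> C2 * q\<^sup>2 * (\<integral>y. \<bar>w y\<bar> \<partial>M) * \<bar>\<delta>\<bar>" .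
    qed
    show "((\<lambda>\<delta>. C2 * q\<^sup>2 * (\<integral>y. \<bar>w y\<bar> \<partial>M) * \<bar>\<delta>\<bar>) \<longlongrightarrow> 0) (at 0)"
      by (rule tendsto_mult_right_zero) (rule tendsto_rabs_zero[OF tendsto_ident_at])
  qed
  then show ?thesis unfolding DERIV_def by (simp add: LIM_zero_iff)
qed

lemma derivs_eqI:
  assumes "\<And>n x. (F n has_real_derivative F (Suc n) x) (at x)"
  shows "(deriv ^^ n) (F 0) = F n"
proof (induction n)
  case (Suc n)
  have "deriv (F n) = F (Suc n)" by (intro ext DERIV_imp_deriv assms)
  then show ?case by (simp add: Suc)
qed simp

text \<open>Uniform continuity along a line, by contradiction with sequences. The parameters
  \<open>t\<close> have a convergent subsequence, and the neighbouring points are then forced,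
  coordinate by coordinate, to the same limit. The tolerance is relative to the edge lengths, so one
  \<theta> serves all coordinates.\<close>

lemma continuous_on_cuboid_slice_uniform:
  fixes F :: "('i \<Rightarrow> real) \<Rightarrow> real"
  assumes F: "continuous_on (cuboid J lo hi) F" and x: "x \<in> cuboid J lo hi" and j: "j \<in> J" and "\<delta> > 0"
  shows "\<exists>\<theta>. 0 < \<theta> \<and> \<theta> < 1 \<and> (\<forall>t\<in>{lo j..hi j}. \<forall>y\<in>cuboid J lo hi.
    (\<forall>i\<in>J. \<bar>y i - (x(j := t)) i\<bar> \<le> \<theta> * (hi i - lo i)) \<longrightarrow> \<bar>F y - F (x(j := t))\<bar> \<le> \<delta>)"
proof (rule ccontr)
  \<comment> \<open>The shift by 2 keeps the tolerance strictly below 1.\<close>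
  let ?\<theta> = "\<lambda>n::nat. 1 / real (n + 2)"
  let ?P = "\<lambda>n t y. t \<in> {lo j..hi j} \<and> y \<in> cuboid J lo hi \<and> (\<forall>i\<in>J. \<bar>y i - (x(j := t)) i\<bar> \<le> ?\<theta> n * (hi i - lo i)) \<and> \<not> \<bar>F y - F (x(j := t))\<bar> \<le> \<delta>"
  assume neg: "\<not> ?thesis"
  have "\<exists>t y. ?P n t y" for n
  proof -
    have "0 < ?\<theta> n" "?\<theta> n < 1" by auto
    then show ?thesis using neg by blast
  qed
  note ex = this
  define T where "T n = (SOME t. \<exists>y. ?P n t y)" for n
  define Y where "Y n = (SOME y. ?P n (T n) y)" for n
  have "\<exists>y. ?P n (T n) y" for n unfolding T_def by (rule someI_ex[OF ex])
  then have TY: "?P n (T n) (Y n)" for n unfolding Y_def by (rule someI_ex)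
  have "seq_compact {lo j..hi j}" by (rule compact_imp_seq_compact) auto
  then obtain l r where lr: "l \<in> {lo j..hi j}" "strict_mono (r :: nat \<Rightarrow> nat)" "(T \<circ> r) \<longlonglongrightarrow> l"
    using TY by (elim seq_compactE[of _ T]) auto
  have upd: "x(j := t) \<in> cuboid J lo hi" if "t \<in> {lo j..hi j}" for t
    using x j that by (auto simp: cuboid_def PiE_def extensional_def)
  have c1: "(\<lambda>n. x(j := T (r n))) \<longlonglongrightarrow> x(j := l)"
    using lr(3) by (intro tendsto_coordinatewise) (auto simp: o_def)
  have c2: "(\<lambda>n. Y (r n)) \<longlonglongrightarrow> x(j := l)"
  proof (rule tendsto_coordinatewise)
    fix i
    show "(\<lambda>n. Y (r n) i) \<longlonglongrightarrow> (x(j := l)) i"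
    proof (cases "i \<in> J")
      case False
      then have "Y (r n) i = (x(j := l)) i" for n
        using TY[of "r n"] x j by (auto simp: cuboid_def PiE_def extensional_def)
      then show ?thesis by simp
    next
      case True
      have "(\<lambda>n. Y (r n) i - (x(j := T (r n))) i) \<longlonglongrightarrow> 0"
      proof (rule Lim_null_comparison)
        show "\<forall>\<^sub>F n in sequentially. norm (Y (r n) i - (x(j := T (r n))) i) \<le> ?\<theta> (r n) * (hi i - lo i)"
          using TY True by (intro always_eventually allI) (simp only: real_norm_def)
        have "(\<lambda>n. 1 / real (n + 2)) \<longlonglongrightarrow> 0"
          using LIMSEQ_ignore_initial_segment[OF lim_1_over_n, of 2] by simp
        from LIMSEQ_subseq_LIMSEQ[OF this lr(2)] show "(\<lambda>n. ?\<theta> (r n) * (hi i - lo i)) \<longlonglongrightarrow> 0"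
          by (intro tendsto_mult_left_zero) (simp add: o_def)
      qed
      moreover have "(\<lambda>n. (x(j := T (r n))) i) \<longlonglongrightarrow> (x(j := l)) i"
        using lr(3) by (auto simp: o_def)
      ultimately have "(\<lambda>n. (Y (r n) i - (x(j := T (r n))) i) + (x(j := T (r n))) i) \<longlonglongrightarrow> 0 + (x(j := l)) i"
        by (rule tendsto_add)
      then show ?thesis by simp
    qed
  qed
  have "(\<lambda>n. F (Y (r n))) \<longlonglongrightarrow> F (x(j := l))"
    by (rule continuous_on_tendsto_compose[OF F c2 upd[OF lr(1)]]) (use TY in \<open>auto intro!: always_eventually\<close>)
  moreover have "(\<lambda>n. F (x(j := T (r n)))) \<longlonglongrightarrow> F (x(j := l))"
    by (rule continuous_on_tendsto_compose[OF F c1 upd[OF lr(1)]]) (use TY upd in \<open>auto intro!: always_eventually\<close>)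
  ultimately have "(\<lambda>n. \<bar>F (Y (r n)) - F (x(j := T (r n)))\<bar>) \<longlonglongrightarrow> \<bar>F (x(j := l)) - F (x(j := l))\<bar>"
    by (intro tendsto_intros)
  then have "\<forall>\<^sub>F n in sequentially. \<bar>F (Y (r n)) - F (x(j := T (r n)))\<bar> < \<delta>"
    using \<open>\<delta> > 0\<close> by (intro order_tendstoD(2)) auto
  then obtain n where "\<bar>F (Y (r n)) - F (x(j := T (r n)))\<bar> < \<delta>"
    by (auto simp: eventually_sequentially)
  then show False using TY[of "r n"] by linarith
qed

section \<open>Mollification inside a box\<close>

lemma bump_integral_pos: "(\<integral>x. bump (- 1) 1 x \<partial>lborel) > 0"
proof -
  have m: "bump (- 1) 1 \<in> borel_measurable borel"
    using smooth_real_measurable[OF smooth_real_bump, of 0] by simp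
  have "integrable lborel (\<lambda>x. bump (- 1) 1 x * indicator {- 1..1} x)"
    using smooth_real_isCont[OF smooth_real_bump, where n = 0] by (intro borel_integrable_atLeastAtMost) simp
  moreover have "(\<lambda>x. bump (- 1) 1 x * indicator {- 1..1} x) = bump (- 1) 1"
  proof
    fix x :: real
    show "bump (- 1) 1 x * indicator {- 1..1} x = bump (- 1) 1 x"
      by (cases "x \<in> {- 1<..<1}") (auto simp: bump_eq_0)
  qed
  ultimately have i: "integrable lborel (bump (- 1) 1)" by simp
  have "(\<integral>x. bump (- 1) 1 x \<partial>lborel) \<noteq> 0"
  proof
    assume "(\<integral>x. bump (- 1) 1 x \<partial>lborel) = 0"
    then have "AE x in lborel. bump (- 1) 1 x = 0"
      using integral_nonneg_eq_0_iff_AE[OF i] bump_nonneg by auto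
    then have "AE x in lborel. x \<notin> {- 1<..<1 :: real}"
    proof eventually_elim
      case (elim x)
      then show ?case using bump_pos[of "- 1" 1 x] by auto
    qed
    then have "emeasure lborel {- 1<..<1 :: real} = 0"
      using AE_iff_null_sets[of "{- 1<..<1 :: real}" lborel] by auto
    then show False by simp
  qed
  moreover have "(\<integral>x. bump (- 1) 1 x \<partial>lborel) \<ge> 0" by (simp add: bump_nonneg)
  ultimately show ?thesis by linarith
qed

text \<open>As long as the kernel fits into the interval, its mass does not depend on its
  centre.\<close>

lemma bump_integral_unif:
  assumes "a < b" "\<eta> > 0" "a < \<tau> - \<eta>" "\<tau> + \<eta> < b"
  shows "(\<integral>x. bump (- 1) 1 ((x - \<tau>) / \<eta>) \<partial>unif a b) = \<eta> * (\<integral>x. bump (- 1) 1 x \<partial>lborel) / (b - a)"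
proof -
  have m [measurable]: "bump (- 1) 1 \<in> borel_measurable borel"
    using smooth_real_measurable[OF smooth_real_bump, of 0] by simp
  have "(\<integral>x. bump (- 1) 1 ((x - \<tau>) / \<eta>) \<partial>unif a b) = (\<integral>x. indicator {a..b} x * bump (- 1) 1 ((x - \<tau>) / \<eta>) \<partial>lborel) / (b - a)"
    by (intro integral_unif assms borel_measurable_unifI) measurable
  also have "(\<lambda>x. indicator {a..b} x * bump (- 1) 1 ((x - \<tau>) / \<eta>)) = (\<lambda>x. bump (- 1) 1 ((x - \<tau>) / \<eta>))"
  proof
    fix x
    have "bump (- 1) 1 ((x - \<tau>) / \<eta>) = 0" if "x \<notin> {a..b}"
      using that assms by (intro bump_eq_0) (auto simp: field_simps)
    then show "indicator {a..b} x * bump (- 1) 1 ((x - \<tau>) / \<eta>) = bump (- 1) 1 ((x - \<tau>) / \<eta>)"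
      by (cases "x \<in> {a..b}") simp_all
  qed
  also have "(\<integral>x. bump (- 1) 1 ((x - \<tau>) / \<eta>) \<partial>lborel) = \<eta> * (\<integral>x. bump (- 1) 1 x \<partial>lborel)"
    using assms by (subst lborel_integral_real_affine[of \<eta> _ \<tau>]) auto
  finally show ?thesis .
qed


text \<open>The slice is approximated by averages of \<open>F\<close> against product kernels that
  follow the line. Pure derivatives of the average are averages of the weak derivative over the
  full-dimensional box, so bounds that hold almost everywhere there become bounds at every point of
  the line. As averages, the values stay in every interval that contains the range of
  \<open>F\<close>.\<close>

lemma slice_approx:
  fixes F :: "('i \<Rightarrow> real) \<Rightarrow> real"
  assumes J: "finite J" "j \<in> J" and lohi: "\<And>i. i \<in> J \<Longrightarrow> lo i < hi i"
    and F: "continuous_on (cuboid J lo hi) F" "integrable (unif_cuboid J lo hi) F"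
    and x: "x \<in> cuboid J lo hi" and "\<delta> > 0"
    and bnd: "\<And>\<kappa>. \<kappa> \<in> Ks \<Longrightarrow> \<exists>G. weak_deriv J lo hi (\<lambda>i. if i = j then \<kappa> else 0) F G \<and>
      (AE y in unif_cuboid J lo hi. \<bar>G y\<bar> \<le> Bb \<kappa>)"
  shows "\<exists>h. smooth_real h \<and> (\<forall>t\<in>{lo j..hi j}. \<bar>h t - F (x(j := t))\<bar> \<le> \<delta> \<and>
     (\<forall>a b. F ` cuboid J lo hi \<subseteq> {a..b} \<longrightarrow> h t \<in> {a..b}) \<and> (\<forall>\<kappa>\<in>Ks. \<bar>(deriv ^^ \<kappa>) h t\<bar> \<le> Bb \<kappa>))"
proof -
  define M where "M = unif_cuboid J lo hi"
  define \<rho> where "\<rho> = bump (- 1) 1"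
  have \<rho>: "smooth_real \<rho>" unfolding \<rho>_def by (rule smooth_real_bump)
  have \<rho>0: "\<rho> u = 0" if "u \<notin> {- 1..1}" for u unfolding \<rho>_def by (rule bump_eq_0) (use that in auto)
  have \<rho>m [measurable]: "(deriv ^^ n) \<rho> \<in> borel_measurable borel" for n by (rule smooth_real_measurable[OF \<rho>])
  have \<rho>nn: "\<rho> u \<ge> 0" for u unfolding \<rho>_def by (rule bump_nonneg)
  have \<rho>b: "\<exists>C\<ge>0. \<forall>t. \<bar>(deriv ^^ n) \<rho> t\<bar> \<le> C" for n by (rule smooth_real_bounded[OF \<rho>]) (rule \<rho>0)
  define I0 where "I0 = (\<integral>u. \<rho> u \<partial>lborel)"
  have I0: "I0 > 0" unfolding I0_def \<rho>_def by (rule bump_integral_pos)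
  \<comment> \<open>The product locale asks for probability spaces at all indices; those off
    \<open>J\<close> get an arbitrary one.\<close>
  have ps: "prob_space (if i \<in> J then unif (lo i) (hi i) else unif 0 1)" for i
    using prob_space_unif lohi by auto
  interpret P: product_prob_space "\<lambda>i. if i \<in> J then unif (lo i) (hi i) else unif 0 1"
    by (intro product_prob_spaceI ps)
  have M_eq: "M = PiM J (\<lambda>i. if i \<in> J then unif (lo i) (hi i) else unif 0 1)"
    unfolding M_def unif_cuboid_def by (rule PiM_cong) auto
  interpret M: prob_space M unfolding M_eq by (rule prob_space_PiM) (rule ps)
  have spM: "space M = cuboid J lo hi"
    by (simp add: M_def unif_cuboid_def space_PiM cuboid_def)
  have comp: "(\<lambda>y. g (y i)) \<in> borel_measurable M" if "i \<in> J" "g \<in> borel_measurable borel" for g i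
    unfolding M_def unif_cuboid_def
    by (rule measurable_compose[OF measurable_component_singleton[OF that(1)] borel_measurable_unifI[OF that(2)]])
  from continuous_on_cuboid_slice_uniform[OF F(1) x J(2) \<open>\<delta> > 0\<close>]
  obtain \<theta> where \<theta>3: "0 < \<theta> \<and> \<theta> < 1 \<and> (\<forall>t\<in>{lo j..hi j}. \<forall>y\<in>cuboid J lo hi.
    (\<forall>i\<in>J. \<bar>y i - (x(j := t)) i\<bar> \<le> \<theta> * (hi i - lo i)) \<longrightarrow> \<bar>F y - F (x(j := t))\<bar> \<le> \<delta>)" ..
  then have \<theta>: "0 < \<theta>" "\<theta> < 1" by (simp_all only:)
  have unif: "\<bar>F y - F (x(j := t))\<bar> \<le> \<delta>" if "t \<in> {lo j..hi j}" "y \<in> cuboid J lo hi"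
     "\<forall>i\<in>J. \<bar>y i - (x(j := t)) i\<bar> \<le> \<theta> * (hi i - lo i)" for t y
    by (rule \<theta>3[THEN conjunct2, THEN conjunct2, THEN bspec, OF that(1), THEN bspec, OF that(2), THEN mp, OF that(3)])
  \<comment> \<open>The contraction of the centres frees a margin of \<theta>/2 edge lengths on each
    side. A kernel of radius \<theta>/4 fits, and displacement plus radius stay below \<theta> edge
    lengths.\<close>
  define \<eta> where "\<eta> i = \<theta> * (hi i - lo i) / 4" for i
  define mid where "mid i = (lo i + hi i) / 2" for i
  \<comment> \<open>Centres are pulled towards the midpoint by the factor 1 - \<theta>, so that
    \<open>F\<close> is never evaluated outside the box and no extension is required.\<close>
  define \<tau> where "\<tau> i c = mid i + (1 - \<theta>) * (c - mid i)" for i c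
  have \<eta>: "\<eta> i > 0" if "i \<in> J" for i using lohi[OF that] \<theta> by (simp add: \<eta>_def)
  have \<tau>: "lo i < \<tau> i c - \<eta> i \<and> \<tau> i c + \<eta> i < hi i \<and> \<bar>\<tau> i c - c\<bar> \<le> \<theta> * (hi i - lo i) / 2"
    if i: "i \<in> J" and c: "c \<in> {lo i..hi i}" for i c
  proof -
    define l where "l = hi i - lo i"
    have l: "l > 0" using lohi[OF i] by (simp add: l_def)
    have lm: "lo i = mid i - l / 2" "hi i = mid i + l / 2" by (auto simp: mid_def l_def field_simps)
    have cm: "\<bar>c - mid i\<bar> \<le> l / 2" using c lm unfolding atLeastAtMost_iff by linarith
    then have "(1 - \<theta>) * \<bar>c - mid i\<bar> \<le> (1 - \<theta>) * (l / 2)" using \<theta> by (intro mult_left_mono) auto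
    moreover have "\<bar>\<tau> i c - mid i\<bar> = (1 - \<theta>) * \<bar>c - mid i\<bar>"
      using \<theta> by (simp add: \<tau>_def abs_mult)
    moreover have "(1 - \<theta>) * (l / 2) = l / 2 - \<theta> * l / 2" by (simp add: field_simps)
    ultimately have "\<bar>\<tau> i c - mid i\<bar> \<le> l / 2 - \<theta> * l / 2" by linarith
    moreover have "\<eta> i = \<theta> * l / 4" by (simp add: \<eta>_def l_def)
    moreover have "\<theta> * l > 0" using \<theta> l by simp
    moreover have "\<tau> i c - c = - (\<theta> * (c - mid i))" by (simp add: \<tau>_def algebra_simps)
    then have "\<bar>\<tau> i c - c\<bar> \<le> \<theta> * (l / 2)" using cm \<theta> by (simp add: abs_mult mult_left_mono)
    ultimately have "lo i < \<tau> i c - \<eta> i" "\<tau> i c + \<eta> i < hi i" "\<bar>\<tau> i c - c\<bar> \<le> \<theta> * l / 2"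
      unfolding lm using \<open>\<bar>\<tau> i c - mid i\<bar> \<le> l / 2 - \<theta> * l / 2\<close> by linarith+
    then show ?thesis by (simp add: l_def)
  qed
  define \<psi> where "\<psi> i c u = \<rho> ((1 / \<eta> i) * u + - (\<tau> i c / \<eta> i))" for i c u
  have \<psi>_eq: "\<psi> i c u = \<rho> ((u - \<tau> i c) / \<eta> i)" for i c u by (simp add: \<psi>_def diff_divide_distrib)
  have \<psi>s: "smooth_real (\<psi> i c)" for i c
    unfolding \<psi>_def by (rule smooth_real_compose[OF \<rho> smooth_real_affine])
  have \<psi>d: "(deriv ^^ n) (\<psi> i c) u = (1 / \<eta> i) ^ n * (deriv ^^ n) \<rho> ((u - \<tau> i c) / \<eta> i)" for n i c u
    unfolding \<psi>_def derivs_affine[OF \<rho>] by (simp add: diff_divide_distrib)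
  have \<psi>0: "\<psi> i c u = 0" if "i \<in> J" "u \<notin> {\<tau> i c - \<eta> i..\<tau> i c + \<eta> i}" for i c u
    unfolding \<psi>_eq by (rule \<rho>0) (use that \<eta>[OF that(1)] in \<open>auto simp: field_simps\<close>)
  have \<psi>m: "(deriv ^^ n) (\<psi> i c) \<in> borel_measurable borel" for n i c
    by (rule smooth_real_measurable[OF \<psi>s])
  have \<psi>nn: "\<psi> i c u \<ge> 0" for i c u by (simp add: \<psi>_def \<rho>nn)
  from \<rho>b[of 0] obtain C\<rho> where C\<rho>': "C\<rho> \<ge> 0 \<and> (\<forall>t. \<bar>(deriv ^^ 0) \<rho> t\<bar> \<le> C\<rho>)" ..
  have C\<rho>: "C\<rho> \<ge> 0" "\<rho> u \<le> C\<rho>" for u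
    using C\<rho>'[THEN conjunct1] C\<rho>'[THEN conjunct2, THEN spec, of u] by simp_all
  define z where "z t = x(j := t)" for t
  have zj: "z t j = t" "i \<noteq> j \<Longrightarrow> z t i = x i" for t i by (auto simp: z_def)
  have zJ: "z t i \<in> {lo i..hi i}" if "t \<in> {lo j..hi j}" "i \<in> J" for t i
    using x that by (auto simp: z_def cuboid_def PiE_def Pi_def)
  define \<Pi>0 where "\<Pi>0 y = (\<Prod>i\<in>J - {j}. \<psi> i (x i) (y i))" for y
  define \<Phi> where "\<Phi> t y = (\<Prod>i\<in>J. \<psi> i (z t i) (y i))" for t y
  have \<Phi>_eq: "\<Phi> t y = \<psi> j t (y j) * \<Pi>0 y" for t y
    unfolding \<Phi>_def \<Pi>0_def using J zj by (subst prod.remove[of J j]) (auto intro!: prod.cong)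
  have \<Phi>nn: "\<Phi> t y \<ge> 0" for t y unfolding \<Phi>_def by (intro prod_nonneg ballI \<psi>nn)
  have \<Pi>m [measurable]: "\<Pi>0 \<in> borel_measurable M"
    unfolding \<Pi>0_def using \<psi>m[of 0] by (intro borel_measurable_prod comp) auto
  have \<Pi>b: "\<bar>\<Pi>0 y\<bar> \<le> C\<rho> ^ card (J - {j})" for y
  proof -
    have "\<bar>\<Pi>0 y\<bar> = (\<Prod>i\<in>J - {j}. \<psi> i (x i) (y i))"
      unfolding \<Pi>0_def using \<psi>nn by (simp add: prod_nonneg)
    also have "\<dots> \<le> (\<Prod>i\<in>J - {j}. C\<rho>)" using \<psi>nn C\<rho>(2) by (intro prod_mono) (auto simp: \<psi>_eq)
    finally show ?thesis by simp
  qed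
  have Fi: "integrable M F" using F(2) by (simp add: M_def)
  then have Fm [measurable]: "F \<in> borel_measurable M" by simp
  have bdd_int: "integrable M (\<lambda>y. g y * b y)" if g: "integrable M g" and b: "b \<in> borel_measurable M" "\<And>y. \<bar>b y\<bar> \<le> C" for g b :: "('i \<Rightarrow> real) \<Rightarrow> real" and C
  proof (rule Bochner_Integration.integrable_bound[OF integrable_mult_right[OF g, of C]])
    show "(\<lambda>y. g y * b y) \<in> borel_measurable M" using g b(1) by simp
    show "AE y in M. norm (g y * b y) \<le> norm (C * g y)"
    proof (intro AE_I2)
      fix y
      have "\<bar>b y\<bar> \<le> \<bar>C\<bar>" using b(2)[of y] by linarith
      then have "\<bar>g y\<bar> * \<bar>b y\<bar> \<le> \<bar>g y\<bar> * \<bar>C\<bar>" by (intro mult_left_mono) auto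
      then show "norm (g y * b y) \<le> norm (C * g y)" by (simp add: abs_mult mult.commute)
    qed
  qed
  have w: "integrable M (\<lambda>y. F y * \<Pi>0 y)" by (rule bdd_int[OF Fi \<Pi>m \<Pi>b])
  have \<Phi>m [measurable]: "\<Phi> t \<in> borel_measurable M" for t
    unfolding \<Phi>_def using \<psi>m[of 0] by (intro borel_measurable_prod comp) auto
  have \<Phi>b: "\<bar>\<Phi> t y\<bar> \<le> C\<rho> ^ card J" for t y
  proof -
    have "\<bar>\<Phi> t y\<bar> = (\<Prod>i\<in>J. \<psi> i (z t i) (y i))"
      unfolding \<Phi>_def using \<psi>nn by (simp add: prod_nonneg)
    also have "\<dots> \<le> (\<Prod>i\<in>J. C\<rho>)" using \<psi>nn C\<rho>(2) by (intro prod_mono) (auto simp: \<psi>_eq)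
    finally show ?thesis by simp
  qed
  have \<Phi>int: "integrable M (\<lambda>y. g y * \<Phi> t y)" if "integrable M g" for g t
    by (rule bdd_int[OF that \<Phi>m \<Phi>b])
  have \<Phi>i: "integrable M (\<Phi> t)" for t using \<Phi>int[of "\<lambda>_. 1" t] by simp
  \<comment> \<open>The mass of the product kernel, the same for all \<open>t\<close> because every
    factor stays inside its interval.\<close>
  define Z where "Z = (\<Prod>i\<in>J. \<eta> i * I0 / (hi i - lo i))"
  have Z: "Z > 0" unfolding Z_def using \<eta> I0 lohi by (intro prod_pos) auto
  have \<Phi>Z: "(\<integral>y. \<Phi> t y \<partial>M) = Z" if t: "t \<in> {lo j..hi j}" for t
  proof -
    have b: "(\<integral>u. \<psi> i (z t i) u \<partial>(if i \<in> J then unif (lo i) (hi i) else unif 0 1)) = \<eta> i * I0 / (hi i - lo i)" if "i \<in> J" for i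
      unfolding \<psi>_eq \<rho>_def I0_def using bump_integral_unif[OF lohi[OF that] \<eta>[OF that]] \<tau>[OF that zJ[OF t that]] that by simp
    have "(\<integral>y. \<Phi> t y \<partial>M) = (\<Prod>i\<in>J. \<integral>u. \<psi> i (z t i) u \<partial>(if i \<in> J then unif (lo i) (hi i) else unif 0 1))"
      unfolding \<Phi>_def M_eq
    proof (rule P.product_integral_prod[OF J(1)])
      fix i assume i: "i \<in> J"
      show "integrable (if i \<in> J then unif (lo i) (hi i) else unif 0 1) (\<psi> i (z t i))"
        using smooth_real_integrable_unif[OF \<psi>s lohi[OF i], where n = 0] i by simp
    qed
    also have "\<dots> = Z" unfolding Z_def using b by (intro prod.cong) auto
    finally show ?thesis .
  qed
  \<comment> \<open>\<open>q\<close> is the rate at which the kernel argument in direction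
    \<open>j\<close> changes with \<open>t\<close>; \<open>p\<close> collects the rest of that
    argument.\<close>
  define q where "q = - (1 - \<theta>) / \<eta> j"
  define p where "p y = (y j - \<theta> * mid j) / \<eta> j" for y
  have p [measurable]: "p \<in> borel_measurable M" unfolding p_def by (rule comp[OF J(2)]) measurable
  have arg: "(y j - \<tau> j t) / \<eta> j = p y + q * t" for y t
    using \<eta>[OF J(2)] by (simp add: p_def q_def \<tau>_def field_simps)
  \<comment> \<open>All derivatives of the mollified slice at once: differentiation in
    \<open>t\<close> produces one factor \<open>q\<close> and one derivative of the kernel.\<close>
  define H where "H n t = ((1 / Z) * q ^ n) * (\<integral>y. (F y * \<Pi>0 y) * (deriv ^^ n) \<rho> (p y + q * t) \<partial>M)" for n t
  have HD: "(H n has_real_derivative H (Suc n) t) (at t)" for n t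
  proof -
    have d0: "u \<notin> {- 1..1} \<Longrightarrow> (deriv ^^ n) \<rho> u = 0" for u by (rule derivs_eq_0_outside[OF \<rho>0])
    have "((\<lambda>t. \<integral>y. (F y * \<Pi>0 y) * (deriv ^^ n) \<rho> (p y + q * t) \<partial>M) has_real_derivative
       (\<integral>y. (F y * \<Pi>0 y) * (q * deriv ((deriv ^^ n) \<rho>) (p y + q * t)) \<partial>M)) (at t)"
      by (rule DERIV_convolution[OF w p smooth_real_derivs[OF \<rho>] d0])
    from DERIV_cmult[OF this, of "(1 / Z) * q ^ n"]
    have "(H n has_real_derivative ((1 / Z) * q ^ n) * (\<integral>y. (F y * \<Pi>0 y) * (q * deriv ((deriv ^^ n) \<rho>) (p y + q * t)) \<partial>M)) (at t)"
      unfolding H_def .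
    moreover have "(\<integral>y. (F y * \<Pi>0 y) * (q * deriv ((deriv ^^ n) \<rho>) (p y + q * t)) \<partial>M)
       = q * (\<integral>y. (F y * \<Pi>0 y) * deriv ((deriv ^^ n) \<rho>) (p y + q * t) \<partial>M)"
      by (simp only: mult.left_commute[of _ q] integral_mult_right_zero)
    ultimately show ?thesis by (simp add: H_def mult_ac)
  qed
  have Hs: "smooth_real (H 0)" by (rule smooth_realI) (rule HD)
  have Hd: "(deriv ^^ n) (H 0) = H n" for n by (rule derivs_eqI) (rule HD)
  have H0: "H 0 t = (1 / Z) * (\<integral>y. F y * \<Phi> t y \<partial>M)" for t
    unfolding H_def \<Phi>_eq \<psi>_eq arg by (simp add: mult_ac)
  \<comment> \<open>Bounds on the kernel support pass to the average. It is used with c the value at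
    the centre for accuracy, and with c = 0 for the range.\<close>
  have avg: "a \<le> H 0 t - c \<and> H 0 t - c \<le> b"
    if t: "t \<in> {lo j..hi j}" and y: "\<And>y. y \<in> cuboid J lo hi \<Longrightarrow> \<Phi> t y \<noteq> 0 \<Longrightarrow> a \<le> F y - c \<and> F y - c \<le> b" for t a b c
  proof -
    have i: "integrable M (\<lambda>y. (F y - c) * \<Phi> t y)" using Fi by (intro \<Phi>int) simp
    have e: "(\<integral>y. (F y - c) * \<Phi> t y \<partial>M) = Z * (H 0 t - c)"
      unfolding left_diff_distrib using \<Phi>int[OF Fi] \<Phi>i \<Phi>Z[OF t] Z by (simp add: H0 algebra_simps)
    have "a * Z = (\<integral>y. a * \<Phi> t y \<partial>M)" using \<Phi>Z[OF t] by simp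
    also have "\<dots> \<le> (\<integral>y. (F y - c) * \<Phi> t y \<partial>M)"
    proof (rule integral_mono[OF _ i])
      show "integrable M (\<lambda>y. a * \<Phi> t y)" using \<Phi>i by simp
      fix y assume "y \<in> space M"
      then show "a * \<Phi> t y \<le> (F y - c) * \<Phi> t y"
        using y[of y] \<Phi>nn[of t y] unfolding spM by (cases "\<Phi> t y = 0") (auto intro!: mult_right_mono)
    qed
    finally have 1: "a \<le> H 0 t - c" using e Z by (simp add: mult.commute[of a])
    have "(\<integral>y. (F y - c) * \<Phi> t y \<partial>M) \<le> (\<integral>y. b * \<Phi> t y \<partial>M)"
    proof (rule integral_mono[OF i])
      show "integrable M (\<lambda>y. b * \<Phi> t y)" using \<Phi>i by simp
      fix y assume "y \<in> space M"
      then show "(F y - c) * \<Phi> t y \<le> b * \<Phi> t y"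
        using y[of y] \<Phi>nn[of t y] unfolding spM by (cases "\<Phi> t y = 0") (auto intro!: mult_right_mono)
    qed
    also have "\<dots> = b * Z" using \<Phi>Z[OF t] by simp
    finally have "H 0 t - c \<le> b" using e Z by (simp add: mult.commute[of b])
    with 1 show ?thesis by simp
  qed
  have A: "\<bar>H 0 t - F (x(j := t))\<bar> \<le> \<delta>" if t: "t \<in> {lo j..hi j}" for t
  proof -
    have "- \<delta> \<le> H 0 t - F (x(j := t)) \<and> H 0 t - F (x(j := t)) \<le> \<delta>"
    proof (rule avg[OF t])
      fix y assume y: "y \<in> cuboid J lo hi" "\<Phi> t y \<noteq> 0"
      have "\<bar>F y - F (x(j := t))\<bar> \<le> \<delta>"
      proof (rule unif[OF t y(1)], rule ballI)
        fix i assume i: "i \<in> J"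
        have "\<psi> i (z t i) (y i) \<noteq> 0" using y(2) i J(1) unfolding \<Phi>_def by (simp add: prod_zero_iff)
        then have "y i \<in> {\<tau> i (z t i) - \<eta> i..\<tau> i (z t i) + \<eta> i}" using \<psi>0[OF i] by blast
        then have "\<bar>y i - \<tau> i (z t i)\<bar> \<le> \<eta> i" by auto
        moreover have "\<bar>\<tau> i (z t i) - z t i\<bar> \<le> \<theta> * (hi i - lo i) / 2" using \<tau>[OF i zJ[OF t i]] by simp
        moreover have "\<eta> i \<le> \<theta> * (hi i - lo i) / 2" using \<theta> lohi[OF i] by (simp add: \<eta>_def)
        ultimately show "\<bar>y i - (x(j := t)) i\<bar> \<le> \<theta> * (hi i - lo i)" unfolding z_def[symmetric] by linarith
      qed
      then show "- \<delta> \<le> F y - F (x(j := t)) \<and> F y - F (x(j := t)) \<le> \<delta>" by linarith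
    qed
    then show ?thesis by linarith
  qed
  have B: "H 0 t \<in> {a..b}" if t: "t \<in> {lo j..hi j}" and "F ` cuboid J lo hi \<subseteq> {a..b}" for t a b
  proof -
    have "a \<le> H 0 t - 0 \<and> H 0 t - 0 \<le> b" by (rule avg[OF t]) (use that(2) in force)
    then show ?thesis by simp
  qed
  \<comment> \<open>Testing the weak derivative with the kernel turns the derivative in
    \<open>t\<close> into an average of \<open>G\<close>. The contraction leaves only the harmless
    factor (1 - \<theta>)^\<kappa> \<le> 1, and the two signs cancel.\<close>
  have D: "\<bar>H \<kappa> t\<bar> \<le> Bb \<kappa>" if t: "t \<in> {lo j..hi j}" and \<kappa>: "\<kappa> \<in> Ks" for t \<kappa>
  proof -
    let ?k = "\<lambda>i. if i = j then \<kappa> else 0"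
    obtain G where G: "weak_deriv J lo hi ?k F G" "AE y in M. \<bar>G y\<bar> \<le> Bb \<kappa>"
      using bnd[OF \<kappa>] unfolding M_def by blast
    have Gi: "integrable M G" using G(1) unfolding weak_deriv_def M_def by (elim conjE)
    then have [measurable]: "G \<in> borel_measurable M" by simp
    have tf: "\<Phi> t \<in> test_functions J lo hi"
      unfolding \<Phi>_def
      by (rule test_function_prod[where c = "\<lambda>i. \<tau> i (z t i) - \<eta> i" and d = "\<lambda>i. \<tau> i (z t i) + \<eta> i", OF J(1) \<psi>s])
         (use \<psi>0 \<tau> zJ[OF t] in auto)
    have pr: "(\<Prod>i\<in>J - {j}. \<psi> i (z t i) (y i)) = \<Pi>0 y" for y
      unfolding \<Pi>0_def by (rule prod.cong) (use zj(2) in auto)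
    have cd: "classical_deriv ?k (\<Phi> t) y = (deriv ^^ \<kappa>) (\<psi> j t) (y j) * \<Pi>0 y" for y
      unfolding \<Phi>_def[abs_def] using classical_deriv_prod[where \<psi> = "\<lambda>i. \<psi> i (z t i)" and j = j and J = J and \<kappa> = \<kappa>, OF J(1) \<psi>s J(2)] zj(1)
      by (simp add: pr)
    have sk: "sum ?k J = \<kappa>" using J by simp
    have "(\<integral>y. F y * classical_deriv ?k (\<Phi> t) y \<partial>M) = (- 1) ^ sum ?k J * (\<integral>y. G y * \<Phi> t y \<partial>M)"
      using G(1)[unfolded weak_deriv_def, THEN conjunct2, THEN conjunct2, THEN bspec, OF tf] unfolding M_def .
    then have e1: "(\<integral>y. F y * ((deriv ^^ \<kappa>) (\<psi> j t) (y j) * \<Pi>0 y) \<partial>M) = (- 1) ^ \<kappa> * (\<integral>y. G y * \<Phi> t y \<partial>M)"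
      unfolding cd sk .
    have "F y * ((1 / \<eta> j) ^ \<kappa> * (deriv ^^ \<kappa>) \<rho> (p y + q * t) * \<Pi>0 y) = (1 / \<eta> j) ^ \<kappa> * ((F y * \<Pi>0 y) * (deriv ^^ \<kappa>) \<rho> (p y + q * t))" for y
      by (simp only: mult_ac)
    then have e2: "(\<integral>y. F y * ((deriv ^^ \<kappa>) (\<psi> j t) (y j) * \<Pi>0 y) \<partial>M) = (1 / \<eta> j) ^ \<kappa> * (\<integral>y. (F y * \<Pi>0 y) * (deriv ^^ \<kappa>) \<rho> (p y + q * t) \<partial>M)"
      unfolding \<psi>d arg by (simp only: integral_mult_right_zero)
    have "q ^ \<kappa> = (- (1 - \<theta>)) ^ \<kappa> * (1 / \<eta> j) ^ \<kappa>"
      unfolding power_mult_distrib[symmetric] q_def by simp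
    then have "H \<kappa> t = (1 / Z) * ((- (1 - \<theta>)) ^ \<kappa> * (\<integral>y. F y * ((deriv ^^ \<kappa>) (\<psi> j t) (y j) * \<Pi>0 y) \<partial>M))"
      unfolding H_def e2 by (simp only: mult.assoc)
    then have "H \<kappa> t = (1 / Z) * ((- (1 - \<theta>)) ^ \<kappa> * ((- 1) ^ \<kappa> * (\<integral>y. G y * \<Phi> t y \<partial>M)))"
      unfolding e1 .
    then have "\<bar>H \<kappa> t\<bar> = (1 / Z) * ((1 - \<theta>) ^ \<kappa> * \<bar>\<integral>y. G y * \<Phi> t y \<partial>M\<bar>)"
      using Z \<theta> by (simp add: abs_mult power_abs)
    also have "\<dots> \<le> (1 / Z) * (1 * (Bb \<kappa> * Z))"
    proof (intro mult_left_mono mult_mono)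
      show "(1 - \<theta>) ^ \<kappa> \<le> 1" using \<theta> by (intro power_le_one) auto
      have "\<bar>\<integral>y. G y * \<Phi> t y \<partial>M\<bar> \<le> (\<integral>y. \<bar>G y * \<Phi> t y\<bar> \<partial>M)"
        using integral_norm_bound[of M "\<lambda>y. G y * \<Phi> t y"] by simp
      also have "\<dots> \<le> (\<integral>y. Bb \<kappa> * \<Phi> t y \<partial>M)"
      proof (rule integral_mono_AE)
        show "integrable M (\<lambda>y. \<bar>G y * \<Phi> t y\<bar>)" by (intro integrable_abs \<Phi>int Gi)
        show "integrable M (\<lambda>y. Bb \<kappa> * \<Phi> t y)" using \<Phi>i by simp
        show "AE y in M. \<bar>G y * \<Phi> t y\<bar> \<le> Bb \<kappa> * \<Phi> t y"
          using G(2) by eventually_elim (use \<Phi>nn in \<open>auto simp: abs_mult intro!: mult_right_mono\<close>)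
      qed
      also have "\<dots> = Bb \<kappa> * Z" using \<Phi>Z[OF t] by simp
      finally show "\<bar>\<integral>y. G y * \<Phi> t y \<partial>M\<bar> \<le> Bb \<kappa> * Z" .
    qed (use Z in auto)
    also have "\<dots> = Bb \<kappa>" using Z by simp
    finally show ?thesis .
  qed
  show ?thesis
    by (intro exI[of _ "H 0"] conjI ballI allI impI Hs A B) (simp_all only: Hd D)
qed

section \<open>Compositional functions on a tree\<close>

locale dim_tree =
  fixes D :: "nat set" and S :: "nat set \<Rightarrow> nat set set"
  assumes tree: "dimension_tree D S"
begin

lemma finite_D: "finite D" and card_D: "2 \<le> card D"
  using tree by (auto simp: dimension_tree_def)

lemma nodeD:
  assumes "\<alpha> \<in> nodes D S"
  shows "\<alpha> \<noteq> {}" "\<alpha> \<subseteq> D" "S \<alpha> = {} \<longleftrightarrow> is_singleton \<alpha>"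
    "S \<alpha> \<noteq> {} \<Longrightarrow> partition_on \<alpha> (S \<alpha>)" "S \<alpha> \<noteq> {} \<Longrightarrow> 2 \<le> card (S \<alpha>)"
proof -
  have *: "\<alpha> \<noteq> {} \<and> \<alpha> \<subseteq> D \<and> (S \<alpha> = {} \<or> partition_on \<alpha> (S \<alpha>) \<and> 2 \<le> card (S \<alpha>)) \<and> (S \<alpha> = {} \<longleftrightarrow> is_singleton \<alpha>)"
    by (rule tree[unfolded dimension_tree_def, THEN conjunct2, THEN conjunct2, THEN bspec, OF assms])
  then show "\<alpha> \<noteq> {}" "\<alpha> \<subseteq> D" "S \<alpha> = {} \<longleftrightarrow> is_singleton \<alpha>"
    "S \<alpha> \<noteq> {} \<Longrightarrow> partition_on \<alpha> (S \<alpha>)" "S \<alpha> \<noteq> {} \<Longrightarrow> 2 \<le> card (S \<alpha>)" by blast+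
qed

lemma node_finite: "\<alpha> \<in> nodes D S \<Longrightarrow> finite \<alpha>"
  by (rule finite_subset[OF nodeD(2) finite_D])

lemma finite_nodes: "finite (nodes D S)"
  by (rule finite_subset[of _ "Pow D"]) (use nodeD(2) finite_D in auto)

lemma sons_finite: "\<alpha> \<in> nodes D S \<Longrightarrow> finite (S \<alpha>)"
  by (rule finite_subset[OF _ finite_nodes]) (rule subsetI, rule nodes.son)

lemma sonD:
  assumes "\<alpha> \<in> nodes D S" "\<beta> \<in> S \<alpha>"
  shows "\<beta> \<in> nodes D S" "\<beta> \<subset> \<alpha>" "\<beta> \<noteq> D" "card \<beta> < card \<alpha>"
proof -
  show "\<beta> \<in> nodes D S" by (rule nodes.son[OF assms])
  have p: "partition_on \<alpha> (S \<alpha>)" "2 \<le> card (S \<alpha>)" using nodeD[OF assms(1)] assms(2) by auto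
  have "\<beta> \<subseteq> \<alpha>" using p(1) assms(2) by (auto simp: partition_on_def)
  moreover have "\<beta> \<noteq> \<alpha>"
  proof
    assume "\<beta> = \<alpha>"
    have "S \<alpha> \<subseteq> {\<alpha>}"
    proof
      fix \<gamma> assume g: "\<gamma> \<in> S \<alpha>"
      have "\<gamma> \<subseteq> \<alpha>" "\<gamma> \<noteq> {}" using p(1) g by (auto simp: partition_on_def)
      moreover have "\<gamma> = \<alpha> \<or> \<gamma> \<inter> \<alpha> = {}"
        using p(1) g assms(2) \<open>\<beta> = \<alpha>\<close> unfolding partition_on_def disjoint_def by blast
      ultimately show "\<gamma> \<in> {\<alpha>}" by blast
    qed
    then have "card (S \<alpha>) \<le> 1" using card_mono[of "{\<alpha>}" "S \<alpha>"] by simp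
    then show False using p(2) by simp
  qed
  ultimately show *: "\<beta> \<subset> \<alpha>" by blast
  then show "\<beta> \<noteq> D" using nodeD(2)[OF assms(1)] by blast
  show "card \<beta> < card \<alpha>" using * node_finite[OF assms(1)] by (rule psubset_card_mono[rotated])
qed

lemma sons_Union: "\<alpha> \<in> nodes D S \<Longrightarrow> S \<alpha> \<noteq> {} \<Longrightarrow> \<Union>(S \<alpha>) = \<alpha>"
  using nodeD(4) by (simp add: partition_on_def)

lemma sons_disjoint: "\<alpha> \<in> nodes D S \<Longrightarrow> \<beta> \<in> S \<alpha> \<Longrightarrow> \<gamma> \<in> S \<alpha> \<Longrightarrow> \<beta> \<noteq> \<gamma> \<Longrightarrow> \<beta> \<inter> \<gamma> = {}"
  using nodeD(4)[of \<alpha>] unfolding partition_on_def disjoint_def by blast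

lemma subnodes:
  assumes "\<beta> \<in> nodes \<alpha> S" "\<alpha> \<in> nodes D S"
  shows "\<beta> \<subseteq> \<alpha> \<and> \<beta> \<in> nodes D S"
  using assms
proof (induction rule: nodes.induct)
  case (son \<gamma> \<beta>)
  then show ?case using sonD(1,2)[of \<gamma> \<beta>] by auto
qed auto

lemma nodes_cases_son: "\<beta> \<in> nodes \<alpha> S \<Longrightarrow> \<beta> = \<alpha> \<or> (\<exists>\<gamma>\<in>S \<alpha>. \<beta> \<in> nodes \<gamma> S)"
proof (induction rule: nodes.induct)
  case (son \<gamma> \<beta>)
  from son.IH show ?case
  proof
    assume "\<gamma> = \<alpha>"
    then show ?thesis using son.hyps(2) nodes.root[of \<beta> S] by auto
  next
    assume "\<exists>\<gamma>'\<in>S \<alpha>. \<gamma> \<in> nodes \<gamma>' S"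
    then obtain \<gamma>' where "\<gamma>' \<in> S \<alpha>" "\<gamma> \<in> nodes \<gamma>' S" by (rule bexE)
    then show ?thesis using nodes.son[OF \<open>\<gamma> \<in> nodes \<gamma>' S\<close> son.hyps(2)] by auto
  qed
qed simp

text \<open>Induction down to \<open>\<alpha>\<close>. A node below a father is the father itself,
  or it lies below one of the sons; the other sons are disjoint from it.\<close>

lemma nodes_laminar':
  assumes "\<alpha> \<in> nodes D S" "\<beta> \<in> nodes D S"
  shows "\<beta> \<in> nodes \<alpha> S \<or> \<alpha> \<in> nodes \<beta> S \<or> \<alpha> \<inter> \<beta> = {}"
  using assms(1)
proof (induction rule: nodes.induct)
  case root
  then show ?case using assms(2) by simp
next
  case (son \<alpha> \<alpha>')
  from son.IH consider "\<beta> \<in> nodes \<alpha> S" | "\<alpha> \<in> nodes \<beta> S" | "\<alpha> \<inter> \<beta> = {}" by blast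
  then show ?case
  proof cases
    case 1
    from nodes_cases_son[OF 1] show ?thesis
    proof
      assume "\<beta> = \<alpha>"
      have "\<alpha> \<in> nodes \<alpha> S" by (rule nodes.root)
      then have "\<alpha>' \<in> nodes \<alpha> S" using son.hyps(2) by (rule nodes.son)
      then show ?thesis unfolding \<open>\<beta> = \<alpha>\<close> by simp
    next
      assume "\<exists>\<gamma>\<in>S \<alpha>. \<beta> \<in> nodes \<gamma> S"
      then obtain \<gamma> where g: "\<gamma> \<in> S \<alpha>" "\<beta> \<in> nodes \<gamma> S" by blast
      have "\<beta> \<subseteq> \<gamma>" using subnodes[OF g(2) sonD(1)[OF son.hyps(1) g(1)]] by simp
      then show ?thesis using sons_disjoint[OF son.hyps g(1)] g(2) by blast
    qed
  next
    case 2
    from nodes.son[OF 2 son.hyps(2)] show ?thesis by simp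
  next
    case 3
    then show ?thesis using sonD(2)[OF son.hyps] by blast
  qed
qed

lemma nodes_laminar:
  assumes "\<alpha> \<in> nodes D S" "\<beta> \<in> nodes D S" "card \<beta> \<le> card \<alpha>" "\<alpha> \<noteq> \<beta>"
  shows "\<beta> \<subset> \<alpha> \<or> \<beta> \<inter> \<alpha> = {}"
proof -
  have "\<beta> \<subseteq> \<alpha> \<or> \<alpha> \<subseteq> \<beta> \<or> \<alpha> \<inter> \<beta> = {}"
    using nodes_laminar'[OF assms(1,2)] subnodes[OF _ assms(1), of \<beta>] subnodes[OF _ assms(2), of \<alpha>] by argo
  moreover have "\<not> \<alpha> \<subseteq> \<beta>"
    using card_seteq[OF node_finite[OF assms(2)] _ assms(3)] assms(4) by auto
  ultimately show ?thesis using assms(4) by auto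
qed

text \<open>Nodes with the same minimum intersect and are nested by laminarity; if they also have
  the same size, they are equal. A quadratic bound is good enough for a constant that is polynomial
  in d.\<close>

lemma card_nodes_le: "card (nodes D S) \<le> card D ^ 2"
proof -
  have "inj_on (\<lambda>\<alpha>. (Min \<alpha>, card \<alpha>)) (nodes D S)"
  proof (rule inj_onI, rule ccontr)
    fix \<alpha> \<beta> assume a: "\<alpha> \<in> nodes D S" "\<beta> \<in> nodes D S" "(Min \<alpha>, card \<alpha>) = (Min \<beta>, card \<beta>)" "\<alpha> \<noteq> \<beta>"
    have "Min \<alpha> \<in> \<alpha>" "Min \<beta> \<in> \<beta>" by (rule Min_in[OF node_finite[OF a(1)] nodeD(1)[OF a(1)]], rule Min_in[OF node_finite[OF a(2)] nodeD(1)[OF a(2)]])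
    moreover have "Min \<alpha> = Min \<beta>" "card \<alpha> = card \<beta>" using a(3) by simp_all
    ultimately have "\<beta> \<subset> \<alpha>" using nodes_laminar[OF a(1,2) _ a(4)] by auto
    then show False using psubset_card_mono[OF node_finite[OF a(1)], of \<beta>] a(3) by simp
  qed
  moreover have "(\<lambda>\<alpha>. (Min \<alpha>, card \<alpha>)) ` nodes D S \<subseteq> D \<times> {1..card D}"
  proof (rule image_subsetI)
    fix \<alpha> assume a: "\<alpha> \<in> nodes D S"
    have "Min \<alpha> \<in> \<alpha>" by (rule Min_in[OF node_finite[OF a] nodeD(1)[OF a]])
    moreover have "card \<alpha> \<le> card D" using nodeD(2)[OF a] finite_D by (rule card_mono[rotated])
    moreover have "card \<alpha> \<noteq> 0" using nodeD(1)[OF a] node_finite[OF a] by simp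
    ultimately show "(Min \<alpha>, card \<alpha>) \<in> D \<times> {1..card D}" using nodeD(2)[OF a] by auto
  qed
  ultimately have "card (nodes D S) \<le> card (D \<times> {1..card D})"
    using finite_D by (intro card_inj_on_le) auto
  then show ?thesis by (simp add: power2_eq_square card_cartesian_product)
qed

text \<open>A smallest node containing \<nu> has no sons, as one of them would be a smaller node
  containing \<nu>.\<close>

lemma singleton_node:
  assumes "\<nu> \<in> D"
  shows "{\<nu>} \<in> nodes D S"
proof -
  let ?P = "\<lambda>\<alpha>. \<alpha> \<in> nodes D S \<and> \<nu> \<in> \<alpha>"
  define \<alpha> where "\<alpha> = arg_min card ?P"
  have "?P D" using assms nodes.root by auto
  then have a: "?P \<alpha>" and m: "\<And>\<beta>. ?P \<beta> \<Longrightarrow> card \<alpha> \<le> card \<beta>"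
    unfolding \<alpha>_def using arg_min_natI[of ?P D card] arg_min_nat_le[of ?P _ card] by blast+
  have "S \<alpha> = {}"
  proof (rule ccontr)
    assume "S \<alpha> \<noteq> {}"
    then obtain \<beta> where b: "\<beta> \<in> S \<alpha>" "\<nu> \<in> \<beta>" using sons_Union a by blast
    then show False using sonD(1,4)[of \<alpha> \<beta>] a m[of \<beta>] by auto
  qed
  then have "is_singleton \<alpha>" using nodeD(3) a by blast
  then show ?thesis using a by (auto simp: is_singleton_def)
qed

lemma sons_D_nonempty: "S D \<noteq> {}"
proof
  assume "S D = {}"
  then have "is_singleton D" using nodeD(3)[OF nodes.root] by simp
  then show False using card_D by (auto simp: is_singleton_def)
qed

lemma node_reach:
  assumes "\<alpha> \<in> nodes D S"
  shows "(D, \<alpha>) \<in> {(\<gamma>, \<beta>). \<beta> \<in> S \<gamma>} ^^ node_level D S \<alpha>" "node_level D S \<alpha> \<le> depth D S"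
proof -
  have "\<exists>k. (D, \<alpha>) \<in> {(\<gamma>, \<beta>). \<beta> \<in> S \<gamma>} ^^ k"
    using assms
  proof (induction rule: nodes.induct)
    case root
    show ?case by (rule exI[of _ 0]) simp
  next
    case (son \<alpha> \<beta>)
    then obtain k where "(D, \<alpha>) \<in> {(\<gamma>, \<beta>). \<beta> \<in> S \<gamma>} ^^ k" by blast
    then show ?case using son.hyps by (intro exI[of _ "Suc k"]) auto
  qed
  then show "(D, \<alpha>) \<in> {(\<gamma>, \<beta>). \<beta> \<in> S \<gamma>} ^^ node_level D S \<alpha>"
    unfolding node_level_def by (rule LeastI_ex)
  show "node_level D S \<alpha> \<le> depth D S"
    unfolding depth_def using assms finite_nodes by (intro Max_ge) auto
qed

lemma reach_node: "(D, \<alpha>) \<in> {(\<gamma>, \<beta>). \<beta> \<in> S \<gamma>} ^^ k \<Longrightarrow> \<alpha> \<in> nodes D S"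
  by (induction k arbitrary: \<alpha>) (auto intro: nodes.intros)

lemma card_sons_le_arity: "\<alpha> \<in> interior_nodes D S \<Longrightarrow> card (S \<alpha>) \<le> arity D S"
  unfolding arity_def using finite_nodes by (intro Max_ge) (auto simp: interior_nodes_def)

lemma arity_ge_2: "2 \<le> arity D S"
  using card_sons_le_arity[of D] nodeD(5)[OF nodes.root] sons_D_nonempty
  by (auto simp: interior_nodes_def nodes.root)

lemma depth_ge_1: "1 \<le> depth D S"
proof -
  obtain \<beta> where b: "\<beta> \<in> S D" using sons_D_nonempty by blast
  then have "\<beta> \<in> nodes D S" "\<beta> \<noteq> D" using sonD[OF nodes.root] by auto
  then have "node_level D S \<beta> \<noteq> 0" using node_reach(1)[of \<beta>] by (cases "node_level D S \<beta>") auto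
  then show ?thesis using node_reach(2)[OF \<open>\<beta> \<in> nodes D S\<close>] by simp
qed

end

text \<open>The variables in \<open>\<alpha>\<close> are taken from \<open>y\<close>, all others from \<open>x\<close>.\<close>

definition mg :: "nat set \<Rightarrow> (nat \<Rightarrow> real) \<Rightarrow> (nat \<Rightarrow> real) \<Rightarrow> nat \<Rightarrow> real" where
  "mg \<alpha> y x = (\<lambda>\<nu>. if \<nu> \<in> \<alpha> then y \<nu> else x \<nu>)"

lemma mg_cuboid: "x \<in> cuboid D lo hi \<Longrightarrow> y \<in> cuboid D lo hi \<Longrightarrow> mg \<alpha> y x \<in> cuboid D lo hi"
  by (auto simp: cuboid_def mg_def PiE_def Pi_def extensional_def)

lemma restrict_mg_subset: "\<beta> \<subseteq> \<alpha> \<Longrightarrow> restrict (mg \<alpha> y x) \<beta> = restrict y \<beta>"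
  by (auto simp: mg_def restrict_def fun_eq_iff)

lemma restrict_mg_disjoint: "\<beta> \<inter> \<alpha> = {} \<Longrightarrow> restrict (mg \<alpha> y x) \<beta> = restrict x \<beta>"
  by (auto simp: mg_def restrict_def fun_eq_iff)

lemma mg_mg_subset: "\<beta> \<subseteq> \<alpha> \<Longrightarrow> mg \<alpha> (mg \<beta> y x) x = mg \<beta> y x"
  by (auto simp: mg_def fun_eq_iff)

lemma mg_mg: "mg \<alpha> z (mg \<alpha> y x) = mg \<alpha> z x"
  by (auto simp: mg_def fun_eq_iff)

lemma AE_esssup_le:
  assumes "Lp_norm \<infinity> M g \<le> ereal c"
  shows "AE x in M. \<bar>g x\<bar> \<le> c"
  using esssup_AE[of "\<lambda>x. ereal \<bar>g x\<bar>" M]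
proof eventually_elim
  case (elim x)
  also have "esssup M (\<lambda>x. ereal \<bar>g x\<bar>) \<le> ereal c" using assms by (simp add: Lp_norm_def)
  finally show ?case by simp
qed

text \<open>Fixes the witnesses that \<open>tree_class\<close> asserts to exist, together with the
  inner functions \<open>g\<close>, so that all later statements refer to the same
  composition.\<close>

locale tree_fun = dim_tree +
  fixes lo hi :: "nat \<Rightarrow> real" and \<Lambda> :: real and s :: nat and B :: "nat \<Rightarrow> real"
    and ilo ihi :: "nat set \<Rightarrow> real" and fs :: "nat set \<Rightarrow> (nat set \<Rightarrow> real) \<Rightarrow> real"
    and f :: "(nat \<Rightarrow> real) \<Rightarrow> real" and g :: "nat set \<Rightarrow> (nat \<Rightarrow> real) \<Rightarrow> real"
  assumes s: "1 \<le> s" and B: "\<forall>j\<in>{1..s}. 1 \<le> B j"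
    and leaf: "\<And>\<nu>. \<nu> \<in> D \<Longrightarrow> ilo {\<nu>} = lo \<nu> \<and> ihi {\<nu>} = hi \<nu>"
    and len: "\<And>\<alpha>. \<alpha> \<in> nodes D S \<Longrightarrow> \<alpha> \<noteq> D \<Longrightarrow> ilo \<alpha> < ihi \<alpha> \<and> ihi \<alpha> - ilo \<alpha> \<le> \<Lambda>"
    and fs_range: "\<And>\<alpha>. \<alpha> \<in> interior_nodes D S \<Longrightarrow> \<alpha> \<noteq> D \<Longrightarrow> fs \<alpha> ` cuboid (S \<alpha>) ilo ihi \<subseteq> {ilo \<alpha>..ihi \<alpha>}"
    and g_leaf: "\<And>\<nu> x. \<nu> \<in> D \<Longrightarrow> x \<in> cuboid {\<nu>} lo hi \<Longrightarrow> g {\<nu>} x = x \<nu>"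
    and g_int: "\<And>\<alpha> x. \<alpha> \<in> interior_nodes D S \<Longrightarrow> \<alpha> \<noteq> D \<Longrightarrow> x \<in> cuboid \<alpha> lo hi \<Longrightarrow>
       g \<alpha> x = fs \<alpha> (\<lambda>\<beta>\<in>S \<alpha>. g \<beta> (restrict x \<beta>))"
    and f_eq: "\<And>x. x \<in> cuboid D lo hi \<Longrightarrow> f x = fs D (\<lambda>\<beta>\<in>S D. g \<beta> (restrict x \<beta>))"
    and fs_cont: "\<And>\<alpha>. \<alpha> \<in> interior_nodes D S \<Longrightarrow> continuous_on (cuboid (S \<alpha>) ilo ihi) (fs \<alpha>)"
    and fs_sob: "\<And>\<alpha>. \<alpha> \<in> interior_nodes D S \<Longrightarrow> fs \<alpha> \<in> sobolev (S \<alpha>) ilo ihi s \<infinity>"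
    and W: "W_inf_norm (S D) ilo ihi s (fs D) \<le> 1"
    and Bnd: "\<And>\<alpha> k. \<alpha> \<in> interior_nodes D S \<Longrightarrow> \<alpha> \<noteq> D \<Longrightarrow> k \<in> multi_indices (S \<alpha>) s \<Longrightarrow> 1 \<le> sum k (S \<alpha>) \<Longrightarrow>
        Lp_norm \<infinity> (unif_cuboid (S \<alpha>) ilo ihi) (Dk (S \<alpha>) ilo ihi k (fs \<alpha>)) \<le> ereal (B (sum k (S \<alpha>)))"
begin

section \<open>Ranges, continuity and measurability of the inner functions\<close>

abbreviation X :: "(nat \<Rightarrow> real) set" where "X \<equiv> cuboid D lo hi"

lemma lo_less_hi: "\<nu> \<in> D \<Longrightarrow> lo \<nu> < hi \<nu> \<and> hi \<nu> - lo \<nu> \<le> \<Lambda>"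
proof -
  assume a: "\<nu> \<in> D"
  have "{\<nu>} \<noteq> D" using card_D by auto
  then show ?thesis using len[OF singleton_node[OF a]] leaf[OF a] by simp
qed

lemma restrict_cuboid: "x \<in> X \<Longrightarrow> \<alpha> \<subseteq> D \<Longrightarrow> restrict x \<alpha> \<in> cuboid \<alpha> lo hi"
  by (auto simp: cuboid_def PiE_def Pi_def)

lemma D_interior: "D \<in> interior_nodes D S"
  using sons_D_nonempty nodes.root by (auto simp: interior_nodes_def)

lemma g_leaf': "{\<nu>} \<in> nodes D S \<Longrightarrow> x \<in> X \<Longrightarrow> g {\<nu>} (restrict x {\<nu>}) = x \<nu>"
  using g_leaf[of \<nu> "restrict x {\<nu>}"] restrict_cuboid[of x "{\<nu>}"] nodeD(2)[of "{\<nu>}"] by auto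

lemma g_int':
  assumes "\<alpha> \<in> interior_nodes D S" "\<alpha> \<noteq> D" "x \<in> X"
  shows "g \<alpha> (restrict x \<alpha>) = fs \<alpha> (\<lambda>\<beta>\<in>S \<alpha>. g \<beta> (restrict x \<beta>))"
proof -
  have a: "\<alpha> \<in> nodes D S" using assms by (simp add: interior_nodes_def)
  have "(\<lambda>\<beta>\<in>S \<alpha>. g \<beta> (restrict (restrict x \<alpha>) \<beta>)) = (\<lambda>\<beta>\<in>S \<alpha>. g \<beta> (restrict x \<beta>))"
  proof (rule restrict_ext)
    fix \<beta> assume "\<beta> \<in> S \<alpha>"
    then have "\<alpha> \<inter> \<beta> = \<beta>" using sonD(2)[OF a] by blast
    then show "g \<beta> (restrict (restrict x \<alpha>) \<beta>) = g \<beta> (restrict x \<beta>)"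
      by (simp add: restrict_restrict)
  qed
  then show ?thesis
    using g_int[OF assms(1,2) restrict_cuboid[OF assms(3) nodeD(2)[OF a]]] by simp
qed

lemma node_induct [consumes 2, case_names leaf int]:
  assumes "\<alpha> \<in> nodes D S" "\<alpha> \<noteq> D"
    and "\<And>\<nu>. {\<nu>} \<in> nodes D S \<Longrightarrow> P {\<nu>}"
    and "\<And>\<alpha>. \<alpha> \<in> interior_nodes D S \<Longrightarrow> \<alpha> \<noteq> D \<Longrightarrow> (\<And>\<beta>. \<beta> \<in> S \<alpha> \<Longrightarrow> P \<beta>) \<Longrightarrow> P \<alpha>"
  shows "P \<alpha>"
  using assms(1,2)
proof (induction "card \<alpha>" arbitrary: \<alpha> rule: less_induct)
  case less
  show ?case
  proof (cases "S \<alpha> = {}")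
    case True
    then have "is_singleton \<alpha>" using nodeD(3)[OF less.prems(1)] by simp
    then show ?thesis using assms(3) less.prems(1) by (auto simp: is_singleton_def)
  next
    case False
    then have "\<alpha> \<in> interior_nodes D S" using less.prems(1) by (simp add: interior_nodes_def)
    then show ?thesis using assms(4) less sonD[OF less.prems(1)] by blast
  qed
qed

lemma g_range:
  assumes "\<alpha> \<in> nodes D S" "\<alpha> \<noteq> D" "x \<in> X"
  shows "g \<alpha> (restrict x \<alpha>) \<in> {ilo \<alpha>..ihi \<alpha>}"
  using assms(1,2)
proof (induction rule: node_induct)
  case (leaf \<nu>)
  then have "\<nu> \<in> D" using nodeD(2) by blast
  then have "x \<nu> \<in> {lo \<nu>..hi \<nu>}" using assms(3) by (auto simp: cuboid_def)
  then show ?case unfolding g_leaf'[OF leaf assms(3)] using tree_fun.leaf[OF tree_fun_axioms \<open>\<nu> \<in> D\<close>] by simp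
next
  case (int \<alpha>)
  have "(\<lambda>\<beta>\<in>S \<alpha>. g \<beta> (restrict x \<beta>)) \<in> cuboid (S \<alpha>) ilo ihi"
    unfolding cuboid_def by (rule restrict_PiE_iff[THEN iffD2], rule ballI, rule int.IH)
  then show ?case unfolding g_int'[OF int.hyps assms(3)] using fs_range[OF int.hyps] by blast
qed

lemma sons_args_in_cuboid:
  assumes "\<alpha> \<in> interior_nodes D S" "x \<in> X"
  shows "(\<lambda>\<beta>\<in>S \<alpha>. g \<beta> (restrict x \<beta>)) \<in> cuboid (S \<alpha>) ilo ihi"
proof -
  have "\<alpha> \<in> nodes D S" using assms by (simp add: interior_nodes_def)
  then show ?thesis
    unfolding cuboid_def
    by (intro restrict_PiE_iff[THEN iffD2] ballI g_range[OF sonD(1) sonD(3) assms(2)])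
qed

lemma g_cont:
  assumes "\<alpha> \<in> nodes D S" "\<alpha> \<noteq> D"
  shows "continuous_on X (\<lambda>x. g \<alpha> (restrict x \<alpha>))"
  using assms
proof (induction rule: node_induct)
  case (leaf \<nu>)
  have "continuous_on X (\<lambda>x. x \<nu>)" by (rule continuous_on_subset[OF continuous_on_product_coordinates]) simp
  then show ?case by (subst continuous_on_cong[OF refl g_leaf'[OF leaf]])
next
  case (int \<alpha>)
  have "continuous_on X (\<lambda>x. \<lambda>\<beta>\<in>S \<alpha>. g \<beta> (restrict x \<beta>))"
  proof (rule continuous_on_coordinatewise_then_product)
    fix \<beta> show "continuous_on X (\<lambda>x. (\<lambda>\<beta>\<in>S \<alpha>. g \<beta> (restrict x \<beta>)) \<beta>)"
    proof (cases "\<beta> \<in> S \<alpha>")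
      case True
      have "(\<lambda>x. (\<lambda>\<beta>\<in>S \<alpha>. g \<beta> (restrict x \<beta>)) \<beta>) = (\<lambda>x. g \<beta> (restrict x \<beta>))"
        by (rule ext) (rule restrict_apply'[OF True])
      then show ?thesis using int.IH[OF True] by (simp only:)
    next
      case False
      have "(\<lambda>x. (\<lambda>\<beta>\<in>S \<alpha>. g \<beta> (restrict x \<beta>)) \<beta>) = (\<lambda>x. undefined)"
        by (rule ext) (simp only: restrict_apply False if_False)
      then show ?thesis by (simp only: continuous_on_const)
    qed
  qed
  then have "continuous_on X (\<lambda>x. fs \<alpha> (\<lambda>\<beta>\<in>S \<alpha>. g \<beta> (restrict x \<beta>)))"
    by (rule continuous_on_compose2[OF fs_cont[OF int.hyps(1)]]) (use sons_args_in_cuboid[OF int.hyps(1)] in auto)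
  then show ?case by (subst continuous_on_cong[OF refl g_int'[OF int.hyps]])
qed

lemma space_M: "space (unif_cuboid D lo hi) = X"
  by (simp add: unif_cuboid_def space_PiM cuboid_def)

lemma prob_space_M: "prob_space (unif_cuboid D lo hi)"
  unfolding unif_cuboid_def
proof -
  have "PiM D (\<lambda>i. unif (lo i) (hi i)) = PiM D (\<lambda>i. if i \<in> D then unif (lo i) (hi i) else unif 0 1)"
    by (rule PiM_cong) auto
  moreover have "prob_space (PiM D (\<lambda>i. if i \<in> D then unif (lo i) (hi i) else unif 0 1))"
    by (rule prob_space_PiM) (use prob_space_unif lo_less_hi in auto)
  ultimately show "prob_space (PiM D (\<lambda>i. unif (lo i) (hi i)))" by simp
qed

text \<open>The multi-index 0 of \<open>sobolev\<close> already contains integrability of the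
  function itself.\<close>

lemma fs_measurable:
  assumes "\<alpha> \<in> interior_nodes D S"
  shows "integrable (unif_cuboid (S \<alpha>) ilo ihi) (fs \<alpha>)"
proof -
  have "(\<lambda>_. 0) \<in> multi_indices (S \<alpha>) s" by (simp add: multi_indices_def)
  then obtain g where "weak_deriv (S \<alpha>) ilo ihi (\<lambda>_. 0) (fs \<alpha>) g"
    using fs_sob[OF assms] by (auto simp: sobolev_def)
  then show ?thesis unfolding weak_deriv_def by (elim conjE)
qed

text \<open>\<open>fs \<alpha>\<close> is measurable for the sigma-algebra of its own box; the
  ranges of the \<open>g \<beta>\<close> make the map of arguments measurable into that box.\<close>

lemma args_measurable:
  assumes a: "\<alpha> \<in> interior_nodes D S"
    and m: "\<And>\<beta>. \<beta> \<in> S \<alpha> \<Longrightarrow> (\<lambda>x. g \<beta> (restrict x \<beta>)) \<in> borel_measurable (unif_cuboid D lo hi)"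
  shows "(\<lambda>x. fs \<alpha> (\<lambda>\<beta>\<in>S \<alpha>. g \<beta> (restrict x \<beta>))) \<in> borel_measurable (unif_cuboid D lo hi)"
proof -
  have an: "\<alpha> \<in> nodes D S" using a by (simp add: interior_nodes_def)
  have "(\<lambda>x. g \<beta> (restrict x \<beta>)) \<in> measurable (unif_cuboid D lo hi) (unif (ilo \<beta>) (ihi \<beta>))" if "\<beta> \<in> S \<alpha>" for \<beta>
  proof -
    have "(\<lambda>x. g \<beta> (restrict x \<beta>)) \<in> measurable (unif_cuboid D lo hi) (restrict_space borel {ilo \<beta>..ihi \<beta>})"
      using m[OF that] g_range[OF sonD(1)[OF an that] sonD(3)[OF an that]]
      by (intro measurable_restrict_space2) (auto simp: space_M)
    then show ?thesis using measurable_cong_sets[OF refl sets_unif] by blast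
  qed
  then have "(\<lambda>x. \<lambda>\<beta>\<in>S \<alpha>. g \<beta> (restrict x \<beta>)) \<in> measurable (unif_cuboid D lo hi) (unif_cuboid (S \<alpha>) ilo ihi)"
    unfolding unif_cuboid_def[of "S \<alpha>"] by (intro measurable_restrict)
  from measurable_compose[OF this borel_measurable_integrable[OF fs_measurable[OF a]]] show ?thesis .
qed

lemma g_measurable:
  assumes "\<alpha> \<in> nodes D S" "\<alpha> \<noteq> D"
  shows "(\<lambda>x. g \<alpha> (restrict x \<alpha>)) \<in> borel_measurable (unif_cuboid D lo hi)"
  using assms
proof (induction rule: node_induct)
  case (leaf \<nu>)
  then have "\<nu> \<in> D" using nodeD(2) by blast
  then have "(\<lambda>x. x \<nu>) \<in> borel_measurable (unif_cuboid D lo hi)"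
    using measurable_compose[OF measurable_component_singleton[of \<nu> D "\<lambda>i. unif (lo i) (hi i)"],
      OF _ borel_measurable_unifI[OF measurable_ident_sets[OF refl]]]
    unfolding unif_cuboid_def by simp
  moreover have "g {\<nu>} (restrict x {\<nu>}) = x \<nu>" if "x \<in> space (unif_cuboid D lo hi)" for x
    using g_leaf'[OF leaf] that unfolding space_M .
  ultimately show ?case by (subst measurable_cong)
next
  case (int \<alpha>)
  have "g \<alpha> (restrict x \<alpha>) = fs \<alpha> (\<lambda>\<beta>\<in>S \<alpha>. g \<beta> (restrict x \<beta>))" if "x \<in> space (unif_cuboid D lo hi)" for x
    using g_int'[OF int.hyps] that unfolding space_M .
  then show ?case using args_measurable[OF int.hyps(1) int.IH] by (subst measurable_cong)
qed

lemma f_measurable: "f \<in> borel_measurable (unif_cuboid D lo hi)"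
proof -
  have "f x = fs D (\<lambda>\<beta>\<in>S D. g \<beta> (restrict x \<beta>))" if "x \<in> space (unif_cuboid D lo hi)" for x
    using f_eq that unfolding space_M .
  then show ?thesis
    using args_measurable[OF D_interior g_measurable[OF sonD(1,3)[OF nodes.root]]] by (subst measurable_cong)
qed

text \<open>Along a coordinate line only multi-indices concentrated at \<open>j\<close> occur.
  Membership in \<open>sobolev\<close> ensures that \<open>Dk\<close>, defined by choice, is a weak
  derivative.\<close>

lemma fs_slice:
  assumes a: "\<alpha> \<in> interior_nodes D S" and j: "j \<in> S \<alpha>" and x: "x \<in> cuboid (S \<alpha>) ilo ihi" and "\<delta> > 0"
    and Ks: "\<And>\<kappa>. \<kappa> \<in> Ks \<Longrightarrow> \<kappa> \<le> s \<and> Lp_norm \<infinity> (unif_cuboid (S \<alpha>) ilo ihi)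
       (Dk (S \<alpha>) ilo ihi (\<lambda>i. if i = j then \<kappa> else 0) (fs \<alpha>)) \<le> ereal (Bb \<kappa>)"
  shows "\<exists>h. smooth_real h \<and> (\<forall>t\<in>{ilo j..ihi j}. \<bar>h t - fs \<alpha> (x(j := t))\<bar> \<le> \<delta> \<and>
     (\<forall>a b. fs \<alpha> ` cuboid (S \<alpha>) ilo ihi \<subseteq> {a..b} \<longrightarrow> h t \<in> {a..b}) \<and> (\<forall>\<kappa>\<in>Ks. \<bar>(deriv ^^ \<kappa>) h t\<bar> \<le> Bb \<kappa>))"
proof (rule slice_approx[OF _ j _ fs_cont[OF a] fs_measurable[OF a] x \<open>\<delta> > 0\<close>])
  have an: "\<alpha> \<in> nodes D S" using a by (simp add: interior_nodes_def)
  show fin: "finite (S \<alpha>)" using sons_finite[OF an] .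
  show "ilo \<beta> < ihi \<beta>" if "\<beta> \<in> S \<alpha>" for \<beta>
    using len[OF sonD(1)[OF an that] sonD(3)[OF an that]] by simp
  fix \<kappa> assume k: "\<kappa> \<in> Ks"
  let ?k = "\<lambda>i. if i = j then \<kappa> else 0"
  have "?k \<in> multi_indices (S \<alpha>) s" using Ks[OF k] j fin by (auto simp: multi_indices_def)
  then have "\<exists>g. weak_deriv (S \<alpha>) ilo ihi ?k (fs \<alpha>) g" using fs_sob[OF a] by (auto simp: sobolev_def)
  from someI_ex[OF this] have "weak_deriv (S \<alpha>) ilo ihi ?k (fs \<alpha>) (Dk (S \<alpha>) ilo ihi ?k (fs \<alpha>))"
    unfolding Dk_def .
  moreover have "AE y in unif_cuboid (S \<alpha>) ilo ihi. \<bar>Dk (S \<alpha>) ilo ihi ?k (fs \<alpha>) y\<bar> \<le> Bb \<kappa>"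
    by (rule AE_esssup_le) (use Ks[OF k] in simp)
  ultimately show "\<exists>G. weak_deriv (S \<alpha>) ilo ihi ?k (fs \<alpha>) G \<and> (AE y in unif_cuboid (S \<alpha>) ilo ihi. \<bar>G y\<bar> \<le> Bb \<kappa>)"
    by (intro exI conjI)
qed

lemma root_slice:
  assumes j: "j \<in> S D" and x: "x \<in> cuboid (S D) ilo ihi"
  shows "apx s (\<lambda>_. 1) (ilo j) (ihi j) (\<lambda>t. fs D (x(j := t)))"
  unfolding apx_def
proof (intro allI impI)
  fix \<delta> :: real assume "\<delta> > 0"
  have fin: "finite (S D)" using sons_finite[OF nodes.root] .
  have "\<exists>h. smooth_real h \<and> (\<forall>t\<in>{ilo j..ihi j}. \<bar>h t - fs D (x(j := t))\<bar> \<le> \<delta> \<and>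
     (\<forall>a b. fs D ` cuboid (S D) ilo ihi \<subseteq> {a..b} \<longrightarrow> h t \<in> {a..b}) \<and> (\<forall>\<kappa>\<in>{..s}. \<bar>(deriv ^^ \<kappa>) h t\<bar> \<le> 1))"
  proof (rule fs_slice[OF D_interior j x \<open>\<delta> > 0\<close>, where Bb = "\<lambda>_. 1"])
    fix \<kappa> assume "\<kappa> \<in> {..s}"
    let ?k = "\<lambda>i. if i = j then \<kappa> else 0"
    have "?k \<in> multi_indices (S D) s" using \<open>\<kappa> \<in> {..s}\<close> j fin by (auto simp: multi_indices_def)
    then have "Lp_norm \<infinity> (unif_cuboid (S D) ilo ihi) (Dk (S D) ilo ihi ?k (fs D)) \<le> W_inf_norm (S D) ilo ihi s (fs D)"
      unfolding W_inf_norm_def by (rule SUP_upper)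
    then show "\<kappa> \<le> s \<and> Lp_norm \<infinity> (unif_cuboid (S D) ilo ihi) (Dk (S D) ilo ihi ?k (fs D)) \<le> ereal 1"
      using W \<open>\<kappa> \<in> {..s}\<close> by (auto simp: one_ereal_def)
  qed
  then obtain h where h: "smooth_real h \<and> (\<forall>t\<in>{ilo j..ihi j}. \<bar>h t - fs D (x(j := t))\<bar> \<le> \<delta> \<and>
     (\<forall>a b. fs D ` cuboid (S D) ilo ihi \<subseteq> {a..b} \<longrightarrow> h t \<in> {a..b}) \<and> (\<forall>\<kappa>\<in>{..s}. \<bar>(deriv ^^ \<kappa>) h t\<bar> \<le> 1))" ..
  then show "\<exists>h. smooth_real h \<and> (\<forall>t\<in>{ilo j..ihi j}. \<bar>h t - fs D (x(j := t))\<bar> \<le> \<delta> \<and> (\<forall>k\<le>s. \<bar>(deriv ^^ k) h t\<bar> \<le> 1))"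
    by (intro exI[of _ h]) simp
qed

lemma B_star_ge: "1 \<le> B_star s B" "k \<in> {2..s} \<Longrightarrow> B k \<le> B_star s B"
proof -
  have "B 1 \<le> Max (B ` {1..s})" using s by (intro Max_ge) auto
  moreover have "1 \<le> B 1" using B s by auto
  ultimately show "1 \<le> B_star s B" by (simp add: B_star_def)
  show "k \<in> {2..s} \<Longrightarrow> B k \<le> B_star s B" by (auto simp: B_star_def intro!: Max_ge)
qed

text \<open>The value bound is replaced by the range of \<open>fs \<alpha>\<close>, which the
  mollified slice inherits; the orders from 2 on are merged into \<open>B_star\<close>.\<close>

lemma inner_slice:
  assumes a: "\<alpha> \<in> interior_nodes D S" "\<alpha> \<noteq> D" and j: "j \<in> S \<alpha>" and x: "x \<in> cuboid (S \<alpha>) ilo ihi"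
  shows "inner_apx s (B 1) (B_star s B) (ilo j) (ihi j) (ilo \<alpha>) (ihi \<alpha>) (\<lambda>t. fs \<alpha> (x(j := t)))"
  unfolding inner_apx_def
proof (intro allI impI)
  fix \<delta> :: real assume "\<delta> > 0"
  have an: "\<alpha> \<in> nodes D S" using a by (simp add: interior_nodes_def)
  have fin: "finite (S \<alpha>)" using sons_finite[OF an] .
  have "\<exists>h. smooth_real h \<and> (\<forall>t\<in>{ilo j..ihi j}. \<bar>h t - fs \<alpha> (x(j := t))\<bar> \<le> \<delta> \<and>
     (\<forall>a b. fs \<alpha> ` cuboid (S \<alpha>) ilo ihi \<subseteq> {a..b} \<longrightarrow> h t \<in> {a..b}) \<and> (\<forall>\<kappa>\<in>{1..s}. \<bar>(deriv ^^ \<kappa>) h t\<bar> \<le> B \<kappa>))"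
  proof (rule fs_slice[OF a(1) j x \<open>\<delta> > 0\<close>])
    fix \<kappa> assume k: "\<kappa> \<in> {1..s}"
    let ?k = "\<lambda>i. if i = j then \<kappa> else 0"
    have "sum ?k (S \<alpha>) = \<kappa>" using j fin by simp
    moreover have "?k \<in> multi_indices (S \<alpha>) s" using k j fin by (auto simp: multi_indices_def)
    ultimately show "\<kappa> \<le> s \<and> Lp_norm \<infinity> (unif_cuboid (S \<alpha>) ilo ihi) (Dk (S \<alpha>) ilo ihi ?k (fs \<alpha>)) \<le> ereal (B \<kappa>)"
      using Bnd[OF a, of ?k] k by simp
  qed
  then obtain h where h: "smooth_real h \<and> (\<forall>t\<in>{ilo j..ihi j}. \<bar>h t - fs \<alpha> (x(j := t))\<bar> \<le> \<delta> \<and>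
     (\<forall>a b. fs \<alpha> ` cuboid (S \<alpha>) ilo ihi \<subseteq> {a..b} \<longrightarrow> h t \<in> {a..b}) \<and> (\<forall>\<kappa>\<in>{1..s}. \<bar>(deriv ^^ \<kappa>) h t\<bar> \<le> B \<kappa>))" ..
  have all: "\<bar>h t - fs \<alpha> (x(j := t))\<bar> \<le> \<delta> \<and> h t \<in> {ilo \<alpha>..ihi \<alpha>} \<and> \<bar>deriv h t\<bar> \<le> B 1 \<and>
     (\<forall>k\<in>{2..s}. \<bar>(deriv ^^ k) h t\<bar> \<le> B_star s B)" if t: "t \<in> {ilo j..ihi j}" for t
  proof (intro conjI ballI)
    note ht = h[THEN conjunct2, THEN bspec, OF t]
    show "\<bar>h t - fs \<alpha> (x(j := t))\<bar> \<le> \<delta>" by (rule ht[THEN conjunct1])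
    show "h t \<in> {ilo \<alpha>..ihi \<alpha>}"
      by (rule ht[THEN conjunct2, THEN conjunct1, THEN spec, THEN spec, THEN mp]) (rule fs_range[OF a])
    note d = ht[THEN conjunct2, THEN conjunct2, THEN bspec]
    show "\<bar>deriv h t\<bar> \<le> B 1" using d[of 1] s by simp
    fix k assume k: "k \<in> {2..s}"
    show "\<bar>(deriv ^^ k) h t\<bar> \<le> B_star s B"
      by (rule order_trans[OF d B_star_ge(2)[OF k]]) (use k in auto)
  qed
  show "\<exists>h. smooth_real h \<and> (\<forall>t\<in>{ilo j..ihi j}. \<bar>h t - fs \<alpha> (x(j := t))\<bar> \<le> \<delta> \<and> h t \<in> {ilo \<alpha>..ihi \<alpha>} \<and> \<bar>deriv h t\<bar> \<le> B 1 \<and>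
     (\<forall>k\<in>{2..s}. \<bar>(deriv ^^ k) h t\<bar> \<le> B_star s B))"
    by (rule exI[of _ h], rule conjI, rule h[THEN conjunct1], rule ballI, rule all)
qed

text \<open>The order 0 of the norm bound at the root. It is what makes the zero tensor sufficient
  for large tolerances.\<close>

lemma f_bounded:
  assumes "x \<in> X"
  shows "\<bar>f x\<bar> \<le> 1"
proof -
  let ?z = "\<lambda>\<beta>\<in>S D. g \<beta> (restrict x \<beta>)"
  obtain j where j: "j \<in> S D" using sons_D_nonempty by blast
  have z: "?z \<in> cuboid (S D) ilo ihi" by (rule sons_args_in_cuboid[OF D_interior assms])
  have t: "?z j \<in> {ilo j..ihi j}" using z j by (auto simp: cuboid_def)
  have zz: "?z(j := ?z j) = ?z" by (rule fun_upd_triv)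
  have "\<bar>fs D ?z\<bar> \<le> 1 + e" if e: "e > 0" for e
  proof -
    from apxD[OF root_slice[OF j z] e] obtain h where h: "smooth_real h \<and> 
      (\<forall>t\<in>{ilo j..ihi j}. \<bar>h t - fs D (?z(j := t))\<bar> \<le> e \<and> (\<forall>k\<le>s. \<bar>(deriv ^^ k) h t\<bar> \<le> 1))" ..
    note ht = h[THEN conjunct2, THEN bspec, OF t]
    have "\<bar>h (?z j) - fs D ?z\<bar> \<le> e" using ht[THEN conjunct1] unfolding zz .
    moreover have "\<bar>h (?z j)\<bar> \<le> 1" using ht[THEN conjunct2, THEN spec, of 0] by simp
    ultimately show ?thesis by linarith
  qed
  then have "\<bar>fs D ?z\<bar> \<le> 1" by (rule field_le_epsilon)
  then show ?thesis using f_eq[OF assms] by simp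
qed

text \<open>Sons are disjoint, so exchanging the variables in \<open>\<beta>\<close> changes a
  single argument of \<open>fs \<alpha>\<close>.\<close>

lemma upd_args:
  assumes an: "\<alpha> \<in> nodes D S" and b: "\<beta> \<in> S \<alpha>"
  shows "(\<lambda>\<gamma>\<in>S \<alpha>. g \<gamma> (restrict (mg \<beta> y x) \<gamma>)) = (\<lambda>\<gamma>\<in>S \<alpha>. g \<gamma> (restrict x \<gamma>))(\<beta> := g \<beta> (restrict y \<beta>))"
proof
  fix \<gamma>
  show "(\<lambda>\<gamma>\<in>S \<alpha>. g \<gamma> (restrict (mg \<beta> y x) \<gamma>)) \<gamma> = ((\<lambda>\<gamma>\<in>S \<alpha>. g \<gamma> (restrict x \<gamma>))(\<beta> := g \<beta> (restrict y \<beta>))) \<gamma>"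
    using b sons_disjoint[OF an, of \<gamma> \<beta>]
    by (cases "\<gamma> = \<beta>"; cases "\<gamma> \<in> S \<alpha>") (simp_all add: restrict_mg_subset restrict_mg_disjoint)
qed

text \<open>Induction on the level: the slice at a node is the slice at its father composed with a
  coordinate slice of the father's function. A path with m + 1 edges has m inner functions. The
  composition property of \<open>C\<close> is an assumption, so that the constant can be chosen
  before the tree.\<close>

lemma path_slice:
  assumes C: "C \<ge> 1" "\<And>m b b' c d a0 a1 H u. 1 \<le> b \<Longrightarrow> 1 \<le> b' \<Longrightarrow> apx s (chain_bound C b b' m) c d H \<Longrightarrow>
     inner_apx s b b' a0 a1 c d u \<Longrightarrow> u ` {a0..a1} \<subseteq> {c..d} \<Longrightarrow> 1 \<le> s \<Longrightarrow>
     apx s (chain_bound C b b' (Suc m)) a0 a1 (\<lambda>t. H (u t))"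
    and "(D, \<alpha>) \<in> {(\<gamma>, \<beta>). \<beta> \<in> S \<gamma>} ^^ Suc m" and x: "x \<in> X"
  shows "\<exists>G. (\<forall>y\<in>X. f (mg \<alpha> y x) = G (g \<alpha> (restrict y \<alpha>))) \<and>
     apx s (chain_bound C (B 1) (B_star s B) m) (ilo \<alpha>) (ihi \<alpha>) G"
  using assms(3)
proof (induction m arbitrary: \<alpha>)
  case 0
  then have a: "\<alpha> \<in> S D" by auto
  let ?z = "\<lambda>\<beta>\<in>S D. g \<beta> (restrict x \<beta>)"
  have B1: "1 \<le> B 1" using B s by auto
  have "apx s (chain_bound C (B 1) (B_star s B) 0) (ilo \<alpha>) (ihi \<alpha>) (\<lambda>t. fs D (?z(\<alpha> := t)))"
    by (rule apx_mono[OF root_slice[OF a sons_args_in_cuboid[OF D_interior x]]])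
       (use chain_bound_ge_1[OF C(1) B1 B_star_ge(1)] in auto)
  moreover have "f (mg \<alpha> y x) = fs D (?z(\<alpha> := g \<alpha> (restrict y \<alpha>)))" if y: "y \<in> X" for y
    using f_eq[OF mg_cuboid[OF x y, of \<alpha>]] unfolding upd_args[OF nodes.root a] .
  ultimately show ?case by (intro exI[of _ "\<lambda>t. fs D (?z(\<alpha> := t))"]) blast
next
  case (Suc m)
  then obtain \<gamma> where \<gamma>: "(D, \<gamma>) \<in> {(\<gamma>, \<beta>). \<beta> \<in> S \<gamma>} ^^ Suc m" "\<alpha> \<in> S \<gamma>" by auto
  then obtain \<gamma>' where "\<gamma> \<in> S \<gamma>'" "\<gamma>' \<in> nodes D S" using reach_node by auto
  then have \<gamma>n: "\<gamma> \<in> nodes D S" "\<gamma> \<noteq> D" using sonD by auto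
  then have \<gamma>i: "\<gamma> \<in> interior_nodes D S" using \<gamma>(2) by (auto simp: interior_nodes_def)
  from Suc.IH[OF \<gamma>(1)] obtain G where G: "(\<forall>y\<in>X. f (mg \<gamma> y x) = G (g \<gamma> (restrict y \<gamma>))) \<and>
     apx s (chain_bound C (B 1) (B_star s B) m) (ilo \<gamma>) (ihi \<gamma>) G" ..
  let ?z = "\<lambda>\<beta>\<in>S \<gamma>. g \<beta> (restrict x \<beta>)"
  let ?u = "\<lambda>t. fs \<gamma> (?z(\<alpha> := t))"
  have z: "?z \<in> cuboid (S \<gamma>) ilo ihi" by (rule sons_args_in_cuboid[OF \<gamma>i x])
  have B1: "1 \<le> B 1" using B s by auto
  have "apx s (chain_bound C (B 1) (B_star s B) (Suc m)) (ilo \<alpha>) (ihi \<alpha>) (\<lambda>t. G (?u t))"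
  proof (rule C(2)[OF B1 B_star_ge(1) G[THEN conjunct2] inner_slice[OF \<gamma>i \<gamma>n(2) \<gamma>(2) z] _ s])
    show "?u ` {ilo \<alpha>..ihi \<alpha>} \<subseteq> {ilo \<gamma>..ihi \<gamma>}"
    proof (rule image_subsetI)
      fix t assume "t \<in> {ilo \<alpha>..ihi \<alpha>}"
      then have "?z(\<alpha> := t) \<in> cuboid (S \<gamma>) ilo ihi"
        using z \<gamma>(2) unfolding cuboid_def by (auto simp: PiE_def Pi_def extensional_def)
      then show "?u t \<in> {ilo \<gamma>..ihi \<gamma>}" using fs_range[OF \<gamma>i \<gamma>n(2)] by blast
    qed
  qed
  moreover have "f (mg \<alpha> y x) = G (?u (g \<alpha> (restrict y \<alpha>)))" if y: "y \<in> X" for y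
  proof -
    have yx: "mg \<alpha> y x \<in> X" by (rule mg_cuboid[OF x y])
    have "\<alpha> \<subseteq> \<gamma>" using sonD(2)[OF \<gamma>n(1) \<gamma>(2)] by blast
    then have "f (mg \<alpha> y x) = f (mg \<gamma> (mg \<alpha> y x) x)" by (simp add: mg_mg_subset)
    also have "\<dots> = G (g \<gamma> (restrict (mg \<alpha> y x) \<gamma>))" by (rule G[THEN conjunct1, THEN bspec, OF yx])
    also have "g \<gamma> (restrict (mg \<alpha> y x) \<gamma>) = ?u (g \<alpha> (restrict y \<alpha>))"
      unfolding g_int'[OF \<gamma>i \<gamma>n(2) yx] upd_args[OF \<gamma>n(1) \<gamma>(2)] ..
    finally show ?thesis .
  qed
  ultimately show ?case by (intro exI[of _ "\<lambda>t. G (?u t)"]) blast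
qed

end

section \<open>Tree formats from linear operators\<close>

lemma span_sum_fun:
  fixes c :: "'i \<Rightarrow> real" and \<phi> :: "'i \<Rightarrow> 'a \<Rightarrow> real"
  assumes "\<And>k. k \<in> I \<Longrightarrow> \<phi> k \<in> fun_vs.span T"
  shows "(\<lambda>x. \<Sum>k\<in>I. c k * \<phi> k x) \<in> fun_vs.span T"
proof (cases "finite I")
  case True
  then show ?thesis using assms
  proof (induction I)
    case empty
    have "(\<lambda>x. \<Sum>k\<in>{}. c k * \<phi> k x) = 0" by (simp add: zero_fun_def)
    then show ?case using fun_vs.span_zero[of T] by (simp only:)
  next
    case (insert k I)
    have "(\<lambda>x. \<Sum>k\<in>insert k I. c k * \<phi> k x) = fscale (c k) (\<phi> k) + (\<lambda>x. \<Sum>k\<in>I. c k * \<phi> k x)"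
      using insert by (simp add: fscale_def plus_fun_def)
    moreover have "\<dots> \<in> fun_vs.span T"
      using insert by (intro fun_vs.span_add fun_vs.span_scale) auto
    ultimately show ?case by (simp only:)
  qed
next
  case False
  have "(\<lambda>x. \<Sum>k\<in>I. c k * \<phi> k x) = 0" using False by (simp add: zero_fun_def)
  then show ?thesis using fun_vs.span_zero[of T] by (simp only:)
qed

text \<open>The common interface of orthogonal projection and interpolation. \<open>W\<close>
  contains the admissible functions, \<open>Lam \<alpha> i\<close> is a functional applied to the
  slice in the variables of \<open>\<alpha>\<close>, \<open>e \<alpha> i\<close> are the
  corresponding basis functions, and \<open>small w c\<close> stands for a norm bound. Linearity is
  demanded only for slices of members of \<open>W\<close>, where the integrals exist. Lists serve as
  indices because every leaf contributes one more index to the terms of the tensor.\<close>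

locale approx_ops = dim_tree +
  fixes lo hi :: "nat \<Rightarrow> real" and W :: "((nat \<Rightarrow> real) \<Rightarrow> real) set" and R :: nat
    and e :: "nat set \<Rightarrow> nat \<Rightarrow> (nat \<Rightarrow> real) \<Rightarrow> real"
    and Lam :: "nat set \<Rightarrow> nat \<Rightarrow> ((nat \<Rightarrow> real) \<Rightarrow> real) \<Rightarrow> real"
    and small :: "((nat \<Rightarrow> real) \<Rightarrow> real) \<Rightarrow> real \<Rightarrow> bool"
    and V :: "nat \<Rightarrow> (real \<Rightarrow> real) set" and \<epsilon> :: "nat \<Rightarrow> nat \<Rightarrow> real \<Rightarrow> real"
  assumes X_nonempty: "cuboid D lo hi \<noteq> {}"
    and e_W: "\<And>\<alpha> i. \<alpha> \<in> nodes D S - {D} \<Longrightarrow> i < R \<Longrightarrow> e \<alpha> i \<in> W"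
    and e_dep: "\<And>\<alpha> i x y. \<alpha> \<in> nodes D S - {D} \<Longrightarrow> i < R \<Longrightarrow> x \<in> cuboid D lo hi \<Longrightarrow> y \<in> cuboid D lo hi \<Longrightarrow>
       (\<forall>\<nu>\<in>\<alpha>. x \<nu> = y \<nu>) \<Longrightarrow> e \<alpha> i x = e \<alpha> i y"
    and e_leaf: "\<And>\<nu> i x. \<nu> \<in> D \<Longrightarrow> i < R \<Longrightarrow> x \<in> cuboid D lo hi \<Longrightarrow> e {\<nu>} i x = \<epsilon> \<nu> i (x \<nu>)"
    and \<epsilon>_V: "\<And>\<nu> i. \<nu> \<in> D \<Longrightarrow> i < R \<Longrightarrow> \<epsilon> \<nu> i \<in> V \<nu>"
    and coef_W: "\<And>\<alpha> i w. \<alpha> \<in> nodes D S - {D} \<Longrightarrow> i < R \<Longrightarrow> w \<in> W \<Longrightarrow> (\<lambda>x. Lam \<alpha> i (\<lambda>y. w (mg \<alpha> y x))) \<in> W"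
    and op_W': "\<And>\<alpha> w. \<alpha> \<in> nodes D S - {D} \<Longrightarrow> w \<in> W \<Longrightarrow>
       (\<lambda>x. \<Sum>i<R. e \<alpha> i x * Lam \<alpha> i (\<lambda>y. w (mg \<alpha> y x))) \<in> W"
    and diff_W: "\<And>w w'. w \<in> W \<Longrightarrow> w' \<in> W \<Longrightarrow> (\<lambda>x. w x - w' x) \<in> W"
    and Lam_lin: "\<And>\<alpha> i x I u c. \<alpha> \<in> nodes D S - {D} \<Longrightarrow> i < R \<Longrightarrow> x \<in> cuboid D lo hi \<Longrightarrow> finite (I :: nat list set) \<Longrightarrow>
       (\<And>k. k \<in> I \<Longrightarrow> u k \<in> W) \<Longrightarrow> Lam \<alpha> i (\<lambda>y. \<Sum>k\<in>I. c k * u k (mg \<alpha> y x)) = (\<Sum>k\<in>I. c k * Lam \<alpha> i (\<lambda>y. u k (mg \<alpha> y x)))"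
    and Lam_cong: "\<And>\<alpha> i w w'. \<alpha> \<in> nodes D S - {D} \<Longrightarrow> i < R \<Longrightarrow> (\<And>y. y \<in> cuboid D lo hi \<Longrightarrow> w y = w' y) \<Longrightarrow> Lam \<alpha> i w = Lam \<alpha> i w'"
    and small_0: "small (\<lambda>_. 0) 0"
    and small_cong: "\<And>w w' c. (\<And>x. x \<in> cuboid D lo hi \<Longrightarrow> w x = w' x) \<Longrightarrow> small w c \<Longrightarrow> small w' c"
    and small_add: "\<And>w w' c c'. w \<in> W \<Longrightarrow> w' \<in> W \<Longrightarrow> small w c \<Longrightarrow> small w' c' \<Longrightarrow> small (\<lambda>x. w x + w' x) (c + c')"
    and small_op: "\<And>\<alpha> w c. \<alpha> \<in> nodes D S - {D} \<Longrightarrow> w \<in> W \<Longrightarrow> small w c \<Longrightarrow>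
       small (\<lambda>x. \<Sum>i<R. e \<alpha> i x * Lam \<alpha> i (\<lambda>y. w (mg \<alpha> y x))) c"
begin

abbreviation Nd where "Nd \<equiv> nodes D S - {D}"
abbreviation X where "X \<equiv> cuboid D lo hi"

definition opP :: "nat set \<Rightarrow> ((nat \<Rightarrow> real) \<Rightarrow> real) \<Rightarrow> (nat \<Rightarrow> real) \<Rightarrow> real" where
  "opP \<alpha> w x = (\<Sum>i<R. e \<alpha> i x * Lam \<alpha> i (\<lambda>y. w (mg \<alpha> y x)))"

definition dep :: "nat set \<Rightarrow> ((nat \<Rightarrow> real) \<Rightarrow> real) \<Rightarrow> bool" where
  "dep \<alpha> w \<longleftrightarrow> (\<forall>x\<in>X. \<forall>y\<in>X. (\<forall>\<nu>\<in>\<alpha>. x \<nu> = y \<nu>) \<longrightarrow> w x = w y)"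

lemma depD:
  assumes "dep \<alpha> w" "x \<in> X" "y \<in> X" "\<And>\<nu>. \<nu> \<in> \<alpha> \<Longrightarrow> x \<nu> = y \<nu>"
  shows "w x = w y"
  by (rule assms(1)[unfolded dep_def, THEN bspec, OF assms(2), THEN bspec, OF assms(3), THEN mp])
     (rule ballI, rule assms(4))

lemma dep_D: "dep D w"
  unfolding dep_def
proof (intro ballI impI)
  fix x y assume x: "x \<in> X" and y: "y \<in> X" and eq: "\<forall>\<nu>\<in>D. x \<nu> = y \<nu>"
  have "x = y"
    by (rule PiE_ext[OF x[unfolded cuboid_def] y[unfolded cuboid_def] eq[THEN bspec]])
  then show "w x = w y" by simp
qed

lemma Nd_sub: "\<alpha> \<in> Nd \<Longrightarrow> \<alpha> \<subseteq> D"
  using nodeD(2) by simp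

lemma op_W: "\<alpha> \<in> Nd \<Longrightarrow> w \<in> W \<Longrightarrow> opP \<alpha> w \<in> W"
  unfolding opP_def[abs_def] by (rule op_W')

lemma small_opP: "\<alpha> \<in> Nd \<Longrightarrow> w \<in> W \<Longrightarrow> small w c \<Longrightarrow> small (opP \<alpha> w) c"
  unfolding opP_def[abs_def] by (rule small_op)

text \<open>Factors that do not depend on the variables of \<open>\<alpha>\<close> pass through the
  operator. Preservation of separated sums, linearity and the tensor structure all follow from
  this.\<close>

lemma opP_sum:
  assumes a: "\<alpha> \<in> Nd" and I: "finite (I :: nat list set)" and b: "\<And>k. k \<in> I \<Longrightarrow> b k \<in> W"
    and d: "\<And>k. k \<in> I \<Longrightarrow> dep \<gamma> (a k)" "\<gamma> \<inter> \<alpha> = {}"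
    and w: "\<And>x. x \<in> X \<Longrightarrow> w x = (\<Sum>k\<in>I. a k x * b k x)" and x: "x \<in> X"
  shows "opP \<alpha> w x = (\<Sum>k\<in>I. a k x * opP \<alpha> (b k) x)"
proof -
  have "Lam \<alpha> i (\<lambda>y. w (mg \<alpha> y x)) = (\<Sum>k\<in>I. a k x * Lam \<alpha> i (\<lambda>y. b k (mg \<alpha> y x)))" if i: "i < R" for i
  proof -
    have "Lam \<alpha> i (\<lambda>y. w (mg \<alpha> y x)) = Lam \<alpha> i (\<lambda>y. \<Sum>k\<in>I. a k x * b k (mg \<alpha> y x))"
    proof (rule Lam_cong[OF a i])
      fix y assume y: "y \<in> X"
      have m: "mg \<alpha> y x \<in> X" by (rule mg_cuboid[OF x y])
      have "a k (mg \<alpha> y x) = a k x" if "k \<in> I" for k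
        by (rule depD[OF d(1)[OF that] m x]) (use d(2) in \<open>auto simp: mg_def\<close>)
      then show "w (mg \<alpha> y x) = (\<Sum>k\<in>I. a k x * b k (mg \<alpha> y x))"
        unfolding w[OF m] by (intro sum.cong) auto
    qed
    also have "\<dots> = (\<Sum>k\<in>I. a k x * Lam \<alpha> i (\<lambda>y. b k (mg \<alpha> y x)))"
      by (rule Lam_lin[where c = "\<lambda>k. a k x" and u = b, OF a i x I b])
    finally show ?thesis .
  qed
  then have "opP \<alpha> w x = (\<Sum>i<R. e \<alpha> i x * (\<Sum>k\<in>I. a k x * Lam \<alpha> i (\<lambda>y. b k (mg \<alpha> y x))))"
    unfolding opP_def by (intro sum.cong) auto
  also have "\<dots> = (\<Sum>k\<in>I. \<Sum>i<R. a k x * (e \<alpha> i x * Lam \<alpha> i (\<lambda>y. b k (mg \<alpha> y x))))"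
    unfolding sum_distrib_left by (subst sum.swap) (intro sum.cong refl mult.left_commute)
  finally show ?thesis by (simp only: opP_def sum_distrib_left)
qed

lemma opP_diff:
  assumes a: "\<alpha> \<in> Nd" and w: "w \<in> W" "w' \<in> W" and x: "x \<in> X"
  shows "opP \<alpha> (\<lambda>x. w x - w' x) x = opP \<alpha> w x - opP \<alpha> w' x"
proof -
  \<comment> \<open>A difference as a sum of two terms with coefficients 1 and -1; constants depend
    on no variable.\<close>
  let ?I = "{[0], [1]} :: nat list set"
  have "opP \<alpha> (\<lambda>x. w x - w' x) x =
     (\<Sum>k\<in>?I. (if k = [0] then 1 else - 1) * opP \<alpha> (if k = [0] then w else w') x)"
    by (rule opP_sum[where \<gamma> = "{}" and a = "\<lambda>k x. if k = [0] then 1 else - 1" and b = "\<lambda>k. if k = [0] then w else w'", OF a])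
       (use w x in \<open>auto simp: dep_def\<close>)
  then show ?thesis by simp
qed

lemma dep_coef:
  assumes "dep \<beta> b" "\<alpha> \<in> Nd" "i < R"
  shows "dep (\<beta> - \<alpha>) (\<lambda>x. Lam \<alpha> i (\<lambda>y. b (mg \<alpha> y x)))"
  unfolding dep_def
proof (intro ballI impI)
  fix x x' assume x: "x \<in> X" "x' \<in> X" "\<forall>\<nu>\<in>\<beta> - \<alpha>. x \<nu> = x' \<nu>"
  show "Lam \<alpha> i (\<lambda>y. b (mg \<alpha> y x)) = Lam \<alpha> i (\<lambda>y. b (mg \<alpha> y x'))"
  proof (rule Lam_cong[OF assms(2,3)])
    fix y assume y: "y \<in> X"
    show "b (mg \<alpha> y x) = b (mg \<alpha> y x')"
      by (rule depD[OF assms(1) mg_cuboid[OF x(1) y] mg_cuboid[OF x(2) y]]) (use x(3) in \<open>auto simp: mg_def\<close>)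
  qed
qed

lemma dep_opP:
  assumes "dep \<beta> b" "\<alpha> \<in> Nd" "\<alpha> \<subseteq> \<beta>"
  shows "dep \<beta> (opP \<alpha> b)"
  unfolding dep_def opP_def
proof (intro ballI impI sum.cong refl)
  fix x x' i assume x: "x \<in> X" "x' \<in> X" "\<forall>\<nu>\<in>\<beta>. x \<nu> = x' \<nu>" and i: "i \<in> {..<R}"
  have "e \<alpha> i x = e \<alpha> i x'" using i x assms(3) by (intro e_dep[OF assms(2)]) auto
  moreover have "Lam \<alpha> i (\<lambda>y. b (mg \<alpha> y x)) = Lam \<alpha> i (\<lambda>y. b (mg \<alpha> y x'))"
    by (rule depD[OF dep_coef[OF assms(1,2)] x(1,2)]) (use i x in auto)
  ultimately show "e \<alpha> i x * Lam \<alpha> i (\<lambda>y. b (mg \<alpha> y x)) = e \<alpha> i x' * Lam \<alpha> i (\<lambda>y. b (mg \<alpha> y x'))" by simp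
qed

text \<open>Stronger than a bound on \<open>node_rank\<close>: the factors belong to
  \<open>W\<close>, so that further operators can be applied to them.\<close>

definition rk :: "nat set \<Rightarrow> ((nat \<Rightarrow> real) \<Rightarrow> real) \<Rightarrow> bool" where
  "rk \<beta> w \<longleftrightarrow> (\<exists>u u'. (\<forall>k<R. u k \<in> W \<and> u' k \<in> W \<and> dep \<beta> (u k) \<and> dep (D - \<beta>) (u' k)) \<and>
     (\<forall>x\<in>X. w x = (\<Sum>k<R. u k x * u' k x)))"

lemma rk_own:
  assumes "\<alpha> \<in> Nd" "w \<in> W"
  shows "rk \<alpha> (opP \<alpha> w)"
  unfolding rk_def
proof (intro exI conjI allI impI ballI)
  fix k assume k: "k < R"
  show "e \<alpha> k \<in> W" by (rule e_W[OF assms(1) k])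
  show "(\<lambda>x. Lam \<alpha> k (\<lambda>y. w (mg \<alpha> y x))) \<in> W" by (rule coef_W[OF assms(1) k assms(2)])
  show "dep \<alpha> (e \<alpha> k)" unfolding dep_def by (intro ballI impI) (rule e_dep[OF assms(1) k])
  show "dep (D - \<alpha>) (\<lambda>x. Lam \<alpha> k (\<lambda>y. w (mg \<alpha> y x)))" by (rule dep_coef[OF dep_D assms(1) k])
next
  fix x show "opP \<alpha> w x = (\<Sum>k<R. e \<alpha> k x * Lam \<alpha> k (\<lambda>y. w (mg \<alpha> y x)))" by (rule opP_def)
qed

lemma opP_sum_nat:
  assumes a: "\<alpha> \<in> Nd" and b: "\<And>k. k < R \<Longrightarrow> b k \<in> W"
    and d: "\<And>k. k < R \<Longrightarrow> dep \<gamma> (a k)" "\<gamma> \<inter> \<alpha> = {}"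
    and w: "\<And>x. x \<in> X \<Longrightarrow> w x = (\<Sum>k<R. a k x * b k x)" and x: "x \<in> X"
  shows "opP \<alpha> w x = (\<Sum>k<R. a k x * opP \<alpha> (b k) x)"
proof -
  let ?I = "(\<lambda>k. [k]) ` {..<R}"
  have inj: "inj_on (\<lambda>k. [k]) {..<R}" by (simp add: inj_on_def)
  have "opP \<alpha> w x = (\<Sum>k\<in>?I. a (hd k) x * opP \<alpha> (b (hd k)) x)"
    by (rule opP_sum[where \<gamma> = \<gamma> and a = "\<lambda>k. a (hd k)" and b = "\<lambda>k. b (hd k)", OF a])
       (use b d w x in \<open>auto simp: sum.reindex[OF inj]\<close>)
  then show ?thesis by (simp add: sum.reindex[OF inj])
qed

text \<open>If \<open>\<alpha>\<close> lies inside \<open>\<beta>\<close>, the operator acts on the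
  first factors; if it is disjoint from \<open>\<beta>\<close>, on the second ones. For a node
  strictly larger than \<open>\<beta>\<close> neither is possible, which dictates the order.\<close>

lemma rk_keep:
  assumes r: "rk \<beta> w" and a: "\<alpha> \<in> Nd" and ab: "\<alpha> \<subseteq> \<beta> \<or> \<alpha> \<inter> \<beta> = {}"
  shows "rk \<beta> (opP \<alpha> w)"
proof -
  from r obtain u u' where u: "\<And>k. k < R \<Longrightarrow> u k \<in> W" "\<And>k. k < R \<Longrightarrow> u' k \<in> W" "\<And>k. k < R \<Longrightarrow> dep \<beta> (u k)"
      "\<And>k. k < R \<Longrightarrow> dep (D - \<beta>) (u' k)" and w: "\<And>x. x \<in> X \<Longrightarrow> w x = (\<Sum>k<R. u k x * u' k x)"
    unfolding rk_def by (elim exE conjE) blast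
  from ab show ?thesis
  proof
    assume "\<alpha> \<subseteq> \<beta>"
    have "opP \<alpha> w x = (\<Sum>k<R. u' k x * opP \<alpha> (u k) x)" if "x \<in> X" for x
      by (rule opP_sum_nat[where \<gamma> = "D - \<beta>", OF a u(1) u(4) _ _ that]) (use \<open>\<alpha> \<subseteq> \<beta>\<close> w in \<open>auto simp: mult.commute\<close>)
    then show ?thesis
      unfolding rk_def using u op_W[OF a u(1)] dep_opP[OF u(3) a \<open>\<alpha> \<subseteq> \<beta>\<close>]
      by (intro exI[of _ "\<lambda>k. opP \<alpha> (u k)"] exI[of _ u']) (simp add: mult.commute)
  next
    assume d: "\<alpha> \<inter> \<beta> = {}"
    then have "\<alpha> \<subseteq> D - \<beta>" using Nd_sub[OF a] by blast
    have "opP \<alpha> w x = (\<Sum>k<R. u k x * opP \<alpha> (u' k) x)" if "x \<in> X" for x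
      by (rule opP_sum_nat[where \<gamma> = \<beta>, OF a u(2) u(3) _ _ that]) (use d w in auto)
    then show ?thesis
      unfolding rk_def using u op_W[OF a u(2)] dep_opP[OF u(4) a \<open>\<alpha> \<subseteq> D - \<beta>\<close>]
      by (intro exI[of _ u] exI[of _ "\<lambda>k. opP \<alpha> (u' k)"]) simp
  qed
qed

lemma fold_op_W: "set \<alpha>s \<subseteq> Nd \<Longrightarrow> w \<in> W \<Longrightarrow> fold opP \<alpha>s w \<in> W"
proof (induction \<alpha>s arbitrary: w)
  case (Cons \<alpha> \<alpha>s)
  then have "opP \<alpha> w \<in> W" by (intro op_W) auto
  then show ?case using Cons by simp
qed simp

lemma rk_fold:
  "rk \<beta> w \<Longrightarrow> set \<alpha>s \<subseteq> Nd \<Longrightarrow> (\<forall>\<alpha>\<in>set \<alpha>s. \<alpha> \<subseteq> \<beta> \<or> \<alpha> \<inter> \<beta> = {}) \<Longrightarrow> rk \<beta> (fold opP \<alpha>s w)"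
proof (induction \<alpha>s arbitrary: w)
  case (Cons \<alpha> \<alpha>s)
  then have "rk \<beta> (opP \<alpha> w)" by (intro rk_keep) auto
  then show ?case using Cons by simp
qed simp

text \<open>Operators before \<open>\<beta>\<close> are arbitrary, its own one creates the expansion
  with \<open>R\<close> terms, and the later ones preserve it.\<close>

lemma rk_fold_all:
  assumes "sorted_wrt (\<lambda>\<beta> \<alpha>. \<alpha> \<subseteq> \<beta> \<or> \<alpha> \<inter> \<beta> = {}) \<alpha>s" "set \<alpha>s \<subseteq> Nd" "w \<in> W" "\<beta> \<in> set \<alpha>s"
  shows "rk \<beta> (fold opP \<alpha>s w)"
proof -
  obtain xs ys where xy: "\<alpha>s = xs @ \<beta> # ys" using assms(4) by (auto dest: split_list)
  have "fold opP xs w \<in> W" using assms xy by (intro fold_op_W) auto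
  then have "rk \<beta> (opP \<beta> (fold opP xs w))" using assms xy by (intro rk_own) auto
  then have "rk \<beta> (fold opP ys (opP \<beta> (fold opP xs w)))"
    using assms(1,2) xy by (intro rk_fold) (auto simp: sorted_wrt_append)
  then show ?thesis using xy by simp
qed

text \<open>The new error is (f - P f) + P (f - w) with \<open>w\<close> the previous result. The
  second part is no larger than the old error because P is a contraction.\<close>

lemma fold_error:
  assumes f: "f \<in> W" and \<alpha>s: "set \<alpha>s \<subseteq> Nd" and E: "\<And>\<alpha>. \<alpha> \<in> Nd \<Longrightarrow> small (\<lambda>x. f x - opP \<alpha> f x) E"
  shows "small (\<lambda>x. f x - fold opP \<alpha>s f x) (real (length \<alpha>s) * E)"
  using \<alpha>s
proof (induction \<alpha>s rule: rev_induct)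
  case Nil
  then show ?case using small_0 by simp
next
  case (snoc \<alpha> \<alpha>s)
  let ?w = "fold opP \<alpha>s f"
  have a: "\<alpha> \<in> Nd" and w: "?w \<in> W" using snoc.prems f fold_op_W by auto
  have d: "(\<lambda>x. f x - ?w x) \<in> W" by (rule diff_W[OF f w])
  have "small (opP \<alpha> (\<lambda>x. f x - ?w x)) (real (length \<alpha>s) * E)"
    by (rule small_opP[OF a d]) (use snoc in auto)
  from small_add[OF diff_W[OF f op_W[OF a f]] op_W[OF a d] E[OF a] this]
  have "small (\<lambda>x. f x - opP \<alpha> f x + opP \<alpha> (\<lambda>x. f x - ?w x) x) (E + real (length \<alpha>s) * E)" .
  then have "small (\<lambda>x. f x - opP \<alpha> ?w x) (E + real (length \<alpha>s) * E)"
    by (rule small_cong[rotated]) (simp add: opP_diff[OF a f w])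
  then show ?case by (simp add: algebra_simps)
qed

text \<open>An intermediate stage: the variables in \<open>A\<close> already occur through functions
  from \<open>V\<close>, and all other dependence sits in \<open>b k\<close>.\<close>

definition tens :: "nat set \<Rightarrow> ((nat \<Rightarrow> real) \<Rightarrow> real) \<Rightarrow> bool" where
  "tens A w \<longleftrightarrow> (\<exists>(I :: nat list set) u b. finite I \<and> (\<forall>k\<in>I. b k \<in> W \<and> dep (D - A) (b k) \<and> (\<forall>\<nu>\<in>A. u k \<nu> \<in> V \<nu>)) \<and>
     (\<forall>x\<in>X. w x = (\<Sum>k\<in>I. (\<Prod>\<nu>\<in>A. u k \<nu> (x \<nu>)) * b k x)))"

lemma tens_empty: "w \<in> W \<Longrightarrow> tens {} w"
  unfolding tens_def using dep_D by (intro exI[of _ "{[]}"] exI[of _ undefined] exI[of _ "\<lambda>_. w"]) simp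

lemma leaf_Nd: "\<nu> \<in> D \<Longrightarrow> {\<nu>} \<in> Nd"
  using singleton_node card_D by auto

text \<open>Expanding each \<open>b k\<close> by the operator of the leaf multiplies the number of
  terms by \<open>R\<close>; the new index is put in front of the list.\<close>

lemma tens_step:
  assumes "tens A w" "\<nu> \<in> D" "\<nu> \<notin> A" "finite A"
  shows "tens (insert \<nu> A) (opP {\<nu>} w)"
proof -
  from assms(1) obtain I :: "nat list set" and u b where I: "finite I"
    and b: "\<And>k. k \<in> I \<Longrightarrow> b k \<in> W" and d: "\<And>k. k \<in> I \<Longrightarrow> dep (D - A) (b k)"
    and u: "\<And>k \<mu>. k \<in> I \<Longrightarrow> \<mu> \<in> A \<Longrightarrow> u k \<mu> \<in> V \<mu>"
    and w: "\<And>x. x \<in> X \<Longrightarrow> w x = (\<Sum>k\<in>I. (\<Prod>\<nu>\<in>A. u k \<nu> (x \<nu>)) * b k x)"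
    unfolding tens_def by blast
  have n: "{\<nu>} \<in> Nd" by (rule leaf_Nd[OF assms(2)])
  let ?J = "(\<lambda>(i, k). i # k) ` ({..<R} \<times> I)"
  define u' where "u' l = (\<lambda>\<mu>. if \<mu> = \<nu> then \<epsilon> \<nu> (hd l) else u (tl l) \<mu>)" for l
  define b' where "b' l = (\<lambda>x. Lam {\<nu>} (hd l) (\<lambda>y. b (tl l) (mg {\<nu>} y x)))" for l
  have inj: "inj_on (\<lambda>(i, k). i # k) ({..<R} \<times> I)" by (auto simp: inj_on_def)
  have "opP {\<nu>} w x = (\<Sum>l\<in>?J. (\<Prod>\<mu>\<in>insert \<nu> A. u' l \<mu> (x \<mu>)) * b' l x)" if x: "x \<in> X" for x
  proof -
    have "opP {\<nu>} w x = (\<Sum>k\<in>I. (\<Prod>\<mu>\<in>A. u k \<mu> (x \<mu>)) * opP {\<nu>} (b k) x)"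
      by (rule opP_sum[where \<gamma> = A, OF n I b _ _ w x]) (use assms(3) in \<open>auto simp: dep_def\<close>)
    also have "\<dots> = (\<Sum>k\<in>I. \<Sum>i<R. (\<Prod>\<mu>\<in>insert \<nu> A. u' (i # k) \<mu> (x \<mu>)) * b' (i # k) x)"
    proof (rule sum.cong[OF refl])
      fix k assume "k \<in> I"
      have "(\<Prod>\<mu>\<in>A. u' (i # k) \<mu> (x \<mu>)) = (\<Prod>\<mu>\<in>A. u k \<mu> (x \<mu>))" for i
        by (rule prod.cong) (use assms(3) in \<open>auto simp: u'_def\<close>)
      then have "(\<Prod>\<mu>\<in>insert \<nu> A. u' (i # k) \<mu> (x \<mu>)) = \<epsilon> \<nu> i (x \<nu>) * (\<Prod>\<mu>\<in>A. u k \<mu> (x \<mu>))" for i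
        using assms(3,4) by (simp add: u'_def)
      moreover have "opP {\<nu>} (b k) x = (\<Sum>i<R. \<epsilon> \<nu> i (x \<nu>) * b' (i # k) x)"
        unfolding opP_def b'_def using e_leaf[OF assms(2) _ x] by (intro sum.cong) auto
      ultimately show "(\<Prod>\<mu>\<in>A. u k \<mu> (x \<mu>)) * opP {\<nu>} (b k) x = (\<Sum>i<R. (\<Prod>\<mu>\<in>insert \<nu> A. u' (i # k) \<mu> (x \<mu>)) * b' (i # k) x)"
        by (simp only: sum_distrib_left mult_ac)
    qed
    also have "\<dots> = (\<Sum>(i, k)\<in>{..<R} \<times> I. (\<Prod>\<mu>\<in>insert \<nu> A. u' (i # k) \<mu> (x \<mu>)) * b' (i # k) x)"
      by (subst sum.swap) (rule sum.cartesian_product)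
    also have "\<dots> = (\<Sum>l\<in>?J. (\<Prod>\<mu>\<in>insert \<nu> A. u' l \<mu> (x \<mu>)) * b' l x)"
      unfolding sum.reindex[OF inj] by (rule sum.cong) auto
    finally show ?thesis .
  qed
  moreover have "b' l \<in> W \<and> dep (D - insert \<nu> A) (b' l) \<and> (\<forall>\<mu>\<in>insert \<nu> A. u' l \<mu> \<in> V \<mu>)" if lJ: "l \<in> ?J" for l
  proof -
    obtain i k where l: "l = i # k" "i < R" "k \<in> I" using lJ by auto
    have "dep (D - A - {\<nu>}) (b' l)" unfolding b'_def using dep_coef[OF d n, of k i] l by simp
    moreover have "D - A - {\<nu>} = D - insert \<nu> A" by auto
    moreover have "b' l \<in> W" unfolding b'_def using coef_W[OF n, of i "b k"] b l by simp
    ultimately show ?thesis using l u \<epsilon>_V[OF assms(2)] by (simp add: u'_def)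
  qed
  moreover have "finite ?J" using I by simp
  ultimately show ?thesis unfolding tens_def by (intro exI[of _ ?J] exI[of _ u'] exI[of _ b']) blast
qed

lemma tens_fold:
  "tens A w \<Longrightarrow> distinct \<nu>s \<Longrightarrow> set \<nu>s \<subseteq> D \<Longrightarrow> set \<nu>s \<inter> A = {} \<Longrightarrow> finite A \<Longrightarrow>
    tens (set \<nu>s \<union> A) (fold opP (map (\<lambda>\<nu>. {\<nu>}) \<nu>s) w)"
proof (induction \<nu>s arbitrary: A w)
  case (Cons \<nu> \<nu>s)
  have "tens (insert \<nu> A) (opP {\<nu>} w)" using Cons.prems by (intro tens_step) auto
  from Cons.IH[OF this] Cons.prems show ?case by simp
qed simp

text \<open>\<open>node_rank\<close> wants functions of restricted points; the missing coordinates
  are filled in from a fixed point of the box.\<close>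

lemma rk_node_rank:
  assumes "rk \<beta> w" "\<And>x. x \<in> X \<Longrightarrow> v x = w x"
  shows "node_rank D lo hi \<beta> v \<le> enat R"
proof -
  obtain x0 where x0: "x0 \<in> X" using X_nonempty by blast
  from assms(1) obtain u u' where u: "\<And>k. k < R \<Longrightarrow> dep \<beta> (u k)" "\<And>k. k < R \<Longrightarrow> dep (D - \<beta>) (u' k)"
     and w: "\<And>x. x \<in> X \<Longrightarrow> w x = (\<Sum>k<R. u k x * u' k x)"
    unfolding rk_def by blast
  define U where "U k z = u k (mg \<beta> z x0)" for k z
  define U' where "U' k z = u' k (mg (D - \<beta>) z x0)" for k z
  have "v x = (\<Sum>k<R. U k (restrict x \<beta>) * U' k (restrict x (D - \<beta>)))" if x: "x \<in> X" for x
  proof -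
    have m: "mg A (restrict x A) x0 = mg A x x0" for A by (auto simp: mg_def fun_eq_iff)
    have "U k (restrict x \<beta>) = u k x" "U' k (restrict x (D - \<beta>)) = u' k x" if "k < R" for k
      unfolding U_def U'_def m
      by (rule depD[OF u(1)[OF that] mg_cuboid[OF x0 x] x], simp add: mg_def,
          rule depD[OF u(2)[OF that] mg_cuboid[OF x0 x] x], simp add: mg_def)
    then show ?thesis unfolding assms(2)[OF x] w[OF x] by (intro sum.cong) auto
  qed
  then show ?thesis unfolding node_rank_def by (intro Inf_lower) blast
qed

lemma sorted_wrt_distinct: "distinct xs \<Longrightarrow> sorted_wrt P xs \<Longrightarrow> sorted_wrt (\<lambda>x y. P x y \<and> x \<noteq> y) xs"
  by (induction xs) auto

text \<open>\<open>v\<close> is an element of the tensor space, \<open>w\<close> the result of the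
  operators. They are compared on the box only, since outside it their values have no
  meaning.\<close>

lemma tree_approximation:
  assumes f: "f \<in> W" and E: "\<And>\<alpha>. \<alpha> \<in> Nd \<Longrightarrow> small (\<lambda>x. f x - opP \<alpha> f x) E"
  shows "\<exists>v\<in>tensor_space D V. (\<forall>\<alpha>\<in>Nd. node_rank D lo hi \<alpha> v \<le> enat R) \<and>
     (\<exists>w\<in>W. (\<forall>x\<in>X. w x = v x) \<and> small (\<lambda>x. f x - w x) (real (card Nd) * E))"
proof -
  obtain \<nu>s where \<nu>s: "set \<nu>s = D" "distinct \<nu>s" using finite_distinct_list[OF finite_D] by blast
  let ?L = "map (\<lambda>\<nu>. {\<nu>}) \<nu>s"
  have "finite (Nd - set ?L)" using finite_nodes by simp
  from finite_distinct_list[OF this] obtain xs where xs: "set xs = Nd - set ?L" "distinct xs" by blast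
  \<comment> \<open>Nodes that are not leaves, by decreasing size; the leaves follow. Since all
    leaves have size 1, the whole list is sorted by size, and laminarity applies to every
    pair.\<close>
  define as where "as = rev (sort_key card xs)"
  have as: "set as = Nd - set ?L" "distinct as" using xs by (simp_all add: as_def)
  have sorted_as: "sorted_wrt (\<lambda>\<beta> \<alpha>. card \<alpha> \<le> card \<beta>) as"
    unfolding as_def sorted_wrt_rev using sorted_sort_key[of card xs] by (simp add: sorted_wrt_map)
  have L: "set ?L \<subseteq> Nd" using \<nu>s leaf_Nd by auto
  have set: "set (as @ ?L) = Nd" using as L by auto
  have dist: "distinct (as @ ?L)" using as \<nu>s by (auto simp: distinct_map inj_on_def)
  have card1: "1 \<le> card \<beta>" if "\<beta> \<in> Nd" for \<beta>
    using nodeD(1)[of \<beta>] node_finite[of \<beta>] that by (simp add: Suc_le_eq card_gt_0_iff)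
  have "sorted_wrt (\<lambda>\<beta> \<alpha>. card \<alpha> \<le> card \<beta>) (as @ ?L)"
    unfolding sorted_wrt_append
  proof (intro conjI ballI)
    show "sorted_wrt (\<lambda>\<beta> \<alpha>. card \<alpha> \<le> card \<beta>) ?L" by (induction \<nu>s) auto
    fix x y assume "x \<in> set as" "y \<in> set ?L"
    then show "card y \<le> card x" using card1[of x] as by auto
  qed (rule sorted_as)
  from sorted_wrt_distinct[OF dist this]
  have sorted: "sorted_wrt (\<lambda>\<beta> \<alpha>. \<alpha> \<subseteq> \<beta> \<or> \<alpha> \<inter> \<beta> = {}) (as @ ?L)"
  proof (rule sorted_wrt_mono_rel[rotated])
    fix \<beta> \<alpha> assume "\<beta> \<in> set (as @ ?L)" "\<alpha> \<in> set (as @ ?L)" and ca: "card \<alpha> \<le> card \<beta> \<and> \<beta> \<noteq> \<alpha>"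
    then have "\<beta> \<in> nodes D S" "\<alpha> \<in> nodes D S" unfolding set by auto
    from nodes_laminar[OF this ca[THEN conjunct1] ca[THEN conjunct2]] show "\<alpha> \<subseteq> \<beta> \<or> \<alpha> \<inter> \<beta> = {}" by blast
  qed
  define w where "w = fold opP (as @ ?L) f"
  have wW: "w \<in> W" unfolding w_def using set f by (intro fold_op_W) auto
  have wr: "rk \<beta> w" if "\<beta> \<in> Nd" for \<beta>
    unfolding w_def by (rule rk_fold_all[OF sorted _ f]) (use set that in auto)
  have len: "length (as @ ?L) = card Nd" using distinct_card[OF dist] unfolding set by (rule sym)
  have we: "small (\<lambda>x. f x - w x) (real (card Nd) * E)"
    unfolding w_def using fold_error[where \<alpha>s = "as @ ?L", OF f equalityD1[OF set] E] unfolding len .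
  have "tens (set \<nu>s \<union> {}) (fold opP ?L (fold opP as f))"
    by (rule tens_fold[OF tens_empty[OF fold_op_W[OF _ f]] \<nu>s(2)]) (use \<nu>s as in auto)
  then have "tens D w" using \<nu>s by (simp add: w_def)
  then obtain I :: "nat list set" and u b where I: "finite I"
    and d: "\<And>k. k \<in> I \<Longrightarrow> dep {} (b k)" and u: "\<And>k. k \<in> I \<Longrightarrow> \<forall>\<nu>\<in>D. u k \<nu> \<in> V \<nu>"
    and w: "\<And>x. x \<in> X \<Longrightarrow> w x = (\<Sum>k\<in>I. (\<Prod>\<nu>\<in>D. u k \<nu> (x \<nu>)) * b k x)"
    unfolding tens_def Diff_cancel by blast
  obtain x0 where x0: "x0 \<in> X" using X_nonempty by blast
  \<comment> \<open>After all leaves, \<open>b k\<close> depends on no variable within the box.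
    Freezing it at \<open>x0\<close> gives true constants and hence a member of the span.\<close>
  define v where "v = (\<lambda>x. \<Sum>k\<in>I. b k x0 * (\<lambda>x. \<Prod>\<nu>\<in>D. u k \<nu> (x \<nu>)) x)"
  have vw: "v x = w x" if x: "x \<in> X" for x
  proof -
    have "b k x = b k x0" if "k \<in> I" for k by (rule depD[OF d[OF that] x x0]) auto
    then show ?thesis unfolding v_def w[OF x] by (intro sum.cong) auto
  qed
  have "v \<in> tensor_space D V"
    unfolding v_def tensor_space_def
    by (rule span_sum_fun, rule fun_vs.span_base) (use u in blast)
  moreover have "\<forall>\<alpha>\<in>Nd. node_rank D lo hi \<alpha> v \<le> enat R"
    using rk_node_rank[OF wr vw] by blast
  ultimately show ?thesis using wW we vw by (intro bexI[of _ v] conjI bexI[of _ w]) auto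
qed

end

section \<open>Approximation in the mean square\<close>

locale semi_inner =
  fixes H :: "('a \<Rightarrow> real) set" and ip :: "('a \<Rightarrow> real) \<Rightarrow> ('a \<Rightarrow> real) \<Rightarrow> real"
  assumes H0: "(\<lambda>_. 0) \<in> H" and Hlin: "\<And>u v c. u \<in> H \<Longrightarrow> v \<in> H \<Longrightarrow> (\<lambda>x. u x + c * v x) \<in> H"
    and ip_sym: "\<And>u v. ip u v = ip v u"
    and ip_lin: "\<And>u v w c. u \<in> H \<Longrightarrow> v \<in> H \<Longrightarrow> w \<in> H \<Longrightarrow> ip (\<lambda>x. u x + c * v x) w = ip u w + c * ip v w"
    and ip_nonneg: "\<And>u. u \<in> H \<Longrightarrow> ip u u \<ge> 0"
begin

lemma Hsum: "(\<And>k. k < (n::nat) \<Longrightarrow> e k \<in> H) \<Longrightarrow> (\<lambda>x. \<Sum>k<n. c k * e k x) \<in> H"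
proof (induction n)
  case (Suc n)
  have "(\<lambda>x. (\<lambda>x. \<Sum>k<n. c k * e k x) x + c n * e n x) \<in> H"
    by (rule Hlin) (use Suc in auto)
  then show ?case by simp
qed (simp add: H0)

lemma ip_0: "w \<in> H \<Longrightarrow> ip (\<lambda>_. 0) w = 0"
  using ip_lin[of "\<lambda>_. 0" "\<lambda>_. 0" w 1] H0 by simp

lemma ip_sum: "(\<And>k. k < (n::nat) \<Longrightarrow> e k \<in> H) \<Longrightarrow> w \<in> H \<Longrightarrow> ip (\<lambda>x. \<Sum>k<n. c k * e k x) w = (\<Sum>k<n. c k * ip (e k) w)"
proof (induction n)
  case (Suc n)
  have "ip (\<lambda>x. (\<lambda>x. \<Sum>k<n. c k * e k x) x + c n * e n x) w = ip (\<lambda>x. \<Sum>k<n. c k * e k x) w + c n * ip (e n) w"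
    by (rule ip_lin) (use Suc Hsum in auto)
  then show ?case using Suc by simp
qed (simp add: ip_0)

lemma ip_quad:
  assumes "u \<in> H" "v \<in> H"
  shows "ip (\<lambda>x. u x + c * v x) (\<lambda>x. u x + c * v x) = ip u u + 2 * c * ip u v + c\<^sup>2 * ip v v"
proof -
  have H: "(\<lambda>x. u x + c * v x) \<in> H" by (rule Hlin[OF assms])
  note l = ip_lin[OF assms H] ip_lin[OF assms assms(1)] ip_lin[OF assms assms(2)]
  have "ip u (\<lambda>x. u x + c * v x) = ip u u + c * ip u v"
    unfolding ip_sym[of u "\<lambda>x. u x + c * v x"] l ip_sym[of v u] ..
  moreover have "ip v (\<lambda>x. u x + c * v x) = ip u v + c * ip v v"
    unfolding ip_sym[of v "\<lambda>x. u x + c * v x"] l ..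
  ultimately show ?thesis unfolding l by (simp add: power2_eq_square algebra_simps)
qed

text \<open>The degenerate case of Cauchy-Schwarz: a nonnegative quadratic polynomial without
  quadratic term has no linear term.\<close>

lemma ip_null:
  assumes "u \<in> H" "v \<in> H" "ip v v = 0"
  shows "ip u v = 0"
proof (rule ccontr)
  assume n: "ip u v \<noteq> 0"
  \<comment> \<open>Makes the polynomial equal to -1.\<close>
  define c where "c = - (ip u u + 1) / (2 * ip u v)"
  have "ip u u + 2 * c * ip u v + c\<^sup>2 * ip v v \<ge> 0"
    using ip_nonneg[OF Hlin[OF assms(1,2), of c]] unfolding ip_quad[OF assms(1,2)] .
  moreover have "2 * c * ip u v = - (ip u u + 1)" using n by (simp add: c_def)
  ultimately show False using assms(3) by simp
qed

definition proj :: "nat \<Rightarrow> (nat \<Rightarrow> 'a \<Rightarrow> real) \<Rightarrow> ('a \<Rightarrow> real) \<Rightarrow> 'a \<Rightarrow> real" where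
  "proj n e h x = (\<Sum>i<n. ip h (e i) * e i x)"

text \<open>
  Orthonormal up to null vectors: as \<open>ip\<close> is only semidefinite, the Gram--Schmidt process may
  produce members \<open>e i\<close> with \<open>ip (e i) (e i) = 0\<close>, and these are kept in the family.
\<close>

definition on :: "nat \<Rightarrow> (nat \<Rightarrow> 'a \<Rightarrow> real) \<Rightarrow> bool" where
  "on n e \<longleftrightarrow> (\<forall>i<n. e i \<in> H) \<and> (\<forall>i<n. \<forall>j<n. i \<noteq> j \<longrightarrow> ip (e i) (e j) = 0) \<and>
     (\<forall>i<n. \<forall>h\<in>H. ip h (e i) * ip (e i) (e i) = ip h (e i))"

lemma proj_H: "on n e \<Longrightarrow> proj n e h \<in> H"
  unfolding proj_def[abs_def] on_def by (intro Hsum) auto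

text \<open>The third clause of \<open>on\<close> replaces normalisation: products with a null
  member vanish, so the identity holds for null and for unit members alike.\<close>

lemma ip_proj_e:
  assumes "on n e" "h \<in> H" "j < n"
  shows "ip (proj n e h) (e j) = ip h (e j)"
proof -
  have e: "\<And>i. i < n \<Longrightarrow> e i \<in> H" and o: "\<And>i. i < n \<Longrightarrow> i \<noteq> j \<Longrightarrow> ip (e i) (e j) = 0"
    and s: "ip h (e j) * ip (e j) (e j) = ip h (e j)"
    using assms unfolding on_def by auto
  have "ip (proj n e h) (e j) = (\<Sum>i<n. ip h (e i) * ip (e i) (e j))"
    unfolding proj_def[abs_def] by (rule ip_sum[OF e e[OF assms(3)]])
  also have "\<dots> = (\<Sum>i<n. if i = j then ip h (e j) else 0)"
    by (rule sum.cong) (use o s in auto)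
  finally show ?thesis using assms(3) by simp
qed

lemma ip_proj:
  assumes "on n e" "h \<in> H"
  shows "ip (proj n e h) (proj n e h) = ip h (proj n e h)"
proof -
  have e: "\<And>i. i < n \<Longrightarrow> e i \<in> H" using assms unfolding on_def by auto
  have g: "ip g (proj n e h) = (\<Sum>i<n. ip h (e i) * ip g (e i))" if "g \<in> H" for g
    unfolding ip_sym[of g] proj_def[abs_def] by (subst ip_sum[OF e that]) (simp_all add: ip_sym)
  show ?thesis
    unfolding g[OF proj_H[OF assms(1)]] g[OF assms(2)]
    by (rule sum.cong) (auto simp: ip_proj_e[OF assms])
qed

lemma residual:
  assumes "on n e" "h \<in> H"
  shows "ip (\<lambda>x. h x + - 1 * proj n e h x) (\<lambda>x. h x + - 1 * proj n e h x) = ip h h - ip (proj n e h) (proj n e h)"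
  unfolding ip_quad[OF assms(2) proj_H[OF assms(1)]] ip_proj[OF assms] by simp

lemma bessel: "on n e \<Longrightarrow> h \<in> H \<Longrightarrow> ip (proj n e h) (proj n e h) \<le> ip h h"
proof -
  assume a: "on n e" "h \<in> H"
  have "ip (\<lambda>x. h x + - 1 * proj n e h x) (\<lambda>x. h x + - 1 * proj n e h x) \<ge> 0"
    by (rule ip_nonneg[OF Hlin[OF a(2) proj_H[OF a(1)]]])
  then show ?thesis unfolding residual[OF a] by simp
qed

text \<open>Optimality is part of the induction. Comparing with arbitrary combinations of the
  original \<open>\<phi>\<close> avoids any statement about equality of spans, which would hold only
  up to null vectors.\<close>

lemma gram_schmidt:
  assumes "\<And>k. k < n \<Longrightarrow> \<phi> k \<in> H"
  shows "\<exists>e. on n e \<and> (\<forall>i<n. \<exists>c. e i = (\<lambda>x. \<Sum>k<n. c k * \<phi> k x)) \<and>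
    (\<forall>h\<in>H. \<forall>c. ip (\<lambda>x. h x + - 1 * proj n e h x) (\<lambda>x. h x + - 1 * proj n e h x)
       \<le> ip (\<lambda>x. h x + - 1 * (\<Sum>k<n. c k * \<phi> k x)) (\<lambda>x. h x + - 1 * (\<Sum>k<n. c k * \<phi> k x)))"
  using assms
proof (induction n)
  case 0
  then show ?case by (intro exI[of _ undefined]) (simp add: on_def proj_def)
next
  case (Suc n)
  have "\<And>k. k < n \<Longrightarrow> \<phi> k \<in> H" using Suc.prems by simp
  from Suc.IH[OF this] obtain e where e0: "on n e \<and> (\<forall>i<n. \<exists>c. e i = (\<lambda>x. \<Sum>k<n. c k * \<phi> k x)) \<and>
    (\<forall>h\<in>H. \<forall>c. ip (\<lambda>x. h x + - 1 * proj n e h x) (\<lambda>x. h x + - 1 * proj n e h x)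
       \<le> ip (\<lambda>x. h x + - 1 * (\<Sum>k<n. c k * \<phi> k x)) (\<lambda>x. h x + - 1 * (\<Sum>k<n. c k * \<phi> k x)))"
    ..
  note on = e0[THEN conjunct1]
  note comb = e0[THEN conjunct2, THEN conjunct1]
  note best = e0[THEN conjunct2, THEN conjunct2, THEN bspec, THEN spec]
  have \<phi>: "\<phi> n \<in> H" using Suc.prems by simp
  have eH: "\<And>i. i < n \<Longrightarrow> e i \<in> H" using on unfolding on_def by auto
  define r where "r = (\<lambda>x. \<phi> n x + - 1 * proj n e (\<phi> n) x)"
  have rH: "r \<in> H" unfolding r_def by (rule Hlin[OF \<phi> proj_H[OF on]])
  have re: "ip r (e j) = 0" if "j < n" for j
    unfolding r_def ip_lin[OF \<phi> proj_H[OF on] eH[OF that]] ip_proj_e[OF on \<phi> that] by simp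
  \<comment> \<open>If the residual is a null vector, the new member is the zero function; the
    family keeps its length.\<close>
  define \<rho> where "\<rho> = (if ip r r = 0 then 0 else 1 / sqrt (ip r r))"
  define en where "en = (\<lambda>x. 0 + \<rho> * r x)"
  have enH: "en \<in> H" unfolding en_def by (rule Hlin[OF H0 rH])
  have ip_en: "ip en g = \<rho> * ip r g" if "g \<in> H" for g
    unfolding en_def using ip_lin[OF H0 rH that, of \<rho>] ip_0[OF that] by simp
  have \<rho>1: "\<rho> * \<rho> * ip r r = (if ip r r = 0 then 0 else 1)"
    using ip_nonneg[OF rH] by (simp add: \<rho>_def)
  have enen: "ip en en = (if ip r r = 0 then 0 else 1)"
    using ip_en[OF enH] ip_en[OF rH] ip_sym[of r en] \<rho>1 by simp
  have en_self: "ip h en * ip en en = ip h en" if "h \<in> H" for h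
    using ip_en[OF that] unfolding enen ip_sym[of h en] by (simp add: \<rho>_def)
  have en_e: "ip en (e j) = 0" if "j < n" for j using ip_en[OF eH[OF that]] re[OF that] by simp
  define e' where "e' i = (if i < n then e i else en)" for i
  have on': "on (Suc n) e'"
    unfolding on_def
  proof (intro conjI allI impI ballI)
    fix i assume "i < Suc n"
    then show "e' i \<in> H" using eH enH by (simp add: e'_def)
    fix h assume h: "h \<in> H"
    show "ip h (e' i) * ip (e' i) (e' i) = ip h (e' i)"
    proof (cases "i < n")
      case True
      from on[unfolded on_def, THEN conjunct2, THEN conjunct2, THEN spec, THEN mp, OF True, THEN bspec, OF h]
      show ?thesis unfolding e'_def if_P[OF True] .
    next
      case False
      show ?thesis unfolding e'_def if_not_P[OF False] by (rule en_self[OF h])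
    qed
  next
    fix i j assume "i < Suc n" "j < Suc n" "i \<noteq> j"
    then show "ip (e' i) (e' j) = 0"
      using on en_e ip_sym[of "e i" en] unfolding on_def by (auto simp: e'_def)
  qed
  have proj': "proj (Suc n) e' h = (\<lambda>x. proj n e h x + ip h en * en x)" for h
    by (auto simp: proj_def e'_def fun_eq_iff intro!: sum.cong)
  have comb': "\<exists>c. e' i = (\<lambda>x. \<Sum>k<Suc n. c k * \<phi> k x)" if "i < Suc n" for i
  proof (cases "i < n")
    case True
    then obtain c where "e i = (\<lambda>x. \<Sum>k<n. c k * \<phi> k x)" using comb by blast
    then show ?thesis using True by (intro exI[of _ "\<lambda>k. if k < n then c k else 0"]) (simp add: e'_def)
  next
    case False
    have "\<forall>i\<in>{..<n}. \<exists>c. e i = (\<lambda>x. \<Sum>k<n. c k * \<phi> k x)" using comb by simp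
    from bchoice[OF this] obtain C where C: "\<forall>i\<in>{..<n}. e i = (\<lambda>x. \<Sum>k<n. C i k * \<phi> k x)" ..
    define c where "c k = (if k < n then - \<rho> * (\<Sum>i<n. ip (\<phi> n) (e i) * C i k) else \<rho>)" for k
    have "en x = (\<Sum>k<Suc n. c k * \<phi> k x)" for x
    proof -
      have ei: "e i x = (\<Sum>k<n. C i k * \<phi> k x)" if "i < n" for i
        using C[THEN bspec, of i] that by simp
      have "proj n e (\<phi> n) x = (\<Sum>i<n. ip (\<phi> n) (e i) * (\<Sum>k<n. C i k * \<phi> k x))"
        unfolding proj_def by (rule sum.cong) (simp_all add: ei)
      also have "\<dots> = (\<Sum>k<n. (\<Sum>i<n. ip (\<phi> n) (e i) * C i k) * \<phi> k x)"
        unfolding sum_distrib_left sum_distrib_right by (subst sum.swap) (simp only: mult.assoc)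
      finally have P: "proj n e (\<phi> n) x = (\<Sum>k<n. (\<Sum>i<n. ip (\<phi> n) (e i) * C i k) * \<phi> k x)" .
      have "en x = \<rho> * \<phi> n x - \<rho> * proj n e (\<phi> n) x"
        unfolding en_def r_def by (simp add: right_diff_distrib)
      then have "en x = \<rho> * \<phi> n x - (\<Sum>k<n. \<rho> * ((\<Sum>i<n. ip (\<phi> n) (e i) * C i k) * \<phi> k x))"
        unfolding P sum_distrib_left[of \<rho>] .
      moreover have "(\<Sum>k<n. c k * \<phi> k x) = - (\<Sum>k<n. \<rho> * ((\<Sum>i<n. ip (\<phi> n) (e i) * C i k) * \<phi> k x))"
        unfolding sum_negf[symmetric] by (rule sum.cong) (simp_all add: c_def)
      ultimately show ?thesis by (simp add: c_def)
    qed
    then show ?thesis using False that by (intro exI[of _ c]) (auto simp: e'_def fun_eq_iff)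
  qed
  have best': "ip (\<lambda>x. h x + - 1 * proj (Suc n) e' h x) (\<lambda>x. h x + - 1 * proj (Suc n) e' h x)
       \<le> ip (\<lambda>x. h x + - 1 * (\<Sum>k<Suc n. c k * \<phi> k x)) (\<lambda>x. h x + - 1 * (\<Sum>k<Suc n. c k * \<phi> k x))"
    if h: "h \<in> H" for h c
  proof -
    \<comment> \<open>The coefficient of \<open>\<phi> n\<close> is absorbed into \<open>h'\<close>,
      so the induction hypothesis handles the remaining ones. It is left to minimise over that
      single coefficient.\<close>
    define h' where "h' = (\<lambda>x. h x + - c n * \<phi> n x)"
    have h'H: "h' \<in> H" unfolding h'_def by (rule Hlin[OF h \<phi>])
    define g where "g = (\<lambda>x. h x + - 1 * proj n e h x)"
    have gH: "g \<in> H" unfolding g_def by (rule Hlin[OF h proj_H[OF on]])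
    have ph: "proj n e h' x = proj n e h x - c n * proj n e (\<phi> n) x" for x
    proof -
      have "proj n e h' x = (\<Sum>i<n. ip h (e i) * e i x - c n * (ip (\<phi> n) (e i) * e i x))"
        unfolding proj_def h'_def
      proof (rule sum.cong[OF refl])
        fix i assume "i \<in> {..<n}"
        then have "e i \<in> H" using eH by simp
        note l = ip_lin[OF h \<phi> this, of "- c n"]
        show "ip (\<lambda>x. h x + - c n * \<phi> n x) (e i) * e i x = ip h (e i) * e i x - c n * (ip (\<phi> n) (e i) * e i x)"
          unfolding l by (simp add: algebra_simps)
      qed
      then show ?thesis by (simp add: proj_def sum_subtractf sum_distrib_left)
    qed
    have 1: "(\<lambda>x. h' x + - 1 * proj n e h' x) = (\<lambda>x. g x + - c n * r x)"
      unfolding ph by (simp add: h'_def g_def r_def fun_eq_iff algebra_simps)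
    have 2: "(\<lambda>x. h' x + - 1 * (\<Sum>k<n. c k * \<phi> k x)) = (\<lambda>x. h x + - 1 * (\<Sum>k<Suc n. c k * \<phi> k x))"
      by (simp add: h'_def fun_eq_iff algebra_simps)
    have 3: "(\<lambda>x. h x + - 1 * proj (Suc n) e' h x) = (\<lambda>x. g x + - ip h en * en x)"
      unfolding proj' by (simp add: g_def fun_eq_iff algebra_simps)
    have pe: "ip (proj n e h) en = 0"
    proof -
      have "ip (proj n e h) en = (\<Sum>i<n. ip h (e i) * ip (e i) en)"
        unfolding proj_def[abs_def] by (rule ip_sum[OF eH enH])
      also have "\<dots> = 0" by (rule sum.neutral) (use en_e ip_sym[of _ en] in auto)
      finally show ?thesis .
    qed
    have ge: "ip g en = ip h en"
      unfolding g_def ip_lin[OF h proj_H[OF on] enH] pe by simp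
    have "ip (\<lambda>x. g x + - ip h en * en x) (\<lambda>x. g x + - ip h en * en x) \<le> ip (\<lambda>x. g x + - c n * r x) (\<lambda>x. g x + - c n * r x)"
    proof (cases "ip r r = 0")
      case True
      have "ip g r = 0" by (rule ip_null[OF gH rH True])
      moreover have "ip g en = 0" "ip en en = 0" using True ip_null[OF gH enH] enen by auto
      ultimately show ?thesis unfolding ip_quad[OF gH rH] ip_quad[OF gH enH] ge[symmetric] using True by simp
    next
      case False
      define a where "a = ip g en"
      have pos: "ip r r > 0" using ip_nonneg[OF rH] False by simp
      have "a = \<rho> * ip g r" unfolding a_def ip_sym[of g] using ip_en[OF gH] by (simp add: ip_sym)
      then have gr: "ip g r = a * sqrt (ip r r)" using False pos by (simp add: \<rho>_def)
      \<comment> \<open>Completing the square: the difference of both sides is (a - c_n sqrt (ip r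
        r))^2.\<close>
      have "ip g g + 2 * - a * a + a\<^sup>2 * 1 \<le> ip g g + 2 * - c n * (a * sqrt (ip r r)) + (c n)\<^sup>2 * (sqrt (ip r r))\<^sup>2"
        using zero_le_power2[of "a - c n * sqrt (ip r r)"] by (simp add: power2_eq_square algebra_simps)
      then show ?thesis
        unfolding ip_quad[OF gH rH] ip_quad[OF gH enH] ge[symmetric] a_def[symmetric] gr enen using False pos by simp
    qed
    then show ?thesis using best[OF h'H, of c] unfolding 1 2 3 by linarith
  qed
  show ?case
    by (rule exI[of _ e'], rule conjI, rule on', rule conjI, intro allI impI, erule comb', intro ballI allI, erule best')
qed

end

text \<open>Mixing coordinates pulls a box back to a product of two boxes, each unconstrained in the
  coordinates taken from the other point.\<close>

lemma mg_vimage_PiE: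
  assumes "\<And>i. i \<in> D \<Longrightarrow> A i \<subseteq> N i"
  shows "(\<lambda>(x, y). mg \<alpha> y x) -` Pi\<^sub>E D A \<inter> (Pi\<^sub>E D N \<times> Pi\<^sub>E D N) =
    Pi\<^sub>E D (\<lambda>i. if i \<in> \<alpha> then N i else A i) \<times> Pi\<^sub>E D (\<lambda>i. if i \<in> \<alpha> then A i else N i)"
proof -
  have "(mg \<alpha> y x \<in> Pi\<^sub>E D A \<and> x \<in> Pi\<^sub>E D N \<and> y \<in> Pi\<^sub>E D N) \<longleftrightarrow>
    x \<in> Pi\<^sub>E D (\<lambda>i. if i \<in> \<alpha> then N i else A i) \<and> y \<in> Pi\<^sub>E D (\<lambda>i. if i \<in> \<alpha> then A i else N i)" for x y
  proof (intro iffI conjI)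
    assume a: "mg \<alpha> y x \<in> Pi\<^sub>E D A \<and> x \<in> Pi\<^sub>E D N \<and> y \<in> Pi\<^sub>E D N"
    then have m: "mg \<alpha> y x \<in> Pi\<^sub>E D A" and x: "x \<in> Pi\<^sub>E D N" and y: "y \<in> Pi\<^sub>E D N" by auto
    have mi: "(if i \<in> \<alpha> then y i else x i) \<in> A i" if "i \<in> D" for i
      using PiE_mem[OF m that] by (simp add: mg_def)
    show "x \<in> Pi\<^sub>E D (\<lambda>i. if i \<in> \<alpha> then N i else A i)"
    proof (rule PiE_I)
      fix i assume i: "i \<in> D"
      show "x i \<in> (if i \<in> \<alpha> then N i else A i)" using mi[OF i] PiE_mem[OF x i] by (cases "i \<in> \<alpha>") simp_all
    qed (rule PiE_arb[OF x])
    show "y \<in> Pi\<^sub>E D (\<lambda>i. if i \<in> \<alpha> then A i else N i)"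
    proof (rule PiE_I)
      fix i assume i: "i \<in> D"
      show "y i \<in> (if i \<in> \<alpha> then A i else N i)" using mi[OF i] PiE_mem[OF y i] by (cases "i \<in> \<alpha>") simp_all
    qed (rule PiE_arb[OF y])
  next
    assume a: "x \<in> Pi\<^sub>E D (\<lambda>i. if i \<in> \<alpha> then N i else A i) \<and> y \<in> Pi\<^sub>E D (\<lambda>i. if i \<in> \<alpha> then A i else N i)"
    note x = a[THEN conjunct1] and y = a[THEN conjunct2]
    have xi: "x i \<in> (if i \<in> \<alpha> then N i else A i)" and yi: "y i \<in> (if i \<in> \<alpha> then A i else N i)" if "i \<in> D" for i
      using PiE_mem[OF x that] PiE_mem[OF y that] .
    have sub: "A i \<subseteq> N i" if "i \<in> D" for i by (rule assms[OF that])
    show "x \<in> Pi\<^sub>E D N"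
    proof (rule PiE_I)
      fix i assume i: "i \<in> D"
      show "x i \<in> N i" using xi[OF i] sub[OF i] by (cases "i \<in> \<alpha>") auto
    qed (rule PiE_arb[OF x])
    show "y \<in> Pi\<^sub>E D N"
    proof (rule PiE_I)
      fix i assume i: "i \<in> D"
      show "y i \<in> N i" using yi[OF i] sub[OF i] by (cases "i \<in> \<alpha>") auto
    qed (rule PiE_arb[OF y])
    show "mg \<alpha> y x \<in> Pi\<^sub>E D A"
    proof (rule PiE_I)
      fix i assume i: "i \<in> D"
      show "mg \<alpha> y x i \<in> A i" using xi[OF i] yi[OF i] by (cases "i \<in> \<alpha>") (simp_all add: mg_def)
    next
      fix i assume i: "i \<notin> D"
      show "mg \<alpha> y x i = undefined" using PiE_arb[OF x i] PiE_arb[OF y i] by (simp add: mg_def)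
    qed
  qed
  then show ?thesis by (simp only: set_eq_iff split_paired_all vimage_eq Int_iff mem_Times_iff case_prod_conv fst_conv snd_conv) simp
qed

text \<open>\<open>q \<nu>\<close> is a square integrable weight of one variable, later chosen to
  dominate the basis functions of the given leaf space, which may be unbounded.\<close>

locale L2_fun = tree_fun +
  fixes q :: "nat \<Rightarrow> real \<Rightarrow> real"
  assumes q1: "\<And>\<nu> t. \<nu> \<in> D \<Longrightarrow> 1 \<le> q \<nu> t"
    and qm: "\<And>\<nu>. \<nu> \<in> D \<Longrightarrow> q \<nu> \<in> borel_measurable (unif (lo \<nu>) (hi \<nu>))"
    and qi: "\<And>\<nu>. \<nu> \<in> D \<Longrightarrow> integrable (unif (lo \<nu>) (hi \<nu>)) (\<lambda>t. (q \<nu> t)\<^sup>2)"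
begin

abbreviation M where "M \<equiv> unif_cuboid D lo hi"

sublocale M: prob_space M by (rule prob_space_M)

definition Q :: "nat set \<Rightarrow> (nat \<Rightarrow> real) \<Rightarrow> real" where
  "Q A x = (\<Prod>\<nu>\<in>A. q \<nu> (x \<nu>))"

text \<open>Agrees with the factors of \<open>M\<close> on \<open>D\<close>; off \<open>D\<close>
  any probability space makes the product locale applicable.\<close>

abbreviation K where "K \<equiv> \<lambda>i. if i \<in> D then unif (lo i) (hi i) else unif 0 1"

lemma K_prob: "prob_space (K i)"
  using prob_space_unif[of "lo i" "hi i"] prob_space_unif[of 0 1] lo_less_hi[of i] by simp

lemma M_eq_K: "M = PiM D K"
  unfolding unif_cuboid_def by (rule PiM_cong) auto

lemma product_K: "product_prob_space K"
  by (intro product_prob_spaceI K_prob)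

lemma Q_ge1: "A \<subseteq> D \<Longrightarrow> 1 \<le> Q A x"
  unfolding Q_def using q1 by (intro prod_ge_1) auto

lemma Q_split: "\<alpha> \<subseteq> D \<Longrightarrow> Q D x = Q \<alpha> x * Q (D - \<alpha>) x"
  unfolding Q_def using prod.subset_diff[of \<alpha> D "\<lambda>\<nu>. q \<nu> (x \<nu>)"] finite_D by (simp add: mult.commute)

lemma Q_le_D: "\<alpha> \<subseteq> D \<Longrightarrow> Q \<alpha> x \<le> Q D x"
  using mult_left_mono[OF Q_ge1[of "D - \<alpha>" x], of "Q \<alpha> x"] Q_ge1[of \<alpha> x] Q_split[of \<alpha> x] by simp

lemma Q_mg: 
  assumes "\<alpha> \<subseteq> D"
  shows "Q D (mg \<alpha> y x) = Q \<alpha> y * Q (D - \<alpha>) x"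
proof -
  have "Q \<alpha> (mg \<alpha> y x) = Q \<alpha> y" "Q (D - \<alpha>) (mg \<alpha> y x) = Q (D - \<alpha>) x"
    unfolding Q_def by (rule prod.cong; simp add: mg_def)+
  then show ?thesis using Q_split[OF assms] by simp
qed

lemma Q2_int: "integrable M (\<lambda>x. (Q D x)\<^sup>2)"
proof -
  interpret P: product_prob_space K by (rule product_K)
  have "integrable (PiM D K) (\<lambda>x. \<Prod>\<nu>\<in>D. (q \<nu> (x \<nu>))\<^sup>2)"
    by (rule P.product_integrable_prod[OF finite_D]) (use qi in simp)
  then show ?thesis unfolding M_eq_K Q_def prod_power_distrib[symmetric] by simp
qed

text \<open>
  Domination by a fixed product weight, rather than square integrability, is inherited by every
  slice of \<open>w\<close>, so that no exceptional null sets have to be tracked.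
\<close>

definition SB :: "nat set \<Rightarrow> ((nat \<Rightarrow> real) \<Rightarrow> real) \<Rightarrow> bool" where
  "SB A w \<longleftrightarrow> w \<in> borel_measurable M \<and> (\<exists>c\<ge>0. \<forall>x\<in>X. \<bar>w x\<bar> \<le> c * Q A x)"

lemma SB_meas: "SB A w \<Longrightarrow> w \<in> borel_measurable M"
  by (simp add: SB_def)

lemma SBI: "w \<in> borel_measurable M \<Longrightarrow> c \<ge> 0 \<Longrightarrow> (\<And>x. x \<in> X \<Longrightarrow> \<bar>w x\<bar> \<le> c * Q A x) \<Longrightarrow> SB A w"
  by (auto simp: SB_def)

lemma SBE:
  assumes "SB A w"
  obtains c where "c \<ge> 0" "\<And>x. x \<in> X \<Longrightarrow> \<bar>w x\<bar> \<le> c * Q A x"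
  using assms unfolding SB_def by blast

lemma SB_D:
  assumes "SB A w" "A \<subseteq> D"
  shows "SB D w"
proof -
  obtain c where c: "c \<ge> 0" "\<And>x. x \<in> X \<Longrightarrow> \<bar>w x\<bar> \<le> c * Q A x" using SBE[OF assms(1)] by blast
  show ?thesis
  proof (rule SBI[OF SB_meas[OF assms(1)] c(1)])
    fix x assume "x \<in> X"
    show "\<bar>w x\<bar> \<le> c * Q D x"
      by (rule order_trans[OF c(2)[OF \<open>x \<in> X\<close>] mult_left_mono[OF Q_le_D[OF assms(2)] c(1)]])
  qed
qed

lemma SB_lin:
  assumes "SB A u" "SB A v" "A \<subseteq> D"
  shows "SB A (\<lambda>x. u x + c * v x)"
proof -
  obtain a where a: "a \<ge> 0" "\<And>x. x \<in> X \<Longrightarrow> \<bar>u x\<bar> \<le> a * Q A x" using SBE[OF assms(1)] by blast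
  obtain b where b: "b \<ge> 0" "\<And>x. x \<in> X \<Longrightarrow> \<bar>v x\<bar> \<le> b * Q A x" using SBE[OF assms(2)] by blast
  show ?thesis
  proof (rule SBI)
    show "(\<lambda>x. u x + c * v x) \<in> borel_measurable M" using SB_meas assms(1,2) by simp
    show "0 \<le> a + \<bar>c\<bar> * b" using a b by simp
    fix x assume x: "x \<in> X"
    have "\<bar>u x + c * v x\<bar> \<le> \<bar>u x\<bar> + \<bar>c\<bar> * \<bar>v x\<bar>" by (simp add: abs_mult[symmetric] abs_triangle_ineq)
    also have "\<dots> \<le> a * Q A x + \<bar>c\<bar> * (b * Q A x)"
      by (intro add_mono a(2)[OF x] mult_left_mono[OF b(2)[OF x]] abs_ge_zero)
    finally show "\<bar>u x + c * v x\<bar> \<le> (a + \<bar>c\<bar> * b) * Q A x" by (simp add: algebra_simps)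
  qed
qed

lemma SB_0: "A \<subseteq> D \<Longrightarrow> SB A (\<lambda>_. 0)"
  by (rule SBI[of _ 0]) auto

lemma SB_sum: "A \<subseteq> D \<Longrightarrow> (\<And>k. k < (n::nat) \<Longrightarrow> SB A (u k)) \<Longrightarrow> SB A (\<lambda>x. \<Sum>k<n. c k * u k x)"
proof (induction n)
  case (Suc n)
  have "SB A (\<lambda>x. (\<lambda>x. \<Sum>k<n. c k * u k x) x + c n * u n x)"
    by (rule SB_lin) (use Suc in auto)
  then show ?case by simp
qed (simp add: SB_0)

lemma SB_prod:
  assumes "SB \<alpha> u" "SB (D - \<alpha>) v" "\<alpha> \<subseteq> D"
  shows "SB D (\<lambda>x. u x * v x)"
proof -
  obtain a where a: "a \<ge> 0" "\<And>x. x \<in> X \<Longrightarrow> \<bar>u x\<bar> \<le> a * Q \<alpha> x" using SBE[OF assms(1)] by blast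
  obtain b where b: "b \<ge> 0" "\<And>x. x \<in> X \<Longrightarrow> \<bar>v x\<bar> \<le> b * Q (D - \<alpha>) x" using SBE[OF assms(2)] by blast
  show ?thesis
  proof (rule SBI)
    show "(\<lambda>x. u x * v x) \<in> borel_measurable M" using SB_meas assms(1,2) by simp
    show "0 \<le> a * b" using a b by simp
    fix x assume x: "x \<in> X"
    have "\<bar>u x * v x\<bar> \<le> (a * Q \<alpha> x) * (b * Q (D - \<alpha>) x)"
      unfolding abs_mult by (rule mult_mono[OF a(2)[OF x] b(2)[OF x] order_trans[OF abs_ge_zero a(2)[OF x]] abs_ge_zero])
    then show "\<bar>u x * v x\<bar> \<le> (a * b) * Q D x" unfolding Q_split[OF assms(3)] by (simp only: mult_ac)
  qed
qed

lemma int_prod: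
  assumes "SB D u" "SB D v"
  shows "integrable M (\<lambda>x. u x * v x)"
proof -
  obtain a where a: "a \<ge> 0" "\<And>x. x \<in> X \<Longrightarrow> \<bar>u x\<bar> \<le> a * Q D x" using SBE[OF assms(1)] by blast
  obtain b where b: "b \<ge> 0" "\<And>x. x \<in> X \<Longrightarrow> \<bar>v x\<bar> \<le> b * Q D x" using SBE[OF assms(2)] by blast
  show ?thesis
  proof (rule Bochner_Integration.integrable_bound[OF integrable_mult_right[OF Q2_int, of "a * b"]])
    show "(\<lambda>x. u x * v x) \<in> borel_measurable M" using SB_meas assms by simp
    show "AE x in M. norm (u x * v x) \<le> norm (a * b * (Q D x)\<^sup>2)"
    proof (rule AE_I2)
      fix x assume "x \<in> space M"
      then have x: "x \<in> X" by (simp only: space_M)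
      have "\<bar>u x * v x\<bar> \<le> (a * Q D x) * (b * Q D x)"
        unfolding abs_mult by (rule mult_mono[OF a(2)[OF x] b(2)[OF x] order_trans[OF abs_ge_zero a(2)[OF x]] abs_ge_zero])
      also have "\<dots> = a * b * (Q D x)\<^sup>2" by (simp add: power2_eq_square)
      also have "\<dots> \<le> \<bar>\<dots>\<bar>" by (rule abs_ge_self)
      finally show "norm (u x * v x) \<le> norm (a * b * (Q D x)\<^sup>2)" by simp
    qed
  qed
qed

lemma mg_measurable: "(\<lambda>(x, y). mg \<alpha> y x) \<in> measurable (M \<Otimes>\<^sub>M M) M"
proof -
  have "(\<lambda>p. mg \<alpha> (snd p) (fst p)) \<in> measurable (M \<Otimes>\<^sub>M M) (PiM D (\<lambda>i. unif (lo i) (hi i)))"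
  proof (rule measurable_PiM_single')
    fix i assume i: "i \<in> D"
    have c: "(\<lambda>x. x i) \<in> measurable M (unif (lo i) (hi i))"
      unfolding unif_cuboid_def by (rule measurable_component_singleton[OF i])
    show "(\<lambda>p. mg \<alpha> (snd p) (fst p) i) \<in> measurable (M \<Otimes>\<^sub>M M) (unif (lo i) (hi i))"
      using measurable_compose[OF measurable_snd c] measurable_compose[OF measurable_fst c]
      by (cases "i \<in> \<alpha>") (simp_all add: mg_def)
  next
    show "(\<lambda>p. mg \<alpha> (snd p) (fst p)) \<in> space (M \<Otimes>\<^sub>M M) \<rightarrow> (\<Pi>\<^sub>E i\<in>D. space (unif (lo i) (hi i)))"
    proof
      fix z assume "z \<in> space (M \<Otimes>\<^sub>M M)"
      then have "fst z \<in> X" "snd z \<in> X" by (auto simp: space_pair_measure space_M)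
      from mg_cuboid[OF this, of \<alpha>] show "mg \<alpha> (snd z) (fst z) \<in> (\<Pi>\<^sub>E i\<in>D. space (unif (lo i) (hi i)))"
        by (simp only: space_unif cuboid_def)
    qed
  qed
  then show ?thesis by (simp add: unif_cuboid_def case_prod_unfold)
qed

lemma mg_slice_measurable:
  assumes "w \<in> borel_measurable M" "x \<in> X"
  shows "(\<lambda>y. w (mg \<alpha> y x)) \<in> borel_measurable M"
proof -
  have "(\<lambda>y. (x, y)) \<in> measurable M (M \<Otimes>\<^sub>M M)"
    by (rule measurable_Pair1') (use assms(2) in \<open>simp add: space_M\<close>)
  from measurable_compose[OF measurable_compose[OF this mg_measurable[of \<alpha>]] assms(1)] show ?thesis by simp
qed

lemma SB_slice:
  assumes "SB D w" "x \<in> X" "\<alpha> \<subseteq> D"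
  shows "SB D (\<lambda>y. w (mg \<alpha> y x))"
proof -
  obtain c where c: "c \<ge> 0" "\<And>x. x \<in> X \<Longrightarrow> \<bar>w x\<bar> \<le> c * Q D x" using SBE[OF assms(1)] by blast
  show ?thesis
  proof (rule SBI[OF mg_slice_measurable[OF SB_meas[OF assms(1)] assms(2)]])
    show "0 \<le> c * Q (D - \<alpha>) x" using c(1) Q_ge1[of "D - \<alpha>" x] by simp
    fix y assume y: "y \<in> X"
    have "\<bar>w (mg \<alpha> y x)\<bar> \<le> c * (Q \<alpha> y * Q (D - \<alpha>) x)"
      using c(2)[OF mg_cuboid[OF assms(2) y, of \<alpha>]] unfolding Q_mg[OF assms(3)] .
    also have "\<dots> \<le> c * (Q D y * Q (D - \<alpha>) x)"
      using Q_ge1[of "D - \<alpha>" x] by (intro mult_left_mono mult_right_mono Q_le_D assms(3) c(1)) auto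
    finally show "\<bar>w (mg \<alpha> y x)\<bar> \<le> c * Q (D - \<alpha>) x * Q D y" by (simp only: mult_ac)
  qed
qed

text \<open>The coefficient is dominated by the weight of the remaining variables alone. Multiplied
  by a function with weight \<open>Q \<alpha>\<close> it stays below a multiple of
  \<open>Q D\<close>, and the class is closed under the operators.\<close>

lemma SB_coef:
  assumes w: "SB D w" and u: "SB D u" and a: "\<alpha> \<subseteq> D"
  shows "SB (D - \<alpha>) (\<lambda>x. \<integral>y. w (mg \<alpha> y x) * u y \<partial>M)"
proof -
  obtain c where c: "c \<ge> 0" "\<And>x. x \<in> X \<Longrightarrow> \<bar>w x\<bar> \<le> c * Q D x" using SBE[OF w] by blast
  obtain b where b: "b \<ge> 0" "\<And>x. x \<in> X \<Longrightarrow> \<bar>u x\<bar> \<le> b * Q D x" using SBE[OF u] by blast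
  show ?thesis
  proof (rule SBI)
    have "(\<lambda>p. w (mg \<alpha> (snd p) (fst p))) \<in> borel_measurable (M \<Otimes>\<^sub>M M)"
      using measurable_compose[OF mg_measurable[of \<alpha>] SB_meas[OF w]] by (simp add: case_prod_unfold)
    moreover have "(\<lambda>p. u (snd p)) \<in> borel_measurable (M \<Otimes>\<^sub>M M)"
      by (rule measurable_compose[OF measurable_snd SB_meas[OF u]])
    ultimately have "(\<lambda>(x, y). w (mg \<alpha> y x) * u y) \<in> borel_measurable (M \<Otimes>\<^sub>M M)"
      unfolding case_prod_unfold by (rule borel_measurable_times)
    then show "(\<lambda>x. \<integral>y. w (mg \<alpha> y x) * u y \<partial>M) \<in> borel_measurable M"
      by (rule M.borel_measurable_lebesgue_integral)
    show "0 \<le> c * b * (\<integral>y. (Q D y)\<^sup>2 \<partial>M)" using c(1) b(1) by simp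
    fix x assume x: "x \<in> X"
    have "\<bar>\<integral>y. w (mg \<alpha> y x) * u y \<partial>M\<bar> \<le> (\<integral>y. \<bar>w (mg \<alpha> y x) * u y\<bar> \<partial>M)"
      using integral_norm_bound[of M "\<lambda>y. w (mg \<alpha> y x) * u y"] by simp
    also have "\<dots> \<le> (\<integral>y. (c * b * Q (D - \<alpha>) x) * (Q D y)\<^sup>2 \<partial>M)"
    proof (rule integral_mono)
      show "integrable M (\<lambda>y. \<bar>w (mg \<alpha> y x) * u y\<bar>)"
        by (rule integrable_abs[OF int_prod[OF SB_slice[OF w x a] u]])
      show "integrable M (\<lambda>y. (c * b * Q (D - \<alpha>) x) * (Q D y)\<^sup>2)" by (rule integrable_mult_right[OF Q2_int])
      fix y assume "y \<in> space M"
      then have y: "y \<in> X" by (simp only: space_M)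
      have 1: "\<bar>w (mg \<alpha> y x)\<bar> \<le> c * (Q \<alpha> y * Q (D - \<alpha>) x)"
        using c(2)[OF mg_cuboid[OF x y, of \<alpha>]] unfolding Q_mg[OF a] .
      also have "\<dots> \<le> c * (Q D y * Q (D - \<alpha>) x)"
        using Q_ge1[of "D - \<alpha>" x] by (intro mult_left_mono mult_right_mono Q_le_D a c(1)) auto
      finally have 2: "\<bar>w (mg \<alpha> y x)\<bar> \<le> c * (Q D y * Q (D - \<alpha>) x)" .
      have "\<bar>w (mg \<alpha> y x) * u y\<bar> \<le> (c * (Q D y * Q (D - \<alpha>) x)) * (b * Q D y)"
        unfolding abs_mult by (rule mult_mono[OF 2 b(2)[OF y] order_trans[OF abs_ge_zero 2] abs_ge_zero])
      then show "\<bar>w (mg \<alpha> y x) * u y\<bar> \<le> (c * b * Q (D - \<alpha>) x) * (Q D y)\<^sup>2"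
        by (simp only: power2_eq_square mult_ac)
    qed
    also have "\<dots> = c * b * (\<integral>y. (Q D y)\<^sup>2 \<partial>M) * Q (D - \<alpha>) x" by simp
    finally show "\<bar>\<integral>y. w (mg \<alpha> y x) * u y \<partial>M\<bar> \<le> c * b * (\<integral>y. (Q D y)\<^sup>2 \<partial>M) * Q (D - \<alpha>) x" .
  qed
qed

text \<open>Choosing each coordinate from one of two independent uniform points gives again a
  uniform point, as is verified on boxes.\<close>

lemma distr_mg: "distr (M \<Otimes>\<^sub>M M) M (\<lambda>(x, y). mg \<alpha> y x) = M"
proof -
  interpret P: product_prob_space K by (rule product_K)
  have "distr (M \<Otimes>\<^sub>M M) M (\<lambda>(x, y). mg \<alpha> y x) = PiM D K"
  proof (rule P.PiM_eqI[OF finite_D])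
    show "sets (distr (M \<Otimes>\<^sub>M M) M (\<lambda>(x, y). mg \<alpha> y x)) = sets (PiM D K)"
      unfolding sets_distr M_eq_K ..
    fix A assume A: "\<And>i. i \<in> D \<Longrightarrow> A i \<in> sets (K i)"
    define B1 where "B1 i = (if i \<in> \<alpha> then space (K i) else A i)" for i
    define B2 where "B2 i = (if i \<in> \<alpha> then A i else space (K i))" for i
    have B: "B1 i \<in> sets (K i)" "B2 i \<in> sets (K i)" if "i \<in> D" for i
      unfolding B1_def B2_def by (cases "i \<in> \<alpha>"; simp only: if_True if_False A[OF that] sets.top)+
    have AM: "Pi\<^sub>E D A \<in> sets M" unfolding M_eq_K by (rule sets_PiM_I_finite[OF finite_D A])
    have BM: "Pi\<^sub>E D B1 \<in> sets M" "Pi\<^sub>E D B2 \<in> sets M"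
      unfolding M_eq_K by (rule sets_PiM_I_finite[OF finite_D B(1)], assumption, rule sets_PiM_I_finite[OF finite_D B(2)], assumption)
    have As: "A i \<subseteq> space (K i)" if "i \<in> D" for i by (rule sets.sets_into_space[OF A[OF that]])
    have spK: "space M = (\<Pi>\<^sub>E i\<in>D. space (K i))" unfolding M_eq_K by (rule space_PiM)
    have pre: "(\<lambda>(x, y). mg \<alpha> y x) -` Pi\<^sub>E D A \<inter> space (M \<Otimes>\<^sub>M M) = Pi\<^sub>E D B1 \<times> Pi\<^sub>E D B2"
      unfolding space_pair_measure spK B1_def[abs_def] B2_def[abs_def] by (rule mg_vimage_PiE) (rule As)
    have eB: "emeasure M (Pi\<^sub>E D B1) = (\<Prod>i\<in>D. emeasure (K i) (B1 i))" "emeasure M (Pi\<^sub>E D B2) = (\<Prod>i\<in>D. emeasure (K i) (B2 i))"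
      unfolding M_eq_K by (rule P.emeasure_PiM[OF finite_D B(1)], assumption, rule P.emeasure_PiM[OF finite_D B(2)], assumption)
    have "emeasure (distr (M \<Otimes>\<^sub>M M) M (\<lambda>(x, y). mg \<alpha> y x)) (Pi\<^sub>E D A) = emeasure (M \<Otimes>\<^sub>M M) (Pi\<^sub>E D B1 \<times> Pi\<^sub>E D B2)"
      unfolding emeasure_distr[OF mg_measurable AM] pre ..
    also have "\<dots> = emeasure M (Pi\<^sub>E D B1) * emeasure M (Pi\<^sub>E D B2)"
      by (rule M.emeasure_pair_measure_Times[OF BM])
    also have "\<dots> = (\<Prod>i\<in>D. emeasure (K i) (B1 i)) * (\<Prod>i\<in>D. emeasure (K i) (B2 i))"
      unfolding eB ..
    also have "\<dots> = (\<Prod>i\<in>D. emeasure (K i) (B1 i) * emeasure (K i) (B2 i))" by (rule prod.distrib[symmetric])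
    also have "\<dots> = (\<Prod>i\<in>D. emeasure (K i) (A i))"
    proof (rule prod.cong[OF refl])
      fix i
      have 1: "emeasure (K i) (space (K i)) = 1" by (rule prob_space.emeasure_space_1[OF K_prob])
      show "emeasure (K i) (B1 i) * emeasure (K i) (B2 i) = emeasure (K i) (A i)"
      proof (cases "i \<in> \<alpha>")
        case True
        then have "B1 i = space (K i)" "B2 i = A i" by (simp_all only: B1_def B2_def if_True)
        then show ?thesis by (simp only: 1 mult_1_left)
      next
        case False
        then have "B1 i = A i" "B2 i = space (K i)" by (simp_all only: B1_def B2_def if_False)
        then show ?thesis by (simp only: 1 mult_1_right)
      qed
    qed
    finally show "emeasure (distr (M \<Otimes>\<^sub>M M) M (\<lambda>(x, y). mg \<alpha> y x)) (Pi\<^sub>E D A) = (\<Prod>i\<in>D. emeasure (K i) (A i))" .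
  qed
  then show ?thesis by (simp only: M_eq_K)
qed

text \<open>Fubini for the variables in \<open>\<alpha>\<close> against the others, without
  splitting the product space: the inner integral runs over a full second point.\<close>

lemma mixing:
  fixes F :: "(nat \<Rightarrow> real) \<Rightarrow> real"
  assumes F: "integrable M F"
  shows "integrable M (\<lambda>x. \<integral>y. F (mg \<alpha> y x) \<partial>M)" "(\<integral>x. F x \<partial>M) = (\<integral>x. \<integral>y. F (mg \<alpha> y x) \<partial>M \<partial>M)"
proof -
  interpret MM: pair_sigma_finite M M
    by (rule pair_sigma_finite.intro[OF M.sigma_finite_measure_axioms M.sigma_finite_measure_axioms])
  have Fm: "F \<in> borel_measurable M" using F by simp
  have i: "integrable (M \<Otimes>\<^sub>M M) (\<lambda>p. F ((\<lambda>(x, y). mg \<alpha> y x) p))"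
    using integrable_distr_eq[OF mg_measurable[of \<alpha>] Fm] F unfolding distr_mg by simp
  show "integrable M (\<lambda>x. \<integral>y. F (mg \<alpha> y x) \<partial>M)"
    using MM.integrable_fst'[OF i] by simp
  have "(\<integral>x. F x \<partial>M) = (\<integral>p. F ((\<lambda>(x, y). mg \<alpha> y x) p) \<partial>(M \<Otimes>\<^sub>M M))"
    using integral_distr[OF mg_measurable[of \<alpha>] Fm] unfolding distr_mg .
  also have "\<dots> = (\<integral>x. \<integral>y. F (mg \<alpha> y x) \<partial>M \<partial>M)"
    using MM.integral_fst'[OF i] by simp
  finally show "(\<integral>x. F x \<partial>M) = (\<integral>x. \<integral>y. F (mg \<alpha> y x) \<partial>M \<partial>M)" .
qed

definition ip :: "((nat \<Rightarrow> real) \<Rightarrow> real) \<Rightarrow> ((nat \<Rightarrow> real) \<Rightarrow> real) \<Rightarrow> real" where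
  "ip u v = (\<integral>x. u x * v x \<partial>M)"

sublocale G: semi_inner "{w. SB D w}" ip
proof
  show "(\<lambda>_. 0) \<in> {w. SB D w}" using SB_0 by simp
  show "(\<lambda>x. u x + c * v x) \<in> {w. SB D w}" if "u \<in> {w. SB D w}" "v \<in> {w. SB D w}" for u v c
    using that SB_lin[of D u v c] by simp
  show "ip u v = ip v u" for u v unfolding ip_def by (simp only: mult.commute)
  show "ip (\<lambda>x. u x + c * v x) w = ip u w + c * ip v w"
    if u: "u \<in> {w. SB D w}" and v: "v \<in> {w. SB D w}" and w: "w \<in> {w. SB D w}" for u v w c
  proof -
    have i: "integrable M (\<lambda>x. u x * w x)" "integrable M (\<lambda>x. v x * w x)" using u v w int_prod by auto
    have "ip (\<lambda>x. u x + c * v x) w = (\<integral>x. u x * w x + c * (v x * w x) \<partial>M)"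
      unfolding ip_def by (simp only: distrib_right mult.assoc)
    also have "\<dots> = (\<integral>x. u x * w x \<partial>M) + c * (\<integral>x. v x * w x \<partial>M)"
      using Bochner_Integration.integral_add[OF i(1) integrable_mult_right[OF i(2), of c]] by simp
    finally show ?thesis unfolding ip_def .
  qed
  show "0 \<le> ip u u" for u unfolding ip_def by (rule Bochner_Integration.integral_nonneg) simp
qed

lemma ip_mixing:
  assumes "SB D w" "\<alpha> \<subseteq> D"
  shows "integrable M (\<lambda>x. ip (\<lambda>y. w (mg \<alpha> y x)) (\<lambda>y. w (mg \<alpha> y x)))"
    "ip w w = (\<integral>x. ip (\<lambda>y. w (mg \<alpha> y x)) (\<lambda>y. w (mg \<alpha> y x)) \<partial>M)"
  unfolding ip_def using mixing[OF int_prod[OF assms(1,1)], of \<alpha>] .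

lemma minkowski:
  assumes "SB D u" "SB D v" "sqrt (ip u u) \<le> a" "sqrt (ip v v) \<le> b"
  shows "sqrt (ip (\<lambda>x. u x + v x) (\<lambda>x. u x + v x)) \<le> a + b"
proof (rule field_le_epsilon)
  fix e :: real assume e: "e > 0"
  \<comment> \<open>Strictly positive versions of the bounds, since their quotient is used
    below.\<close>
  define a' b' where "a' = a + e / 2" and "b' = b + e / 2"
  have a0: "a \<ge> 0" "b \<ge> 0"
    using assms(3,4) order_trans[OF real_sqrt_ge_zero] G.ip_nonneg assms(1,2) by (metis mem_Collect_eq)+
  have ab: "a' > 0" "b' > 0" using a0 e by (simp_all add: a'_def b'_def)
  have uu: "ip u u \<le> a'\<^sup>2"
    using assms(3) e by (intro sqrt_le_D) (simp add: a'_def)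
  have vv: "ip v v \<le> b'\<^sup>2"
    using assms(4) e by (intro sqrt_le_D) (simp add: b'_def)
  have H: "u \<in> {w. SB D w}" "v \<in> {w. SB D w}" using assms by auto
  \<comment> \<open>This multiple of \<open>v\<close> yields Cauchy-Schwarz in the form
    \<open>ip u v \<le> a' * b'\<close>.\<close>
  have "0 \<le> ip (\<lambda>x. u x + - (a' / b') * v x) (\<lambda>x. u x + - (a' / b') * v x)"
    by (rule G.ip_nonneg[OF G.Hlin[OF H]])
  then have "0 \<le> ip u u - 2 * (a' / b') * ip u v + (a' / b')\<^sup>2 * ip v v" unfolding G.ip_quad[OF H] by simp
  also have "\<dots> \<le> a'\<^sup>2 - 2 * (a' / b') * ip u v + (a' / b')\<^sup>2 * b'\<^sup>2"
    by (intro add_mono diff_right_mono uu mult_left_mono vv) simp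
  finally have "2 * (a' / b') * ip u v \<le> 2 * a'\<^sup>2" using ab by (simp add: power_divide)
  then have "(2 * (a' / b') * ip u v) * (b' / a') \<le> (2 * a'\<^sup>2) * (b' / a')"
    by (rule mult_right_mono) (use ab in simp)
  then have uv: "2 * ip u v \<le> 2 * (a' * b')" using ab by (simp add: power2_eq_square field_simps)
  have "ip (\<lambda>x. u x + 1 * v x) (\<lambda>x. u x + 1 * v x) \<le> (a' + b')\<^sup>2"
    unfolding G.ip_quad[OF H] using uu vv uv by (simp add: power2_sum)
  then have "sqrt (ip (\<lambda>x. u x + v x) (\<lambda>x. u x + v x)) \<le> a' + b'"
    using ab by (intro real_le_lsqrt) auto
  then show "sqrt (ip (\<lambda>x. u x + v x) (\<lambda>x. u x + v x)) \<le> a + b + e" by (simp add: a'_def b'_def)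
qed

lemma SB_f: "SB D f"
proof (rule SBI[OF f_measurable, of 1])
  fix x assume "x \<in> X"
  then show "\<bar>f x\<bar> \<le> 1 * Q D x" using f_bounded[of x] Q_ge1[of D x] by simp
qed simp

text \<open>On each slice the operator is an orthogonal projection onto combinations of the \<phi>.
  Bessel and best approximation hold slice by slice, and mixing integrates them over the outer
  variables.\<close>

lemma L2_tree_approx:
  fixes \<phi> :: "nat set \<Rightarrow> nat \<Rightarrow> (nat \<Rightarrow> real) \<Rightarrow> real" and b :: "nat \<Rightarrow> nat \<Rightarrow> real \<Rightarrow> real"
  assumes SB\<phi>: "\<And>\<alpha> k. \<alpha> \<in> nodes D S - {D} \<Longrightarrow> k < R \<Longrightarrow> SB \<alpha> (\<phi> \<alpha> k)"
    and dep: "\<And>\<alpha> k x y. \<alpha> \<in> nodes D S - {D} \<Longrightarrow> k < R \<Longrightarrow> x \<in> X \<Longrightarrow> y \<in> X \<Longrightarrow> (\<forall>\<nu>\<in>\<alpha>. x \<nu> = y \<nu>) \<Longrightarrow> \<phi> \<alpha> k x = \<phi> \<alpha> k y"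
    and leaf: "\<And>\<nu> k x. \<nu> \<in> D \<Longrightarrow> k < R \<Longrightarrow> x \<in> X \<Longrightarrow> \<phi> {\<nu>} k x = b \<nu> k (x \<nu>)"
    and V: "\<And>\<nu>. \<nu> \<in> D \<Longrightarrow> fun_vs.subspace (V \<nu>)" "\<And>\<nu> k. \<nu> \<in> D \<Longrightarrow> k < R \<Longrightarrow> b \<nu> k \<in> V \<nu>"
    and E: "E \<ge> 0" and appr: "\<And>\<alpha> x. \<alpha> \<in> nodes D S - {D} \<Longrightarrow> x \<in> X \<Longrightarrow>
       \<exists>c. (\<integral>y. (f (mg \<alpha> y x) - (\<Sum>k<R. c k * \<phi> \<alpha> k y))\<^sup>2 \<partial>M) \<le> E\<^sup>2"
  shows "\<exists>v\<in>tensor_space D V. (\<forall>\<alpha>\<in>nodes D S - {D}. node_rank D lo hi \<alpha> v \<le> enat R) \<and>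
     Lp_norm 2 M (\<lambda>x. f x - v x) \<le> ereal (real (card (nodes D S - {D})) * E)"
proof -
  let ?Nd = "nodes D S - {D}"
  have sub: "\<alpha> \<subseteq> D" if "\<alpha> \<in> ?Nd" for \<alpha> using nodeD(2) that by simp
  have \<phi>D: "SB D (\<phi> \<alpha> k)" if "\<alpha> \<in> ?Nd" "k < R" for \<alpha> k by (rule SB_D[OF SB\<phi>[OF that] sub[OF that(1)]])
  let ?P = "\<lambda>\<alpha> e. G.on R e \<and> (\<forall>i<R. \<exists>c. e i = (\<lambda>x. \<Sum>k<R. c k * \<phi> \<alpha> k x)) \<and>
    (\<forall>h\<in>{w. SB D w}. \<forall>c. ip (\<lambda>x. h x + - 1 * G.proj R e h x) (\<lambda>x. h x + - 1 * G.proj R e h x)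
       \<le> ip (\<lambda>x. h x + - 1 * (\<Sum>k<R. c k * \<phi> \<alpha> k x)) (\<lambda>x. h x + - 1 * (\<Sum>k<R. c k * \<phi> \<alpha> k x)))"
  have "\<exists>e. ?P \<alpha> e" if "\<alpha> \<in> ?Nd" for \<alpha>
    by (rule G.gram_schmidt) (use \<phi>D[OF that] in simp)
  then have "\<forall>\<alpha>\<in>?Nd. \<exists>e. ?P \<alpha> e" by (rule ballI)
  from bchoice[OF this] obtain e where e: "\<forall>\<alpha>\<in>?Nd. ?P \<alpha> (e \<alpha>)" ..
  have on: "G.on R (e \<alpha>)" if "\<alpha> \<in> ?Nd" for \<alpha> by (rule e[THEN bspec, OF that, THEN conjunct1])
  have ecomb: "\<exists>c. e \<alpha> i = (\<lambda>x. \<Sum>k<R. c k * \<phi> \<alpha> k x)" if "\<alpha> \<in> ?Nd" "i < R" for \<alpha> i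
    by (rule e[THEN bspec, OF that(1), THEN conjunct2, THEN conjunct1, THEN spec, THEN mp, OF that(2)])
  have ebest: "ip (\<lambda>x. h x + - 1 * G.proj R (e \<alpha>) h x) (\<lambda>x. h x + - 1 * G.proj R (e \<alpha>) h x)
       \<le> ip (\<lambda>x. h x + - 1 * (\<Sum>k<R. c k * \<phi> \<alpha> k x)) (\<lambda>x. h x + - 1 * (\<Sum>k<R. c k * \<phi> \<alpha> k x))"
    if "\<alpha> \<in> ?Nd" "SB D h" for \<alpha> h c
    by (rule e[THEN bspec, OF that(1), THEN conjunct2, THEN conjunct2, THEN bspec, THEN spec]) (use that(2) in simp)
  have SBe: "SB \<alpha> (e \<alpha> i)" if a: "\<alpha> \<in> ?Nd" "i < R" for \<alpha> i
  proof -
    from ecomb[OF a] obtain c where c: "e \<alpha> i = (\<lambda>x. \<Sum>k<R. c k * \<phi> \<alpha> k x)" ..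
    show ?thesis unfolding c by (rule SB_sum[OF sub[OF a(1)] SB\<phi>[OF a(1)]])
  qed
  have eD: "SB D (e \<alpha> i)" if "\<alpha> \<in> ?Nd" "i < R" for \<alpha> i by (rule SB_D[OF SBe[OF that] sub[OF that(1)]])
  have edep: "e \<alpha> i x = e \<alpha> i y" if a: "\<alpha> \<in> ?Nd" "i < R" and xy: "x \<in> X" "y \<in> X" "\<forall>\<nu>\<in>\<alpha>. x \<nu> = y \<nu>" for \<alpha> i x y
  proof -
    from ecomb[OF a] obtain c where c: "e \<alpha> i = (\<lambda>x. \<Sum>k<R. c k * \<phi> \<alpha> k x)" ..
    show ?thesis unfolding c
    proof (rule sum.cong[OF refl])
      fix k assume "k \<in> {..<R}"
      then have "\<phi> \<alpha> k x = \<phi> \<alpha> k y" by (intro dep[OF a(1) _ xy]) simp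
      then show "c k * \<phi> \<alpha> k x = c k * \<phi> \<alpha> k y" by simp
    qed
  qed
  \<comment> \<open>At a leaf the orthogonalised functions are combinations of the given basis;
    these coefficients define functions of one real variable that belong to
    \<open>V\<close>.\<close>
  have "\<forall>p\<in>D \<times> {..<R}. \<exists>c. e {fst p} (snd p) = (\<lambda>x. \<Sum>k<R. c k * \<phi> {fst p} k x)"
  proof
    fix p assume p: "p \<in> D \<times> {..<R}"
    have "{fst p} \<noteq> D" using card_D by auto
    then show "\<exists>c. e {fst p} (snd p) = (\<lambda>x. \<Sum>k<R. c k * \<phi> {fst p} k x)"
      using p singleton_node[of "fst p"] by (intro ecomb) auto
  qed
  from bchoice[OF this] obtain C where C: "\<forall>p\<in>D \<times> {..<R}. e {fst p} (snd p) = (\<lambda>x. \<Sum>k<R. C p k * \<phi> {fst p} k x)" ..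
  define \<epsilon> where "\<epsilon> \<nu> i = (\<lambda>t. \<Sum>k<R. C (\<nu>, i) k * b \<nu> k t)" for \<nu> i
  define L where "L \<alpha> i w = (\<integral>y. w y * e \<alpha> i y \<partial>M)" for \<alpha> i and w :: "(nat \<Rightarrow> real) \<Rightarrow> real"
  define small where "small w c \<longleftrightarrow> sqrt (ip w w) \<le> c" for w and c :: real
  have coefSB: "SB (D - \<alpha>) (\<lambda>x. L \<alpha> i (\<lambda>y. w (mg \<alpha> y x)))" if "\<alpha> \<in> ?Nd" "i < R" "SB D w" for \<alpha> i w
    unfolding L_def by (rule SB_coef[OF that(3) eD[OF that(1,2)] sub[OF that(1)]])
  have op_SB: "SB D (\<lambda>x. \<Sum>i<R. e \<alpha> i x * L \<alpha> i (\<lambda>y. w (mg \<alpha> y x)))" if a: "\<alpha> \<in> ?Nd" "SB D w" for \<alpha> w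
  proof -
    have "SB D (\<lambda>x. \<Sum>i<R. 1 * (\<lambda>x. e \<alpha> i x * L \<alpha> i (\<lambda>y. w (mg \<alpha> y x))) x)"
      by (rule SB_sum[OF order_refl]) (rule SB_prod[OF SBe[OF a(1)] coefSB[OF a(1) _ a(2)] sub[OF a(1)]])
    then show ?thesis by simp
  qed
  \<comment> \<open>Mixing twice keeps only the outermost choice, so the coefficients depend on the
    outer point \<open>x\<close> alone.\<close>
  have op_mg: "(\<Sum>i<R. e \<alpha> i (mg \<alpha> y x) * L \<alpha> i (\<lambda>z. w (mg \<alpha> z (mg \<alpha> y x)))) = G.proj R (e \<alpha>) (\<lambda>y. w (mg \<alpha> y x)) y"
    if a: "\<alpha> \<in> ?Nd" and x: "x \<in> X" and y: "y \<in> X" for \<alpha> w x y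
    unfolding G.proj_def
  proof (rule sum.cong[OF refl])
    fix i assume "i \<in> {..<R}"
    then have "e \<alpha> i (mg \<alpha> y x) = e \<alpha> i y"
      by (intro edep[OF a _ mg_cuboid[OF x y] y]) (auto simp: mg_def)
    then show "e \<alpha> i (mg \<alpha> y x) * L \<alpha> i (\<lambda>z. w (mg \<alpha> z (mg \<alpha> y x))) = ip (\<lambda>y. w (mg \<alpha> y x)) (e \<alpha> i) * e \<alpha> i y"
      unfolding mg_mg L_def ip_def by simp
  qed
  have ip_cong: "ip u u = ip v v" if "\<And>x. x \<in> X \<Longrightarrow> u x = v x" for u v
    unfolding ip_def by (rule Bochner_Integration.integral_cong[OF refl]) (use that space_M in simp)
  have contr: "ip (\<lambda>x. \<Sum>i<R. e \<alpha> i x * L \<alpha> i (\<lambda>y. w (mg \<alpha> y x))) (\<lambda>x. \<Sum>i<R. e \<alpha> i x * L \<alpha> i (\<lambda>y. w (mg \<alpha> y x))) \<le> ip w w"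
    if a: "\<alpha> \<in> ?Nd" and w: "SB D w" for \<alpha> w
  proof -
    define ow where "ow = (\<lambda>x. \<Sum>i<R. e \<alpha> i x * L \<alpha> i (\<lambda>y. w (mg \<alpha> y x)))"
    have ow: "SB D ow" unfolding ow_def by (rule op_SB[OF a w])
    have "ip ow ow = (\<integral>x. ip (\<lambda>y. ow (mg \<alpha> y x)) (\<lambda>y. ow (mg \<alpha> y x)) \<partial>M)" by (rule ip_mixing(2)[OF ow sub[OF a]])
    also have "\<dots> \<le> (\<integral>x. ip (\<lambda>y. w (mg \<alpha> y x)) (\<lambda>y. w (mg \<alpha> y x)) \<partial>M)"
    proof (rule integral_mono[OF ip_mixing(1)[OF ow sub[OF a]] ip_mixing(1)[OF w sub[OF a]]])
      fix x assume "x \<in> space M"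
      then have x: "x \<in> X" by (simp only: space_M)
      have "ip (\<lambda>y. ow (mg \<alpha> y x)) (\<lambda>y. ow (mg \<alpha> y x)) = ip (G.proj R (e \<alpha>) (\<lambda>y. w (mg \<alpha> y x))) (G.proj R (e \<alpha>) (\<lambda>y. w (mg \<alpha> y x)))"
        by (rule ip_cong) (unfold ow_def, rule op_mg[OF a x])
      also have "\<dots> \<le> ip (\<lambda>y. w (mg \<alpha> y x)) (\<lambda>y. w (mg \<alpha> y x))"
        by (rule G.bessel[OF on[OF a]]) (use SB_slice[OF w x sub[OF a]] in simp)
      finally show "ip (\<lambda>y. ow (mg \<alpha> y x)) (\<lambda>y. ow (mg \<alpha> y x)) \<le> ip (\<lambda>y. w (mg \<alpha> y x)) (\<lambda>y. w (mg \<alpha> y x))" .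
    qed
    also have "\<dots> = ip w w" by (rule ip_mixing(2)[OF w sub[OF a], symmetric])
    finally show ?thesis unfolding ow_def .
  qed
  \<comment> \<open>The bound holds for every outer point, and the total mass is 1, so averaging
    leaves it unchanged.\<close>
  have err: "ip (\<lambda>x. f x - (\<Sum>i<R. e \<alpha> i x * L \<alpha> i (\<lambda>y. f (mg \<alpha> y x)))) (\<lambda>x. f x - (\<Sum>i<R. e \<alpha> i x * L \<alpha> i (\<lambda>y. f (mg \<alpha> y x)))) \<le> E\<^sup>2"
    if a: "\<alpha> \<in> ?Nd" for \<alpha>
  proof -
    define d where "d = (\<lambda>x. f x + - 1 * (\<Sum>i<R. e \<alpha> i x * L \<alpha> i (\<lambda>y. f (mg \<alpha> y x))))"
    have d: "SB D d" unfolding d_def by (rule SB_lin[OF SB_f op_SB[OF a SB_f] order_refl])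
    have "ip d d = (\<integral>x. ip (\<lambda>y. d (mg \<alpha> y x)) (\<lambda>y. d (mg \<alpha> y x)) \<partial>M)" by (rule ip_mixing(2)[OF d sub[OF a]])
    also have "\<dots> \<le> (\<integral>x. E\<^sup>2 \<partial>M)"
    proof (rule integral_mono[OF ip_mixing(1)[OF d sub[OF a]]])
      fix x assume "x \<in> space M"
      then have x: "x \<in> X" by (simp only: space_M)
      let ?h = "\<lambda>y. f (mg \<alpha> y x)"
      from appr[OF a x] obtain c where c: "(\<integral>y. (?h y - (\<Sum>k<R. c k * \<phi> \<alpha> k y))\<^sup>2 \<partial>M) \<le> E\<^sup>2" ..
      have "ip (\<lambda>y. d (mg \<alpha> y x)) (\<lambda>y. d (mg \<alpha> y x)) = ip (\<lambda>y. ?h y + - 1 * G.proj R (e \<alpha>) ?h y) (\<lambda>y. ?h y + - 1 * G.proj R (e \<alpha>) ?h y)"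
        by (rule ip_cong) (simp only: d_def op_mg[OF a x])
      also have "\<dots> \<le> ip (\<lambda>y. ?h y + - 1 * (\<Sum>k<R. c k * \<phi> \<alpha> k y)) (\<lambda>y. ?h y + - 1 * (\<Sum>k<R. c k * \<phi> \<alpha> k y))"
        by (rule ebest[OF a SB_slice[OF SB_f x sub[OF a]]])
      also have "\<dots> \<le> E\<^sup>2" using c unfolding ip_def by (simp add: power2_eq_square)
      finally show "ip (\<lambda>y. d (mg \<alpha> y x)) (\<lambda>y. d (mg \<alpha> y x)) \<le> E\<^sup>2" .
    qed simp
    also have "\<dots> = E\<^sup>2" by (simp add: M.prob_space)
    finally show ?thesis unfolding d_def by simp
  qed
  have leafNd: "{\<nu>} \<in> ?Nd" if "\<nu> \<in> D" for \<nu> using singleton_node[OF that] card_D by auto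
  interpret A: approx_ops D S lo hi "{w. SB D w}" R e L small V \<epsilon>
  proof
    show "cuboid D lo hi \<noteq> {}" unfolding space_M[symmetric] by (rule M.not_empty)
    show "e \<alpha> i \<in> {w. SB D w}" if "\<alpha> \<in> ?Nd" "i < R" for \<alpha> i using eD[OF that] by simp
    show "e \<alpha> i x = e \<alpha> i y" if "\<alpha> \<in> ?Nd" "i < R" "x \<in> X" "y \<in> X" "\<forall>\<nu>\<in>\<alpha>. x \<nu> = y \<nu>" for \<alpha> i x y
      by (rule edep[OF that])
    show "e {\<nu>} i x = \<epsilon> \<nu> i (x \<nu>)" if n: "\<nu> \<in> D" "i < R" "x \<in> X" for \<nu> i x
    proof -
      have "(\<nu>, i) \<in> D \<times> {..<R}" using n by simp
      from C[THEN bspec, OF this] have "e {\<nu>} i x = (\<Sum>k<R. C (\<nu>, i) k * \<phi> {\<nu>} k x)" by simp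
      then show ?thesis unfolding \<epsilon>_def using leaf[OF n(1) _ n(3)] by simp
    qed
    show "\<epsilon> \<nu> i \<in> V \<nu>" if n: "\<nu> \<in> D" "i < R" for \<nu> i
    proof -
      have s: "fun_vs.span (V \<nu>) = V \<nu>" using V(1)[OF n(1)] by (simp only: fun_vs.span_eq_iff)
      have "\<epsilon> \<nu> i \<in> fun_vs.span (V \<nu>)"
        unfolding \<epsilon>_def by (rule span_sum_fun) (use V(2)[OF n(1)] fun_vs.span_base in auto)
      then show ?thesis unfolding s .
    qed
    show "(\<lambda>x. L \<alpha> i (\<lambda>y. w (mg \<alpha> y x))) \<in> {w. SB D w}" if "\<alpha> \<in> ?Nd" "i < R" "w \<in> {w. SB D w}" for \<alpha> i w
      using SB_D[OF coefSB[OF that(1,2)]] that(3) by simp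
    show "(\<lambda>x. \<Sum>i<R. e \<alpha> i x * L \<alpha> i (\<lambda>y. w (mg \<alpha> y x))) \<in> {w. SB D w}" if "\<alpha> \<in> ?Nd" "w \<in> {w. SB D w}" for \<alpha> w
      using op_SB[OF that(1)] that(2) by simp
    show "(\<lambda>x. w x - w' x) \<in> {w. SB D w}" if "w \<in> {w. SB D w}" "w' \<in> {w. SB D w}" for w w'
      using SB_lin[of D w w' "- 1"] that by simp
    show "L \<alpha> i (\<lambda>y. \<Sum>k\<in>I. c k * u k (mg \<alpha> y x)) = (\<Sum>k\<in>I. c k * L \<alpha> i (\<lambda>y. u k (mg \<alpha> y x)))"
      if a: "\<alpha> \<in> ?Nd" "i < R" and x: "x \<in> X" and I: "finite (I :: nat list set)" and u: "\<And>k. k \<in> I \<Longrightarrow> u k \<in> {w. SB D w}" for \<alpha> i x I u c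
    proof -
      have i: "integrable M (\<lambda>y. c k * (u k (mg \<alpha> y x) * e \<alpha> i y))" if "k \<in> I" for k
        by (rule integrable_mult_right[OF int_prod[OF SB_slice[OF _ x sub[OF a(1)]] eD[OF a]]]) (use u[OF that] in simp)
      have "L \<alpha> i (\<lambda>y. \<Sum>k\<in>I. c k * u k (mg \<alpha> y x)) = (\<integral>y. (\<Sum>k\<in>I. c k * (u k (mg \<alpha> y x) * e \<alpha> i y)) \<partial>M)"
        unfolding L_def sum_distrib_right by (simp only: mult.assoc)
      also have "\<dots> = (\<Sum>k\<in>I. \<integral>y. c k * (u k (mg \<alpha> y x) * e \<alpha> i y) \<partial>M)"
        by (rule Bochner_Integration.integral_sum[OF i])
      also have "\<dots> = (\<Sum>k\<in>I. c k * L \<alpha> i (\<lambda>y. u k (mg \<alpha> y x)))"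
        unfolding L_def by (simp only: integral_mult_right_zero)
      finally show ?thesis .
    qed
    show "L \<alpha> i w = L \<alpha> i w'" if "\<And>y. y \<in> X \<Longrightarrow> w y = w' y" for \<alpha> i w w'
      unfolding L_def by (rule Bochner_Integration.integral_cong[OF refl]) (use that space_M in simp)
    show "small (\<lambda>_. 0) 0" by (simp add: small_def ip_def)
    show "small w' c" if "\<And>x. x \<in> X \<Longrightarrow> w x = w' x" "small w c" for w w' c
      using that(2) ip_cong[of w w'] that(1) unfolding small_def by simp
    show "small (\<lambda>x. w x + w' x) (c + c')" if "w \<in> {w. SB D w}" "w' \<in> {w. SB D w}" "small w c" "small w' c'" for w w' c c'
      using minkowski[of w w' c c'] that unfolding small_def by simp
    show "small (\<lambda>x. \<Sum>i<R. e \<alpha> i x * L \<alpha> i (\<lambda>y. w (mg \<alpha> y x))) c" if "\<alpha> \<in> ?Nd" "w \<in> {w. SB D w}" "small w c" for \<alpha> w c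
      using order_trans[OF real_sqrt_le_mono[OF contr[of \<alpha> w]]] that unfolding small_def by simp
  qed
  have fE: "small (\<lambda>x. f x - A.opP \<alpha> f x) E" if "\<alpha> \<in> ?Nd" for \<alpha>
    unfolding A.opP_def small_def using real_sqrt_le_mono[OF err[OF that]] E by simp
  have fW: "f \<in> {w. SB D w}" using SB_f by simp
  from A.tree_approximation[OF fW fE] obtain v where v: "v \<in> tensor_space D V"
    "(\<forall>\<alpha>\<in>?Nd. node_rank D lo hi \<alpha> v \<le> enat R) \<and>
     (\<exists>w\<in>{w. SB D w}. (\<forall>x\<in>X. w x = v x) \<and> small (\<lambda>x. f x - w x) (real (card ?Nd) * E))" by (rule bexE)
  from v(2) obtain w where w: "SB D w" "\<And>x. x \<in> X \<Longrightarrow> w x = v x" "small (\<lambda>x. f x - w x) (real (card ?Nd) * E)" by blast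
  have fw: "SB D (\<lambda>x. f x + - 1 * w x)" by (rule SB_lin[OF SB_f w(1) order_refl])
  have "Lp_norm 2 M (\<lambda>x. f x - v x) \<le> ereal (real (card ?Nd) * E)"
  proof (rule Lp_norm_2_le)
    have eq: "f x - v x = f x + - 1 * w x" if "x \<in> space M" for x using w(2)[of x] that by (simp add: space_M)
    show "(\<lambda>x. f x - v x) \<in> borel_measurable M"
      using SB_meas[OF fw] eq by (subst measurable_cong) auto
    have i: "integrable M (\<lambda>x. (f x + - 1 * w x) * (f x + - 1 * w x))" by (rule int_prod[OF fw fw])
    show "integrable M (\<lambda>x. (f x - v x)\<^sup>2)"
      using i eq by (subst Bochner_Integration.integrable_cong[OF refl, where g = "\<lambda>x. (f x + - 1 * w x) * (f x + - 1 * w x)"])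
         (simp_all add: power2_eq_square)
    have "(\<integral>x. (f x - v x)\<^sup>2 \<partial>M) = ip (\<lambda>x. f x - w x) (\<lambda>x. f x - w x)"
      unfolding ip_def by (rule Bochner_Integration.integral_cong[OF refl]) (use eq in \<open>simp add: power2_eq_square\<close>)
    also have "\<dots> \<le> (real (card ?Nd) * E)\<^sup>2" by (rule sqrt_le_D) (use w(3) in \<open>simp add: small_def\<close>)
    finally show "(\<integral>x. (f x - v x)\<^sup>2 \<partial>M) \<le> (real (card ?Nd) * E)\<^sup>2" .
  qed (use E in simp)
  then show ?thesis using v by blast
qed

end

section \<open>Approximation in the supremum norm\<close>

lemma continuous_on_hat: "continuous_on A (hat a b n i)"
  unfolding hat_def[abs_def] divide_inverse by (intro continuous_intros)

lemma hat_in_piecewise_linear: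
  assumes "a < b" "n \<ge> 2"
  shows "(\<lambda>t. if t \<in> {a..b} then hat a b n i t else 0) \<in> piecewise_linear a b n"
proof -
  let ?u = "\<lambda>t. if t \<in> {a..b} then hat a b n i t else 0"
  define h where "h = (b - a) / real (n - 1)"
  have h: "h > 0" using assms by (simp add: h_def)
  have c: "continuous_on {a..b} ?u"
    using continuous_on_hat[of "{a..b}" a b n i] by (rule continuous_on_eq) simp
  have l: "\<exists>c e. \<forall>t\<in>{equispaced_node a b n k..equispaced_node a b n (Suc k)}. ?u t = c + e * t" if k: "k < n - 1" for k
  proof -
    let ?x = "equispaced_node a b n k"
    have sub: "{?x..equispaced_node a b n (Suc k)} \<subseteq> {a..b}"
      using equispaced_node_in[of a b n k] equispaced_node_in[of a b n "Suc k"] assms k by auto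
    have u: "?u t = (if i = k then 1 - (t - ?x) / h else if i = Suc k then (t - ?x) / h else 0)"
      if t: "t \<in> {?x..equispaced_node a b n (Suc k)}" for t
    proof -
      have "t = ?x + (t - ?x) / h * ((b - a) / real (n - 1))" using h unfolding h_def[symmetric] by simp
      moreover have "0 \<le> (t - ?x) / h" "(t - ?x) / h \<le> 1"
        using t h unfolding equispaced_node_Suc h_def[symmetric] by auto
      ultimately have "hat a b n i t = (if i = k then 1 - (t - ?x) / h else if i = Suc k then (t - ?x) / h else 0)"
        by (rule hat_eq[OF assms])
      then show ?thesis using sub t by auto
    qed
    consider "i = k" | "i = Suc k" | "i \<noteq> k" "i \<noteq> Suc k" by blast
    then show ?thesis
    proof cases
      case 1
      show ?thesis
        by (rule exI[of _ "1 + ?x / h"], rule exI[of _ "- 1 / h"], rule ballI, subst u) (use 1 h in \<open>auto simp: field_simps\<close>)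
    next
      case 2
      show ?thesis
        by (rule exI[of _ "- ?x / h"], rule exI[of _ "1 / h"], rule ballI, subst u) (use 2 h in \<open>auto simp: field_simps\<close>)
    next
      case 3
      show ?thesis
        by (rule exI[of _ 0], rule exI[of _ 0], rule ballI, subst u) (use 3 in auto)
    qed
  qed
  show ?thesis unfolding piecewise_linear_def using assms c l by simp
qed

text \<open>Interpolation reproduces piecewise linear functions, so the \<open>n\<close> hats span
  the space. The complexity count only requires this upper bound.\<close>

lemma dim_piecewise_linear_le:
  assumes "a < b" "n \<ge> 2"
  shows "fun_vs.dim (piecewise_linear a b n) \<le> n"
proof -
  define \<epsilon> where "\<epsilon> i = (\<lambda>t. if t \<in> {a..b} then hat a b n i t else 0)" for i
  have "u \<in> fun_vs.span (\<epsilon> ` {..<n})" if u: "u \<in> piecewise_linear a b n" for u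
  proof -
    have "u t = (\<Sum>i<n. u (equispaced_node a b n i) * \<epsilon> i t)" for t
    proof (cases "t \<in> {a..b}")
      case False
      then have "u t = 0" using u unfolding piecewise_linear_def by blast
      moreover have "\<epsilon> i t = 0" for i using False unfolding \<epsilon>_def by (rule if_not_P)
      ultimately show ?thesis by simp
    next
      case t: True
      define h where "h = (b - a) / real (n - 1)"
      have h: "h > 0" using assms by (simp add: h_def)
      obtain k \<theta> where k: "k < n - 1" "0 \<le> \<theta>" "\<theta> \<le> 1" "t = equispaced_node a b n k + \<theta> * ((b - a) / real (n - 1))"
        using equispaced_cell[OF assms t] by blast
      let ?x = "equispaced_node a b n k"
      have y: "equispaced_node a b n (Suc k) = ?x + h" unfolding equispaced_node_Suc h_def ..
      obtain c e where ce: "\<And>t. t \<in> {?x..?x + h} \<Longrightarrow> u t = c + e * t"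
        using u k(1) assms(2) unfolding piecewise_linear_def y[symmetric] by auto
      have th: "\<theta> * h \<le> 1 * h" by (rule mult_right_mono) (use k h in auto)
      have "u t = (1 - \<theta>) * u ?x + \<theta> * u (?x + h)"
        using k h th ce[of ?x] ce[of "?x + h"] ce[of t] unfolding h_def[symmetric] by (simp add: algebra_simps)
      also have "\<dots> = (\<Sum>i<n. u (equispaced_node a b n i) * hat a b n i t)"
        unfolding sum_hat[OF assms k(4,2,3,1)] y ..
      finally show ?thesis using t by (simp add: \<epsilon>_def)
    qed
    then have "u = (\<lambda>t. \<Sum>i<n. u (equispaced_node a b n i) * \<epsilon> i t)" by (rule ext)
    moreover have "(\<lambda>t. \<Sum>i<n. u (equispaced_node a b n i) * \<epsilon> i t) \<in> fun_vs.span (\<epsilon> ` {..<n})"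
      by (rule span_sum_fun) (auto intro: fun_vs.span_base)
    ultimately show ?thesis by simp
  qed
  then have "piecewise_linear a b n \<subseteq> fun_vs.span (\<epsilon> ` {..<n})" by blast
  from fun_vs.dim_le_card[OF this] have "fun_vs.dim (piecewise_linear a b n) \<le> card (\<epsilon> ` {..<n})" by simp
  also have "\<dots> \<le> n" using card_image_le[of "{..<n}" \<epsilon>] by simp
  finally show ?thesis .
qed

section \<open>Interpolation operators on the tree\<close>

context tree_fun begin

text \<open>For interpolation the inner point is fixed at a sample and the coefficient is a function
  of the outer point.\<close>

lemma mg_outer_measurable:
  assumes "w \<in> borel_measurable (unif_cuboid D lo hi)" "y \<in> X"
  shows "(\<lambda>x. w (mg \<alpha> y x)) \<in> borel_measurable (unif_cuboid D lo hi)"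
proof -
  have yi: "y i \<in> {lo i..hi i}" if "i \<in> D" for i using assms(2) that by (auto simp: cuboid_def)
  have "(\<lambda>x. mg \<alpha> y x) \<in> measurable (unif_cuboid D lo hi) (PiM D (\<lambda>i. unif (lo i) (hi i)))"
  proof (rule measurable_PiM_single')
    fix i assume i: "i \<in> D"
    show "(\<lambda>x. mg \<alpha> y x i) \<in> measurable (unif_cuboid D lo hi) (unif (lo i) (hi i))"
    proof (cases "i \<in> \<alpha>")
      case True
      then show ?thesis using yi[OF i] by (simp add: mg_def)
    next
      case False
      have "(\<lambda>x. x i) \<in> measurable (unif_cuboid D lo hi) (unif (lo i) (hi i))"
        unfolding unif_cuboid_def by (rule measurable_component_singleton[OF i])
      then show ?thesis using False by (simp add: mg_def)
    qed
  next
    show "(\<lambda>x. mg \<alpha> y x) \<in> space (unif_cuboid D lo hi) \<rightarrow> (\<Pi>\<^sub>E i\<in>D. space (unif (lo i) (hi i)))"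
    proof
      fix z assume "z \<in> space (unif_cuboid D lo hi)"
      then have "z \<in> X" by (simp only: space_M)
      from mg_cuboid[OF this assms(2), of \<alpha>] show "mg \<alpha> y z \<in> (\<Pi>\<^sub>E i\<in>D. space (unif (lo i) (hi i)))"
        by (simp only: space_unif cuboid_def)
    qed
  qed
  then have "(\<lambda>x. mg \<alpha> y x) \<in> measurable (unif_cuboid D lo hi) (unif_cuboid D lo hi)"
    by (simp only: unif_cuboid_def)
  from measurable_compose[OF this assms(1)] show ?thesis .
qed

lemma X_nonempty: "X \<noteq> {}"
  unfolding space_M[symmetric] by (rule prob_space.not_empty[OF prob_space_M])

text \<open>The values actually attained may form a proper subinterval of the given one.
  Interpolation nodes are placed in the attained interval, so that each is the value of some point
  of the box.\<close>

lemma g_image: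
  assumes "\<alpha> \<in> nodes D S" "\<alpha> \<noteq> D"
  shows "\<exists>a b. (\<lambda>x. g \<alpha> (restrict x \<alpha>)) ` X = {a..b}"
proof -
  have "compact ((\<lambda>x. g \<alpha> (restrict x \<alpha>)) ` X)" "connected ((\<lambda>x. g \<alpha> (restrict x \<alpha>)) ` X)"
    using g_cont[OF assms] compact_PiE_Icc[of D lo hi] connected_PiE_Icc[of D lo hi]
    unfolding cuboid_def by (auto intro: compact_continuous_image connected_continuous_image)
  then show ?thesis by (simp only: connected_compact_interval_1[symmetric])
qed

lemma g_image_leaf:
  assumes "\<nu> \<in> D"
  shows "(\<lambda>x. g {\<nu>} (restrict x {\<nu>})) ` X = {lo \<nu>..hi \<nu>}"
proof (intro set_eqI iffI)
  fix t assume "t \<in> (\<lambda>x. g {\<nu>} (restrict x {\<nu>})) ` X"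
  then show "t \<in> {lo \<nu>..hi \<nu>}" using g_leaf'[OF singleton_node[OF assms]] assms by (auto simp: cuboid_def)
next
  fix t assume t: "t \<in> {lo \<nu>..hi \<nu>}"
  obtain x where x: "x \<in> X" using X_nonempty by blast
  have "x(\<nu> := t) \<in> X" using x t assms by (auto simp: cuboid_def PiE_def Pi_def extensional_def)
  moreover have "g {\<nu>} (restrict (x(\<nu> := t)) {\<nu>}) = t"
    using g_leaf'[OF singleton_node[OF assms] calculation] by simp
  ultimately show "t \<in> (\<lambda>x. g {\<nu>} (restrict x {\<nu>})) ` X" by (metis image_eqI)
qed

text \<open>The functionals are evaluations at sample points and the basis functions form a
  nonnegative partition of unity, which gives a contraction in the supremum norm.\<close>

lemma sup_tree_approx:
  assumes s2: "s = 1 \<or> s = 2" and R: "R \<ge> 2" and K: "K \<ge> 0"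
    and slice: "\<And>\<alpha> x. \<alpha> \<in> nodes D S - {D} \<Longrightarrow> x \<in> X \<Longrightarrow>
      \<exists>G. (\<forall>y\<in>X. f (mg \<alpha> y x) = G (g \<alpha> (restrict y \<alpha>))) \<and> apx s (\<lambda>_. K) (ilo \<alpha>) (ihi \<alpha>) G"
  shows "\<exists>v\<in>tensor_space D (\<lambda>\<nu>. piecewise_linear (lo \<nu>) (hi \<nu>) R).
     (\<forall>\<alpha>\<in>nodes D S - {D}. node_rank D lo hi \<alpha> v \<le> enat R) \<and>
     Lp_norm \<infinity> (unif_cuboid D lo hi) (\<lambda>x. f x - v x) \<le> ereal (real (card (nodes D S - {D})) * (K * (\<Lambda> / real (R - 1)) ^ s))"
proof -
  let ?Nd = "nodes D S - {D}" and ?M = "unif_cuboid D lo hi"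
  define \<gamma> where "\<gamma> \<alpha> x = g \<alpha> (restrict x \<alpha>)" for \<alpha> x
  have "\<exists>ab. \<gamma> \<alpha> ` X = {fst ab..snd ab}" if "\<alpha> \<in> ?Nd" for \<alpha>
  proof -
    have "\<exists>a b. (\<lambda>x. g \<alpha> (restrict x \<alpha>)) ` X = {a..b}" by (rule g_image) (use that in auto)
    then obtain a b where "(\<lambda>x. g \<alpha> (restrict x \<alpha>)) ` X = {a..b}" by (elim exE)
    then show ?thesis unfolding \<gamma>_def[abs_def] by (intro exI[of _ "(a, b)"]) simp
  qed
  then have "\<forall>\<alpha>\<in>?Nd. \<exists>ab. \<gamma> \<alpha> ` X = {fst ab..snd ab}" by (rule ballI)
  from bchoice[OF this] obtain ab where ab: "\<forall>\<alpha>\<in>?Nd. \<gamma> \<alpha> ` X = {fst (ab \<alpha>)..snd (ab \<alpha>)}" ..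
  define a b where "a \<alpha> = fst (ab \<alpha>)" and "b \<alpha> = snd (ab \<alpha>)" for \<alpha>
  have img: "\<gamma> \<alpha> ` X = {a \<alpha>..b \<alpha>}" if "\<alpha> \<in> ?Nd" for \<alpha> unfolding a_def b_def by (rule ab[THEN bspec, OF that])
  have \<gamma>_in: "\<gamma> \<alpha> x \<in> {a \<alpha>..b \<alpha>}" if "\<alpha> \<in> ?Nd" "x \<in> X" for \<alpha> x
    unfolding img[OF that(1), symmetric] by (rule imageI[OF that(2)])
  have le: "a \<alpha> \<le> b \<alpha>" if \<alpha>: "\<alpha> \<in> ?Nd" for \<alpha>
  proof -
    obtain x where "x \<in> X" using X_nonempty by blast
    from \<gamma>_in[OF \<alpha> this] show ?thesis by simp
  qed
  have sub: "{a \<alpha>..b \<alpha>} \<subseteq> {ilo \<alpha>..ihi \<alpha>}" if "\<alpha> \<in> ?Nd" for \<alpha>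
    unfolding img[OF that, symmetric] \<gamma>_def using g_range[of \<alpha>] that by auto
  have lenab: "b \<alpha> - a \<alpha> \<le> \<Lambda>" if "\<alpha> \<in> ?Nd" for \<alpha>
    using sub[OF that] le[OF that] len[of \<alpha>] that by simp
  have leafab: "a {\<nu>} = lo \<nu>" "b {\<nu>} = hi \<nu>" if n: "\<nu> \<in> D" for \<nu>
  proof -
    have "{\<nu>} \<in> ?Nd" using singleton_node[OF n] card_D by auto
    then have "{a {\<nu>}..b {\<nu>}} = \<gamma> {\<nu>} ` X" by (rule img[symmetric])
    also have "\<dots> = {lo \<nu>..hi \<nu>}" unfolding \<gamma>_def[abs_def] by (rule g_image_leaf[OF n])
    finally have "{a {\<nu>}..b {\<nu>}} = {lo \<nu>..hi \<nu>}" .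
    then show "a {\<nu>} = lo \<nu>" "b {\<nu>} = hi \<nu>" using lo_less_hi[OF n] by (auto simp: Icc_eq_Icc)
  qed
  \<comment> \<open>A sample point for every node and every interpolation index.\<close>
  have "\<forall>p\<in>?Nd \<times> {..<R}. \<exists>y. y \<in> X \<and> \<gamma> (fst p) y = equispaced_node (a (fst p)) (b (fst p)) R (snd p)"
  proof
    fix p assume p: "p \<in> ?Nd \<times> {..<R}"
    then have \<alpha>: "fst p \<in> ?Nd" and i: "snd p < R" by auto
    have "equispaced_node (a (fst p)) (b (fst p)) R (snd p) \<in> \<gamma> (fst p) ` X"
      unfolding img[OF \<alpha>] by (rule equispaced_node_in[OF le[OF \<alpha>] R i])
    then show "\<exists>y. y \<in> X \<and> \<gamma> (fst p) y = equispaced_node (a (fst p)) (b (fst p)) R (snd p)" by auto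
  qed
  from bchoice[OF this] obtain yy where yy: "\<forall>p\<in>?Nd \<times> {..<R}. yy p \<in> X \<and> \<gamma> (fst p) (yy p) = equispaced_node (a (fst p)) (b (fst p)) R (snd p)" ..
  have yX: "yy (\<alpha>, i) \<in> X" and y\<gamma>: "\<gamma> \<alpha> (yy (\<alpha>, i)) = equispaced_node (a \<alpha>) (b \<alpha>) R i" if "\<alpha> \<in> ?Nd" "i < R" for \<alpha> i
    using yy[THEN bspec, of "(\<alpha>, i)"] that by simp_all
  \<comment> \<open>A constant inner function makes the interval degenerate. Division by zero would
    then turn every hat into 1 and spoil the partition of unity, so a single constant takes over and
    is exact.\<close>
  define e where "e \<alpha> i x = (if a \<alpha> < b \<alpha> then hat (a \<alpha>) (b \<alpha>) R i (\<gamma> \<alpha> x) else if i = 0 then 1 else 0)" for \<alpha> i x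
  have e0: "e \<alpha> i x \<ge> 0" for \<alpha> i x by (simp add: e_def hat_nonneg)
  have e1: "(\<Sum>i<R. e \<alpha> i x) = 1" if "\<alpha> \<in> ?Nd" "x \<in> X" for \<alpha> x
  proof (cases "a \<alpha> < b \<alpha>")
    case True
    then show ?thesis unfolding e_def if_P[OF True] by (rule sum_hat_eq_1[OF _ R \<gamma>_in[OF that]])
  next
    case False
    have "(\<Sum>i<R. e \<alpha> i x) = (\<Sum>i<R. if i = 0 then 1 else 0)" unfolding e_def if_not_P[OF False] ..
    also have "\<dots> = 1" using R by simp
    finally show ?thesis .
  qed
  have em: "e \<alpha> i \<in> borel_measurable ?M" if "\<alpha> \<in> ?Nd" for \<alpha> i
  proof (cases "a \<alpha> < b \<alpha>")
    case True
    have "hat (a \<alpha>) (b \<alpha>) R i \<in> borel_measurable borel" by (rule borel_measurable_continuous_onI[OF continuous_on_hat])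
    moreover have "\<gamma> \<alpha> \<in> borel_measurable ?M" unfolding \<gamma>_def[abs_def] by (rule g_measurable) (use that in auto)
    ultimately have "(\<lambda>x. hat (a \<alpha>) (b \<alpha>) R i (\<gamma> \<alpha> x)) \<in> borel_measurable ?M" by (rule measurable_compose[rotated])
    then show ?thesis unfolding e_def[abs_def] if_P[OF True] .
  next
    case False
    show ?thesis unfolding e_def[abs_def] if_not_P[OF False] by (rule borel_measurable_const)
  qed
  define L where "L \<alpha> i w = w (yy (\<alpha>, i))" for \<alpha> i and w :: "(nat \<Rightarrow> real) \<Rightarrow> real"
  define small where "small w c \<longleftrightarrow> (\<forall>x\<in>X. \<bar>w x\<bar> \<le> c)" for w and c :: real
  define \<epsilon> where "\<epsilon> \<nu> i = (\<lambda>t. if t \<in> {lo \<nu>..hi \<nu>} then hat (lo \<nu>) (hi \<nu>) R i t else 0)" for \<nu> i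
  have coefW: "(\<lambda>x. L \<alpha> i (\<lambda>y. w (mg \<alpha> y x))) \<in> borel_measurable ?M" if "\<alpha> \<in> ?Nd" "i < R" "w \<in> borel_measurable ?M" for \<alpha> i w
    unfolding L_def by (rule mg_outer_measurable[OF that(3) yX[OF that(1,2)]])
  interpret A: approx_ops D S lo hi "borel_measurable ?M" R e L small "\<lambda>\<nu>. piecewise_linear (lo \<nu>) (hi \<nu>) R" \<epsilon>
  proof
    show "cuboid D lo hi \<noteq> {}" by (rule X_nonempty)
    show "e \<alpha> i \<in> borel_measurable ?M" if "\<alpha> \<in> ?Nd" "i < R" for \<alpha> i by (rule em[OF that(1)])
    show "e \<alpha> i x = e \<alpha> i y" if "\<alpha> \<in> ?Nd" "i < R" "x \<in> X" "y \<in> X" "\<forall>\<nu>\<in>\<alpha>. x \<nu> = y \<nu>" for \<alpha> i x y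
    proof -
      have "restrict x \<alpha> = restrict y \<alpha>" by (rule restrict_ext) (rule that(5)[THEN bspec])
      then show ?thesis unfolding e_def \<gamma>_def by (simp only:)
    qed
    show "e {\<nu>} i x = \<epsilon> \<nu> i (x \<nu>)" if n: "\<nu> \<in> D" "i < R" "x \<in> X" for \<nu> i x
    proof -
      have "\<gamma> {\<nu>} x = x \<nu>" unfolding \<gamma>_def by (rule g_leaf'[OF singleton_node[OF n(1)] n(3)])
      moreover have "x \<nu> \<in> {lo \<nu>..hi \<nu>}" using n by (auto simp: cuboid_def)
      ultimately show ?thesis using lo_less_hi[OF n(1)] by (simp add: e_def \<epsilon>_def leafab[OF n(1)])
    qed
    show "\<epsilon> \<nu> i \<in> piecewise_linear (lo \<nu>) (hi \<nu>) R" if n: "\<nu> \<in> D" "i < R" for \<nu> i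
      unfolding \<epsilon>_def by (rule hat_in_piecewise_linear[OF _ R]) (use lo_less_hi[OF n(1)] in simp)
    show "(\<lambda>x. L \<alpha> i (\<lambda>y. w (mg \<alpha> y x))) \<in> borel_measurable ?M" if "\<alpha> \<in> ?Nd" "i < R" "w \<in> borel_measurable ?M" for \<alpha> i w
      by (rule coefW[OF that])
    show "(\<lambda>x. \<Sum>i<R. e \<alpha> i x * L \<alpha> i (\<lambda>y. w (mg \<alpha> y x))) \<in> borel_measurable ?M" if "\<alpha> \<in> ?Nd" "w \<in> borel_measurable ?M" for \<alpha> w
      by (rule borel_measurable_sum, rule borel_measurable_times[OF em[OF that(1)] coefW[OF that(1) _ that(2)]]) simp
    show "(\<lambda>x. w x - w' x) \<in> borel_measurable ?M" if "w \<in> borel_measurable ?M" "w' \<in> borel_measurable ?M" for w w' :: "(nat \<Rightarrow> real) \<Rightarrow> real"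
      by (rule borel_measurable_diff[OF that])
    show "L \<alpha> i (\<lambda>y. \<Sum>k\<in>I. c k * u k (mg \<alpha> y x)) = (\<Sum>k\<in>I. c k * L \<alpha> i (\<lambda>y. u k (mg \<alpha> y x)))"
      for \<alpha> i x and I :: "nat list set" and u c unfolding L_def ..
    show "L \<alpha> i w = L \<alpha> i w'" if "\<alpha> \<in> ?Nd" "i < R" "\<And>y. y \<in> X \<Longrightarrow> w y = w' y" for \<alpha> i w w'
      unfolding L_def by (rule that(3)[OF yX[OF that(1,2)]])
    show "small (\<lambda>_. 0) 0" by (simp add: small_def)
    show "small w' c" if "\<And>x. x \<in> X \<Longrightarrow> w x = w' x" "small w c" for w w' c
      using that(2) that(1)[symmetric] unfolding small_def by simp
    show "small (\<lambda>x. w x + w' x) (c + c')" if "small w c" "small w' c'" for w w' c c'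
      unfolding small_def
    proof
      fix x assume "x \<in> X"
      then have "\<bar>w x\<bar> \<le> c" "\<bar>w' x\<bar> \<le> c'" using that unfolding small_def by auto
      then show "\<bar>w x + w' x\<bar> \<le> c + c'" by linarith
    qed
    show "small (\<lambda>x. \<Sum>i<R. e \<alpha> i x * L \<alpha> i (\<lambda>y. w (mg \<alpha> y x))) c" if \<alpha>: "\<alpha> \<in> ?Nd" and w: "small w c" for \<alpha> w c
      unfolding small_def
    proof
      fix x assume x: "x \<in> X"
      have "\<bar>\<Sum>i<R. e \<alpha> i x * L \<alpha> i (\<lambda>y. w (mg \<alpha> y x))\<bar> \<le> (\<Sum>i<R. \<bar>e \<alpha> i x * L \<alpha> i (\<lambda>y. w (mg \<alpha> y x))\<bar>)"
        by (rule sum_abs)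
      also have "\<dots> \<le> (\<Sum>i<R. e \<alpha> i x * c)"
      proof (rule sum_mono)
        fix i assume "i \<in> {..<R}"
        then have "mg \<alpha> (yy (\<alpha>, i)) x \<in> X" using mg_cuboid[OF x yX[OF \<alpha>, of i]] by simp
        then have "\<bar>L \<alpha> i (\<lambda>y. w (mg \<alpha> y x))\<bar> \<le> c" using w unfolding small_def L_def by (rule bspec[rotated])
        from mult_left_mono[OF this e0[of \<alpha> i x]]
        show "\<bar>e \<alpha> i x * L \<alpha> i (\<lambda>y. w (mg \<alpha> y x))\<bar> \<le> e \<alpha> i x * c"
          unfolding abs_mult abs_of_nonneg[OF e0] .
      qed
      also have "\<dots> = c" unfolding sum_distrib_right[symmetric] e1[OF \<alpha> x] by simp
      finally show "\<bar>\<Sum>i<R. e \<alpha> i x * L \<alpha> i (\<lambda>y. w (mg \<alpha> y x))\<bar> \<le> c" .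
    qed
  qed
  have fE: "small (\<lambda>x. f x - A.opP \<alpha> f x) (K * (\<Lambda> / real (R - 1)) ^ s)" if \<alpha>: "\<alpha> \<in> ?Nd" for \<alpha>
    unfolding small_def
  proof
    fix x assume x: "x \<in> X"
    from slice[OF \<alpha> x] obtain G where G0: "(\<forall>y\<in>X. f (mg \<alpha> y x) = G (g \<alpha> (restrict y \<alpha>))) \<and> apx s (\<lambda>_. K) (ilo \<alpha>) (ihi \<alpha>) G" ..
    have G: "f (mg \<alpha> y x) = G (\<gamma> \<alpha> y)" if "y \<in> X" for y
      unfolding \<gamma>_def by (rule G0[THEN conjunct1, THEN bspec, OF that])
    have aG: "apx s (\<lambda>_. K) (a \<alpha>) (b \<alpha>) G" by (rule apx_mono[OF G0[THEN conjunct2] _ sub[OF \<alpha>]]) simp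
    have "mg \<alpha> x x = x" by (simp add: mg_def)
    with G[OF x] have fx: "f x = G (\<gamma> \<alpha> x)" by simp
    have op: "A.opP \<alpha> f x = (\<Sum>i<R. e \<alpha> i x * G (equispaced_node (a \<alpha>) (b \<alpha>) R i))"
      unfolding A.opP_def L_def
    proof (rule sum.cong[OF refl])
      fix i assume "i \<in> {..<R}"
      then have i: "i < R" by simp
      show "e \<alpha> i x * f (mg \<alpha> (yy (\<alpha>, i)) x) = e \<alpha> i x * G (equispaced_node (a \<alpha>) (b \<alpha>) R i)"
        unfolding G[OF yX[OF \<alpha> i]] y\<gamma>[OF \<alpha> i] ..
    qed
    show "\<bar>f x - A.opP \<alpha> f x\<bar> \<le> K * (\<Lambda> / real (R - 1)) ^ s"
    proof (cases "a \<alpha> < b \<alpha>")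
      case True
      have "A.opP \<alpha> f x = (\<Sum>i<R. G (equispaced_node (a \<alpha>) (b \<alpha>) R i) * hat (a \<alpha>) (b \<alpha>) R i (\<gamma> \<alpha> x))"
        unfolding op e_def if_P[OF True] by (simp only: mult.commute)
      then have "\<bar>f x - A.opP \<alpha> f x\<bar> \<le> K * ((b \<alpha> - a \<alpha>) / real (R - 1)) ^ s"
        unfolding fx using hat_interpolation_error[OF aG True R s2 \<gamma>_in[OF \<alpha> x]] by simp
      also have "\<dots> \<le> K * (\<Lambda> / real (R - 1)) ^ s"
        using lenab[OF \<alpha>] le[OF \<alpha>] by (intro mult_left_mono[OF _ K] power_mono divide_right_mono) auto
      finally show ?thesis .
    next
      case False
      then have eq: "a \<alpha> = b \<alpha>" using le[OF \<alpha>] by simp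
      have "\<gamma> \<alpha> x = a \<alpha>" using \<gamma>_in[OF \<alpha> x] eq by simp
      moreover have "A.opP \<alpha> f x = (\<Sum>i<R. if i = 0 then G (a \<alpha>) else 0)"
        unfolding op e_def if_not_P[OF False] by (rule sum.cong) (simp_all add: equispaced_node_def)
      moreover have "(\<Sum>i<R. if i = 0 then G (a \<alpha>) else 0) = G (a \<alpha>)" using R by simp
      ultimately have "\<bar>f x - A.opP \<alpha> f x\<bar> = 0" unfolding fx by simp
      moreover have "0 \<le> \<Lambda>" using lenab[OF \<alpha>] le[OF \<alpha>] by simp
      ultimately show ?thesis using K by simp
    qed
  qed
  from A.tree_approximation[OF f_measurable fE] obtain v where v: "v \<in> tensor_space D (\<lambda>\<nu>. piecewise_linear (lo \<nu>) (hi \<nu>) R)"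
    "(\<forall>\<alpha>\<in>?Nd. node_rank D lo hi \<alpha> v \<le> enat R) \<and>
     (\<exists>w\<in>borel_measurable ?M. (\<forall>x\<in>X. w x = v x) \<and> small (\<lambda>x. f x - w x) (real (card ?Nd) * (K * (\<Lambda> / real (R - 1)) ^ s)))" by (rule bexE)
  from v(2)[THEN conjunct2] obtain w where wm: "w \<in> borel_measurable ?M"
    and w: "(\<forall>x\<in>X. w x = v x) \<and> small (\<lambda>x. f x - w x) (real (card ?Nd) * (K * (\<Lambda> / real (R - 1)) ^ s))" by (rule bexE)
  have bd: "\<bar>f x - v x\<bar> \<le> real (card ?Nd) * (K * (\<Lambda> / real (R - 1)) ^ s)" if "x \<in> X" for x
    using w that unfolding small_def by auto
  have vm: "v \<in> borel_measurable ?M"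
    using wm w by (subst measurable_cong[of _ _ w]) (simp_all add: space_M)
  have "Lp_norm \<infinity> ?M (\<lambda>x. f x - v x) \<le> ereal (real (card ?Nd) * (K * (\<Lambda> / real (R - 1)) ^ s))"
    unfolding Lp_norm_def if_P[OF refl]
  proof (rule esssup_I)
    have "(\<lambda>x. \<bar>f x - v x\<bar>) \<in> borel_measurable ?M" by (intro borel_measurable_abs borel_measurable_diff f_measurable vm)
    then show "(\<lambda>x. ereal \<bar>f x - v x\<bar>) \<in> borel_measurable ?M" by (rule borel_measurable_ereal)
    show "AE x in ?M. ereal \<bar>f x - v x\<bar> \<le> ereal (real (card ?Nd) * (K * (\<Lambda> / real (R - 1)) ^ s))"
    proof (rule AE_I2)
      fix x assume "x \<in> space ?M"
      then have "x \<in> X" by (simp only: space_M)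
      then show "ereal \<bar>f x - v x\<bar> \<le> ereal (real (card ?Nd) * (K * (\<Lambda> / real (R - 1)) ^ s))"
        unfolding ereal_less_eq by (rule bd)
    qed
  qed
  then show ?thesis using v by auto
qed

end

section \<open>Error bounds with explicit rank\<close>

lemma span_image_coeffs:
  fixes b :: "nat \<Rightarrow> 'a \<Rightarrow> real"
  assumes "v \<in> fun_vs.span (b ` {..<n})"
  shows "\<exists>c. v = (\<lambda>x. \<Sum>k<n. c k * b k x)"
proof -
  let ?W = "{v. \<exists>c. v = (\<lambda>x. \<Sum>k<n. c k * b k x)}"
  have "fun_vs.span (b ` {..<n}) \<subseteq> ?W"
  proof (rule fun_vs.span_minimal)
    show "b ` {..<n} \<subseteq> ?W"
    proof (rule image_subsetI)
      fix j assume "j \<in> {..<n}"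
      then have j: "j < n" by simp
      have "b j x = (\<Sum>k<n. (if k = j then 1 else 0) * b k x)" for x
      proof -
        have "(\<Sum>k<n. (if k = j then 1 else 0) * b k x) = (\<Sum>k<n. if k = j then b k x else 0)"
          by (rule sum.cong) simp_all
        then show ?thesis using j by simp
      qed
      then have "b j = (\<lambda>x. \<Sum>k<n. (if k = j then 1 else 0) * b k x)" by (rule ext)
      then show "b j \<in> ?W" by (intro CollectI) (rule exI)
    qed
    show "fun_vs.subspace ?W"
    proof (rule fun_vs.subspaceI)
      have "0 = (\<lambda>x. \<Sum>k<n. 0 * b k x)" by (simp add: zero_fun_def)
      then show "0 \<in> ?W" by (intro CollectI) (rule exI)
    next
      fix u w assume "u \<in> ?W" "w \<in> ?W"
      then obtain c d where "u = (\<lambda>x. \<Sum>k<n. c k * b k x)" "w = (\<lambda>x. \<Sum>k<n. d k * b k x)" by auto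
      then have "u + w = (\<lambda>x. \<Sum>k<n. (c k + d k) * b k x)"
        by (simp add: plus_fun_def sum.distrib distrib_right)
      then show "u + w \<in> ?W" by (intro CollectI) (rule exI)
    next
      fix a u assume "u \<in> ?W"
      then obtain c where "u = (\<lambda>x. \<Sum>k<n. c k * b k x)" by auto
      then have "fscale a u = (\<lambda>x. \<Sum>k<n. (a * c k) * b k x)"
        by (simp add: fscale_def sum_distrib_left mult.assoc)
      then show "fscale a u \<in> ?W" by (intro CollectI) (rule exI)
    qed
  qed
  from subsetD[OF this assms] show ?thesis by (rule CollectD)
qed

lemma integrable_square_add:
  fixes f g :: "'a \<Rightarrow> real"
  assumes "f \<in> borel_measurable M" "g \<in> borel_measurable M" "integrable M (\<lambda>x. (f x)\<^sup>2)" "integrable M (\<lambda>x. (g x)\<^sup>2)"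
  shows "integrable M (\<lambda>x. (f x + g x)\<^sup>2)"
proof (rule Bochner_Integration.integrable_bound)
  show "integrable M (\<lambda>x. 2 * (f x)\<^sup>2 + 2 * (g x)\<^sup>2)" using assms by simp
  show "(\<lambda>x. (f x + g x)\<^sup>2) \<in> borel_measurable M" using assms by measurable
  show "AE x in M. norm ((f x + g x)\<^sup>2) \<le> norm (2 * (f x)\<^sup>2 + 2 * (g x)\<^sup>2)"
  proof (rule AE_I2)
    fix x
    have "(f x + g x)\<^sup>2 \<le> 2 * (f x)\<^sup>2 + 2 * (g x)\<^sup>2"
      using zero_le_power2[of "f x - g x"] unfolding power2_diff power2_sum by linarith
    then show "norm ((f x + g x)\<^sup>2) \<le> norm (2 * (f x)\<^sup>2 + 2 * (g x)\<^sup>2)" by simp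
  qed
qed

lemma L2_subspace_basis:
  assumes V: "L2_subspace a b n V" and n: "n \<ge> 1"
  shows "\<exists>\<beta>. (\<forall>k<n. \<beta> k \<in> V) \<and> (\<forall>v\<in>V. \<exists>c. v = (\<lambda>t. \<Sum>k<n. c k * \<beta> k t))"
proof -
  obtain Bs where Bs: "Bs \<subseteq> V" "V \<subseteq> fun_vs.span Bs" "card Bs = fun_vs.dim V"
    by (rule fun_vs.basis_exists[of V])
  have card: "card Bs = n" using Bs(3) V unfolding L2_subspace_def by simp
  then have "finite Bs" using n by (intro card_ge_0_finite) simp
  from ex_bij_betw_nat_finite[OF this] obtain \<beta> where "bij_betw \<beta> {0..<card Bs} Bs" ..
  then have im: "\<beta> ` {..<n} = Bs" unfolding card atLeast0LessThan by (rule bij_betw_imp_surj_on)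
  have "\<exists>c. v = (\<lambda>t. \<Sum>k<n. c k * \<beta> k t)" if "v \<in> V" for v
    by (rule span_image_coeffs) (use that Bs(2) im in auto)
  moreover have "\<beta> k \<in> V" if "k < n" for k using that im Bs(1) by auto
  ultimately show ?thesis by (intro exI[of _ \<beta>] conjI allI impI ballI)
qed

text \<open>A crude bound that may depend on \<open>i\<close>; it only places the functions in the
  dominated class and does not enter the constants.\<close>

lemma pw_poly_bounded:
  assumes "t \<in> {a..b}" "q \<ge> 1" "s \<ge> 1"
  shows "\<bar>pw_poly s a b q i t\<bar> \<le> (1 + (b - a) + real i * (b - a)) ^ s"
proof -
  let ?Z = "1 + (b - a) + real i * (b - a)"
  have ab: "b - a \<ge> 0" using assms(1) by simp
  have "real i * (b - a) \<ge> 0" using ab by (intro mult_nonneg_nonneg) simp_all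
  then have Z1: "?Z \<ge> 1" using ab by linarith
  have "real (i div s) * (b - a) / real q \<le> real i * (b - a) / 1"
    using assms ab by (intro frac_le mult_right_mono) auto
  moreover have "real (i div s) * (b - a) / real q \<ge> 0" using ab by simp
  ultimately have "\<bar>t - (a + real (i div s) * (b - a) / real q)\<bar> \<le> ?Z" using assms(1) unfolding atLeastAtMost_iff by linarith
  then have "\<bar>t - (a + real (i div s) * (b - a) / real q)\<bar> ^ (i mod s) \<le> ?Z ^ (i mod s)"
    by (rule power_mono) simp
  also have "\<dots> \<le> ?Z ^ s"
    by (rule power_increasing) (use Z1 assms(3) in \<open>auto intro: less_imp_le\<close>)
  finally show ?thesis using Z1 by (simp add: pw_poly_def power_abs)
qed

section \<open>Error bounds for slices and leaves\<close>

context tree_fun begin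

text \<open>Simplifies \<open>chain_bound\<close> to one bound for all nodes and orders, using m + 1
  \<le> L, k - 1 \<le> s and k m \<le> s L. Being an s-th power, it enters the rank with exponent
  1.\<close>

lemma tree_slice:
  assumes C: "C \<ge> 1" "\<And>m b b' c d a0 a1 H u. 1 \<le> b \<Longrightarrow> 1 \<le> b' \<Longrightarrow> apx s (chain_bound C b b' m) c d H \<Longrightarrow>
     inner_apx s b b' a0 a1 c d u \<Longrightarrow> u ` {a0..a1} \<subseteq> {c..d} \<Longrightarrow> 1 \<le> s \<Longrightarrow>
     apx s (chain_bound C b b' (Suc m)) a0 a1 (\<lambda>t. H (u t))"
    and \<alpha>: "\<alpha> \<in> nodes D S - {D}" and x: "x \<in> X" and L: "depth D S \<le> L"
  shows "\<exists>G. (\<forall>y\<in>X. f (mg \<alpha> y x) = G (g \<alpha> (restrict y \<alpha>))) \<and>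
     apx s (\<lambda>_. (C * real L * B 1 ^ L * B_star s B) ^ s) (ilo \<alpha>) (ihi \<alpha>) G"
proof -
  have reach: "(D, \<alpha>) \<in> {(\<gamma>, \<beta>). \<beta> \<in> S \<gamma>} ^^ node_level D S \<alpha>" and le: "node_level D S \<alpha> \<le> depth D S"
    using node_reach \<alpha> by auto
  have "node_level D S \<alpha> \<noteq> 0" using reach \<alpha> by (cases "node_level D S \<alpha>") auto
  then obtain m where m: "node_level D S \<alpha> = Suc m" by (cases "node_level D S \<alpha>") auto
  have "\<exists>G. (\<forall>y\<in>X. f (mg \<alpha> y x) = G (g \<alpha> (restrict y \<alpha>))) \<and>
     apx s (chain_bound C (B 1) (B_star s B) m) (ilo \<alpha>) (ihi \<alpha>) G"
    by (rule path_slice[OF C(1) _ reach[unfolded m] x]) (rule C(2); assumption)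
  then obtain G where G: "(\<forall>y\<in>X. f (mg \<alpha> y x) = G (g \<alpha> (restrict y \<alpha>))) \<and>
     apx s (chain_bound C (B 1) (B_star s B) m) (ilo \<alpha>) (ihi \<alpha>) G" ..
  have B1: "1 \<le> B 1" using B s by auto
  have Bs: "1 \<le> B_star s B"
  proof (cases "2 \<le> s")
    case True
    have "B 1 \<le> Max (B ` {1..s})" using s by (intro Max_ge) auto
    with B1 have "1 \<le> Max (B ` {1..s})" by (rule order_trans)
    then show ?thesis unfolding B_star_def if_P[OF True] .
  qed (simp add: B_star_def)
  have mL: "real (m + 1) \<le> real L" using le m L by simp
  have L1: "1 \<le> real L" using mL by simp
  have "chain_bound C (B 1) (B_star s B) m k \<le> (C * real L * B 1 ^ L * B_star s B) ^ s" if k: "k \<le> s" for k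
  proof -
    have "C ^ (k - 1) * real (m + 1) ^ (k - 1) * B 1 ^ (k * m) * B_star s B ^ (k - 1)
      \<le> C ^ s * real L ^ s * B 1 ^ (L * s) * B_star s B ^ s"
    proof (intro mult_mono)
      show "C ^ (k - 1) \<le> C ^ s" using C(1) k by (intro power_increasing) auto
      show "B_star s B ^ (k - 1) \<le> B_star s B ^ s" using Bs k by (intro power_increasing) auto
      have "real (m + 1) ^ (k - 1) \<le> real L ^ (k - 1)" using mL by (intro power_mono) auto
      also have "\<dots> \<le> real L ^ s" using L1 k by (intro power_increasing) auto
      finally show "real (m + 1) ^ (k - 1) \<le> real L ^ s" .
      have "k * m \<le> L * s" using mult_le_mono[OF k, of m L] mL by (simp add: mult.commute)
      then show "B 1 ^ (k * m) \<le> B 1 ^ (L * s)" using B1 by (intro power_increasing) auto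
    qed (use C(1) B1 Bs in auto)
    then show ?thesis by (simp only: chain_bound_def power_mult_distrib power_mult)
  qed
  from apx_mono[OF G[THEN conjunct2] this order_refl]
  have "apx s (\<lambda>_. (C * real L * B 1 ^ L * B_star s B) ^ s) (ilo \<alpha>) (ihi \<alpha>) G" .
  then show ?thesis using G[THEN conjunct1] by (intro exI[of _ G] conjI)
qed

lemma distr_component:
  assumes "\<nu> \<in> D"
  shows "distr (unif_cuboid D lo hi) (unif (lo \<nu>) (hi \<nu>)) (\<lambda>x. x \<nu>) = unif (lo \<nu>) (hi \<nu>)"
  unfolding unif_cuboid_def by (rule distr_PiM_component[OF _ assms]) (use prob_space_unif lo_less_hi in blast)

lemma component_measurable:
  assumes "\<nu> \<in> D"
  shows "(\<lambda>x. x \<nu>) \<in> measurable (unif_cuboid D lo hi) (unif (lo \<nu>) (hi \<nu>))"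
  unfolding unif_cuboid_def by (rule measurable_component_singleton[OF assms])

text \<open>The slice at a leaf is only a uniform limit of smooth functions, so the Jackson estimate
  is applied to an approximant \<open>h\<close>, and G - h is added in the mean square.\<close>

lemma leaf_approx:
  assumes \<nu>: "\<nu> \<in> D" and J: "jackson M s (lo \<nu>) (hi \<nu>) R V" and L2: "L2_subspace (lo \<nu>) (hi \<nu>) R V"
    and R: "R \<ge> 1" and K: "K \<ge> 1" and G: "apx s (\<lambda>_. K) (lo \<nu>) (hi \<nu>) G"
  shows "\<exists>v\<in>V. (\<integral>y. (G (y \<nu>) - v (y \<nu>))\<^sup>2 \<partial>unif_cuboid D lo hi) \<le> ((2 * \<bar>M\<bar> * sqrt (real (s + 1)) + 2) * K / real R ^ s)\<^sup>2"
proof -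
  let ?u = "unif (lo \<nu>) (hi \<nu>)"
  have ab: "lo \<nu> < hi \<nu>" using lo_less_hi[OF \<nu>] by simp
  have rs: "real R ^ s > 0" using R by simp
  \<comment> \<open>Serves twice: as accuracy of the smooth approximant and as margin above the
    infimum, which may not be attained. In 2 T + 2 \<eta> it produces the summand 2 of the
    constant.\<close>
  define \<eta> where "\<eta> = K / (2 * real R ^ s)"
  define T where "T = \<bar>M\<bar> * sqrt (real (s + 1)) * K / real R ^ s + \<eta>"
  have \<eta>: "\<eta> > 0" using K rs by (simp add: \<eta>_def)
  have T0: "T \<ge> 0" using \<eta> K rs by (simp add: T_def)
  obtain h where h: "smooth_real h"
    "\<forall>t\<in>{lo \<nu>..hi \<nu>}. \<bar>h t - G t\<bar> \<le> \<eta> \<and> (\<forall>k\<le>s. \<bar>(deriv ^^ k) h t\<bar> \<le> K)"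
    using apxD[OF G \<eta>] by blast
  have hK: "\<bar>(deriv ^^ k) h t\<bar> \<le> K" if "t \<in> {lo \<nu>..hi \<nu>}" "k \<le> s" for t k using h(2) that by blast
  have K0: "0 \<le> K" using K by simp
  note Hs = Hs_norm_smooth[OF h(1) ab hK K0]
  have powr: "real R powr - real s = 1 / real R ^ s"
    using R by (simp add: powr_minus powr_realpow divide_inverse)
  have Hs0: "0 \<le> Hs_norm (lo \<nu>) (hi \<nu>) s h" unfolding Hs_norm_def by (intro real_sqrt_ge_zero sum_nonneg) simp
  have "M * real R powr - real s * Hs_norm (lo \<nu>) (hi \<nu>) s h \<le> \<bar>M\<bar> * (1 / real R ^ s) * (sqrt (real (s + 1)) * K)"
    unfolding powr using Hs(2) Hs0 rs by (intro mult_mono) auto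
  also have "\<dots> < T" using \<eta> by (simp add: T_def mult_ac)
  finally have lt: "ereal (M * real R powr - real s * Hs_norm (lo \<nu>) (hi \<nu>) s h) < ereal T" by simp
  have "(INF v\<in>V. Lp_norm 2 ?u (\<lambda>t. h t - v t)) \<le> ereal (M * real R powr - real s * Hs_norm (lo \<nu>) (hi \<nu>) s h)"
    using J Hs(1) unfolding jackson_def by blast
  then have "(INF v\<in>V. Lp_norm 2 ?u (\<lambda>t. h t - v t)) < ereal T" using lt by (rule le_less_trans)
  then obtain v where v: "v \<in> V" "Lp_norm 2 ?u (\<lambda>t. h t - v t) < ereal T" unfolding INF_less_iff by blast
  note n = Lp_norm_2_less_top[OF disjI1, OF v(2)]
  have "sqrt (\<integral>t. (h t - v t)\<^sup>2 \<partial>?u) < T" using v(2) unfolding n(3) by simp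
  then have I: "(\<integral>t. (h t - v t)\<^sup>2 \<partial>?u) \<le> T\<^sup>2" by (intro sqrt_le_D) simp
  have m: "(\<lambda>t. (h t - v t)\<^sup>2) \<in> borel_measurable ?u" using n(1) by measurable
  have i': "integrable (unif_cuboid D lo hi) (\<lambda>y. (h (y \<nu>) - v (y \<nu>))\<^sup>2)"
    using integrable_distr_eq[OF component_measurable[OF \<nu>] m] n(2) unfolding distr_component[OF \<nu>] by simp
  have I': "(\<integral>y. (h (y \<nu>) - v (y \<nu>))\<^sup>2 \<partial>unif_cuboid D lo hi) = (\<integral>t. (h t - v t)\<^sup>2 \<partial>?u)"
    using integral_distr[OF component_measurable[OF \<nu>] m] unfolding distr_component[OF \<nu>] by simp
  interpret PM: prob_space "unif_cuboid D lo hi" by (rule prob_space_M)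
  have "(\<integral>y. (G (y \<nu>) - v (y \<nu>))\<^sup>2 \<partial>unif_cuboid D lo hi) \<le> (\<integral>y. 2 * (h (y \<nu>) - v (y \<nu>))\<^sup>2 + 2 * \<eta>\<^sup>2 \<partial>unif_cuboid D lo hi)"
  proof (rule integral_mono')
    show "integrable (unif_cuboid D lo hi) (\<lambda>y. 2 * (h (y \<nu>) - v (y \<nu>))\<^sup>2 + 2 * \<eta>\<^sup>2)" using i' by simp
    fix y assume "y \<in> space (unif_cuboid D lo hi)"
    then have "y \<nu> \<in> {lo \<nu>..hi \<nu>}" using \<nu> unfolding space_M cuboid_def by auto
    then have "\<bar>h (y \<nu>) - G (y \<nu>)\<bar> \<le> \<eta>" using h(2) by blast
    then have "(h (y \<nu>) - G (y \<nu>))\<^sup>2 \<le> \<eta>\<^sup>2" using power_mono[of "\<bar>h (y \<nu>) - G (y \<nu>)\<bar>" \<eta> 2] by simp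
    moreover have "(G (y \<nu>) - v (y \<nu>))\<^sup>2 \<le> 2 * (h (y \<nu>) - v (y \<nu>))\<^sup>2 + 2 * (h (y \<nu>) - G (y \<nu>))\<^sup>2"
      using zero_le_power2[of "(h (y \<nu>) - v (y \<nu>)) + (h (y \<nu>) - G (y \<nu>))"]
      by (simp add: power2_eq_square algebra_simps)
    ultimately show "(G (y \<nu>) - v (y \<nu>))\<^sup>2 \<le> 2 * (h (y \<nu>) - v (y \<nu>))\<^sup>2 + 2 * \<eta>\<^sup>2" by linarith
  qed simp
  also have "\<dots> = 2 * (\<integral>y. (h (y \<nu>) - v (y \<nu>))\<^sup>2 \<partial>unif_cuboid D lo hi) + 2 * \<eta>\<^sup>2"
    using i' by (simp add: PM.prob_space)
  also have "\<dots> \<le> 2 * T\<^sup>2 + 2 * \<eta>\<^sup>2" unfolding I' using I by simp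
  also have "\<dots> \<le> (2 * T + 2 * \<eta>)\<^sup>2"
    using T0 \<eta> by (simp add: power2_sum power_mult_distrib)
  also have "2 * T + 2 * \<eta> = (2 * \<bar>M\<bar> * sqrt (real (s + 1)) + 2) * K / real R ^ s"
    using rs by (simp add: T_def \<eta>_def field_simps)
  finally show ?thesis using v(1) by blast
qed

text \<open>At inner nodes the \<open>R\<close> functions are polynomials of degree below
  \<open>s\<close> on 2 q cells, at leaves a basis of the given space of dimension \<open>R\<close>;
  hence the shape of \<open>R\<close>.\<close>

lemma L2_tree_bound:
  assumes U: "\<And>\<nu>. \<nu> \<in> D \<Longrightarrow> L2_subspace (lo \<nu>) (hi \<nu>) R (U \<nu>) \<and> jackson M s (lo \<nu>) (hi \<nu>) R (U \<nu>)"
    and q: "q \<ge> 1" and R: "R = 2 * q * s" and K: "K \<ge> 1"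
    and slice: "\<And>\<alpha> x. \<alpha> \<in> nodes D S - {D} \<Longrightarrow> x \<in> X \<Longrightarrow>
      \<exists>G. (\<forall>y\<in>X. f (mg \<alpha> y x) = G (g \<alpha> (restrict y \<alpha>))) \<and> apx s (\<lambda>_. K) (ilo \<alpha>) (ihi \<alpha>) G"
  shows "\<exists>v\<in>tensor_space D U. (\<forall>\<alpha>\<in>nodes D S - {D}. node_rank D lo hi \<alpha> v \<le> enat R) \<and>
     Lp_norm 2 (unif_cuboid D lo hi) (\<lambda>x. f x - v x) \<le>
       ereal (real (card (nodes D S - {D})) * ((2 * (2 * \<bar>\<Lambda>\<bar> * real s) ^ s + 2 * \<bar>M\<bar> * sqrt (real (s + 1)) + 2) * K / real R ^ s))"
proof -
  let ?Nd = "nodes D S - {D}"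
  define E where "E = (2 * (2 * \<bar>\<Lambda>\<bar> * real s) ^ s + 2 * \<bar>M\<bar> * sqrt (real (s + 1)) + 2) * K / real R ^ s"
  have R1: "R \<ge> 1" using q s R by simp
  have rs: "real R ^ s > 0" using R1 by simp
  have "\<forall>\<nu>\<in>D. \<exists>\<beta>. (\<forall>k<R. \<beta> k \<in> U \<nu>) \<and> (\<forall>v\<in>U \<nu>. \<exists>c. v = (\<lambda>t. \<Sum>k<R. c k * \<beta> k t))"
  proof
    fix \<nu> assume n: "\<nu> \<in> D"
    show "\<exists>\<beta>. (\<forall>k<R. \<beta> k \<in> U \<nu>) \<and> (\<forall>v\<in>U \<nu>. \<exists>c. v = (\<lambda>t. \<Sum>k<R. c k * \<beta> k t))"
      by (rule L2_subspace_basis[OF U[OF n, THEN conjunct1] R1])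
  qed
  from bchoice[OF this] obtain b where b: "\<forall>\<nu>\<in>D. (\<forall>k<R. b \<nu> k \<in> U \<nu>) \<and> (\<forall>v\<in>U \<nu>. \<exists>c. v = (\<lambda>t. \<Sum>k<R. c k * b \<nu> k t))" ..
  have bU: "b \<nu> k \<in> U \<nu>" if "\<nu> \<in> D" "k < R" for \<nu> k using b[THEN bspec, OF that(1), THEN conjunct1] that(2) by simp
  have bspan: "\<exists>c. v = (\<lambda>t. \<Sum>k<R. c k * b \<nu> k t)" if "\<nu> \<in> D" "v \<in> U \<nu>" for \<nu> v
    by (rule b[THEN bspec, OF that(1), THEN conjunct2, THEN bspec, OF that(2)])
  have bL: "b \<nu> k \<in> borel_measurable (unif (lo \<nu>) (hi \<nu>)) \<and> integrable (unif (lo \<nu>) (hi \<nu>)) (\<lambda>t. (b \<nu> k t)\<^sup>2)" if n: "\<nu> \<in> D" "k < R" for \<nu> k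
  proof -
    have "Lp_norm 2 (unif (lo \<nu>) (hi \<nu>)) (b \<nu> k) < \<infinity>" using U[OF n(1)] bU[OF n] unfolding L2_subspace_def by blast
    then have "Lp_norm 2 (unif (lo \<nu>) (hi \<nu>)) (b \<nu> k) < ereal 0 \<or> Lp_norm 2 (unif (lo \<nu>) (hi \<nu>)) (b \<nu> k) \<le> ereal 0 \<or> Lp_norm 2 (unif (lo \<nu>) (hi \<nu>)) (b \<nu> k) < \<infinity>" by simp
    from Lp_norm_2_less_top(1,2)[OF this] show ?thesis by simp
  qed
  \<comment> \<open>Dominates every basis function of the leaf; it is square integrable as a finite
    sum and at least 1, as the weights must be.\<close>
  define qq where "qq \<nu> t = 1 + (\<Sum>k<R. \<bar>b \<nu> k t\<bar>)" for \<nu> t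
  have qn: "(\<lambda>t. 1 + (\<Sum>k<n. \<bar>b \<nu> k t\<bar>)) \<in> borel_measurable (unif (lo \<nu>) (hi \<nu>)) \<and>
      integrable (unif (lo \<nu>) (hi \<nu>)) (\<lambda>t. (1 + (\<Sum>k<n. \<bar>b \<nu> k t\<bar>))\<^sup>2)" if n: "\<nu> \<in> D" "n \<le> R" for \<nu> n
    using n(2)
  proof (induction n)
    case 0
    interpret u: prob_space "unif (lo \<nu>) (hi \<nu>)" by (rule prob_space_unif) (use lo_less_hi[OF n(1)] in simp)
    show ?case by simp
  next
    case (Suc j)
    have j: "j < R" using Suc.prems by simp
    note IH = Suc.IH[OF less_imp_le[OF j]]
    have m: "(\<lambda>t. \<bar>b \<nu> j t\<bar>) \<in> borel_measurable (unif (lo \<nu>) (hi \<nu>))"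
      by (rule borel_measurable_abs[OF bL[OF n(1) j, THEN conjunct1]])
    have i: "integrable (unif (lo \<nu>) (hi \<nu>)) (\<lambda>t. \<bar>b \<nu> j t\<bar>\<^sup>2)"
      unfolding power2_abs by (rule bL[OF n(1) j, THEN conjunct2])
    have eq: "1 + (\<Sum>k<Suc j. \<bar>b \<nu> k t\<bar>) = (1 + (\<Sum>k<j. \<bar>b \<nu> k t\<bar>)) + \<bar>b \<nu> j t\<bar>" for t by simp
    show ?case unfolding eq
      by (rule conjI, rule borel_measurable_add[OF IH[THEN conjunct1] m],
          rule integrable_square_add[OF IH[THEN conjunct1] m IH[THEN conjunct2] i])
  qed
  interpret Q: L2_fun D S lo hi \<Lambda> s B ilo ihi fs f g qq
  proof
    show "1 \<le> qq \<nu> t" for \<nu> t unfolding qq_def by (simp add: sum_nonneg)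
    show "qq \<nu> \<in> borel_measurable (unif (lo \<nu>) (hi \<nu>))" if "\<nu> \<in> D" for \<nu>
      using qn[OF that order_refl] unfolding qq_def[abs_def] by (rule conjunct1)
    show "integrable (unif (lo \<nu>) (hi \<nu>)) (\<lambda>t. (qq \<nu> t)\<^sup>2)" if "\<nu> \<in> D" for \<nu>
      using qn[OF that order_refl] unfolding qq_def by (rule conjunct2)
  qed
  \<comment> \<open>The approximating functions see the variables of an inner node only through the
    number \<open>g \<alpha>\<close>.\<close>
  define \<phi> where "\<phi> \<alpha> k x = (if is_singleton \<alpha> then b (the_elem \<alpha>) k (x (the_elem \<alpha>))
     else pw_poly s (ilo \<alpha>) (ihi \<alpha>) (2 * q) k (g \<alpha> (restrict x \<alpha>)))" for \<alpha> k x
  have \<phi>1: "\<phi> {\<nu>} k x = b \<nu> k (x \<nu>)" for \<nu> k x by (simp add: \<phi>_def is_singleton_def)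
  have \<phi>2: "\<phi> \<alpha> k x = pw_poly s (ilo \<alpha>) (ihi \<alpha>) (2 * q) k (g \<alpha> (restrict x \<alpha>))" if "\<not> is_singleton \<alpha>" for \<alpha> k x
    using that by (simp add: \<phi>_def)
  have sub: "\<alpha> \<subseteq> D" if "\<alpha> \<in> ?Nd" for \<alpha> using nodeD(2) that by simp
  have E0: "0 \<le> E" using K rs by (simp add: E_def)
  show ?thesis unfolding E_def[symmetric]
  proof (rule Q.L2_tree_approx[where \<phi> = \<phi> and b = b])
    fix \<alpha> k assume \<alpha>: "\<alpha> \<in> ?Nd" and k: "k < R"
    show "Q.SB \<alpha> (\<phi> \<alpha> k)"
    proof (cases "is_singleton \<alpha>")
      case True
      then obtain \<nu> where \<nu>: "\<alpha> = {\<nu>}" unfolding is_singleton_def by blast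
      have n: "\<nu> \<in> D" using sub[OF \<alpha>] \<nu> by simp
      show ?thesis
      proof (rule Q.SBI[of _ 1])
        show "\<phi> \<alpha> k \<in> borel_measurable Q.M"
          unfolding \<nu> \<phi>1[abs_def] by (rule measurable_compose[OF component_measurable[OF n] bL[OF n k, THEN conjunct1]])
        fix x
        have "\<bar>b \<nu> k (x \<nu>)\<bar> \<le> (\<Sum>k<R. \<bar>b \<nu> k (x \<nu>)\<bar>)" by (rule member_le_sum) (use k in auto)
        then show "\<bar>\<phi> \<alpha> k x\<bar> \<le> 1 * Q.Q \<alpha> x" unfolding \<nu> \<phi>1 Q.Q_def by (simp add: qq_def)
      qed simp
    next
      case False
      show ?thesis
      proof (rule Q.SBI)
        show "\<phi> \<alpha> k \<in> borel_measurable Q.M"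
          unfolding \<phi>2[OF False, abs_def] by (rule measurable_compose[OF g_measurable pw_poly_measurable]) (use \<alpha> in auto)
        show "0 \<le> (1 + (ihi \<alpha> - ilo \<alpha>) + real k * (ihi \<alpha> - ilo \<alpha>)) ^ s"
          using len[of \<alpha>] \<alpha> by (intro zero_le_power) auto
        fix x assume x: "x \<in> X"
        have gr: "g \<alpha> (restrict x \<alpha>) \<in> {ilo \<alpha>..ihi \<alpha>}" by (rule g_range[OF _ _ x]) (use \<alpha> in auto)
        have b1: "\<bar>\<phi> \<alpha> k x\<bar> \<le> (1 + (ihi \<alpha> - ilo \<alpha>) + real k * (ihi \<alpha> - ilo \<alpha>)) ^ s" (is "_ \<le> ?c")
          unfolding \<phi>2[OF False] by (rule pw_poly_bounded[OF gr _ s]) (use q in simp)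
        also have "?c = ?c * 1" by simp
        also have "\<dots> \<le> ?c * Q.Q \<alpha> x"
          by (rule mult_left_mono[OF Q.Q_ge1[OF sub[OF \<alpha>]] order_trans[OF abs_ge_zero b1]])
        finally show "\<bar>\<phi> \<alpha> k x\<bar> \<le> ?c * Q.Q \<alpha> x" .
      qed
    qed
  next
    fix \<alpha> k x y assume \<alpha>: "\<alpha> \<in> ?Nd" and xy: "x \<in> X" "y \<in> X" "\<forall>\<nu>\<in>\<alpha>. x \<nu> = y \<nu>"
    show "\<phi> \<alpha> k x = \<phi> \<alpha> k y"
    proof (cases "is_singleton \<alpha>")
      case True
      then obtain \<nu> where \<nu>: "\<alpha> = {\<nu>}" unfolding is_singleton_def by blast
      show ?thesis using xy(3) unfolding \<nu> \<phi>1 by simp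
    next
      case False
      have "restrict x \<alpha> = restrict y \<alpha>" by (rule restrict_ext) (rule xy(3)[THEN bspec])
      then show ?thesis unfolding \<phi>2[OF False] by (simp only:)
    qed
  next
    show "\<phi> {\<nu>} k x = b \<nu> k (x \<nu>)" for \<nu> k x by (rule \<phi>1)
    show "fun_vs.subspace (U \<nu>)" if "\<nu> \<in> D" for \<nu> using U[OF that] unfolding L2_subspace_def by blast
    show "b \<nu> k \<in> U \<nu>" if "\<nu> \<in> D" "k < R" for \<nu> k by (rule bU[OF that])
    show "0 \<le> E" by (rule E0)
  next
    fix \<alpha> x assume \<alpha>: "\<alpha> \<in> ?Nd" and x: "x \<in> X"
    from slice[OF this] obtain G where G0: "(\<forall>y\<in>X. f (mg \<alpha> y x) = G (g \<alpha> (restrict y \<alpha>))) \<and> apx s (\<lambda>_. K) (ilo \<alpha>) (ihi \<alpha>) G" ..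
    have G: "f (mg \<alpha> y x) = G (g \<alpha> (restrict y \<alpha>))" if "y \<in> X" for y by (rule G0[THEN conjunct1, THEN bspec, OF that])
    show "\<exists>c. (\<integral>y. (f (mg \<alpha> y x) - (\<Sum>k<R. c k * \<phi> \<alpha> k y))\<^sup>2 \<partial>Q.M) \<le> E\<^sup>2"
    proof (cases "is_singleton \<alpha>")
      case True
      then obtain \<nu> where \<nu>: "\<alpha> = {\<nu>}" unfolding is_singleton_def by blast
      have n: "\<nu> \<in> D" using sub[OF \<alpha>] \<nu> by simp
      have "apx s (\<lambda>_. K) (lo \<nu>) (hi \<nu>) G" using G0 leaf[OF n] unfolding \<nu> by simp
      from leaf_approx[OF n U[OF n, THEN conjunct2] U[OF n, THEN conjunct1] R1 K this]
      obtain v where v: "v \<in> U \<nu>"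
        "(\<integral>y. (G (y \<nu>) - v (y \<nu>))\<^sup>2 \<partial>Q.M) \<le> ((2 * \<bar>M\<bar> * sqrt (real (s + 1)) + 2) * K / real R ^ s)\<^sup>2" ..
      from bspan[OF n v(1)] obtain c where c: "v = (\<lambda>t. \<Sum>k<R. c k * b \<nu> k t)" ..
      have "(\<integral>y. (f (mg \<alpha> y x) - (\<Sum>k<R. c k * \<phi> \<alpha> k y))\<^sup>2 \<partial>Q.M) = (\<integral>y. (G (y \<nu>) - v (y \<nu>))\<^sup>2 \<partial>Q.M)"
      proof (rule Bochner_Integration.integral_cong[OF refl])
        fix y assume "y \<in> space Q.M"
        then have y: "y \<in> X" by (simp only: space_M)
        show "(f (mg \<alpha> y x) - (\<Sum>k<R. c k * \<phi> \<alpha> k y))\<^sup>2 = (G (y \<nu>) - v (y \<nu>))\<^sup>2"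
          unfolding G[OF y] unfolding \<nu> g_leaf'[OF singleton_node[OF n] y] \<phi>1 c ..
      qed
      also note v(2)
      also have "((2 * \<bar>M\<bar> * sqrt (real (s + 1)) + 2) * K / real R ^ s)\<^sup>2 \<le> E\<^sup>2"
        unfolding E_def using K rs by (intro power_mono divide_right_mono mult_right_mono) auto
      finally show ?thesis by (rule exI[of _ c])
    next
      case False
      have ab: "ilo \<alpha> < ihi \<alpha>" "ihi \<alpha> - ilo \<alpha> \<le> \<Lambda>" using len[of \<alpha>] \<alpha> by auto
      have "1 \<le> 2 * q" "K > 0" using q K by auto
      from pw_poly_approx[OF G0[THEN conjunct2] ab(1) s this] obtain c where
        c: "\<forall>t\<in>{ilo \<alpha>..ihi \<alpha>}. \<bar>G t - (\<Sum>i<2 * q * s. c i * pw_poly s (ilo \<alpha>) (ihi \<alpha>) (2 * q) i t)\<bar> \<le> 2 * K * ((ihi \<alpha> - ilo \<alpha>) / real (2 * q)) ^ s" ..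
      have "2 * K * ((ihi \<alpha> - ilo \<alpha>) / real (2 * q)) ^ s \<le> 2 * K * (2 * \<bar>\<Lambda>\<bar> * real s / real R) ^ s"
      proof (intro mult_left_mono power_mono)
        have "(ihi \<alpha> - ilo \<alpha>) / real (2 * q) \<le> (2 * \<bar>\<Lambda>\<bar>) / real (2 * q)"
          using ab by (intro divide_right_mono) auto
        also have "\<dots> = 2 * \<bar>\<Lambda>\<bar> * real s / real R" using q s by (simp add: R)
        finally show "(ihi \<alpha> - ilo \<alpha>) / real (2 * q) \<le> 2 * \<bar>\<Lambda>\<bar> * real s / real R" .
      qed (use K ab in auto)
      also have "\<dots> \<le> E" unfolding E_def power_divide using K rs
        by (simp add: divide_right_mono distrib_right distrib_left)
      finally have le: "2 * K * ((ihi \<alpha> - ilo \<alpha>) / real (2 * q)) ^ s \<le> E" .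
      have "(\<integral>y. (f (mg \<alpha> y x) - (\<Sum>k<R. c k * \<phi> \<alpha> k y))\<^sup>2 \<partial>Q.M) \<le> (\<integral>y. E\<^sup>2 \<partial>Q.M)"
      proof (rule integral_mono')
        fix y assume "y \<in> space Q.M"
        then have y: "y \<in> X" by (simp only: space_M)
        have gr: "g \<alpha> (restrict y \<alpha>) \<in> {ilo \<alpha>..ihi \<alpha>}" by (rule g_range[OF _ _ y]) (use \<alpha> in auto)
        have "\<bar>f (mg \<alpha> y x) - (\<Sum>k<R. c k * \<phi> \<alpha> k y)\<bar> \<le> E"
          unfolding G[OF y] \<phi>2[OF False] R by (rule order_trans[OF c[THEN bspec, OF gr] le])
        then show "(f (mg \<alpha> y x) - (\<Sum>k<R. c k * \<phi> \<alpha> k y))\<^sup>2 \<le> E\<^sup>2"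
          by (rule abs_le_square_iff[THEN iffD1, OF order_trans[OF _ abs_ge_self]])
      qed simp_all
      also have "\<dots> = E\<^sup>2" by (simp add: Q.M.prob_space)
      finally show ?thesis by (rule exI[of _ c])
    qed
  qed
qed

text \<open>Both norms are brought to the same rank \<open>R\<close> and the same error constant, so
  that the choice of the rank is made once.\<close>

lemma tree_bound:
  assumes p: "p = 2 \<or> (p = \<infinity> \<and> s \<le> 2)" and A: "approximation_spaces p s M D lo hi U"
    and q: "q \<ge> 1" and R: "R = 2 * q * s" and K: "K \<ge> 1"
    and slice: "\<And>\<alpha> x. \<alpha> \<in> nodes D S - {D} \<Longrightarrow> x \<in> X \<Longrightarrow>
      \<exists>G. (\<forall>y\<in>X. f (mg \<alpha> y x) = G (g \<alpha> (restrict y \<alpha>))) \<and> apx s (\<lambda>_. K) (ilo \<alpha>) (ihi \<alpha>) G"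
  shows "\<exists>v\<in>tensor_space D (\<lambda>\<nu>. U \<nu> R). (\<forall>\<alpha>\<in>nodes D S - {D}. node_rank D lo hi \<alpha> v \<le> enat R) \<and>
     Lp_norm p (unif_cuboid D lo hi) (\<lambda>x. f x - v x) \<le>
       ereal (real (card (nodes D S - {D})) * ((2 * (2 * \<bar>\<Lambda>\<bar> * real s) ^ s + 2 * \<bar>M\<bar> * sqrt (real (s + 1)) + 2) * K / real R ^ s))"
    and "\<forall>\<nu>\<in>D. fun_vs.dim (U \<nu> R) \<le> R"
proof -
  let ?c0 = "2 * (2 * \<bar>\<Lambda>\<bar> * real s) ^ s + 2 * \<bar>M\<bar> * sqrt (real (s + 1)) + 2"
  \<comment> \<open>The factor 2 in \<open>R\<close> guarantees two interpolation nodes even for q =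
    s = 1.\<close>
  have R2: "R \<ge> 2" using q s R by (cases q; cases s) auto
  have "(\<exists>v\<in>tensor_space D (\<lambda>\<nu>. U \<nu> R). (\<forall>\<alpha>\<in>nodes D S - {D}. node_rank D lo hi \<alpha> v \<le> enat R) \<and>
     Lp_norm p (unif_cuboid D lo hi) (\<lambda>x. f x - v x) \<le> ereal (real (card (nodes D S - {D})) * (?c0 * K / real R ^ s))) \<and>
     (\<forall>\<nu>\<in>D. fun_vs.dim (U \<nu> R) \<le> R)"
  proof (cases "p = \<infinity>")
    case True
    have U: "U \<nu> R = piecewise_linear (lo \<nu>) (hi \<nu>) R" if "\<nu> \<in> D" for \<nu>
      using A that R2 True unfolding approximation_spaces_def by auto
    have s2: "s = 1 \<or> s = 2" using p True s by auto
    have ts: "tensor_space D (\<lambda>\<nu>. U \<nu> R) = tensor_space D (\<lambda>\<nu>. piecewise_linear (lo \<nu>) (hi \<nu>) R)"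
      unfolding tensor_space_def using U by (intro arg_cong[where f = fun_vs.span]) auto
    have K0: "0 \<le> K" using K by simp
    from sup_tree_approx[OF s2 R2 K0 slice] obtain v where v: "v \<in> tensor_space D (\<lambda>\<nu>. U \<nu> R)"
      "(\<forall>\<alpha>\<in>nodes D S - {D}. node_rank D lo hi \<alpha> v \<le> enat R) \<and>
       Lp_norm \<infinity> (unif_cuboid D lo hi) (\<lambda>x. f x - v x) \<le> ereal (real (card (nodes D S - {D})) * (K * (\<Lambda> / real (R - 1)) ^ s))"
      unfolding ts by (rule bexE)
    \<comment> \<open>\<open>R\<close> nodes bound only R - 1 cells; the loss is at most a factor 2,
      provided for in the constant by 2 \<bar>\<Lambda>\<bar>.\<close>
    have R1: "real (R - 1) \<ge> real R / 2" using R2 by simp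
    obtain \<nu> where "\<nu> \<in> D" using card_D by fastforce
    then have \<Lambda>: "\<Lambda> \<ge> 0" using lo_less_hi[of \<nu>] by simp
    have "\<Lambda> / real (R - 1) \<le> \<Lambda> / (real R / 2)" using R1 R2 \<Lambda> by (intro divide_left_mono mult_pos_pos) auto
    also have "\<dots> = 2 * \<bar>\<Lambda>\<bar> * 1 / real R" using \<Lambda> by simp
    also have "\<dots> \<le> 2 * \<bar>\<Lambda>\<bar> * real s / real R" using s by (intro divide_right_mono mult_left_mono) auto
    finally have "(\<Lambda> / real (R - 1)) ^ s \<le> (2 * \<bar>\<Lambda>\<bar> * real s / real R) ^ s"
      using \<Lambda> by (intro power_mono) auto
    then have "K * (\<Lambda> / real (R - 1)) ^ s \<le> K * ((2 * \<bar>\<Lambda>\<bar> * real s) ^ s / real R ^ s)"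
      unfolding power_divide by (rule mult_left_mono[OF _ K0])
    also have "\<dots> = (2 * \<bar>\<Lambda>\<bar> * real s) ^ s * K / real R ^ s" by simp
    also have "\<dots> \<le> ?c0 * K / real R ^ s" using K by (intro divide_right_mono mult_right_mono) auto
    finally have "real (card (nodes D S - {D})) * (K * (\<Lambda> / real (R - 1)) ^ s) \<le> real (card (nodes D S - {D})) * (?c0 * K / real R ^ s)"
      by (rule mult_left_mono) simp
    then have "Lp_norm p (unif_cuboid D lo hi) (\<lambda>x. f x - v x) \<le> ereal (real (card (nodes D S - {D})) * (?c0 * K / real R ^ s))"
      using order_trans[OF v(2)[THEN conjunct2]] unfolding True by simp
    moreover have "\<forall>\<nu>\<in>D. fun_vs.dim (U \<nu> R) \<le> R"
    proof
      fix \<nu> assume n: "\<nu> \<in> D"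
      show "fun_vs.dim (U \<nu> R) \<le> R" unfolding U[OF n] by (rule dim_piecewise_linear_le[OF _ R2]) (use lo_less_hi[OF n] in simp)
    qed
    ultimately show ?thesis using v by blast
  next
    case False
    then have p2: "p = 2" using p by simp
    have U: "L2_subspace (lo \<nu>) (hi \<nu>) R (U \<nu> R) \<and> jackson M s (lo \<nu>) (hi \<nu>) R (U \<nu> R)" if "\<nu> \<in> D" for \<nu>
      using A that R2 False unfolding approximation_spaces_def by auto
    have d: "\<forall>\<nu>\<in>D. fun_vs.dim (U \<nu> R) \<le> R" using U unfolding L2_subspace_def by auto
    show ?thesis using L2_tree_bound[where U = "\<lambda>\<nu>. U \<nu> R", OF U q R K slice] d unfolding p2 by (rule conjI)
  qed
  then show "\<exists>v\<in>tensor_space D (\<lambda>\<nu>. U \<nu> R). (\<forall>\<alpha>\<in>nodes D S - {D}. node_rank D lo hi \<alpha> v \<le> enat R) \<and>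
     Lp_norm p (unif_cuboid D lo hi) (\<lambda>x. f x - v x) \<le> ereal (real (card (nodes D S - {D})) * (?c0 * K / real R ^ s))"
    "\<forall>\<nu>\<in>D. fun_vs.dim (U \<nu> R) \<le> R" by (rule conjunct1, rule conjunct2)
qed

end

section \<open>Complexity\<close>

lemma min_complexity_le:
  assumes "r D = 1" "\<forall>\<nu>\<in>D. 1 \<le> n \<nu>" "v \<in> tensor_space D (\<lambda>\<nu>. U \<nu> (n \<nu>))"
    "\<forall>\<alpha>\<in>nodes D S - {D}. node_rank D lo hi \<alpha> v \<le> enat (r \<alpha>)"
    "Lp_norm p (unif_cuboid D lo hi) (\<lambda>x. f x - v x) \<le> ereal \<epsilon>"
  shows "min_complexity D S lo hi U p f \<epsilon> \<le> enat (complexity D S r (\<lambda>\<nu>. U \<nu> (n \<nu>)))"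
proof -
  have v: "v \<in> tree_format D S lo hi r (tensor_space D (\<lambda>\<nu>. U \<nu> (n \<nu>)))"
    using assms(3,4) unfolding tree_format_def by (intro CollectI conjI)
  have "best_error D S lo hi r (tensor_space D (\<lambda>\<nu>. U \<nu> (n \<nu>))) p f \<le> ereal \<epsilon>"
    unfolding best_error_def by (rule INF_lower2[where i = v]) (rule v, rule assms(5))
  then show ?thesis unfolding min_complexity_def
    by (intro Inf_lower CollectI exI[of _ r] exI[of _ n] conjI refl assms(1,2))
qed

section \<open>Counting parameters\<close>

context dim_tree begin

text \<open>Each of the at most d^2 interior nodes costs no more than \<open>R\<close> to the power
  a + 1. The leaf part, d R^2, is absorbed because the arity is at least 2.\<close>

lemma complexity_le:
  assumes R: "R \<ge> 1" and V: "\<forall>\<nu>\<in>D. fun_vs.dim (V \<nu>) \<le> R"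
  shows "real (complexity D S (\<lambda>\<alpha>. if \<alpha> = D then 1 else R) V) \<le> 2 * real (card D) ^ 2 * real R ^ (arity D S + 1)"
proof -
  let ?r = "\<lambda>\<alpha>. if \<alpha> = D then 1 else R" and ?a = "arity D S"
  have rR: "?r \<alpha> \<le> R" for \<alpha> using R by simp
  have "(\<Sum>\<alpha>\<in>interior_nodes D S. ?r \<alpha> * (\<Prod>\<beta>\<in>S \<alpha>. ?r \<beta>)) \<le> (\<Sum>\<alpha>\<in>interior_nodes D S. R ^ (?a + 1))"
  proof (rule sum_mono)
    fix \<alpha> assume \<alpha>: "\<alpha> \<in> interior_nodes D S"
    have "(\<Prod>\<beta>\<in>S \<alpha>. ?r \<beta>) \<le> (\<Prod>\<beta>\<in>S \<alpha>. R)" by (rule prod_mono) (use R in simp)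
    also have "\<dots> \<le> R ^ ?a" using card_sons_le_arity[OF \<alpha>] R by (simp add: power_increasing)
    finally have "?r \<alpha> * (\<Prod>\<beta>\<in>S \<alpha>. ?r \<beta>) \<le> R * R ^ ?a" by (rule mult_le_mono[OF rR])
    then show "?r \<alpha> * (\<Prod>\<beta>\<in>S \<alpha>. ?r \<beta>) \<le> R ^ (?a + 1)" by simp
  qed
  also have "\<dots> = card (interior_nodes D S) * R ^ (?a + 1)" by simp
  also have "\<dots> \<le> card D ^ 2 * R ^ (?a + 1)"
  proof (rule mult_le_mono1)
    have "card (interior_nodes D S) \<le> card (nodes D S)"
      by (rule card_mono[OF finite_nodes]) (simp add: interior_nodes_def)
    then show "card (interior_nodes D S) \<le> card D ^ 2" using card_nodes_le by simp
  qed
  finally have 1: "(\<Sum>\<alpha>\<in>interior_nodes D S. ?r \<alpha> * (\<Prod>\<beta>\<in>S \<alpha>. ?r \<beta>)) \<le> card D ^ 2 * R ^ (?a + 1)" .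
  have "(\<Sum>\<nu>\<in>D. ?r {\<nu>} * fun_vs.dim (V \<nu>)) \<le> (\<Sum>\<nu>\<in>D. R * R)"
    by (rule sum_mono) (rule mult_le_mono[OF rR], rule V[THEN bspec])
  also have "\<dots> = card D * R ^ 2" by (simp add: power2_eq_square)
  also have "\<dots> \<le> card D ^ 2 * R ^ (?a + 1)"
    using R arity_ge_2 card_D by (intro mult_le_mono power_increasing self_le_power) auto
  finally have "complexity D S ?r V \<le> card D ^ 2 * R ^ (?a + 1) + card D ^ 2 * R ^ (?a + 1)"
    unfolding complexity_def using 1 by (intro add_le_mono)
  then have "real (complexity D S ?r V) \<le> real (card D ^ 2 * R ^ (?a + 1) + card D ^ 2 * R ^ (?a + 1))"
    by (simp only: of_nat_le_iff)
  then show ?thesis by (simp add: mult_ac)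
qed

lemma trivial_tree_props:
  assumes "trivial_tree D S"
  shows "interior_nodes D S = {D}" "card (S D) \<le> card D" "depth D S \<le> 1"
proof -
  have N: "nodes D S = insert D ((\<lambda>\<nu>. {\<nu>}) ` D)" using assms unfolding trivial_tree_def by blast
  have leaf: "S \<alpha> = {}" if a: "\<alpha> \<in> nodes D S" "\<alpha> \<noteq> D" for \<alpha>
  proof -
    obtain \<nu> where "\<alpha> = {\<nu>}" using a N by auto
    then show ?thesis using nodeD(3)[OF a(1)] by simp
  qed
  show "interior_nodes D S = {D}"
    unfolding interior_nodes_def using leaf sons_D_nonempty nodes.root by auto
  have "S D \<subseteq> (\<lambda>\<nu>. {\<nu>}) ` D"
  proof
    fix \<beta> assume "\<beta> \<in> S D"
    then have "\<beta> \<in> nodes D S" "\<beta> \<noteq> D" using sonD[OF nodes.root] by auto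
    then show "\<beta> \<in> (\<lambda>\<nu>. {\<nu>}) ` D" using N by auto
  qed
  then have "card (S D) \<le> card ((\<lambda>\<nu>. {\<nu>}) ` D)" using finite_D by (intro card_mono) auto
  also have "\<dots> \<le> card D" by (rule card_image_le[OF finite_D])
  finally show "card (S D) \<le> card D" .
  have "node_level D S \<alpha> \<le> 1" if a: "\<alpha> \<in> nodes D S" for \<alpha>
  proof (cases "node_level D S \<alpha>")
    case (Suc m)
    have "(D, \<alpha>) \<in> {(\<gamma>, \<beta>). \<beta> \<in> S \<gamma>} ^^ Suc m" using node_reach(1)[OF a] unfolding Suc .
    then obtain \<gamma> where g: "(D, \<gamma>) \<in> {(\<gamma>, \<beta>). \<beta> \<in> S \<gamma>} ^^ m" "\<alpha> \<in> S \<gamma>" by auto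
    have "\<gamma> = D" using leaf[OF reach_node[OF g(1)]] g(2) by blast
    then have "(D, \<alpha>) \<in> {(\<gamma>, \<beta>). \<beta> \<in> S \<gamma>} ^^ 1" using g(2) by simp
    then show ?thesis unfolding node_level_def by (rule Least_le)
  qed simp
  then show "depth D S \<le> 1"
    unfolding depth_def using finite_nodes nodes.root by (subst Max_le_iff) auto
qed

text \<open>The only interior node is the root, whose own rank is 1; this saves one power of
  \<open>R\<close> compared with a general tree.\<close>

lemma complexity_trivial_le:
  assumes T: "trivial_tree D S" and R: "R \<ge> 1" and V: "\<forall>\<nu>\<in>D. fun_vs.dim (V \<nu>) \<le> R"
  shows "real (complexity D S (\<lambda>\<alpha>. if \<alpha> = D then 1 else R) V) \<le> (1 + real (card D)) * real R ^ card D"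
proof -
  let ?r = "\<lambda>\<alpha>. if \<alpha> = D then 1 else R"
  have rR: "?r \<alpha> \<le> R" for \<alpha> using R by simp
  have "(\<Sum>\<alpha>\<in>interior_nodes D S. ?r \<alpha> * (\<Prod>\<beta>\<in>S \<alpha>. ?r \<beta>)) = (\<Prod>\<beta>\<in>S D. ?r \<beta>)"
    unfolding trivial_tree_props(1)[OF T] by simp
  also have "\<dots> \<le> (\<Prod>\<beta>\<in>S D. R)" by (rule prod_mono) (use R in simp)
  also have "\<dots> \<le> R ^ card D" using trivial_tree_props(2)[OF T] R by (simp add: power_increasing)
  finally have 1: "(\<Sum>\<alpha>\<in>interior_nodes D S. ?r \<alpha> * (\<Prod>\<beta>\<in>S \<alpha>. ?r \<beta>)) \<le> R ^ card D" .
  have "(\<Sum>\<nu>\<in>D. ?r {\<nu>} * fun_vs.dim (V \<nu>)) \<le> (\<Sum>\<nu>\<in>D. R * R)"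
    by (rule sum_mono) (rule mult_le_mono[OF rR], rule V[THEN bspec])
  also have "\<dots> = card D * R ^ 2" by (simp add: power2_eq_square)
  also have "\<dots> \<le> card D * R ^ card D" using R card_D by (intro mult_le_mono2 power_increasing) auto
  finally have "complexity D S ?r V \<le> R ^ card D + card D * R ^ card D"
    unfolding complexity_def using 1 by (intro add_le_mono)
  then have "real (complexity D S ?r V) \<le> real (R ^ card D + card D * R ^ card D)"
    by (simp only: of_nat_le_iff)
  then show ?thesis by (simp add: distrib_right)
qed

end

section \<open>Choice of the rank\<close>

context tree_fun begin

text \<open>A case of its own because the claimed bound tends to 0 as \<epsilon> grows. Rank 0
  everywhere below the root gives complexity exactly 0.\<close>

lemma min_complexity_large_eps:
  assumes p: "p = 2 \<or> p = \<infinity>" and \<epsilon>: "\<epsilon> \<ge> 1"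
  shows "min_complexity D S lo hi U p f \<epsilon> \<le> enat 0"
proof -
  let ?r = "\<lambda>\<alpha>. if \<alpha> = D then 1 else 0 :: nat"
  have "(\<lambda>_. 0) = (0 :: (nat \<Rightarrow> real) \<Rightarrow> real)" by (simp add: zero_fun_def)
  then have v: "(\<lambda>_. 0) \<in> tensor_space D (\<lambda>\<nu>. U \<nu> 1)" unfolding tensor_space_def using fun_vs.span_zero by (simp only:)
  have rk: "\<forall>\<alpha>\<in>nodes D S - {D}. node_rank D lo hi \<alpha> (\<lambda>_. 0) \<le> enat (?r \<alpha>)"
  proof
    fix \<alpha> assume "\<alpha> \<in> nodes D S - {D}"
    then have "?r \<alpha> = 0" by simp
    moreover have "node_rank D lo hi \<alpha> (\<lambda>_. 0) \<le> enat 0"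
      unfolding node_rank_def by (intro Inf_lower CollectI exI[of _ 0] conjI refl) simp
    ultimately show "node_rank D lo hi \<alpha> (\<lambda>_. 0) \<le> enat (?r \<alpha>)" by (simp only:)
  qed
  interpret PM: prob_space "unif_cuboid D lo hi" by (rule prob_space_M)
  have "Lp_norm p (unif_cuboid D lo hi) (\<lambda>x. f x - 0) \<le> ereal 1"
  proof (cases "p = 2")
    case True
    have b: "(f x)\<^sup>2 \<le> 1" if "x \<in> space (unif_cuboid D lo hi)" for x
      using f_bounded[of x] that abs_square_le_1[of "f x"] by (simp add: space_M)
    have m2: "(\<lambda>x. (f x)\<^sup>2) \<in> borel_measurable (unif_cuboid D lo hi)" using f_measurable by measurable
    have i: "integrable (unif_cuboid D lo hi) (\<lambda>x. (f x)\<^sup>2)"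
      by (rule PM.integrable_const_bound[OF _ m2, where B = 1]) (rule AE_I2, use b in simp)
    have "(\<integral>x. (f x)\<^sup>2 \<partial>unif_cuboid D lo hi) \<le> (\<integral>x. 1 \<partial>unif_cuboid D lo hi)"
      by (rule integral_mono[OF i]) (use b in simp_all)
    then have "(\<integral>x. (f x)\<^sup>2 \<partial>unif_cuboid D lo hi) \<le> 1\<^sup>2" by (simp add: PM.prob_space)
    then show ?thesis unfolding True diff_0_right by (rule Lp_norm_2_le[OF f_measurable i]) simp
  next
    case False
    then have p': "p = \<infinity>" using p by simp
    show ?thesis unfolding p' Lp_norm_def if_P[OF refl] diff_0_right
    proof (rule esssup_I)
      show "(\<lambda>x. ereal \<bar>f x\<bar>) \<in> borel_measurable (unif_cuboid D lo hi)"
        by (rule borel_measurable_ereal[OF borel_measurable_abs[OF f_measurable]])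
      show "AE x in unif_cuboid D lo hi. ereal \<bar>f x\<bar> \<le> ereal 1"
        by (rule AE_I2) (use f_bounded in \<open>simp add: space_M\<close>)
    qed
  qed
  then have "Lp_norm p (unif_cuboid D lo hi) (\<lambda>x. f x - 0) \<le> ereal \<epsilon>"
    by (rule order_trans) (use \<epsilon> in simp)
  from min_complexity_le[where r = ?r and n = "\<lambda>_. 1" and v = "\<lambda>_. 0" and U = U, OF _ _ v rk this]
  have "min_complexity D S lo hi U p f \<epsilon> \<le> enat (complexity D S ?r (\<lambda>\<nu>. U \<nu> 1))" by simp
  also have "complexity D S ?r (\<lambda>\<nu>. U \<nu> 1) = 0"
  proof -
    have "?r \<alpha> * (\<Prod>\<beta>\<in>S \<alpha>. ?r \<beta>) = 0" if a: "\<alpha> \<in> interior_nodes D S" for \<alpha>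
    proof -
      have an: "\<alpha> \<in> nodes D S" "S \<alpha> \<noteq> {}" using a unfolding interior_nodes_def by auto
      then obtain \<beta> where b: "\<beta> \<in> S \<alpha>" by blast
      have "\<beta> \<noteq> D" using sonD[OF an(1) b] nodeD(2)[OF an(1)] by auto
      then have "(\<Prod>\<beta>\<in>S \<alpha>. ?r \<beta>) = 0" using b by (intro prod_zero[OF sons_finite[OF an(1)]] bexI[of _ \<beta>]) simp_all
      then show ?thesis by (simp only: mult_0_right)
    qed
    then have "(\<Sum>\<alpha>\<in>interior_nodes D S. ?r \<alpha> * (\<Prod>\<beta>\<in>S \<alpha>. ?r \<beta>)) = 0"
      by (intro sum.neutral ballI)
    moreover have "(\<Sum>\<nu>\<in>D. ?r {\<nu>} * fun_vs.dim (U \<nu> 1)) = 0"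
    proof (intro sum.neutral ballI)
      fix \<nu>
      have "{\<nu>} \<noteq> D" using card_D by auto
      then show "?r {\<nu>} * fun_vs.dim (U \<nu> 1) = 0" by simp
    qed
    ultimately show ?thesis unfolding complexity_def by (simp only: add_0)
  qed
  finally show ?thesis .
qed

text \<open>For \<epsilon> < 1 the ideal number Y is at least 1, so rounding up costs at most a
  factor 2 and R \<le> 4 s Y; this is the origin of \<open>4 * real s\<close>. The exponent
  \<open>e\<close> and the prefactor \<open>P\<close> come from the parameter count and are left
  open for both parts.\<close>

lemma min_complexity_small_eps:
  assumes p: "p = 2 \<or> (p = \<infinity> \<and> s \<le> 2)" and A: "approximation_spaces p s M D lo hi U"
    and \<epsilon>: "0 < \<epsilon>" "\<epsilon> < 1" and Z: "Z \<ge> 1"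
    and slice: "\<And>\<alpha> x. \<alpha> \<in> nodes D S - {D} \<Longrightarrow> x \<in> X \<Longrightarrow>
      \<exists>G. (\<forall>y\<in>X. f (mg \<alpha> y x) = G (g \<alpha> (restrict y \<alpha>))) \<and> apx s (\<lambda>_. Z ^ s) (ilo \<alpha>) (ihi \<alpha>) G"
    and P: "P \<ge> 0" "\<And>R. R \<ge> 1 \<Longrightarrow> \<forall>\<nu>\<in>D. fun_vs.dim (U \<nu> R) \<le> R \<Longrightarrow>
      real (complexity D S (\<lambda>\<alpha>. if \<alpha> = D then 1 else R) (\<lambda>\<nu>. U \<nu> R)) \<le> P * real R ^ e"
    and c0: "c0 = 2 * (2 * \<bar>\<Lambda>\<bar> * real s) ^ s + 2 * \<bar>M\<bar> * sqrt (real (s + 1)) + 2"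
  shows "ereal_of_enat (min_complexity D S lo hi U p f \<epsilon>)
    \<le> ereal (P * (4 * real s) ^ e * (real (card D) ^ 2 * c0 * Z) ^ e * \<epsilon> powr (- (real e / real s)))"
proof -
  define w where "w = real (card D) ^ 2 * c0"
  define h where "h = \<epsilon> powr (- (1 / real s))"
  \<comment> \<open>Chosen so that Y^s is at least w Z^s / \<epsilon>, where w collects the number
    of nodes and the error constant.\<close>
  define Y where "Y = w * Z * h"
  define q where "q = nat \<lceil>Y\<rceil>"
  define R where "R = 2 * q * s"
  have c1: "c0 \<ge> 1" unfolding c0 by simp
  have "1 \<le> real (card D) ^ 2" using card_D by (intro one_le_power) simp
  then have w1: "w \<ge> 1" unfolding w_def using mult_mono[of 1 "real (card D) ^ 2" 1 c0] c1 by simp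
  have "\<epsilon> powr 0 \<le> h" unfolding h_def using \<epsilon> by (intro powr_mono') auto
  then have h1: "h \<ge> 1" using \<epsilon> by simp
  have wZ: "1 \<le> w * Z" using mult_mono[of 1 w 1 Z] w1 Z by simp
  have Y1: "Y \<ge> 1" unfolding Y_def using mult_mono[of 1 "w * Z" 1 h] wZ h1 by simp
  have q: "real q \<ge> Y" "real q \<le> 2 * Y" "q \<ge> 1" unfolding q_def using Y1 by linarith+
  have s1: "real s \<ge> 1" using s by simp
  have hs: "h ^ s = 1 / \<epsilon>"
  proof -
    have "h ^ s = \<epsilon> powr (real s * - (1 / real s))" unfolding h_def by (rule powr_power) (use \<epsilon> in simp)
    also have "real s * - (1 / real s) = - 1" using s1 by simp
    finally show ?thesis using \<epsilon> by (simp add: powr_minus divide_inverse)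
  qed
  have he: "h ^ e = \<epsilon> powr (- (real e / real s))"
  proof -
    have "h ^ e = \<epsilon> powr (real e * - (1 / real s))" unfolding h_def by (rule powr_power) (use \<epsilon> in simp)
    then show ?thesis by simp
  qed
  have R1: "R \<ge> 1" using q(3) s by (simp add: R_def)
  have rs: "real R ^ s > 0" using R1 by simp
  have "real q * 1 \<le> real q * (2 * real s)" using s1 by (intro mult_left_mono) auto
  then have RY: "Y \<le> real R" using q(1) by (simp add: R_def mult_ac)
  \<comment> \<open>The bound w \<le> w^s, from w \<ge> 1, lets \<open>w\<close> enter Y
    linearly.\<close>
  have "w * Z ^ s * (1 / \<epsilon>) \<le> w ^ s * Z ^ s * (1 / \<epsilon>)"
    using w1 s Z \<epsilon> by (intro mult_right_mono self_le_power) auto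
  also have "\<dots> = Y ^ s" unfolding Y_def power_mult_distrib hs ..
  also have "\<dots> \<le> real R ^ s" using RY Y1 by (intro power_mono) auto
  finally have "w * Z ^ s \<le> \<epsilon> * real R ^ s" using \<epsilon> by (simp add: field_simps)
  then have e1: "w * Z ^ s / real R ^ s \<le> \<epsilon>" using rs by (simp add: field_simps)
  have cN: "real (card (nodes D S - {D})) \<le> real (card D) ^ 2"
  proof -
    have "card (nodes D S - {D}) \<le> card D ^ 2"
      using card_mono[OF finite_nodes, of "nodes D S - {D}"] card_nodes_le by simp
    then have "real (card (nodes D S - {D})) \<le> real (card D ^ 2)" by (simp only: of_nat_le_iff)
    then show ?thesis by simp
  qed
  have "real (card (nodes D S - {D})) * (c0 * Z ^ s / real R ^ s) \<le> real (card D) ^ 2 * (c0 * Z ^ s / real R ^ s)"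
    using cN c1 Z by (intro mult_right_mono) auto
  also have "\<dots> = w * Z ^ s / real R ^ s" by (simp add: w_def)
  finally have err: "real (card (nodes D S - {D})) * (c0 * Z ^ s / real R ^ s) \<le> \<epsilon>" using e1 by simp
  have Zs: "Z ^ s \<ge> 1" using Z by (rule one_le_power)
  note tb = tree_bound[OF p A q(3) R_def Zs slice]
  from tb(1) obtain v where v: "v \<in> tensor_space D (\<lambda>\<nu>. U \<nu> R)" "(\<forall>\<alpha>\<in>nodes D S - {D}. node_rank D lo hi \<alpha> v \<le> enat R) \<and>
     Lp_norm p (unif_cuboid D lo hi) (\<lambda>x. f x - v x) \<le> ereal (real (card (nodes D S - {D})) * (c0 * Z ^ s / real R ^ s))"
    unfolding c0 by (rule bexE)
  have "min_complexity D S lo hi U p f \<epsilon> \<le> enat (complexity D S (\<lambda>\<alpha>. if \<alpha> = D then 1 else R) (\<lambda>\<nu>. U \<nu> R))"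
  proof (rule min_complexity_le)
    show "\<forall>\<alpha>\<in>nodes D S - {D}. node_rank D lo hi \<alpha> v \<le> enat (if \<alpha> = D then 1 else R)" using v(2) by auto
    show "Lp_norm p (unif_cuboid D lo hi) (\<lambda>x. f x - v x) \<le> ereal \<epsilon>"
      by (rule order_trans[OF v(2)[THEN conjunct2]]) (use err in simp)
  qed (use R1 v(1) in simp_all)
  then have "ereal_of_enat (min_complexity D S lo hi U p f \<epsilon>) \<le> ereal_of_enat (enat (complexity D S (\<lambda>\<alpha>. if \<alpha> = D then 1 else R) (\<lambda>\<nu>. U \<nu> R)))"
    by (simp only: ereal_of_enat_le_iff)
  also have "\<dots> \<le> ereal (P * real R ^ e)" using P(2)[OF R1 tb(2)] by simp
  also have "P * real R ^ e \<le> P * (4 * real s * Y) ^ e"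
  proof (intro mult_left_mono power_mono P(1))
    have "real R = 2 * real s * real q" by (simp add: R_def)
    also have "\<dots> \<le> 2 * real s * (2 * Y)" by (rule mult_left_mono[OF q(2)]) simp
    finally show "real R \<le> 4 * real s * Y" by simp
  qed simp
  also have "P * (4 * real s * Y) ^ e = P * (4 * real s) ^ e * (w * Z) ^ e * h ^ e"
    by (simp only: Y_def power_mult_distrib mult_ac)
  finally show ?thesis unfolding he w_def by simp
qed

end

section \<open>Constants and conclusion\<close>

lemma tree_class_tree_fun:
  assumes s: "1 \<le> s" and B: "\<forall>j\<in>{1..s}. 1 \<le> B j" and T: "dimension_tree D S" and f: "f \<in> tree_class D S lo hi \<Lambda> s B"
  shows "\<exists>ilo ihi fs g. tree_fun D S lo hi \<Lambda> s B ilo ihi fs f g"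
proof -
  from f[unfolded tree_class_def, THEN CollectD] obtain ilo ihi fs where
    1: "tree_composition D S lo hi \<Lambda> ilo ihi fs f" and
    2: "\<forall>\<alpha>\<in>interior_nodes D S. continuous_on (cuboid (S \<alpha>) ilo ihi) (fs \<alpha>) \<and> fs \<alpha> \<in> sobolev (S \<alpha>) ilo ihi s \<infinity>" and
    3: "W_inf_norm (S D) ilo ihi s (fs D) \<le> 1" and
    4: "\<forall>\<alpha>\<in>interior_nodes D S - {D}. \<forall>k\<in>multi_indices (S \<alpha>) s. 1 \<le> sum k (S \<alpha>) \<longrightarrow>
        Lp_norm \<infinity> (unif_cuboid (S \<alpha>) ilo ihi) (Dk (S \<alpha>) ilo ihi k (fs \<alpha>)) \<le> ereal (B (sum k (S \<alpha>)))"
    by (elim exE conjE)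
  from 1[unfolded tree_composition_def] obtain g where
    5: "\<forall>\<nu>\<in>D. ilo {\<nu>} = lo \<nu> \<and> ihi {\<nu>} = hi \<nu>" and
    6: "\<forall>\<alpha>\<in>nodes D S - {D}. ilo \<alpha> < ihi \<alpha> \<and> ihi \<alpha> - ilo \<alpha> \<le> \<Lambda>" and
    7: "\<forall>\<alpha>\<in>interior_nodes D S - {D}. fs \<alpha> ` cuboid (S \<alpha>) ilo ihi \<subseteq> {ilo \<alpha>..ihi \<alpha>}" and
    8: "\<forall>\<nu>\<in>D. \<forall>x\<in>cuboid {\<nu>} lo hi. g {\<nu>} x = x \<nu>" and
    9: "\<forall>\<alpha>\<in>interior_nodes D S - {D}. \<forall>x\<in>cuboid \<alpha> lo hi. g \<alpha> x = fs \<alpha> (\<lambda>\<beta>\<in>S \<alpha>. g \<beta> (restrict x \<beta>))" and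
    10: "\<forall>x\<in>cuboid D lo hi. f x = fs D (\<lambda>\<beta>\<in>S D. g \<beta> (restrict x \<beta>))"
    by (elim exE conjE)
  have "tree_fun D S lo hi \<Lambda> s B ilo ihi fs f g"
  proof
    show "dimension_tree D S" by (rule T)
    show "1 \<le> s" by (rule s)
    show "\<forall>j\<in>{1..s}. 1 \<le> B j" by (rule B)
    show "W_inf_norm (S D) ilo ihi s (fs D) \<le> 1" by (rule 3)
    fix \<alpha> assume a: "\<alpha> \<in> interior_nodes D S"
    show "continuous_on (cuboid (S \<alpha>) ilo ihi) (fs \<alpha>)" by (rule 2[THEN bspec, OF a, THEN conjunct1])
    show "fs \<alpha> \<in> sobolev (S \<alpha>) ilo ihi s \<infinity>" by (rule 2[THEN bspec, OF a, THEN conjunct2])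
    assume "\<alpha> \<noteq> D"
    with a have a': "\<alpha> \<in> interior_nodes D S - {D}" by simp
    show "fs \<alpha> ` cuboid (S \<alpha>) ilo ihi \<subseteq> {ilo \<alpha>..ihi \<alpha>}" by (rule 7[THEN bspec, OF a'])
    show "g \<alpha> x = fs \<alpha> (\<lambda>\<beta>\<in>S \<alpha>. g \<beta> (restrict x \<beta>))" if "x \<in> cuboid \<alpha> lo hi" for x
      by (rule 9[THEN bspec, OF a', THEN bspec, OF that])
    show "Lp_norm \<infinity> (unif_cuboid (S \<alpha>) ilo ihi) (Dk (S \<alpha>) ilo ihi k (fs \<alpha>)) \<le> ereal (B (sum k (S \<alpha>)))"
      if "k \<in> multi_indices (S \<alpha>) s" "1 \<le> sum k (S \<alpha>)" for k
      by (rule 4[THEN bspec, OF a', THEN bspec, OF that(1), THEN mp, OF that(2)])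
  next
    show "ilo {\<nu>} = lo \<nu> \<and> ihi {\<nu>} = hi \<nu>" if "\<nu> \<in> D" for \<nu> by (rule 5[THEN bspec, OF that])
    show "ilo \<alpha> < ihi \<alpha> \<and> ihi \<alpha> - ilo \<alpha> \<le> \<Lambda>" if "\<alpha> \<in> nodes D S" "\<alpha> \<noteq> D" for \<alpha>
      by (rule 6[THEN bspec]) (use that in simp)
    show "g {\<nu>} x = x \<nu>" if "\<nu> \<in> D" "x \<in> cuboid {\<nu>} lo hi" for \<nu> x
      by (rule 8[THEN bspec, OF that(1), THEN bspec, OF that(2)])
    show "f x = fs D (\<lambda>\<beta>\<in>S D. g \<beta> (restrict x \<beta>))" if "x \<in> cuboid D lo hi" for x
      by (rule 10[THEN bspec, OF that])
  qed
  then show ?thesis by (intro exI)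
qed

text \<open>K^d = 2^(-d) (2 K)^d, and (2 K)^d \<le> d^d as soon as d \<ge> 2 K.\<close>

lemma superexponentialI:
  assumes "\<And>d. d \<ge> 1 \<Longrightarrow> C d \<ge> real d ^ d"
  shows "superexponential C"
  unfolding superexponential_def
proof (intro allI impI landau_o.smallI)
  fix K c :: real assume K: "K > 0" and c: "c > 0"
  have "(\<lambda>d. (1 / 2) ^ d :: real) \<longlonglongrightarrow> 0" by (rule LIMSEQ_power_zero) simp
  then have "\<forall>\<^sub>F d in sequentially. (1 / 2) ^ d < c" using c by (rule order_tendstoD)
  moreover have "\<forall>\<^sub>F d in sequentially. 2 * K \<le> real d"
    by (rule filterlim_at_top[THEN iffD1, OF filterlim_real_sequentially, THEN spec])
  moreover have "\<forall>\<^sub>F d in sequentially. (1::nat) \<le> d" by (rule eventually_ge_at_top)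
  ultimately show "\<forall>\<^sub>F d in sequentially. norm (K ^ d) \<le> c * norm (C d)"
  proof eventually_elim
    case (elim d)
    have "K ^ d = (1 / 2) ^ d * (2 * K) ^ d" by (subst power_mult_distrib[symmetric]) simp
    also have "\<dots> \<le> c * real d ^ d"
      by (intro mult_mono power_mono less_imp_le[OF elim(1)] elim(2)) (use K c in simp_all)
    also have "\<dots> \<le> c * C d" by (rule mult_left_mono[OF assms[OF elim(3)] less_imp_le[OF c]])
    also have "\<dots> \<le> c * norm (C d)" by (rule mult_left_mono[OF _ less_imp_le[OF c]]) simp
    finally show ?case using K by (simp only: real_norm_def power_abs abs_of_pos)
  qed
qed

theorem theorem4p13:
  fixes s :: nat and p :: ereal and M \<Lambda> :: real
  assumes "1 \<le> s"
    and "p = 2 \<or> (p = \<infinity> \<and> s \<le> 2)"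
  shows "(\<forall>B :: nat \<Rightarrow> real. (\<forall>j\<in>{1..s}. 1 \<le> B j) \<longrightarrow>
      (\<exists>C :: nat \<Rightarrow> real. superexponential C \<and>
        (\<forall>d\<ge>2. \<forall>(lo :: nat \<Rightarrow> real) (hi :: nat \<Rightarrow> real) U S f. \<forall>\<epsilon>>0.
           trivial_tree {1..d} S \<longrightarrow>
           approximation_spaces p s M {1..d} lo hi U \<longrightarrow>
           f \<in> tree_class {1..d} S lo hi \<Lambda> s B \<longrightarrow>
           ereal_of_enat (min_complexity {1..d} S lo hi U p f \<epsilon>)
             \<le> ereal (C d * \<epsilon> powr (- (real d / real s))))))
    \<and> (\<forall>a :: nat. \<exists>C :: nat \<Rightarrow> real. polynomially_bounded C \<and>
        (\<forall>d\<ge>2. \<forall>(B :: nat \<Rightarrow> real) (lo :: nat \<Rightarrow> real) (hi :: nat \<Rightarrow> real) U S f. \<forall>\<epsilon>>0.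
           (\<forall>j\<in>{1..s}. 1 \<le> B j) \<longrightarrow>
           dimension_tree {1..d} S \<longrightarrow>
           arity {1..d} S = a \<longrightarrow>
           approximation_spaces p s M {1..d} lo hi U \<longrightarrow>
           f \<in> tree_class {1..d} S lo hi \<Lambda> s B \<longrightarrow>
           ereal_of_enat (min_complexity {1..d} S lo hi U p f \<epsilon>)
             \<le> ereal (C d * real (depth {1..d} S) ^ (a + 1) * \<epsilon> powr (- (real (a + 1) / real s))
                 * B 1 ^ ((a + 1) * depth {1..d} S) * B_star s B ^ (a + 1))))"
proof -
  define c0 where "c0 = 2 * (2 * \<bar>\<Lambda>\<bar> * real s) ^ s + 2 * \<bar>M\<bar> * sqrt (real (s + 1)) + 2"
  have c0: "c0 \<ge> 1" unfolding c0_def by simp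
  \<comment> \<open>Depends on \<open>s\<close> only and is fixed before \<open>B\<close>, the
    arity, the dimension and the tree.\<close>
  obtain C where C0: "C \<ge> 1 \<and> (\<forall>m b b' c d a0 a1 H u. 1 \<le> b \<longrightarrow> 1 \<le> b' \<longrightarrow> apx s (chain_bound C b b' m) c d H \<longrightarrow>
     inner_apx s b b' a0 a1 c d u \<longrightarrow> u ` {a0..a1} \<subseteq> {c..d} \<longrightarrow> 1 \<le> s \<longrightarrow>
     apx s (chain_bound C b b' (Suc m)) a0 a1 (\<lambda>t. H (u t)))" using apx_compose[of s] by (elim exE)
  note C1 = C0[THEN conjunct1] and C2 = C0[THEN conjunct2, rule_format]
  have p': "p = 2 \<or> p = \<infinity>" using assms(2) by auto
  have s1: "real s \<ge> 1" using assms(1) by simp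
  have B1: "1 \<le> B 1" and Bs: "1 \<le> B_star s B" if B: "\<forall>j\<in>{1..s}. 1 \<le> B j" for B :: "nat \<Rightarrow> real"
  proof -
    show b: "1 \<le> B 1" using B assms(1) by auto
    show "1 \<le> B_star s B"
    proof (cases "2 \<le> s")
      case True
      have "B 1 \<le> Max (B ` {1..s})" using assms(1) by (intro Max_ge) auto
      with b have "1 \<le> Max (B ` {1..s})" by (rule order_trans)
      then show ?thesis unfolding B_star_def if_P[OF True] .
    qed (simp add: B_star_def)
  qed
  \<comment> \<open>Serves both parts: with L = 1, e = d for the trivial tree, and with L the depth,
    e = a + 1 in general.\<close>
  have main: "ereal_of_enat (min_complexity {1..d} S lo hi U p f \<epsilon>)
      \<le> ereal (P * (4 * real s) ^ e * (real d ^ 2 * c0 * (C * real L * B 1 ^ L * B_star s B)) ^ e * \<epsilon> powr (- (real e / real s)))"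
    if \<epsilon>: "\<epsilon> > 0" and B: "\<forall>j\<in>{1..s}. 1 \<le> B j" and T: "dimension_tree {1..d} S" and A: "approximation_spaces p s M {1..d} lo hi U"
      and f: "f \<in> tree_class {1..d} S lo hi \<Lambda> s B" and L: "depth {1..d} S \<le> L" and P: "P \<ge> 0"
      and cx: "\<And>R. R \<ge> 1 \<Longrightarrow> \<forall>\<nu>\<in>{1..d}. fun_vs.dim (U \<nu> R) \<le> R \<Longrightarrow>
        real (complexity {1..d} S (\<lambda>\<alpha>. if \<alpha> = {1..d} then 1 else R) (\<lambda>\<nu>. U \<nu> R)) \<le> P * real R ^ e"
    for d B lo hi U S f \<epsilon> L P e
  proof -
    from tree_class_tree_fun[OF assms(1) B T f] obtain ilo ihi fs g
      where tf: "tree_fun {1..d} S lo hi \<Lambda> s B ilo ihi fs f g" by (elim exE)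
    interpret F: tree_fun "{1..d}" S lo hi \<Lambda> s B ilo ihi fs f g by (rule tf)
    have "real L \<ge> 1" using F.depth_ge_1 L by simp
    then have Z: "1 \<le> C * real L * B 1 ^ L * B_star s B"
      using C1 B1[OF B] Bs[OF B] by (intro mult_ge1_I one_le_power)
    have slice: "\<exists>G. (\<forall>y\<in>F.X. f (mg \<alpha> y x) = G (g \<alpha> (restrict y \<alpha>))) \<and>
       apx s (\<lambda>_. (C * real L * B 1 ^ L * B_star s B) ^ s) (ilo \<alpha>) (ihi \<alpha>) G"
      if "\<alpha> \<in> nodes {1..d} S - {{1..d}}" "x \<in> F.X" for \<alpha> x
      by (rule F.tree_slice[OF C1 _ that L]) (rule C2; assumption)
    show ?thesis
    proof (cases "\<epsilon> < 1")
      case True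
      have "ereal_of_enat (min_complexity {1..d} S lo hi U p f \<epsilon>)
        \<le> ereal (P * (4 * real s) ^ e * (real (card {1..d}) ^ 2 * c0 * (C * real L * B 1 ^ L * B_star s B)) ^ e * \<epsilon> powr (- (real e / real s)))"
        by (rule F.min_complexity_small_eps[OF assms(2) A \<epsilon> True Z _ P _ c0_def], erule (1) slice, erule (1) cx)
      then show ?thesis unfolding card_atLeastAtMost diff_Suc_1 .
    next
      case False
      then have "ereal_of_enat (min_complexity {1..d} S lo hi U p f \<epsilon>) \<le> ereal_of_enat (enat 0)"
        unfolding ereal_of_enat_le_iff by (intro F.min_complexity_large_eps[OF p']) simp
      also have "\<dots> \<le> ereal (P * (4 * real s) ^ e * (real d ^ 2 * c0 * (C * real L * B 1 ^ L * B_star s B)) ^ e * \<epsilon> powr (- (real e / real s)))"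
        using P c0 Z by simp
      finally show ?thesis .
    qed
  qed
  show ?thesis
  proof (intro conjI allI impI)
    fix B :: "nat \<Rightarrow> real" assume B: "\<forall>j\<in>{1..s}. 1 \<le> B j"
    \<comment> \<open>The depth is at most 1, so L = 1 and \<open>z\<close> is determined by
      \<open>s\<close> and \<open>B\<close>; part (i) allows the constant to depend on
      \<open>B\<close>.\<close>
    define z where "z = C * real 1 * B 1 ^ 1 * B_star s B"
    define Cd where "Cd d = (1 + real d) * (4 * real s) ^ d * (real d ^ 2 * c0 * z) ^ d" for d
    have z: "z \<ge> 1" unfolding z_def using C1 B1[OF B] Bs[OF B] by (intro mult_ge1_I one_le_power) simp_all
    have 1: "superexponential Cd"
    proof (rule superexponentialI)
      fix d :: nat assume d: "d \<ge> 1"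
      have cz: "1 \<le> c0 * z" using c0 z by (rule mult_ge1_I)
      have "real d \<le> real d ^ 2" using d by (intro self_le_power) auto
      also have "\<dots> * 1 \<le> real d ^ 2 * (c0 * z)" using cz by (intro mult_left_mono) auto
      finally have "real d ^ d \<le> (real d ^ 2 * c0 * z) ^ d" by (intro power_mono) (simp_all add: mult.assoc)
      moreover have "1 \<le> (1 + real d) * (4 * real s) ^ d" using s1 by (intro mult_ge1_I one_le_power) auto
      ultimately have "1 * real d ^ d \<le> (1 + real d) * (4 * real s) ^ d * (real d ^ 2 * c0 * z) ^ d"
        by (intro mult_mono) auto
      then show "real d ^ d \<le> Cd d" by (simp add: Cd_def)
    qed
    have 2: "ereal_of_enat (min_complexity {1..d} S lo hi U p f \<epsilon>) \<le> ereal (Cd d * \<epsilon> powr (- (real d / real s)))"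
      if "\<epsilon> > 0" and T: "trivial_tree {1..d} S" and A: "approximation_spaces p s M {1..d} lo hi U"
        and f: "f \<in> tree_class {1..d} S lo hi \<Lambda> s B" for d lo hi U S f \<epsilon>
    proof -
      have dt: "dimension_tree {1..d} S" using T unfolding trivial_tree_def by (rule conjunct1)
      interpret dim_tree "{1..d}" S by (rule dim_tree.intro[OF dt])
      show ?thesis unfolding Cd_def z_def
      proof (rule main[OF that(1) B dt A f trivial_tree_props(3)[OF T]])
        show "real (complexity {1..d} S (\<lambda>\<alpha>. if \<alpha> = {1..d} then 1 else R) (\<lambda>\<nu>. U \<nu> R)) \<le> (1 + real d) * real R ^ d"
          if "R \<ge> 1" "\<forall>\<nu>\<in>{1..d}. fun_vs.dim (U \<nu> R) \<le> R" for R
          using complexity_trivial_le[where V = "\<lambda>\<nu>. U \<nu> R", OF T that] by simp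
      qed simp
    qed
    show "\<exists>C. superexponential C \<and>
        (\<forall>d\<ge>2. \<forall>(lo :: nat \<Rightarrow> real) (hi :: nat \<Rightarrow> real) U S f. \<forall>\<epsilon>>0.
           trivial_tree {1..d} S \<longrightarrow>
           approximation_spaces p s M {1..d} lo hi U \<longrightarrow>
           f \<in> tree_class {1..d} S lo hi \<Lambda> s B \<longrightarrow>
           ereal_of_enat (min_complexity {1..d} S lo hi U p f \<epsilon>)
             \<le> ereal (C d * \<epsilon> powr (- (real d / real s))))"
      by (rule exI[of _ Cd], rule conjI[OF 1], intro allI impI, rule 2)
  next
    fix a :: nat
    \<comment> \<open>Degree 2 in d from the number of nodes in the complexity, and 2 (a + 1) from
      the number of nodes in the error, which enters through the rank.\<close>
    define Cd where "Cd d = 2 * real d ^ 2 * (4 * real s) ^ (a + 1) * (real d ^ 2 * c0 * C) ^ (a + 1)" for d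
    have "Cd \<in> O(\<lambda>d. real d ^ (2 + 2 * (a + 1)))"
    proof (rule bigoI)
      have "Cd d = 2 * (4 * real s) ^ (a + 1) * (c0 * C) ^ (a + 1) * real d ^ (2 + 2 * (a + 1))" for d
        unfolding Cd_def power_add power_mult power_mult_distrib by (simp only: mult_ac)
      then show "\<forall>\<^sub>F d in sequentially. norm (Cd d) \<le> norm (2 * (4 * real s) ^ (a + 1) * (c0 * C) ^ (a + 1)) * norm (real d ^ (2 + 2 * (a + 1)))"
        by (simp only: norm_mult order_refl eventually_True)
    qed
    then have 1: "polynomially_bounded Cd" unfolding polynomially_bounded_def by (rule exI)
    have 2: "ereal_of_enat (min_complexity {1..d} S lo hi U p f \<epsilon>)
        \<le> ereal (Cd d * real (depth {1..d} S) ^ (a + 1) * \<epsilon> powr (- (real (a + 1) / real s))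
                 * B 1 ^ ((a + 1) * depth {1..d} S) * B_star s B ^ (a + 1))"
      if "\<epsilon> > 0" and B: "\<forall>j\<in>{1..s}. 1 \<le> B j" and dt: "dimension_tree {1..d} S" and ar: "arity {1..d} S = a"
        and A: "approximation_spaces p s M {1..d} lo hi U"
        and f: "f \<in> tree_class {1..d} S lo hi \<Lambda> s B" for d B lo hi U S f \<epsilon>
    proof -
      interpret dim_tree "{1..d}" S by (rule dim_tree.intro[OF dt])
      let ?L = "depth {1..d} S"
      have "ereal_of_enat (min_complexity {1..d} S lo hi U p f \<epsilon>)
         \<le> ereal (2 * real d ^ 2 * (4 * real s) ^ (a + 1) * (real d ^ 2 * c0 * (C * real ?L * B 1 ^ ?L * B_star s B)) ^ (a + 1)
             * \<epsilon> powr (- (real (a + 1) / real s)))"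
      proof (rule main[OF that(1) B dt A f order_refl])
        show "real (complexity {1..d} S (\<lambda>\<alpha>. if \<alpha> = {1..d} then 1 else R) (\<lambda>\<nu>. U \<nu> R)) \<le> 2 * real d ^ 2 * real R ^ (a + 1)"
          if "R \<ge> 1" "\<forall>\<nu>\<in>{1..d}. fun_vs.dim (U \<nu> R) \<le> R" for R
          using complexity_le[where V = "\<lambda>\<nu>. U \<nu> R", OF that] unfolding ar by simp
      qed simp
      also have "2 * real d ^ 2 * (4 * real s) ^ (a + 1) * (real d ^ 2 * c0 * (C * real ?L * B 1 ^ ?L * B_star s B)) ^ (a + 1)
             * \<epsilon> powr (- (real (a + 1) / real s))
         = Cd d * real ?L ^ (a + 1) * \<epsilon> powr (- (real (a + 1) / real s)) * B 1 ^ ((a + 1) * ?L) * B_star s B ^ (a + 1)"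
        unfolding Cd_def power_mult_distrib mult.commute[of "a + 1" ?L] power_mult by (simp only: mult_ac)
      finally show ?thesis .
    qed
    show "\<exists>C. polynomially_bounded C \<and>
        (\<forall>d\<ge>2. \<forall>(B :: nat \<Rightarrow> real) (lo :: nat \<Rightarrow> real) (hi :: nat \<Rightarrow> real) U S f. \<forall>\<epsilon>>0.
           (\<forall>j\<in>{1..s}. 1 \<le> B j) \<longrightarrow>
           dimension_tree {1..d} S \<longrightarrow>
           arity {1..d} S = a \<longrightarrow>
           approximation_spaces p s M {1..d} lo hi U \<longrightarrow>
           f \<in> tree_class {1..d} S lo hi \<Lambda> s B \<longrightarrow>
           ereal_of_enat (min_complexity {1..d} S lo hi U p f \<epsilon>)
             \<le> ereal (C d * real (depth {1..d} S) ^ (a + 1) * \<epsilon> powr (- (real (a + 1) / real s))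
                 * B 1 ^ ((a + 1) * depth {1..d} S) * B_star s B ^ (a + 1)))"
      by (rule exI[of _ Cd], rule conjI[OF 1], intro allI impI, rule 2)
  qed
qed

end
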